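(* Let $Y$ be a closed, connected, oriented $3$-manifold, and let $K$ be a fibered knot in $Y$ with (oriented) fiber surface $F$ and monodromy $\varphi$. Define $W = S^1 \times E_Y(K)$, so that $\partial W = T^3$. Let $\pi: T^3=\partial W \to S^1$ be a (surjective) fibration with fiber $T$. If $T$ contains the curve $\lambda = \{\mathrm{pt}\} \times \partial F$, then $\pi$ extends to a fibration of $W$; that is, there is a fibration $\hat\pi: W \to S^1$ such that $\hat\pi|_{\partial W} = \pi$.
   Context: All manifolds and maps are smooth; a fibration means a smooth fiber bundle. $E_Y(K) = Y \setminus \mathring{\nu}K$ denotes the exterior of $K$, where $\mathring{\nu}K$ is the interior of a closed tubular neighborhood of $K$. The knot $K$ is fibered if $E_Y(K)$ admits a smooth fibration over $S^1$ whose fiber is a Seifert surface $F$ for $K$ (a compact, connected, oriented surface with a single boundary component, a longitude of $K$ on $\partial E_Y(K)$); the monodromy is a diffeomorphism $\varphi$ of $F$ with $E_Y(K)$ the mapping torus of $\varphi$. In $\{\mathrm{pt}\}\times\partial F$ the point lies in the $S^1$ factor of $S^1\times E_Y(K)$. *)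

theory Defs
  imports "HOL-Analysis.Analysis"
begin

text \<open>
  Smooth manifolds with boundary, given by a topology and an atlas.  The charts take their values
  in a Euclidean space \<open>'e\<close> whose dimension may exceed that of the manifold: the local model in
  dimension \<open>d\<close> is a \<open>d\<close>-dimensional linear subspace of \<open>'e\<close>, or a closed half-space of one.  If
  \<open>d = DIM('e)\<close> this is the usual notion.  The extra room lets a submanifold use the restricted
  charts of the ambient manifold.
\<close>

record ('a, 'e) mfd =
  mtop :: "'a topology"
  mdim :: nat
  matlas :: "('a set \<times> ('a \<Rightarrow> 'e)) set"

abbreviation mspace :: "('a, 'e) mfd \<Rightarrow> 'a set" where
  "mspace M \<equiv> topspace (mtop M)"

primrec Ck_on :: "nat \<Rightarrow> ('e::euclidean_space \<Rightarrow> 'f::euclidean_space) \<Rightarrow> 'e set \<Rightarrow> bool" where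
  "Ck_on 0 f U \<longleftrightarrow> continuous_on U f"
| "Ck_on (Suc k) f U \<longleftrightarrow>
     (\<exists>f'. (\<forall>x\<in>U. (f has_derivative f' x) (at x)) \<and> (\<forall>v. Ck_on k (\<lambda>x. f' x v) U))"

text \<open>Smoothness on an arbitrary subset: near each point there is a smooth extension.\<close>

definition smooth_on :: "'e::euclidean_space set \<Rightarrow> ('e \<Rightarrow> 'f::euclidean_space) \<Rightarrow> bool" where
  "smooth_on S f \<longleftrightarrow>
     (\<forall>x\<in>S. \<exists>U g. open U \<and> x \<in> U \<and> (\<forall>k. Ck_on k g U) \<and> (\<forall>y\<in>U \<inter> S. g y = f y))"

text \<open>The set \<open>{x \<in> V. 0 \<le> b \<bullet> x}\<close> is \<open>V\<close> itself if \<open>b\<close> is orthogonal to \<open>V\<close> (in particular if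
  \<open>b = 0\<close>), and otherwise a closed half-space of \<open>V\<close>.\<close>

definition is_chart ::
    "nat \<Rightarrow> 'a topology \<Rightarrow> 'a set \<times> ('a \<Rightarrow> 'e::euclidean_space) \<Rightarrow> bool" where
  "is_chart d X = (\<lambda>(U, \<phi>). openin X U \<and>
     homeomorphic_map (subtopology X U) (top_of_set (\<phi> ` U)) \<phi> \<and>
     (\<exists>V b. subspace V \<and> dim V = d \<and> openin (top_of_set {x \<in> V. 0 \<le> b \<bullet> x}) (\<phi> ` U)))"

definition compatible ::
    "'a set \<times> ('a \<Rightarrow> 'e::euclidean_space) \<Rightarrow> 'a set \<times> ('a \<Rightarrow> 'e) \<Rightarrow> bool" where
  "compatible = (\<lambda>(U, \<phi>) (V, \<psi>).
     smooth_on (\<phi> ` (U \<inter> V)) (\<psi> \<circ> inv_into U \<phi>) \<and>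
     smooth_on (\<psi> ` (U \<inter> V)) (\<phi> \<circ> inv_into V \<psi>))"

definition smooth_manifold :: "('a, 'e::euclidean_space) mfd \<Rightarrow> bool" where
  "smooth_manifold M \<longleftrightarrow>
     Hausdorff_space (mtop M) \<and> second_countable (mtop M) \<and>
     (\<Union>(U, \<phi>)\<in>matlas M. U) = mspace M \<and>
     (\<forall>c\<in>matlas M. is_chart (mdim M) (mtop M) c) \<and>
     (\<forall>c\<in>matlas M. \<forall>c'\<in>matlas M. compatible c c')"

definition full_atlas ::
    "('a, 'e::euclidean_space) mfd \<Rightarrow> ('a set \<times> ('a \<Rightarrow> 'e)) set" where
  "full_atlas M = {c. is_chart (mdim M) (mtop M) c \<and> (\<forall>c'\<in>matlas M. compatible c c')}"

definition mboundary :: "('a, 'e::euclidean_space) mfd \<Rightarrow> 'a set" where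
  "mboundary M = (\<Union>(U, \<phi>)\<in>matlas M. {x \<in> U. \<phi> x \<notin> rel_interior (\<phi> ` U)})"

definition closed_manifold :: "('a, 'e::euclidean_space) mfd \<Rightarrow> bool" where
  "closed_manifold M \<longleftrightarrow> smooth_manifold M \<and> compact_space (mtop M) \<and> mboundary M = {}"

definition smooth_map ::
    "('a, 'e::euclidean_space) mfd \<Rightarrow> ('b, 'f::euclidean_space) mfd \<Rightarrow> ('a \<Rightarrow> 'b) \<Rightarrow> bool" where
  "smooth_map M N f \<longleftrightarrow> continuous_map (mtop M) (mtop N) f \<and>
     (\<forall>(U, \<phi>)\<in>matlas M. \<forall>(V, \<psi>)\<in>matlas N.
        smooth_on (\<phi> ` (U \<inter> f -` V)) (\<psi> \<circ> f \<circ> inv_into U \<phi>))"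

definition diffeo ::
    "('a, 'e::euclidean_space) mfd \<Rightarrow> ('b, 'f::euclidean_space) mfd \<Rightarrow> ('a \<Rightarrow> 'b) \<Rightarrow> bool" where
  "diffeo M N f \<longleftrightarrow> smooth_map M N f \<and>
     (\<exists>g. smooth_map N M g \<and> (\<forall>x\<in>mspace M. g (f x) = x) \<and> (\<forall>y\<in>mspace N. f (g y) = y))"

text \<open>
  The structure induced on a subset \<open>S\<close>: restrict those charts \<open>\<phi>\<close> of the maximal atlas for which
  \<open>\<phi> (U \<inter> S)\<close> is open in a \<open>k\<close>-dimensional local model (slice charts).  The subset is a submanifold
  iff these cover it.  This includes codimension zero, submanifolds with boundary, and the
  boundary of \<open>M\<close> itself.
\<close>

definition submfd :: "nat \<Rightarrow> ('a, 'e::euclidean_space) mfd \<Rightarrow> 'a set \<Rightarrow> ('a, 'e) mfd" where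
  "submfd k M S = \<lparr> mtop = subtopology (mtop M) S, mdim = k,
     matlas = {(U \<inter> S, \<phi>) |U \<phi>. (U, \<phi>) \<in> full_atlas M \<and>
                 is_chart k (subtopology (mtop M) S) (U \<inter> S, \<phi>)} \<rparr>"

definition embedded_submanifold :: "nat \<Rightarrow> ('a, 'e::euclidean_space) mfd \<Rightarrow> 'a set \<Rightarrow> bool" where
  "embedded_submanifold k M S \<longleftrightarrow> S \<subseteq> mspace M \<and> smooth_manifold (submfd k M S)"

abbreviation open_part :: "('a, 'e::euclidean_space) mfd \<Rightarrow> 'a set \<Rightarrow> ('a, 'e) mfd" where
  "open_part M U \<equiv> submfd (mdim M) M U"

definition bdry :: "('a, 'e::euclidean_space) mfd \<Rightarrow> ('a, 'e) mfd" where
  "bdry M = submfd (mdim M - 1) M (mboundary M)"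

text \<open>Only used when at most one factor has boundary, so there are no corners.\<close>

definition prod_mfd ::
    "('a, 'e::euclidean_space) mfd \<Rightarrow> ('b, 'f::euclidean_space) mfd \<Rightarrow> ('a \<times> 'b, 'e \<times> 'f) mfd"
  where
  "prod_mfd M N = \<lparr> mtop = prod_topology (mtop M) (mtop N), mdim = mdim M + mdim N,
     matlas = {(U \<times> V, map_prod \<phi> \<psi>) |U \<phi> V \<psi>. (U, \<phi>) \<in> matlas M \<and> (V, \<psi>) \<in> matlas N} \<rparr>"

definition euclidean_mfd :: "('e::euclidean_space, 'e) mfd" where
  "euclidean_mfd = \<lparr> mtop = euclidean, mdim = DIM('e), matlas = {(UNIV, id)} \<rparr>"

definition circle_mfd :: "(complex, complex) mfd" where
  "circle_mfd = submfd 1 euclidean_mfd (sphere 0 1)"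

definition disc_mfd :: "(complex, complex) mfd" where
  "disc_mfd = submfd 2 euclidean_mfd (cball 0 1)"

text \<open>
  An orientation is given by an atlas \<open>A\<close>, all of whose charts take values in one subspace with
  orthonormal basis \<open>bs\<close>, such that the coordinate changes have positive Jacobian determinant.
  The determinant in the basis \<open>bs\<close> is written out by the Leibniz formula, because the library's
  \<open>det\<close> needs a type-indexed dimension.  Half-spaces with either side are allowed as models, so
  manifolds with boundary need no special treatment in dimension one.
\<close>

definition oriented_by ::
    "('a, 'e::euclidean_space) mfd \<Rightarrow> ('a set \<times> ('a \<Rightarrow> 'e)) set \<Rightarrow> bool" where
  "oriented_by M A \<longleftrightarrow> A \<subseteq> full_atlas M \<and> (\<Union>(U, \<phi>)\<in>A. U) = mspace M \<and>
     (\<exists>bs. length bs = mdim M \<and>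
       (\<forall>i<mdim M. \<forall>j<mdim M. bs ! i \<bullet> bs ! j = (if i = j then 1 else 0)) \<and>
       (\<forall>(U, \<phi>)\<in>A. \<phi> ` U \<subseteq> span (set bs)) \<and>
       (\<forall>(U, \<phi>)\<in>A. \<forall>(V, \<psi>)\<in>A. \<forall>x\<in>U \<inter> V. \<exists>D.
          ((\<psi> \<circ> inv_into U \<phi>) has_derivative D) (at (\<phi> x) within \<phi> ` (U \<inter> V)) \<and>
          0 < (\<Sum>\<sigma> | \<sigma> permutes {..<mdim M}.
                 of_int (sign \<sigma>) * (\<Prod>i<mdim M. bs ! i \<bullet> D (bs ! \<sigma> i)))))"

definition fiber :: "('a, 'e) mfd \<Rightarrow> ('a \<Rightarrow> 'b) \<Rightarrow> 'b \<Rightarrow> 'a set" where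
  "fiber M p y = {x \<in> mspace M. p x = y}"

text \<open>Surjective smooth fiber bundles; the local trivializations use the actual fibers.\<close>

definition fibration ::
    "('a, 'e::euclidean_space) mfd \<Rightarrow> ('b, 'f::euclidean_space) mfd \<Rightarrow> ('a \<Rightarrow> 'b) \<Rightarrow> bool" where
  "fibration M B p \<longleftrightarrow> smooth_map M B p \<and> p ` mspace M = mspace B \<and>
     (\<forall>y\<in>mspace B.
        embedded_submanifold (mdim M - mdim B) M (fiber M p y) \<and>
        (\<exists>U h. openin (mtop B) U \<and> y \<in> U \<and>
           diffeo (open_part M {x \<in> mspace M. p x \<in> U})
                  (prod_mfd (open_part B U) (submfd (mdim M - mdim B) M (fiber M p y))) h \<and>
           (\<forall>x\<in>mspace M. p x \<in> U \<longrightarrow> fst (h x) = p x)))"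

definition knot :: "('a, 'e::euclidean_space) mfd \<Rightarrow> 'a set \<Rightarrow> bool" where
  "knot Y K \<longleftrightarrow> embedded_submanifold 1 Y K \<and> (\<exists>k. diffeo circle_mfd (submfd 1 Y K) k)"

text \<open>In an oriented 3-manifold the normal disc bundle of a knot is trivial, so a closed tubular
  neighborhood is a solid torus with the knot as its core.\<close>

definition tubular_nbhd :: "('a, 'e::euclidean_space) mfd \<Rightarrow> 'a set \<Rightarrow> 'a set \<Rightarrow> bool" where
  "tubular_nbhd Y K N \<longleftrightarrow> embedded_submanifold 3 Y N \<and>
     (\<exists>\<tau>. diffeo (prod_mfd circle_mfd disc_mfd) (submfd 3 Y N) \<tau> \<and> \<tau> ` (sphere 0 1 \<times> {0}) = K)"

definition exterior :: "('a, 'e::euclidean_space) mfd \<Rightarrow> 'a set \<Rightarrow> ('a, 'e) mfd" where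
  "exterior Y N = submfd 3 Y (mspace Y - (mtop Y interior_of N))"

text \<open>A longitude: a simple closed curve on the boundary torus that is parallel to the knot in the
  tubular neighborhood, i.e. homotopic to it there (up to the choice of directions).\<close>

definition longitude ::
    "('a, 'e::euclidean_space) mfd \<Rightarrow> 'a set \<Rightarrow> 'a set \<Rightarrow> 'a set \<Rightarrow> bool" where
  "longitude Y K N L \<longleftrightarrow> embedded_submanifold 1 (bdry (exterior Y N)) L \<and>
     (\<exists>k l. diffeo circle_mfd (submfd 1 Y K) k \<and>
            diffeo circle_mfd (submfd 1 (bdry (exterior Y N)) L) l \<and>
            homotopic_with (\<lambda>_. True) (mtop circle_mfd) (subtopology (mtop Y) N) k l)"

text \<open>The single boundary component is expressed by the whole boundary of \<open>F\<close> being a longitude,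
  hence a circle.  The last argument is the orientation of \<open>F\<close>.\<close>

definition seifert_surface ::
    "('a, 'e::euclidean_space) mfd \<Rightarrow> 'a set \<Rightarrow> 'a set \<Rightarrow> 'a set \<Rightarrow>
     ('a set \<times> ('a \<Rightarrow> 'e)) set \<Rightarrow> bool" where
  "seifert_surface Y K N F A \<longleftrightarrow>
     embedded_submanifold 2 (exterior Y N) F \<and>
     compactin (mtop Y) F \<and> connectedin (mtop Y) F \<and>
     oriented_by (submfd 2 (exterior Y N) F) A \<and>
     longitude Y K N (mboundary (submfd 2 (exterior Y N) F))"

definition local_diffeo ::
    "('a, 'e::euclidean_space) mfd \<Rightarrow> ('b, 'f::euclidean_space) mfd \<Rightarrow> ('a \<Rightarrow> 'b) \<Rightarrow> bool" where
  "local_diffeo M N f \<longleftrightarrow> (\<forall>x\<in>mspace M. \<exists>U. openin (mtop M) U \<and> x \<in> U \<and>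
     openin (mtop N) (f ` U) \<and> diffeo (open_part M U) (open_part N (f ` U)) f)"

text \<open>
  The fibration \<open>p\<close> of \<open>E\<close> over the circle, with fiber \<open>F\<close> over \<open>c\<close>, is the mapping torus of \<open>\<phi>\<close>:
  \<open>\<Phi>\<close> identifies \<open>E\<close> with the quotient of \<open>F \<times> \<real>\<close> by \<open>(x, t + 1) \<sim> (\<phi> x, t)\<close>, compatibly with the
  projections and with the inclusion of \<open>F\<close>.
\<close>

definition monodromy ::
    "('a, 'e::euclidean_space) mfd \<Rightarrow> ('a \<Rightarrow> complex) \<Rightarrow> complex \<Rightarrow> ('a \<Rightarrow> 'a) \<Rightarrow> bool" where
  "monodromy E p c \<phi> \<longleftrightarrow>
     (let F = fiber E p c; FM = submfd (mdim E - 1) E F in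
      diffeo FM FM \<phi> \<and>
      (\<exists>\<Phi>. local_diffeo (prod_mfd FM (euclidean_mfd :: (real, real) mfd)) E \<Phi> \<and>
         \<Phi> ` (F \<times> UNIV) = mspace E \<and>
         (\<forall>x\<in>F. \<forall>y\<in>F. \<forall>s t. \<Phi> (x, s) = \<Phi> (y, t) \<longleftrightarrow>
            (\<exists>n::nat. s = t + real n \<and> y = (\<phi> ^^ n) x \<or> t = s + real n \<and> x = (\<phi> ^^ n) y)) \<and>
         (\<forall>x\<in>F. \<Phi> (x, 0) = x) \<and>
         (\<forall>x\<in>F. \<forall>t. p (\<Phi> (x, t)) = c * cis (2 * pi * t))))"

text \<open>\<open>K\<close>, with tubular neighborhood \<open>N\<close>, is fibered by \<open>p\<close>, with fiber surface \<open>F\<close> oriented by \<open>A\<close>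
  and with monodromy \<open>\<phi>\<close>.\<close>

definition fibered_knot ::
    "('a, 'e::euclidean_space) mfd \<Rightarrow> 'a set \<Rightarrow> 'a set \<Rightarrow> ('a \<Rightarrow> complex) \<Rightarrow> 'a set \<Rightarrow>
     ('a set \<times> ('a \<Rightarrow> 'e)) set \<Rightarrow> ('a \<Rightarrow> 'a) \<Rightarrow> bool" where
  "fibered_knot Y K N p F A \<phi> \<longleftrightarrow>
     knot Y K \<and> tubular_nbhd Y K N \<and>
     fibration (exterior Y N) circle_mfd p \<and>
     seifert_surface Y K N F A \<and>
     (\<exists>c\<in>sphere 0 1. F = fiber (exterior Y N) p c \<and> monodromy (exterior Y N) p c \<phi>)"

end

theory Submission imports Defs begin

text \<open>Since \<open>\<lambda>\<close> lies in a fiber, \<open>\<pi>\<close> has degree zero on \<open>\<lambda>\<close>, so on \<open>\<partial>W\<close> it is homotopic to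
  \<open>q(\<theta>, x) = \<theta>\<^sup>a p(x)\<^sup>b\<close>, where \<open>p\<close> is the fibration of the knot exterior: \<open>\<pi> = q \<cdot> cis h\<close> with \<open>h\<close> real and, without
  loss of generality, positive.  Moreover \<open>(a, b) \<noteq> (0, 0)\<close>, as otherwise \<open>\<pi>\<close> would be critical where \<open>h\<close> is maximal.
  Extend \<open>h\<close> to a smooth \<open>H \<ge> 0\<close> supported in a thin collar of \<open>\<partial>W\<close>, where it decreases so steeply in the normal
  direction that it is strictly decreasing along curves in the fibers of \<open>q\<close> as long as it is positive.  Then
  \<open>q \<cdot> cis H\<close> extends \<open>\<pi>\<close> and has no critical points: where \<open>H > 0\<close> because of these curves, and where \<open>H = 0\<close> because
  there \<open>dH = 0\<close> and \<open>q\<close> is a submersion.  By Ehresmann's theorem it is a fibration.\<close>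

subsection \<open>Smooth functions on subsets of Euclidean space\<close>

text \<open>On a manifold with boundary, a fibration must also be regular along the boundary, and a
  trivialization must respect it. Both demands are met by one notion: through every point passes a
  curve along which the value turns with nonzero speed, and which stays in the boundary if it starts
  there. On \<partial>W such curves exist because \<pi> is a fibration. The curves in the fibers of
  q need inward directions along which p is constant; they exist because p is regular along
  \<partial>E too. The form of q rests on \<partial>E being the mapping torus of the monodromy on
  \<partial>F: this makes \<partial>W a quotient of R^3, \<pi> lifts to a real function there, and
  its changes under the identifications are the degrees. The decay in the collar is modelled on
  e^(-1/u), whose derivative is at least its own value for 0 < u \<le> 1. Hence one steepness
  constant beats the variation of the coefficient in front uniformly, up to the edge of the support
  where both contributions tend to 0.\<close>

lemma Ck_on_cong:
  assumes "open U" "\<And>x. x \<in> U \<Longrightarrow> f x = g x" "Ck_on k f U"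
  shows "Ck_on k g U"
proof (cases k)
  case 0
  then show ?thesis using assms continuous_on_cong[of U U f g] by simp
next
  case (Suc m)
  then obtain f' where f': "\<forall>x\<in>U. (f has_derivative f' x) (at x)" "\<forall>v. Ck_on m (\<lambda>x. f' x v) U"
    using assms(3) by auto
  have "(g has_derivative f' x) (at x)" if "x \<in> U" for x
    using has_derivative_transform_within_open[of f "f' x" x UNIV U g] f'(1) assms(1,2) that by auto
  then show ?thesis using Suc f'(2) by auto
qed

lemma Ck_on_subset: "Ck_on k f U \<Longrightarrow> V \<subseteq> U \<Longrightarrow> Ck_on k f V"
  by (induction k arbitrary: f) (auto intro: continuous_on_subset, blast)

lemma Ck_on_continuous: "Ck_on k f U \<Longrightarrow> continuous_on U f"
  by (cases k) (auto intro!: continuous_at_imp_continuous_on dest!: has_derivative_continuous)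

lemma Ck_on_SucD: "Ck_on (Suc k) f U \<Longrightarrow> Ck_on k f U"
proof (induction k arbitrary: f)
  case 0
  then show ?case using Ck_on_continuous[of "Suc 0" f] by (simp only: Ck_on.simps(1))
next
  case (Suc k)
  then show ?case by (metis Ck_on.simps(2))
qed

lemma Ck_on_const [simp]: "Ck_on k (\<lambda>x. c) U"
proof (induction k arbitrary: c)
  case (Suc k)
  then show ?case by (auto intro!: exI[of _ "\<lambda>x v. 0"])
qed simp

lemma Ck_on_linear:
  assumes "bounded_linear L" shows "Ck_on k L U"
proof (cases k)
  case 0 then show ?thesis using assms by (simp add: linear_continuous_on)
next
  case (Suc m)
  then show ?thesis using assms bounded_linear_imp_has_derivative
    by (auto intro!: exI[of _ "\<lambda>x. L"])
qed

lemma Ck_on_linear_comp: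
  assumes "bounded_linear L" shows "Ck_on k f U \<Longrightarrow> Ck_on k (\<lambda>x. L (f x)) U"
proof (induction k arbitrary: f)
  case 0
  then show ?case using assms by (simp add: bounded_linear.continuous_on)
next
  case (Suc k)
  then obtain f' where f': "\<forall>x\<in>U. (f has_derivative f' x) (at x)" "\<forall>v. Ck_on k (\<lambda>x. f' x v) U" by auto
  have "((\<lambda>x. L (f x)) has_derivative (\<lambda>v. L (f' x v))) (at x)" if "x \<in> U" for x
    using bounded_linear.has_derivative[OF assms, of f "f' x"] f' that by blast
  then show ?case using Suc.IH f' by (auto intro!: exI[of _ "\<lambda>x v. L (f' x v)"])
qed

lemma Ck_on_add: "Ck_on k f U \<Longrightarrow> Ck_on k g U \<Longrightarrow> Ck_on k (\<lambda>x. f x + g x) U"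
proof (induction k arbitrary: f g)
  case (Suc k)
  then obtain f' g' where
    "\<forall>x\<in>U. (f has_derivative f' x) (at x)" "\<forall>v. Ck_on k (\<lambda>x. f' x v) U"
    "\<forall>x\<in>U. (g has_derivative g' x) (at x)" "\<forall>v. Ck_on k (\<lambda>x. g' x v) U" by auto
  then show ?case
    by (auto intro!: exI[of _ "\<lambda>x v. f' x v + g' x v"] has_derivative_add Suc.IH)
qed (simp add: continuous_on_add)

lemma Ck_on_sum:
  assumes "\<And>i. i \<in> I \<Longrightarrow> Ck_on k (f i) U"
  shows "Ck_on k (\<lambda>x. \<Sum>i\<in>I. f i x) U"
  using assms by (induction I rule: infinite_finite_induct) (simp_all add: Ck_on_add)

lemma Ck_on_bilinear:
  assumes B: "bounded_bilinear B"
  shows "Ck_on k f U \<Longrightarrow> Ck_on k g U \<Longrightarrow> Ck_on k (\<lambda>x. B (f x) (g x)) U"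
proof (induction k arbitrary: f g)
  case 0
  then show ?case using bounded_bilinear.continuous_on[OF B] by simp
next
  case (Suc k)
  then obtain f' g' where
    *: "\<forall>x\<in>U. (f has_derivative f' x) (at x)" "\<forall>v. Ck_on k (\<lambda>x. f' x v) U"
    "\<forall>x\<in>U. (g has_derivative g' x) (at x)" "\<forall>v. Ck_on k (\<lambda>x. g' x v) U" by auto
  have "Ck_on k (\<lambda>x. B (f x) (g' x v) + B (f' x v) (g x)) U" for v
    by (intro Ck_on_add Suc.IH) (use * Suc.prems in \<open>simp_all only: Ck_on_SucD\<close>)
  moreover have "((\<lambda>x. B (f x) (g x)) has_derivative (\<lambda>v. B (f x) (g' x v) + B (f' x v) (g x))) (at x)"
    if "x \<in> U" for x
    using bounded_bilinear.FDERIV[OF B, of f "f' x" x UNIV g "g' x"] * that by blast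
  ultimately show ?case by (auto intro!: exI[of _ "\<lambda>x v. B (f x) (g' x v) + B (f' x v) (g x)"])
qed

text \<open>The derivative \<open>g' (f x) (f' x v)\<close> has a direction that varies with
  \<open>x\<close>, whereas \<open>Ck_on\<close> controls fixed directions only. Expanding
  \<open>f' x v\<close> in the standard basis gives a sum of scalar functions times
  \<open>g' (f x) i\<close> with \<open>i\<close> fixed, to which the induction hypothesis
  applies.\<close>

lemma Ck_on_comp:
  fixes f :: "'a::euclidean_space \<Rightarrow> 'b::euclidean_space" and g :: "'b \<Rightarrow> 'c::euclidean_space"
  assumes "open U" "f ` U \<subseteq> V"
  shows "Ck_on k f U \<Longrightarrow> Ck_on k g V \<Longrightarrow> Ck_on k (\<lambda>x. g (f x)) U"
proof (induction k arbitrary: g)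
  case 0
  then show ?case using assms continuous_on_compose2 by auto
next
  case (Suc k)
  then obtain f' g' where
    *: "\<forall>x\<in>U. (f has_derivative f' x) (at x)" "\<forall>v. Ck_on k (\<lambda>x. f' x v) U"
    "\<forall>x\<in>V. (g has_derivative g' x) (at x)" "\<forall>v. Ck_on k (\<lambda>x. g' x v) V" by auto
  have "Ck_on k (\<lambda>x. \<Sum>i\<in>Basis. (f' x v \<bullet> i) *\<^sub>R g' (f x) i) U" for v
    by (intro Ck_on_sum Ck_on_bilinear[OF bounded_bilinear_scaleR] Suc.IH
        Ck_on_linear_comp[OF bounded_linear_inner_left])
      (use * Suc.prems in \<open>simp_all only: Ck_on_SucD\<close>)
  moreover have "(\<Sum>i\<in>Basis. (f' x v \<bullet> i) *\<^sub>R g' (f x) i) = g' (f x) (f' x v)" if "x \<in> U" for x v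
  proof -
    have "f x \<in> V" using that assms by auto
    then have "(g has_derivative g' (f x)) (at (f x))" using *(3) by blast
    then interpret bounded_linear "g' (f x)" by (rule has_derivative_bounded_linear)
    have "g' (f x) (f' x v) = g' (f x) (\<Sum>i\<in>Basis. (f' x v \<bullet> i) *\<^sub>R i)"
      by (simp only: euclidean_representation)
    then show ?thesis by (simp only: sum scaleR)
  qed
  ultimately have "Ck_on k (\<lambda>x. g' (f x) (f' x v)) U" for v
    using Ck_on_cong[OF assms(1), of "\<lambda>x. \<Sum>i\<in>Basis. (f' x v \<bullet> i) *\<^sub>R g' (f x) i"
      "\<lambda>x. g' (f x) (f' x v)" k] by simp
  moreover have "((\<lambda>x. g (f x)) has_derivative (\<lambda>v. g' (f x) (f' x v))) (at x)" if "x \<in> U" for x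
    using diff_chain_at[of f "f' x" x g "g' (f x)"] * that assms by (auto simp: o_def)
  ultimately show ?case by (auto intro!: exI[of _ "\<lambda>x v. g' (f x) (f' x v)"])
qed

text \<open>Bootstrapping: a function gains one order of differentiability over its derivative.
  \<open>exp\<close>, \<open>inverse\<close>, \<open>Ln\<close> and \<open>flat\<close> are handled
  this way, since their derivatives are built from functions of the same kind or from functions
  already treated.\<close>

lemma Ck_on_field_deriv:
  fixes f :: "'a::{euclidean_space, real_normed_field} \<Rightarrow> 'a"
  assumes "\<And>x. x \<in> U \<Longrightarrow> (f has_field_derivative g x) (at x)" "Ck_on k g U"
  shows "Ck_on (Suc k) f U"
  using assms Ck_on_linear_comp[OF bounded_linear_mult_left]
  by (auto intro!: exI[of _ "\<lambda>x v. g x * v"] simp: has_field_derivative_def)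

lemma Ck_on_exp: "Ck_on k (exp :: 'a::{euclidean_space, real_normed_field, banach} \<Rightarrow> 'a) U"
proof (induction k)
  case (Suc k) then show ?case by (intro Ck_on_field_deriv) (auto intro: DERIV_exp)
qed (simp add: continuous_on_exp)

lemma Ck_on_inverse:
  "0 \<notin> U \<Longrightarrow> Ck_on k (inverse :: 'a::{euclidean_space, real_normed_field} \<Rightarrow> 'a) U"
proof (induction k)
  case 0
  then have "continuous_on U (\<lambda>x. inverse x :: 'a)" by (intro continuous_on_inverse) auto
  then show ?case by (simp add: comp_def)
next
  case (Suc k)
  then have "Ck_on k (\<lambda>x::'a. - (inverse x * inverse x)) U"
    by (intro Ck_on_linear_comp[OF bounded_linear_minus[OF bounded_linear_ident]]
        Ck_on_bilinear[OF bounded_bilinear_mult]) auto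
  then show ?case using Suc(2)
    by (intro Ck_on_field_deriv[where g="\<lambda>x. - (inverse x * inverse x)"])
       (auto intro!: derivative_eq_intros simp: power2_eq_square)
qed

lemma Ck_on_Ln: "U \<inter> \<real>\<^sub>\<le>\<^sub>0 = {} \<Longrightarrow> Ck_on k Ln U"
proof (cases k)
  case 0
  then show "U \<inter> \<real>\<^sub>\<le>\<^sub>0 = {} \<Longrightarrow> Ck_on k Ln U"
    by (auto intro!: continuous_at_imp_continuous_on continuous_at_Ln)
next
  case (Suc m)
  assume a: "U \<inter> \<real>\<^sub>\<le>\<^sub>0 = {}"
  then have "0 \<notin> U" by auto
  then show ?thesis unfolding Suc using a Ck_on_inverse
    by (intro Ck_on_field_deriv) (auto intro: has_field_derivative_Ln)
qed

text \<open>\<open>Ck_on\<close> asks for one derivative function on the whole set, while the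
  hypotheses supply a different one near each point. Uniqueness of the derivative makes all of them
  agree with \<open>frechet_derivative\<close>, which serves as the global witness.\<close>

lemma Ck_on_local:
  assumes "\<And>x. x \<in> U \<Longrightarrow> \<exists>V. open V \<and> x \<in> V \<and> Ck_on k f V"
  shows "Ck_on k f U"
  using assms
proof (induction k arbitrary: f)
  case 0
  then show ?case
    by (metis Ck_on.simps(1) continuous_at_imp_continuous_on continuous_on_eq_continuous_at)
next
  case (Suc k)
  have d: "(f has_derivative frechet_derivative f (at x)) (at x)" if "x \<in> U" for x
    using Suc.prems[OF that] unfolding frechet_derivative_works[symmetric] differentiable_def by auto
  have "Ck_on k (\<lambda>x. frechet_derivative f (at x) v) U" for v
  proof (rule Suc.IH)
    fix x assume "x \<in> U"
    then obtain V where V0: "open V" "x \<in> V" "Ck_on (Suc k) f V" using Suc.prems by blast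
    then obtain f' where V: "open V" "x \<in> V" "\<forall>x\<in>V. (f has_derivative f' x) (at x)"
       "\<forall>v. Ck_on k (\<lambda>x. f' x v) V" by auto
    have "f' y v = frechet_derivative f (at y) v" if "y \<in> V" for y
      using V(3) that frechet_derivative_at by metis
    then show "\<exists>V. open V \<and> x \<in> V \<and> Ck_on k (\<lambda>x. frechet_derivative f (at x) v) V"
      using V(1,2) Ck_on_cong[OF V(1), of "\<lambda>x. f' x v" "\<lambda>x. frechet_derivative f (at x) v" k] V(4)
      by (intro exI[of _ V]) simp
  qed
  then show ?case using d by (auto intro!: exI[of _ "\<lambda>x. frechet_derivative f (at x)"])
qed

text \<open>On an open set a local extension coincides with the function near the point, so
  \<open>Ck_on_local\<close> applies. This carries the calculus of \<open>Ck_on\<close> over to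
  \<open>smooth_on\<close>.\<close>

lemma smooth_on_open_iff: "open U \<Longrightarrow> smooth_on U f \<longleftrightarrow> (\<forall>k. Ck_on k f U)"
proof
  assume U: "open U" and s: "smooth_on U f"
  show "\<forall>k. Ck_on k f U"
  proof
    fix k show "Ck_on k f U"
    proof (rule Ck_on_local)
      fix x assume "x \<in> U"
      then obtain V g where V: "open V" "x \<in> V" "\<forall>k. Ck_on k g V" "\<forall>y\<in>V \<inter> U. g y = f y"
        using s unfolding smooth_on_def by blast
      have "Ck_on k f (V \<inter> U)"
        by (rule Ck_on_cong[of _ g]) (use V U Ck_on_subset[of k g V] in auto)
      then show "\<exists>V. open V \<and> x \<in> V \<and> Ck_on k f V" using V U \<open>x \<in> U\<close> by (intro exI[of _ "V \<inter> U"]) auto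
    qed
  qed
qed (auto simp: smooth_on_def)

lemma smooth_on_subset: "smooth_on S f \<Longrightarrow> T \<subseteq> S \<Longrightarrow> smooth_on T f"
  unfolding smooth_on_def by (meson IntD1 IntD2 IntI subsetD)

lemma smooth_on_cong: "smooth_on S f \<Longrightarrow> (\<And>x. x \<in> S \<Longrightarrow> f x = g x) \<Longrightarrow> smooth_on S g"
  unfolding smooth_on_def by (metis IntD2)

lemma smooth_on_local:
  assumes "\<And>x. x \<in> S \<Longrightarrow> \<exists>O'. open O' \<and> x \<in> O' \<and> smooth_on (S \<inter> O') f"
  shows "smooth_on S f"
  unfolding smooth_on_def
proof
  fix x assume x: "x \<in> S"
  then obtain O' where O': "open O'" "x \<in> O'" "smooth_on (S \<inter> O') f" using assms by blast
  then obtain U g where "open U" "x \<in> U" "\<forall>k. Ck_on k g U" "\<forall>y\<in>U \<inter> (S \<inter> O'). g y = f y"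
    using x unfolding smooth_on_def by blast
  then show "\<exists>U g. open U \<and> x \<in> U \<and> (\<forall>k. Ck_on k g U) \<and> (\<forall>y\<in>U \<inter> S. g y = f y)"
    using O' Ck_on_subset[of _ g U "U \<inter> O'"] by (intro exI[of _ "U \<inter> O'"] exI[of _ g]) auto
qed

lemma smooth_on_continuous: "smooth_on S f \<Longrightarrow> continuous_on S f"
proof -
  assume s: "smooth_on S f"
  have "\<exists>T. open T \<and> x \<in> T \<and> continuous_on (S \<inter> T) f" if x: "x \<in> S" for x
  proof -
    obtain U g where U: "open U" "x \<in> U" "\<forall>k. Ck_on k g U" "\<forall>y\<in>U \<inter> S. g y = f y"
      using s x unfolding smooth_on_def by blast
    have "continuous_on (S \<inter> U) g" using Ck_on_continuous[of 0 g U] U(3) continuous_on_subset by blast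
    then have "continuous_on (S \<inter> U) f" using U(4) by (metis Int_commute continuous_on_eq)
    then show ?thesis using U by blast
  qed
  show ?thesis
    unfolding continuous_on_eq_continuous_within
  proof
    fix x assume x: "x \<in> S"
    then obtain T where T: "open T" "x \<in> T" "continuous_on (S \<inter> T) f"
      using \<open>\<And>x. x \<in> S \<Longrightarrow> \<exists>T. open T \<and> x \<in> T \<and> continuous_on (S \<inter> T) f\<close> by blast
    then have "continuous (at x within S \<inter> T) f"
      using x continuous_on_eq_continuous_within by blast
    moreover have "at x within S \<inter> T = at x within S"
      by (rule at_within_nhd[OF T(2,1)]) auto
    ultimately show "continuous (at x within S) f" by simp
  qed
qed

lemma smooth_on_comp:
  fixes f :: "'a::euclidean_space \<Rightarrow> 'b::euclidean_space" and g :: "'b \<Rightarrow> 'c::euclidean_space"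
  assumes f: "smooth_on S f" and g: "smooth_on T g" and sub: "\<And>x. x \<in> S \<Longrightarrow> f x \<in> T"
  shows "smooth_on S (\<lambda>x. g (f x))"
  unfolding smooth_on_def
proof
  fix x assume x: "x \<in> S"
  obtain U f1 where U: "open U" "x \<in> U" "\<And>k. Ck_on k f1 U" "\<forall>y\<in>U \<inter> S. f1 y = f y"
    using f x unfolding smooth_on_def by blast
  obtain V g1 where V: "open V" "f x \<in> V" "\<And>k. Ck_on k g1 V" "\<forall>y\<in>V \<inter> T. g1 y = g y"
    using g sub[OF x] unfolding smooth_on_def by blast
  let ?U = "U \<inter> f1 -` V"
  have o: "open ?U" using Ck_on_continuous[OF U(3)[of 0]] U(1) V(1)
    by (simp add: continuous_on_open_vimage[OF U(1)] Int_commute)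
  moreover have "x \<in> ?U" using U V x by auto
  moreover have "Ck_on k (\<lambda>x. g1 (f1 x)) ?U" for k
    by (rule Ck_on_comp[OF o _ Ck_on_subset[OF U(3)] V(3)]) auto
  moreover have "\<forall>y\<in>?U \<inter> S. g1 (f1 y) = g (f y)"
    using U(4) V(4) sub by (metis IntD1 IntD2 IntI vimageE)
  ultimately show "\<exists>U h. open U \<and> x \<in> U \<and> (\<forall>k. Ck_on k h U) \<and> (\<forall>y\<in>U \<inter> S. h y = g (f y))"
    by blast
qed

lemma smooth_on_CkI: "open V \<Longrightarrow> (\<And>k. Ck_on k g V) \<Longrightarrow> smooth_on V g"
  by (simp add: smooth_on_open_iff)

lemma smooth_on_const [simp]: "smooth_on S (\<lambda>x. c)"
  using smooth_on_CkI[of UNIV "\<lambda>x. c"] smooth_on_subset[of UNIV "\<lambda>x. c" S] by simp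

lemma smooth_on_linear: "bounded_linear L \<Longrightarrow> smooth_on S L"
  using smooth_on_CkI[of UNIV L] smooth_on_subset[of UNIV L S] Ck_on_linear[of L _ UNIV] by simp

lemma smooth_on_id [simp]: "smooth_on S (\<lambda>x. x)" "smooth_on S id"
  using smooth_on_linear[OF bounded_linear_ident] by (simp_all add: id_def)

lemma smooth_on_linear_comp: "bounded_linear L \<Longrightarrow> smooth_on S f \<Longrightarrow> smooth_on S (\<lambda>x. L (f x))"
  using smooth_on_comp[of S f UNIV L] smooth_on_linear by auto

lemma smooth_on_fst: "smooth_on S f \<Longrightarrow> smooth_on S (\<lambda>x. fst (f x))"
  by (rule smooth_on_linear_comp[OF bounded_linear_fst])

lemma smooth_on_snd: "smooth_on S f \<Longrightarrow> smooth_on S (\<lambda>x. snd (f x))"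
  by (rule smooth_on_linear_comp[OF bounded_linear_snd])

lemma smooth_on_Pair:
  assumes "smooth_on S f" "smooth_on S g" shows "smooth_on S (\<lambda>x. (f x, g x))"
  unfolding smooth_on_def
proof
  fix x assume x: "x \<in> S"
  obtain U f1 where U: "open U" "x \<in> U" "\<And>k. Ck_on k f1 U" "\<forall>y\<in>U \<inter> S. f1 y = f y"
    using assms(1) x unfolding smooth_on_def by blast
  obtain V g1 where V: "open V" "x \<in> V" "\<And>k. Ck_on k g1 V" "\<forall>y\<in>V \<inter> S. g1 y = g y"
    using assms(2) x unfolding smooth_on_def by blast
  have l1: "bounded_linear (\<lambda>a::'b. (a, 0::'c))" 
    by (intro bounded_linear_Pair bounded_linear_ident bounded_linear_zero)
  have l2: "bounded_linear (\<lambda>a::'c. (0::'b, a))"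
    by (intro bounded_linear_Pair bounded_linear_ident bounded_linear_zero)
  have "Ck_on k (\<lambda>x. (f1 x, 0) + (0, g1 x)) (U \<inter> V)" for k
    by (intro Ck_on_add Ck_on_linear_comp[OF l1] Ck_on_linear_comp[OF l2])
      (auto intro: Ck_on_subset[OF U(3)] Ck_on_subset[OF V(3)])
  then have "\<forall>k. Ck_on k (\<lambda>x. (f1 x, g1 x)) (U \<inter> V)" by simp
  then show "\<exists>U h. open U \<and> x \<in> U \<and> (\<forall>k. Ck_on k h U) \<and> (\<forall>y\<in>U \<inter> S. h y = (f y, g y))"
    using U V by (intro exI[of _ "U \<inter> V"] exI[of _ "\<lambda>x. (f1 x, g1 x)"]) auto
qed

lemma smooth_on_bilinear:
  fixes B :: "'b::euclidean_space \<Rightarrow> 'c::euclidean_space \<Rightarrow> 'd::euclidean_space"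
  assumes B: "bounded_bilinear B" and f: "smooth_on S f" and g: "smooth_on S g"
  shows "smooth_on S (\<lambda>x. B (f x) (g x))"
proof -
  have "smooth_on UNIV (\<lambda>p::'b \<times> 'c. B (fst p) (snd p))"
    by (intro smooth_on_CkI Ck_on_bilinear[OF B] Ck_on_linear bounded_linear_fst bounded_linear_snd) simp
  from smooth_on_comp[OF smooth_on_Pair[OF f g] this] show ?thesis by simp
qed

lemmas smooth_on_mult = smooth_on_bilinear[OF bounded_bilinear_mult]
  and smooth_on_scaleR = smooth_on_bilinear[OF bounded_bilinear_scaleR]
  and smooth_on_inner = smooth_on_bilinear[OF bounded_bilinear_inner]
  and smooth_on_of_real = smooth_on_linear_comp[OF bounded_linear_of_real]
  and smooth_on_Re = smooth_on_linear_comp[OF bounded_linear_Re]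
  and smooth_on_Im = smooth_on_linear_comp[OF bounded_linear_Im]
  and smooth_on_cnj = smooth_on_linear_comp[OF bounded_linear_cnj]
  and smooth_on_minus = smooth_on_linear_comp[OF bounded_linear_minus[OF bounded_linear_ident]]

lemma smooth_on_add:
  fixes f g :: "'a::euclidean_space \<Rightarrow> 'b::euclidean_space"
  assumes "smooth_on S f" "smooth_on S g" shows "smooth_on S (\<lambda>x. f x + g x)"
proof -
  have "bounded_linear (\<lambda>p::'b \<times> 'b. fst p + snd p)"
    by (intro bounded_linear_add bounded_linear_fst bounded_linear_snd)
  from smooth_on_linear_comp[OF this smooth_on_Pair[OF assms]] show ?thesis by simp
qed

lemma smooth_on_diff:
  fixes f g :: "'a::euclidean_space \<Rightarrow> 'b::euclidean_space"
  assumes "smooth_on S f" "smooth_on S g" shows "smooth_on S (\<lambda>x. f x - g x)"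
  using smooth_on_add[OF assms(1) smooth_on_minus[OF assms(2)]] by simp

lemma smooth_on_power:
  fixes f :: "_ \<Rightarrow> 'b::{euclidean_space, real_normed_field}"
  assumes "smooth_on S f" shows "smooth_on S (\<lambda>x. f x ^ n)"
  using assms by (induction n) (simp_all add: smooth_on_mult)

lemma smooth_on_exp:
  fixes f :: "_ \<Rightarrow> 'b::{euclidean_space, real_normed_field, banach}"
  assumes "smooth_on S f" shows "smooth_on S (\<lambda>x. exp (f x))"
  using smooth_on_comp[OF assms smooth_on_CkI[OF open_UNIV Ck_on_exp]] by simp

lemma smooth_on_inverse:
  fixes f :: "_ \<Rightarrow> 'b::{euclidean_space, real_normed_field}"
  assumes "smooth_on S f" "\<And>x. x \<in> S \<Longrightarrow> f x \<noteq> 0" shows "smooth_on S (\<lambda>x. inverse (f x))"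
  using smooth_on_comp[OF assms(1) smooth_on_CkI[of "- {0}", OF _ Ck_on_inverse]] assms(2) by auto

lemma smooth_on_divide:
  fixes f g :: "_ \<Rightarrow> 'b::{euclidean_space, real_normed_field}"
  assumes "smooth_on S f" "smooth_on S g" "\<And>x. x \<in> S \<Longrightarrow> g x \<noteq> 0"
  shows "smooth_on S (\<lambda>x. f x / g x)"
  unfolding divide_inverse by (intro smooth_on_mult smooth_on_inverse assms)

lemma smooth_on_Ln:
  assumes "smooth_on S f" "\<And>x. x \<in> S \<Longrightarrow> f x \<notin> \<real>\<^sub>\<le>\<^sub>0" shows "smooth_on S (\<lambda>x. Ln (f x))"
  using smooth_on_comp[OF assms(1) smooth_on_CkI[of "- \<real>\<^sub>\<le>\<^sub>0", OF _ Ck_on_Ln]] assms(2)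
  by (auto simp: closed_nonpos_Reals_complex open_Compl)

lemma smooth_on_cis: "smooth_on S f \<Longrightarrow> smooth_on S (\<lambda>x. cis (f x))"
  unfolding cis_conv_exp by (intro smooth_on_exp smooth_on_mult smooth_on_of_real smooth_on_const)

lemma smooth_on_powi:
  fixes f :: "_ \<Rightarrow> 'b::{euclidean_space, real_normed_field}"
  assumes "smooth_on S f" "\<And>x. x \<in> S \<Longrightarrow> f x \<noteq> 0" shows "smooth_on S (\<lambda>x. f x powi n)"
proof (cases "0 \<le> n")
  case True then show ?thesis unfolding power_int_def using smooth_on_power[OF assms(1)] by simp
next
  case False then show ?thesis unfolding power_int_def
    using smooth_on_power[OF smooth_on_inverse[OF assms]] by simp
qed

lemma smooth_on_deriv:
  assumes "open U" "smooth_on U f"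
  shows "x \<in> U \<Longrightarrow> (f has_derivative frechet_derivative f (at x)) (at x)"
    and "smooth_on U (\<lambda>x. frechet_derivative f (at x) v)"
proof -
  have C: "Ck_on k f U" for k using assms smooth_on_open_iff[of U f] by simp
  show "(f has_derivative frechet_derivative f (at x)) (at x)" if "x \<in> U"
    using C[of "Suc 0"] that unfolding frechet_derivative_works[symmetric] differentiable_def by auto
  show "smooth_on U (\<lambda>x. frechet_derivative f (at x) v)"
  proof (rule smooth_on_CkI[OF assms(1)])
    fix k
    obtain f' where f': "\<forall>x\<in>U. (f has_derivative f' x) (at x)" "\<forall>v. Ck_on k (\<lambda>x. f' x v) U"
      using C[of "Suc k"] by auto
    have "f' y v = frechet_derivative f (at y) v" if "y \<in> U" for y
      using f'(1) that frechet_derivative_at by metis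
    then show "Ck_on k (\<lambda>x. frechet_derivative f (at x) v) U"
      using Ck_on_cong[OF assms(1), of "\<lambda>x. f' x v" "\<lambda>x. frechet_derivative f (at x) v" k] f'(2) by simp
  qed
qed

section \<open>A flat function and a smooth step\<close>

text \<open>For x > 0 this is x^(-n) e^(-1/x). The whole family is introduced because it is closed
  under differentiation up to linear combinations, so that one induction over the order gives
  smoothness for all \<open>n\<close>. Later only \<open>n = 0\<close> and its derivative
  \<open>n = 2\<close> matter.\<close>

definition flat :: "nat \<Rightarrow> real \<Rightarrow> real" where
  "flat n x = (if x \<le> 0 then 0 else inverse x ^ n / exp (inverse x))"

lemma flat_tendsto_0: "(flat n \<longlongrightarrow> 0) (at 0)"
proof -
  have "((\<lambda>x::real. inverse x ^ n / exp (inverse x)) \<longlongrightarrow> 0) (at_right 0)"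
    by (rule filterlim_compose[OF tendsto_power_div_exp_0 filterlim_inverse_at_top_right])
  then have "(flat n \<longlongrightarrow> 0) (at_right 0)"
    by (rule Lim_transform_eventually) (auto simp: flat_def eventually_at_filter)
  moreover have "(flat n \<longlongrightarrow> 0) (at_left 0)"
    by (rule tendsto_eventually) (auto simp: flat_def eventually_at_filter)
  ultimately show ?thesis by (simp add: filterlim_split_at)
qed

lemma flat_DERIV: "(flat n has_field_derivative flat (n + 2) x - real n * flat (n + 1) x) (at x)"
proof -
  consider "x < 0" | "x = 0" | "x > 0" by linarith
  then show ?thesis
  proof cases
    case 1
    have "((\<lambda>x. 0) has_field_derivative flat (n + 2) x - real n * flat (n + 1) x) (at x)"
      using 1 by (simp add: flat_def)
    then show ?thesis
      by (rule has_field_derivative_transform_within_open[where S="{..<0}"]) (use 1 in \<open>auto simp: flat_def\<close>)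
  next
    case 2
    \<comment> \<open>The difference quotient at 0 is the next member of the family,
      \<open>flat (n + 1) h\<close>, whose limit is known.\<close>
    have "((\<lambda>h. flat n h / h) \<longlongrightarrow> 0) (at 0)"
      by (rule Lim_transform_eventually[OF flat_tendsto_0[of "Suc n"]])
        (auto simp: flat_def eventually_at_filter divide_simps)
    then show ?thesis using 2 unfolding DERIV_def by (simp add: flat_def)
  next
    case 3
    \<comment> \<open>The cases keep the exponent \<open>n - 1\<close> in the derivative of the
      power free of truncated subtraction.\<close>
    have "n = 0 \<or> n = 1 \<or> (\<exists>m. n = Suc (Suc m))" by presburger
    then have "((\<lambda>x. inverse x ^ n * exp (- inverse x)) has_field_derivative
         flat (n + 2) x - real n * flat (n + 1) x) (at x)"
      using 3
      by (auto intro!: derivative_eq_intros simp: flat_def exp_minus field_simps power2_eq_square)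
    then show ?thesis
      by (rule has_field_derivative_transform_within_open[where S="{0<..}"])
        (use 3 in \<open>auto simp: flat_def exp_minus divide_inverse\<close>)
  qed
qed

lemma Ck_on_flat: "Ck_on k (flat n) UNIV"
proof (induction k arbitrary: n)
  case 0
  then show ?case using DERIV_isCont[OF flat_DERIV]
    by (auto intro: continuous_at_imp_continuous_on)
next
  case (Suc k)
  have "Ck_on k (\<lambda>x. flat (n + 2) x + (- real n) * flat (n + 1) x) UNIV"
    by (intro Ck_on_add Suc Ck_on_linear_comp[OF bounded_linear_mult_right])
  then show ?case
    by (intro Ck_on_field_deriv[where g="\<lambda>x. flat (n + 2) x + (- real n) * flat (n + 1) x"])
       (use flat_DERIV[of n] in auto)
qed

lemma smooth_on_flat: "smooth_on S f \<Longrightarrow> smooth_on S (\<lambda>x. flat n (f x))"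
  using smooth_on_comp[of S f UNIV "flat n"] smooth_on_CkI[OF open_UNIV Ck_on_flat] by auto

lemma flat_nonneg: "0 \<le> flat n x" by (simp add: flat_def)

lemma flat_pos_iff: "0 < flat n x \<longleftrightarrow> 0 < x" by (simp add: flat_def)

text \<open>\<open>1 - t\<close> and \<open>t - 1 / 2\<close> are never both nonpositive, so the
  quotient is smooth on the whole line. It is the usual step from 1 (up to 1/2) down to 0 (from 1
  on).\<close>

definition plateau :: "real \<Rightarrow> real" where
  "plateau t = flat 0 (1 - t) / (flat 0 (1 - t) + flat 0 (t - 1 / 2))"

lemma plateau_denominator: "0 < flat 0 (1 - t) + flat 0 (t - 1 / 2)"
proof (cases "t < 1")
  case True then have "0 < flat 0 (1 - t)" by (simp add: flat_pos_iff)
  then show ?thesis using flat_nonneg by (simp add: add_pos_nonneg)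
next
  case False then have "0 < flat 0 (t - 1 / 2)" by (simp add: flat_pos_iff)
  then show ?thesis using flat_nonneg by (simp add: add_nonneg_pos)
qed

lemma smooth_on_plateau: "smooth_on S f \<Longrightarrow> smooth_on S (\<lambda>x. plateau (f x))"
  unfolding plateau_def
  by (intro smooth_on_divide smooth_on_add smooth_on_flat smooth_on_diff smooth_on_const)
    (use plateau_denominator in \<open>auto simp: less_le\<close>)

lemma plateau_bounds: "0 \<le> plateau t" "plateau t \<le> 1"
  using plateau_denominator[of t] flat_nonneg by (auto simp: plateau_def divide_simps)

lemma plateau_eq_1: "t \<le> 1 / 2 \<Longrightarrow> plateau t = 1"
  using plateau_denominator[of t] by (auto simp: plateau_def flat_def)

lemma plateau_eq_0: "1 \<le> t \<Longrightarrow> plateau t = 0"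
  by (simp add: plateau_def flat_def)

section \<open>Replacing one coordinate by a function\<close>

text \<open>The map y |-> y + (G y - w.y) w changes only the component along the unit vector
  \<open>w\<close>, which becomes \<open>G y\<close>; its derivative at \<open>x0\<close> is
  invertible because dG(w) is nonzero there. The inverse function theorem yields a C^1 inverse, and
  its smoothness is obtained by bootstrapping, because the derivative of the inverse is a rational
  expression in derivatives of \<open>G\<close> evaluated at the inverse.\<close>

lemma smooth_replace_coordinate:
  fixes G :: "'e::euclidean_space \<Rightarrow> real" and w :: 'e
  assumes op: "open S" "x0 \<in> S" and G: "smooth_on S G" and w: "norm w = 1"
    and nz: "frechet_derivative G (at x0) w \<noteq> 0"
  obtains P Q \<Gamma> where "open P" "x0 \<in> P" "P \<subseteq> S" "open Q" "smooth_on Q \<Gamma>"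
    "\<And>y. y \<in> P \<Longrightarrow> y + (G y - w \<bullet> y) *\<^sub>R w \<in> Q \<and> \<Gamma> (y + (G y - w \<bullet> y) *\<^sub>R w) = y"
    "\<And>z. z \<in> Q \<Longrightarrow> \<Gamma> z \<in> P \<and> \<Gamma> z + (G (\<Gamma> z) - w \<bullet> \<Gamma> z) *\<^sub>R w = z"
proof -
  define D where "D y = frechet_derivative G (at y)" for y
  define \<Theta> where "\<Theta> y = y + (G y - w \<bullet> y) *\<^sub>R w" for y
  have sD: "smooth_on S (\<lambda>y. D y v)" for v unfolding D_def by (rule smooth_on_deriv(2)[OF op(1) G])
  define S1 where "S1 = S \<inter> (\<lambda>y. D y w) -` (- {0})"
  have S1: "open S1" unfolding S1_def
    using continuous_on_open_vimage[OF op(1), of "\<lambda>y. D y w"] smooth_on_continuous[OF sD]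
    by (metis inf_commute open_Compl closed_singleton)
  have dG: "(G has_derivative D y) (at y)" if "y \<in> S" for y
    unfolding D_def by (rule smooth_on_deriv(1)[OF op(1) G that])
  have blD: "bounded_linear (D y)" if "y \<in> S" for y using dG[OF that] has_derivative_bounded_linear by blast
  define f' where "f' y = Blinfun (\<lambda>v. v + (D y v - w \<bullet> v) *\<^sub>R w)" for y
  have bl1: "bounded_linear (\<lambda>v. v + (D y v - w \<bullet> v) *\<^sub>R w)" if "y \<in> S" for y
    by (intro bounded_linear_add bounded_linear_ident bounded_linear_scaleR_const
         bounded_linear_sub blD[OF that] bounded_linear_inner_right)
  have f'_app: "blinfun_apply (f' y) v = v + (D y v - w \<bullet> v) *\<^sub>R w" if "y \<in> S" for y v
    unfolding f'_def by (simp add: bounded_linear_Blinfun_apply bl1 that)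
  have f'_app2: "blinfun_apply (f' y) = (\<lambda>v. v + (D y v - w \<bullet> v) *\<^sub>R w)" if "y \<in> S" for y
    using f'_app[OF that] by auto
  have der: "(\<Theta> has_derivative blinfun_apply (f' y)) (at y)" if "y \<in> S1" for y
  proof -
    have y: "y \<in> S" using that S1_def by auto
    show ?thesis unfolding \<Theta>_def f'_app2[OF y]
      by (auto intro!: derivative_eq_intros dG[OF y])
  qed
  have cont: "continuous_on S1 f'"
  proof (rule continuous_on_blinfun_componentwise)
    fix i :: 'e assume "i \<in> Basis"
    have "continuous_on S1 (\<lambda>x. D x i)"
      using smooth_on_continuous[OF sD] continuous_on_subset S1_def by blast
    then have "continuous_on S1 (\<lambda>y. i + (D y i - w \<bullet> i) *\<^sub>R w)" by (intro continuous_intros)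
    then show "continuous_on S1 (\<lambda>x. blinfun_apply (f' x) i)"
      by (rule continuous_on_eq) (auto simp: f'_app S1_def)
  qed
  have x0: "x0 \<in> S1" using nz op by (auto simp: S1_def D_def)
  \<comment> \<open>The derivative of \<open>\<Theta>\<close> is a rank-one change of the identity,
    so its inverse has this closed form, whose only denominator is dG(w).\<close>
  define inv' where "inv' y u = u + ((w \<bullet> u - D y u) * inverse (D y w)) *\<^sub>R w" for y u
  have bl2: "bounded_linear (inv' y)" if "y \<in> S" for y
    unfolding inv'_def
    by (intro bounded_linear_add bounded_linear_ident bounded_linear_scaleR_const
         bounded_linear_mult_const bounded_linear_sub blD[OF that] bounded_linear_inner_right)
  have ww: "w \<bullet> w = 1" using w by (simp add: dot_square_norm)
  have inv'_left: "inv' y (v + (D y v - w \<bullet> v) *\<^sub>R w) = v" if "y \<in> S1" for y v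
  proof -
    interpret bounded_linear "D y" using blD that S1_def by auto
    have nz: "D y w \<noteq> 0" using that S1_def by auto
    have "w \<bullet> (v + (D y v - w \<bullet> v) *\<^sub>R w) = D y v" by (simp add: inner_add_right ww)
    moreover have "D y (v + (D y v - w \<bullet> v) *\<^sub>R w) = D y v + (D y v - w \<bullet> v) * D y w"
      by (simp add: add scaleR)
    ultimately have "inv' y (v + (D y v - w \<bullet> v) *\<^sub>R w)
       = v + (D y v - w \<bullet> v) *\<^sub>R w + (- (D y v - w \<bullet> v)) *\<^sub>R w"
      unfolding inv'_def using nz by (simp add: mult.assoc flip: scaleR_minus_left)
    then show ?thesis by (simp only: scaleR_minus_left) simp
  qed
  have "Blinfun (inv' x0) o\<^sub>L f' x0 = id_blinfun"
    by (rule blinfun_eqI)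
      (use x0 bl2[of x0] in \<open>simp add: bounded_linear_Blinfun_apply f'_app inv'_left S1_def\<close>)
  from inverse_function_theorem[OF S1 der cont x0 this]
  obtain P Q \<Gamma> g' where PQ: "open P" "P \<subseteq> S1" "x0 \<in> P" "open Q" "\<Theta> x0 \<in> Q" "homeomorphism P Q \<Theta> \<Gamma>"
    and dg: "\<And>y. y \<in> Q \<Longrightarrow> (\<Gamma> has_derivative (g' y)) (at y)"
    "\<And>y. y \<in> Q \<Longrightarrow> g' y = inv (blinfun_apply (f' (\<Gamma> y)))"
    "\<And>y. y \<in> Q \<Longrightarrow> bij (blinfun_apply (f' (\<Gamma> y)))" by blast
  have GP: "\<Gamma> y \<in> P" if "y \<in> Q" for y using PQ(6) that by (auto simp: homeomorphism_def)
  have g': "g' y = inv' (\<Gamma> y)" if y: "y \<in> Q" for y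
  proof
    fix u
    have s1: "\<Gamma> y \<in> S1" "\<Gamma> y \<in> S" using GP[OF y] PQ(2) S1_def by auto
    obtain v where v: "u = blinfun_apply (f' (\<Gamma> y)) v" using dg(3)[OF y] by (meson bij_pointE)
    have "g' y u = v" unfolding dg(2)[OF y] v using dg(3)[OF y] by (simp add: bij_is_inj)
    then show "g' y u = inv' (\<Gamma> y) u" using inv'_left[OF s1(1)] v f'_app[OF s1(2)] by simp
  qed
  have PS: "P \<subseteq> S" using PQ(2) S1_def by auto
  have CkD: "Ck_on k (\<lambda>y. D y v) P" for k v
  proof -
    have "Ck_on k (\<lambda>y. D y v) S" using sD[of v] smooth_on_open_iff[OF op(1), of "\<lambda>y. D y v"] by simp
    then show ?thesis by (rule Ck_on_subset[OF _ PS])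
  qed
  \<comment> \<open>If \<open>\<Gamma>\<close> is C^k, then so is its derivative
    \<open>inv' (\<Gamma> y)\<close>, and \<open>\<Gamma>\<close> is C^(k+1).\<close>
  have Ck: "Ck_on k \<Gamma> Q" for k
  proof (induction k)
    case 0 show ?case using PQ(6) by (simp add: homeomorphism_def)
  next
    case (Suc k)
    have s: "\<Gamma> ` Q \<subseteq> P" using GP by auto
    have nz: "0 \<notin> (\<lambda>y. D (\<Gamma> y) w) ` Q"
    proof
      assume "0 \<in> (\<lambda>y. D (\<Gamma> y) w) ` Q"
      then obtain y where "y \<in> Q" "D (\<Gamma> y) w = 0" by auto
      then show False using GP[of y] PQ(2) S1_def by auto
    qed
    have D1: "Ck_on k (\<lambda>y. D (\<Gamma> y) u) Q" for u
      by (rule Ck_on_comp[OF PQ(4) s Suc CkD])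
    have D2: "Ck_on k (\<lambda>y. inverse (D (\<Gamma> y) w)) Q"
      by (rule Ck_on_comp[OF PQ(4) order_refl D1 Ck_on_inverse[OF nz]])
    have D3: "Ck_on k (\<lambda>y. w \<bullet> u + (- D (\<Gamma> y) u)) Q" for u
      by (intro Ck_on_add Ck_on_const Ck_on_linear_comp[OF bounded_linear_minus[OF bounded_linear_ident]] D1)
    have "Ck_on k (\<lambda>y. u + ((w \<bullet> u + (- D (\<Gamma> y) u)) * inverse (D (\<Gamma> y) w)) *\<^sub>R w) Q" for u
      by (intro Ck_on_add Ck_on_const Ck_on_linear_comp[OF bounded_linear_scaleR_left]
          Ck_on_bilinear[OF bounded_bilinear_mult] D2 D3)
    then show ?case using dg(1) g' by (auto simp: inv'_def intro!: exI[of _ "\<lambda>y. inv' (\<Gamma> y)"])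
  qed
  show thesis
  proof (rule that[OF PQ(1,3) _ PQ(4)])
    show "P \<subseteq> S" using PQ(2) S1_def by auto
    show "smooth_on Q \<Gamma>" by (rule smooth_on_CkI[OF PQ(4) Ck])
  qed (use PQ(6) in \<open>auto simp: homeomorphism_def \<Theta>_def[symmetric]\<close>)
qed

subsection \<open>Charts and smooth maps\<close>

text \<open>\<open>is_chart\<close> in working form: the homeomorphism is split into two statements
  about open sets, the ingredients of the image are named, and the normal \<open>b\<close> is
  required to lie in \<open>V\<close>. With this normalization, \<open>b = 0\<close> means that the
  model is all of \<open>V\<close>, and \<open>b \<noteq> 0\<close> that it is a genuine
  half-space.\<close>

definition chart_data ::
    "nat \<Rightarrow> 'a topology \<Rightarrow> 'a set \<Rightarrow> ('a \<Rightarrow> 'e::euclidean_space) \<Rightarrow> 'e set \<Rightarrow> 'e \<Rightarrow> 'e set \<Rightarrow> bool" where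
  "chart_data d X U \<phi> V b \<Omega> \<longleftrightarrow> openin X U \<and> inj_on \<phi> U \<and>
     (\<forall>T. open T \<longrightarrow> openin X (U \<inter> \<phi> -` T)) \<and>
     (\<forall>T. openin X T \<longrightarrow> (\<exists>T'. open T' \<and> \<phi> ` (U \<inter> T) = \<phi> ` U \<inter> T')) \<and>
     subspace V \<and> dim V = d \<and> b \<in> V \<and> open \<Omega> \<and> \<phi> ` U = {x \<in> V. 0 \<le> b \<bullet> x} \<inter> \<Omega>"

text \<open>Project \<open>b\<close> orthogonally to \<open>V\<close>; inner products with vectors
  of \<open>V\<close> do not change.\<close>

lemma halfspace_normal_in_subspace:
  fixes V :: "'e::euclidean_space set"
  assumes "subspace V"
  shows "\<exists>b'\<in>V. {x \<in> V. 0 \<le> b \<bullet> x} = {x \<in> V. 0 \<le> b' \<bullet> x}"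
proof -
  obtain y z where yz: "y \<in> span V" "\<And>w. w \<in> span V \<Longrightarrow> orthogonal z w" "b = y + z"
    using orthogonal_subspace_decomp_exists by blast
  have s: "span V = V" using assms by (simp add: span_eq_iff)
  have "b \<bullet> x = y \<bullet> x" if "x \<in> V" for x
    using yz that s by (simp add: inner_add_left orthogonal_def)
  then show ?thesis using yz(1) s by (intro bexI[of _ y]) auto
qed

lemma is_chart_iff: "is_chart d X (U, \<phi>) \<longleftrightarrow> (\<exists>V b \<Omega>. chart_data d X U \<phi> V b \<Omega>)"
proof
  assume c: "is_chart d X (U, \<phi>)"
  then have U: "openin X U" and h: "homeomorphic_map (subtopology X U) (top_of_set (\<phi> ` U)) \<phi>"
    by (auto simp: is_chart_def)
  obtain V b where V: "subspace V" "dim V = d" "openin (top_of_set {x \<in> V. 0 \<le> b \<bullet> x}) (\<phi> ` U)"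
    using c by (auto simp: is_chart_def)
  obtain b' where b': "b' \<in> V" "{x \<in> V. 0 \<le> b \<bullet> x} = {x \<in> V. 0 \<le> b' \<bullet> x}"
    using halfspace_normal_in_subspace[OF V(1)] by blast
  obtain \<Omega> where \<Omega>: "open \<Omega>" "\<phi> ` U = {x \<in> V. 0 \<le> b' \<bullet> x} \<inter> \<Omega>"
    using V(3) unfolding b' openin_open by blast
  have t: "topspace (subtopology X U) = U" using openin_subset[OF U] by auto
  have inj: "inj_on \<phi> U" using homeomorphic_imp_injective_map[OF h] t by simp
  have "openin X (U \<inter> \<phi> -` T)" if "open T" for T
  proof -
    have "openin (subtopology X U) {x \<in> topspace (subtopology X U). \<phi> x \<in> \<phi> ` U \<inter> T}"
      by (rule openin_continuous_map_preimage[OF homeomorphic_imp_continuous_map[OF h]])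
        (use that in \<open>auto simp: openin_open\<close>)
    moreover have "{x \<in> topspace (subtopology X U). \<phi> x \<in> \<phi> ` U \<inter> T} = U \<inter> \<phi> -` T"
      unfolding t by auto
    ultimately show ?thesis using U openin_trans_full by fastforce
  qed
  moreover have "\<exists>T'. open T' \<and> \<phi> ` (U \<inter> T) = \<phi> ` U \<inter> T'" if "openin X T" for T
  proof -
    have "openin (subtopology X U) (U \<inter> T)" using that by (simp add: openin_subtopology_Int2)
    then have "openin (top_of_set (\<phi> ` U)) (\<phi> ` (U \<inter> T))"
      using homeomorphic_imp_open_map[OF h] open_map_def by blast
    then show ?thesis by (auto simp: openin_open)
  qed
  ultimately show "\<exists>V b \<Omega>. chart_data d X U \<phi> V b \<Omega>"
    using U inj V(1,2) b'(1) \<Omega> unfolding chart_data_def by blast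
next
  assume "\<exists>V b \<Omega>. chart_data d X U \<phi> V b \<Omega>"
  then obtain V b \<Omega> where c: "chart_data d X U \<phi> V b \<Omega>" by blast
  then have U: "openin X U" and inj: "inj_on \<phi> U"
    and pre: "\<And>T. open T \<Longrightarrow> openin X (U \<inter> \<phi> -` T)"
    and img: "\<And>T. openin X T \<Longrightarrow> \<exists>T'. open T' \<and> \<phi> ` (U \<inter> T) = \<phi> ` U \<inter> T'"
    by (auto simp: chart_data_def)
  have t: "topspace (subtopology X U) = U" using openin_subset[OF U] by auto
  have "homeomorphic_map (subtopology X U) (top_of_set (\<phi> ` U)) \<phi>"
  proof (rule bijective_open_imp_homeomorphic_map)
    show "continuous_map (subtopology X U) (top_of_set (\<phi> ` U)) \<phi>"
      unfolding continuous_map_def t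
    proof (intro conjI allI impI)
      fix T assume "openin (top_of_set (\<phi> ` U)) T"
      then obtain T' where "open T'" "T = \<phi> ` U \<inter> T'" by (auto simp: openin_open)
      moreover then have "{x \<in> U. \<phi> x \<in> T} = U \<inter> (U \<inter> \<phi> -` T')" by auto
      ultimately show "openin (subtopology X U) {x \<in> U. \<phi> x \<in> T}"
        using pre by (metis openin_subtopology_Int2)
    qed auto
    show "open_map (subtopology X U) (top_of_set (\<phi> ` U)) \<phi>"
      unfolding open_map_def
    proof (intro allI impI)
      fix T assume "openin (subtopology X U) T"
      then obtain T' where "openin X T'" "T = U \<inter> T'" by (auto simp: openin_subtopology)
      then show "openin (top_of_set (\<phi> ` U)) (\<phi> ` T)" using img by (auto simp: openin_open)
    qed
  qed (use t inj in auto)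
  moreover have "openin (top_of_set {x \<in> V. 0 \<le> b \<bullet> x}) (\<phi> ` U)"
  proof -
    have "open \<Omega>" "\<phi> ` U = {x \<in> V. 0 \<le> b \<bullet> x} \<inter> \<Omega>" using c by (simp_all add: chart_data_def)
    then show ?thesis unfolding openin_open by (intro exI[of _ \<Omega>] conjI)
  qed
  moreover have "subspace V \<and> dim V = d" using c by (simp add: chart_data_def)
  ultimately show "is_chart d X (U, \<phi>)" unfolding is_chart_def prod.case using U by blast
qed

lemma chart_dataD:
  assumes "chart_data d X U \<phi> V b \<Omega>"
  shows "openin X U" "inj_on \<phi> U" "\<And>T. open T \<Longrightarrow> openin X (U \<inter> \<phi> -` T)"
    "\<And>T. openin X T \<Longrightarrow> \<exists>T'. open T' \<and> \<phi> ` (U \<inter> T) = \<phi> ` U \<inter> T'"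
    "subspace V" "dim V = d" "b \<in> V" "open \<Omega>" "\<phi> ` U = {x \<in> V. 0 \<le> b \<bullet> x} \<inter> \<Omega>"
    "U \<subseteq> topspace X"
proof -
  show "\<exists>T'. open T' \<and> \<phi> ` (U \<inter> T) = \<phi> ` U \<inter> T'" if "openin X T" for T
  proof -
    have "\<forall>T. openin X T \<longrightarrow> (\<exists>T'. open T' \<and> \<phi> ` (U \<inter> T) = \<phi> ` U \<inter> T')"
      using assms unfolding chart_data_def by (elim conjE)
    then show ?thesis using that by simp
  qed
qed (use assms openin_subset[of X U] in \<open>simp_all add: chart_data_def\<close>)

lemma chart_data_restrict:
  assumes c: "chart_data d X U \<phi> V b \<Omega>" and T: "openin X T"
  shows "\<exists>\<Omega>'\<subseteq>\<Omega>. chart_data d X (U \<inter> T) \<phi> V b \<Omega>'"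
proof -
  note c' = chart_dataD[OF c]
  obtain T' where T': "open T'" "\<phi> ` (U \<inter> T) = \<phi> ` U \<inter> T'" using c'(4) T by blast
  have "openin X (U \<inter> T \<inter> \<phi> -` A)" if "open A" for A
    using c'(3)[OF that] T openin_Int by (metis Int_assoc Int_commute)
  moreover have "\<exists>A'. open A' \<and> \<phi> ` (U \<inter> T \<inter> A) = \<phi> ` (U \<inter> T) \<inter> A'" if A: "openin X A" for A
  proof -
    obtain A' where A': "open A'" "\<phi> ` (U \<inter> A) = \<phi> ` U \<inter> A'" using c'(4) A by blast
    have "\<phi> ` (U \<inter> T \<inter> A) = \<phi> ` (U \<inter> T) \<inter> \<phi> ` (U \<inter> A)"
      using inj_on_image_Int[OF c'(2), of "U \<inter> T" "U \<inter> A"] by (simp add: Int_assoc Int_left_commute)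
    then show ?thesis using A' T'(2) by (intro exI[of _ A']) auto
  qed
  ultimately have "chart_data d X (U \<inter> T) \<phi> V b (\<Omega> \<inter> T')"
    unfolding chart_data_def using c' T T' inj_on_subset[OF c'(2)] by auto
  then show ?thesis by blast
qed

lemma is_chart_restrict: "is_chart d X (U, \<phi>) \<Longrightarrow> openin X T \<Longrightarrow> is_chart d X (U \<inter> T, \<phi>)"
  unfolding is_chart_iff by (meson chart_data_restrict)

lemma chart_inj: "is_chart d X (U, \<phi>) \<Longrightarrow> inj_on \<phi> U"
  and chart_openin: "is_chart d X (U, \<phi>) \<Longrightarrow> openin X U"
  and chart_preimage: "is_chart d X (U, \<phi>) \<Longrightarrow> open T \<Longrightarrow> openin X (U \<inter> \<phi> -` T)"
  unfolding is_chart_iff by (auto dest: chart_dataD(1-3))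

text \<open>The set \<open>S\<close> is an arbitrary part of the chart domain. This is what is
  needed to localize maps that are given on a subset only, where the domain of the coordinate
  expression is not open.\<close>

lemma chart_image_Int:
  assumes "is_chart d X (U, \<phi>)" "openin X T" "S \<subseteq> U"
  shows "\<exists>T'. open T' \<and> \<phi> ` (S \<inter> T) = \<phi> ` S \<inter> T'"
proof -
  obtain V b \<Omega> where c: "chart_data d X U \<phi> V b \<Omega>" using assms(1) is_chart_iff by blast
  obtain T' where T': "open T'" "\<phi> ` (U \<inter> T) = \<phi> ` U \<inter> T'" using chart_dataD(4)[OF c assms(2)] by blast
  have "\<phi> ` (S \<inter> T) = \<phi> ` S \<inter> \<phi> ` (U \<inter> T)"
    using inj_on_image_Int[OF chart_dataD(2)[OF c], of S "U \<inter> T"] assms(3)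
    by (simp add: Int_assoc[symmetric] Int_absorb2)
  then show ?thesis using T' assms(3) by (intro exI[of _ T']) auto
qed

lemma full_atlas_chart: "(U, \<phi>) \<in> full_atlas M \<Longrightarrow> is_chart (mdim M) (mtop M) (U, \<phi>)"
  by (simp add: full_atlas_def)

lemma atlas_subset_full: "smooth_manifold M \<Longrightarrow> matlas M \<subseteq> full_atlas M"
  by (auto simp: smooth_manifold_def full_atlas_def)

lemma atlas_cover:
  assumes "smooth_manifold M" "x \<in> mspace M"
  obtains U \<phi> where "(U, \<phi>) \<in> matlas M" "(U, \<phi>) \<in> full_atlas M" "x \<in> U"
proof -
  have "x \<in> (\<Union>(U, \<phi>)\<in>matlas M. U)" using assms by (simp add: smooth_manifold_def)
  then show thesis using that atlas_subset_full[OF assms(1)] by auto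
qed

text \<open>Both charts are compatible with the atlas, and near each point the transition between
  them factors through an atlas chart there.\<close>

lemma full_atlas_compatible:
  assumes M: "smooth_manifold M" and c: "(U, \<phi>) \<in> full_atlas M" and c': "(V, \<psi>) \<in> full_atlas M"
  shows "smooth_on (\<phi> ` (U \<inter> V)) (\<lambda>y. \<psi> (inv_into U \<phi> y))"
proof (rule smooth_on_local)
  fix y assume "y \<in> \<phi> ` (U \<inter> V)"
  then obtain x where x: "y = \<phi> x" "x \<in> U" "x \<in> V" by auto
  note ch = full_atlas_chart[OF c] full_atlas_chart[OF c']
  have "x \<in> mspace M" using openin_subset[OF chart_openin[OF ch(1)]] x by blast
  then obtain Z \<zeta> where Z: "(Z, \<zeta>) \<in> matlas M" "(Z, \<zeta>) \<in> full_atlas M" "x \<in> Z"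
    using atlas_cover[OF M] by blast
  note cz = full_atlas_chart[OF Z(2)]
  obtain T where T: "open T" "\<phi> ` (U \<inter> V \<inter> Z) = \<phi> ` (U \<inter> V) \<inter> T"
    using chart_image_Int[OF ch(1) chart_openin[OF cz], of "U \<inter> V"] by auto
  have 1: "smooth_on (\<phi> ` (U \<inter> Z)) (\<zeta> \<circ> inv_into U \<phi>)"
    using c Z(1) unfolding full_atlas_def compatible_def by fastforce
  have 2: "smooth_on (\<zeta> ` (V \<inter> Z)) (\<psi> \<circ> inv_into Z \<zeta>)"
    using c' Z(1) unfolding full_atlas_def compatible_def by fastforce
  have "smooth_on (\<phi> ` (U \<inter> V \<inter> Z)) (\<lambda>y. (\<psi> \<circ> inv_into Z \<zeta>) ((\<zeta> \<circ> inv_into U \<phi>) y))"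
    by (rule smooth_on_comp[OF smooth_on_subset[OF 1] 2])
       (auto simp: inv_into_f_f[OF chart_inj[OF ch(1)]])
  then have "smooth_on (\<phi> ` (U \<inter> V \<inter> Z)) (\<lambda>y. \<psi> (inv_into U \<phi> y))"
    by (rule smooth_on_cong)
      (auto simp: inv_into_f_f[OF chart_inj[OF ch(1)]] inv_into_f_f[OF chart_inj[OF cz]])
  then show "\<exists>T. open T \<and> y \<in> T \<and> smooth_on (\<phi> ` (U \<inter> V) \<inter> T) (\<lambda>y. \<psi> (inv_into U \<phi> y))"
    using T x Z(3) by (intro exI[of _ T]) auto
qed

lemma full_atlasI:
  assumes "is_chart (mdim M) (mtop M) (U, \<phi>)"
    "\<And>V \<psi>. (V, \<psi>) \<in> matlas M \<Longrightarrow> smooth_on (\<phi> ` (U \<inter> V)) (\<lambda>y. \<psi> (inv_into U \<phi> y))"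
    "\<And>V \<psi>. (V, \<psi>) \<in> matlas M \<Longrightarrow> smooth_on (\<psi> ` (U \<inter> V)) (\<lambda>y. \<phi> (inv_into V \<psi> y))"
  shows "(U, \<phi>) \<in> full_atlas M"
  using assms unfolding full_atlas_def compatible_def by (auto simp: o_def)

lemma full_atlas_restrict:
  assumes c: "(U, \<phi>) \<in> full_atlas M" and T: "openin (mtop M) T"
  shows "(U \<inter> T, \<phi>) \<in> full_atlas M"
proof (rule full_atlasI)
  show "is_chart (mdim M) (mtop M) (U \<inter> T, \<phi>)"
    using is_chart_restrict[OF full_atlas_chart[OF c] T] .
  fix V \<psi> assume V: "(V, \<psi>) \<in> matlas M"
  have c1: "smooth_on (\<phi> ` (U \<inter> V)) (\<psi> \<circ> inv_into U \<phi>)" "smooth_on (\<psi> ` (U \<inter> V)) (\<phi> \<circ> inv_into V \<psi>)"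
    using c V unfolding full_atlas_def compatible_def by (fastforce simp: Int_commute)+
  show "smooth_on (\<psi> ` (U \<inter> T \<inter> V)) (\<lambda>y. \<phi> (inv_into V \<psi> y))"
    using smooth_on_subset[OF c1(2), of "\<psi> ` (U \<inter> T \<inter> V)"] by (auto simp: o_def)
  have "smooth_on (\<phi> ` (U \<inter> T \<inter> V)) (\<psi> \<circ> inv_into U \<phi>)"
    by (rule smooth_on_subset[OF c1(1)]) auto
  then show "smooth_on (\<phi> ` (U \<inter> T \<inter> V)) (\<lambda>y. \<psi> (inv_into (U \<inter> T) \<phi> y))"
    by (rule smooth_on_cong)
      (auto simp: inv_into_f_f chart_inj[OF full_atlas_chart[OF c]] intro!: inv_into_f_f[symmetric]
        arg_cong[where f=\<psi>] inj_on_subset[OF chart_inj[OF full_atlas_chart[OF c]]])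
qed

section \<open>Smoothness on subsets of a manifold\<close>

text \<open>A notion for arbitrary subsets \<open>A\<close> is needed for functions on the boundary,
  maps on level sets, and curves on an interval. Only one pair of charts per point is demanded,
  which makes it easy to establish; \<open>smooth_in_charts\<close> shows that all pairs from the
  maximal atlases then qualify.\<close>

definition smooth_in ::
  "('a, 'e::euclidean_space) mfd \<Rightarrow> ('b, 'f::euclidean_space) mfd \<Rightarrow> 'a set \<Rightarrow> ('a \<Rightarrow> 'b) \<Rightarrow> bool" where
  "smooth_in M N A f \<longleftrightarrow> A \<subseteq> mspace M \<and> continuous_map (subtopology (mtop M) A) (mtop N) f \<and>
     (\<forall>x\<in>A. \<exists>U \<phi> V \<psi>. (U, \<phi>) \<in> full_atlas M \<and> (V, \<psi>) \<in> full_atlas N \<and> x \<in> U \<and> f x \<in> V \<and>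
        smooth_on (\<phi> ` (U \<inter> A \<inter> f -` V)) (\<lambda>y. \<psi> (f (inv_into U \<phi> y))))"

lemma smooth_inE:
  assumes "smooth_in M N A f" "x \<in> A"
  obtains U \<phi> V \<psi> where "(U, \<phi>) \<in> full_atlas M" "(V, \<psi>) \<in> full_atlas N" "x \<in> U" "f x \<in> V"
    "smooth_on (\<phi> ` (U \<inter> A \<inter> f -` V)) (\<lambda>y. \<psi> (f (inv_into U \<phi> y)))"
proof -
  have "\<forall>x\<in>A. \<exists>U \<phi> V \<psi>. (U, \<phi>) \<in> full_atlas M \<and> (V, \<psi>) \<in> full_atlas N \<and> x \<in> U \<and> f x \<in> V \<and>
        smooth_on (\<phi> ` (U \<inter> A \<inter> f -` V)) (\<lambda>y. \<psi> (f (inv_into U \<phi> y)))"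
    using assms(1) unfolding smooth_in_def by (elim conjE)
  from bspec[OF this assms(2)] show thesis using that by (elim exE conjE)
qed

lemma smooth_in_subset_mspace: "smooth_in M N A f \<Longrightarrow> A \<subseteq> mspace M"
  by (simp add: smooth_in_def)

lemma smooth_in_continuous: "smooth_in M N A f \<Longrightarrow> continuous_map (subtopology (mtop M) A) (mtop N) f"
  by (simp add: smooth_in_def)

lemma smooth_in_image: "smooth_in M N A f \<Longrightarrow> x \<in> A \<Longrightarrow> f x \<in> mspace N"
  unfolding smooth_in_def continuous_map_def by (auto simp: Pi_iff)

lemma smooth_in_preimage:
  assumes "smooth_in M N A f" "openin (mtop N) V"
  obtains T where "openin (mtop M) T" "A \<inter> f -` V = A \<inter> T"
proof -
  have "openin (subtopology (mtop M) A) {x \<in> topspace (subtopology (mtop M) A). f x \<in> V}"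
    by (rule openin_continuous_map_preimage[OF smooth_in_continuous[OF assms(1)] assms(2)])
  moreover have "{x \<in> topspace (subtopology (mtop M) A). f x \<in> V} = A \<inter> f -` V"
    using smooth_in_subset_mspace[OF assms(1)] by auto
  ultimately show thesis using that by (auto simp: openin_subtopology Int_commute)
qed

text \<open>Near each point the given good pair of charts is converted into the desired one by
  transition maps on both sides. Continuity of \<open>f\<close> makes the set on which this works
  relatively open in \<open>A\<close>.\<close>

lemma smooth_in_charts:
  assumes M: "smooth_manifold M" and N: "smooth_manifold N" and f: "smooth_in M N A f"
    and c: "(U, \<phi>) \<in> full_atlas M" and c': "(V, \<psi>) \<in> full_atlas N"
  shows "smooth_on (\<phi> ` (U \<inter> A \<inter> f -` V)) (\<lambda>y. \<psi> (f (inv_into U \<phi> y)))"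
proof (rule smooth_on_local)
  fix y assume "y \<in> \<phi> ` (U \<inter> A \<inter> f -` V)"
  then obtain x where x: "y = \<phi> x" "x \<in> U" "x \<in> A" "f x \<in> V" by blast
  obtain U1 \<phi>1 V1 \<psi>1 where d: "(U1, \<phi>1) \<in> full_atlas M" "(V1, \<psi>1) \<in> full_atlas N" "x \<in> U1" "f x \<in> V1"
    "smooth_on (\<phi>1 ` (U1 \<inter> A \<inter> f -` V1)) (\<lambda>y. \<psi>1 (f (inv_into U1 \<phi>1 y)))"
    using smooth_inE[OF f x(3)] by metis
  note ch = full_atlas_chart[OF c] full_atlas_chart[OF c'] full_atlas_chart[OF d(1)] full_atlas_chart[OF d(2)]
  obtain T where T: "openin (mtop M) T" "A \<inter> f -` V1 = A \<inter> T"
    using smooth_in_preimage[OF f chart_openin[OF ch(4)]] by blast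
  let ?S = "U \<inter> A \<inter> f -` V"
  obtain T' where T': "open T'" "\<phi> ` (?S \<inter> (T \<inter> U1)) = \<phi> ` ?S \<inter> T'"
    using chart_image_Int[OF ch(1) openin_Int[OF T(1) chart_openin[OF ch(3)]], of ?S] by blast
  have inv1: "inv_into U \<phi> (\<phi> z) = z" if "z \<in> U" for z using inv_into_f_f[OF chart_inj[OF ch(1)] that] .
  have inv3: "inv_into U1 \<phi>1 (\<phi>1 z) = z" if "z \<in> U1" for z using inv_into_f_f[OF chart_inj[OF ch(3)] that] .
  have inv4: "inv_into V1 \<psi>1 (\<psi>1 z) = z" if "z \<in> V1" for z using inv_into_f_f[OF chart_inj[OF ch(4)] that] .
  have fT: "f z \<in> V1" if "z \<in> A" "z \<in> T" for z using T(2) that by blast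
  have "smooth_on (\<phi> ` (?S \<inter> (T \<inter> U1))) (\<lambda>y. \<phi>1 (inv_into U \<phi> y))"
    by (rule smooth_on_subset[OF full_atlas_compatible[OF M c d(1)]]) auto
  then have "smooth_on (\<phi> ` (?S \<inter> (T \<inter> U1))) (\<lambda>y. \<psi>1 (f (inv_into U1 \<phi>1 (\<phi>1 (inv_into U \<phi> y)))))"
    by (rule smooth_on_comp[OF _ d(5)]) (use fT in \<open>auto simp: inv1\<close>)
  then have "smooth_on (\<phi> ` (?S \<inter> (T \<inter> U1)))
      (\<lambda>y. \<psi> (inv_into V1 \<psi>1 (\<psi>1 (f (inv_into U1 \<phi>1 (\<phi>1 (inv_into U \<phi> y)))))))"
    by (rule smooth_on_comp[OF _ full_atlas_compatible[OF N d(2) c']]) (use fT in \<open>auto simp: inv1 inv3\<close>)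
  then have "smooth_on (\<phi> ` (?S \<inter> (T \<inter> U1))) (\<lambda>y. \<psi> (f (inv_into U \<phi> y)))"
    by (rule smooth_on_cong) (use fT in \<open>auto simp: inv1 inv3 inv4\<close>)
  moreover have "y \<in> T'" using T' x d T(2) by (metis IntD2 IntI image_eqI vimageI)
  ultimately show "\<exists>T. open T \<and> y \<in> T \<and> smooth_on (\<phi> ` ?S \<inter> T) (\<lambda>y. \<psi> (f (inv_into U \<phi> y)))"
    using T' by (intro exI[of _ T']) auto
qed

lemma continuous_map_local:
  assumes "\<And>x. x \<in> topspace X \<Longrightarrow> \<exists>T. openin X T \<and> x \<in> T \<and> continuous_map (subtopology X T) Y f"
  shows "continuous_map X Y f"
  unfolding continuous_map_def
proof (intro conjI allI impI)
  show "f \<in> topspace X \<rightarrow> topspace Y"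
  proof
    fix x assume "x \<in> topspace X"
    then obtain T where T: "x \<in> T" "continuous_map (subtopology X T) Y f"
      using assms[OF \<open>x \<in> topspace X\<close>] by auto
    have "f \<in> topspace (subtopology X T) \<rightarrow> topspace Y" using T(2) by (simp add: continuous_map_def)
    then show "f x \<in> topspace Y" using T(1) \<open>x \<in> topspace X\<close> by auto
  qed
  fix V assume V: "openin Y V"
  show "openin X {x \<in> topspace X. f x \<in> V}"
  proof (subst openin_subopen, rule ballI)
    fix x assume x: "x \<in> {x \<in> topspace X. f x \<in> V}"
    then have "x \<in> topspace X" by simp
    then obtain T where T: "openin X T" "x \<in> T" "continuous_map (subtopology X T) Y f"
      using assms[OF \<open>x \<in> topspace X\<close>] by auto
    have "openin (subtopology X T) {x \<in> topspace (subtopology X T). f x \<in> V}"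
      by (rule openin_continuous_map_preimage[OF T(3) V])
    then have "openin X {x \<in> topspace (subtopology X T). f x \<in> V}" using T(1) openin_trans_full by blast
    then show "\<exists>T. openin X T \<and> x \<in> T \<and> T \<subseteq> {x \<in> topspace X. f x \<in> V}"
      using T x by (intro exI[of _ "{x \<in> topspace (subtopology X T). f x \<in> V}"]) auto
  qed
qed

text \<open>The open set \<open>T\<close> allows the chart domain to be shrunk, so that the
  coordinate expression only has to be smooth near \<open>x\<close>.\<close>

lemma smooth_inI:
  assumes A: "A \<subseteq> mspace M"
    and cont: "continuous_map (subtopology (mtop M) A) (mtop N) f"
    and ch: "\<And>x. x \<in> A \<Longrightarrow> \<exists>U \<phi> V \<psi> T. (U, \<phi>) \<in> full_atlas M \<and> (V, \<psi>) \<in> full_atlas N \<and> x \<in> U \<and> f x \<in> V \<and>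
        openin (mtop M) T \<and> x \<in> T \<and> smooth_on (\<phi> ` (U \<inter> T \<inter> A \<inter> f -` V)) (\<lambda>y. \<psi> (f (inv_into U \<phi> y)))"
  shows "smooth_in M N A f"
  unfolding smooth_in_def
proof (intro conjI ballI A cont)
  fix x assume "x \<in> A"
  then obtain U \<phi> V \<psi> T where c: "(U, \<phi>) \<in> full_atlas M" "(V, \<psi>) \<in> full_atlas N" "x \<in> U" "f x \<in> V"
    "openin (mtop M) T" "x \<in> T" "smooth_on (\<phi> ` (U \<inter> T \<inter> A \<inter> f -` V)) (\<lambda>y. \<psi> (f (inv_into U \<phi> y)))"
    using ch[OF \<open>x \<in> A\<close>] by (elim exE conjE)
  note inj = chart_inj[OF full_atlas_chart[OF c(1)]]
  have "smooth_on (\<phi> ` (U \<inter> T \<inter> A \<inter> f -` V)) (\<lambda>y. \<psi> (f (inv_into (U \<inter> T) \<phi> y)))"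
    by (rule smooth_on_cong[OF c(7)])
      (auto simp: inv_into_f_f[OF inj] inv_into_f_f[OF inj_on_subset[OF inj]])
  then show "\<exists>U \<phi> V \<psi>. (U, \<phi>) \<in> full_atlas M \<and> (V, \<psi>) \<in> full_atlas N \<and> x \<in> U \<and> f x \<in> V \<and>
        smooth_on (\<phi> ` (U \<inter> A \<inter> f -` V)) (\<lambda>y. \<psi> (f (inv_into U \<phi> y)))"
    using full_atlas_restrict[OF c(1,5)] c
    by (intro exI[of _ "U \<inter> T"] exI[of _ \<phi>] exI[of _ V] exI[of _ \<psi>]) simp
qed

lemma smooth_in_subset:
  assumes f: "smooth_in M N A f" and B: "B \<subseteq> A"
  shows "smooth_in M N B f"
proof (rule smooth_inI)
  show "B \<subseteq> mspace M" using smooth_in_subset_mspace[OF f] B by blast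
  show "continuous_map (subtopology (mtop M) B) (mtop N) f"
    using continuous_map_from_subtopology_mono smooth_in_continuous[OF f] B by blast
  fix x assume "x \<in> B"
  then obtain U \<phi> V \<psi> where c: "(U, \<phi>) \<in> full_atlas M" "(V, \<psi>) \<in> full_atlas N" "x \<in> U" "f x \<in> V"
    "smooth_on (\<phi> ` (U \<inter> A \<inter> f -` V)) (\<lambda>y. \<psi> (f (inv_into U \<phi> y)))"
    using smooth_inE[OF f subsetD[OF B \<open>x \<in> B\<close>]] by metis
  have "smooth_on (\<phi> ` (U \<inter> U \<inter> B \<inter> f -` V)) (\<lambda>y. \<psi> (f (inv_into U \<phi> y)))"
    by (rule smooth_on_subset[OF c(5)]) (use B in auto)
  then show "\<exists>U \<phi> V \<psi> T. (U, \<phi>) \<in> full_atlas M \<and> (V, \<psi>) \<in> full_atlas N \<and> x \<in> U \<and> f x \<in> V \<and>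
        openin (mtop M) T \<and> x \<in> T \<and> smooth_on (\<phi> ` (U \<inter> T \<inter> B \<inter> f -` V)) (\<lambda>y. \<psi> (f (inv_into U \<phi> y)))"
    using c chart_openin[OF full_atlas_chart[OF c(1)]]
    by (intro exI[of _ U] exI[of _ \<phi>] exI[of _ V] exI[of _ \<psi>] exI[of _ U]) simp
qed

lemma smooth_in_cong:
  assumes f: "smooth_in M N A f" and eq: "\<And>x. x \<in> A \<Longrightarrow> f x = g x"
  shows "smooth_in M N A g"
proof (rule smooth_inI)
  show A: "A \<subseteq> mspace M" using smooth_in_subset_mspace[OF f] .
  show "continuous_map (subtopology (mtop M) A) (mtop N) g"
    by (rule continuous_map_eq[OF smooth_in_continuous[OF f]]) (use A eq in auto)
  fix x assume "x \<in> A"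
  then obtain U \<phi> V \<psi> where c: "(U, \<phi>) \<in> full_atlas M" "(V, \<psi>) \<in> full_atlas N" "x \<in> U" "f x \<in> V"
    "smooth_on (\<phi> ` (U \<inter> A \<inter> f -` V)) (\<lambda>y. \<psi> (f (inv_into U \<phi> y)))"
    using smooth_inE[OF f \<open>x \<in> A\<close>] by metis
  have s: "U \<inter> A \<inter> f -` V = U \<inter> U \<inter> A \<inter> g -` V" using eq by auto
  have "smooth_on (\<phi> ` (U \<inter> U \<inter> A \<inter> g -` V)) (\<lambda>y. \<psi> (g (inv_into U \<phi> y)))"
    unfolding s[symmetric] by (rule smooth_on_cong[OF c(5)])
      (auto simp: inv_into_f_f[OF chart_inj[OF full_atlas_chart[OF c(1)]]] eq)
  then show "\<exists>U \<phi> V \<psi> T. (U, \<phi>) \<in> full_atlas M \<and> (V, \<psi>) \<in> full_atlas N \<and> x \<in> U \<and> g x \<in> V \<and>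
        openin (mtop M) T \<and> x \<in> T \<and> smooth_on (\<phi> ` (U \<inter> T \<inter> A \<inter> g -` V)) (\<lambda>y. \<psi> (g (inv_into U \<phi> y)))"
    using c chart_openin[OF full_atlas_chart[OF c(1)]] eq[OF \<open>x \<in> A\<close>]
    by (intro exI[of _ U] exI[of _ \<phi>] exI[of _ V] exI[of _ \<psi>] exI[of _ U]) simp
qed

lemma smooth_in_local:
  assumes "\<And>x. x \<in> A \<Longrightarrow> \<exists>T. openin (mtop M) T \<and> x \<in> T \<and> smooth_in M N (A \<inter> T) f"
  shows "smooth_in M N A f"
proof (rule smooth_inI)
  show A: "A \<subseteq> mspace M" using assms smooth_in_subset_mspace by blast
  show "continuous_map (subtopology (mtop M) A) (mtop N) f"
  proof (rule continuous_map_local)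
    fix x assume "x \<in> topspace (subtopology (mtop M) A)"
    then obtain T where T: "openin (mtop M) T" "x \<in> T" "x \<in> A" "smooth_in M N (A \<inter> T) f" using assms by auto
    have "subtopology (subtopology (mtop M) A) (A \<inter> T) = subtopology (mtop M) (A \<inter> T)"
      by (simp add: subtopology_subtopology)
    then show "\<exists>T. openin (subtopology (mtop M) A) T \<and> x \<in> T \<and>
        continuous_map (subtopology (subtopology (mtop M) A) T) (mtop N) f"
      using T smooth_in_continuous[OF T(4)] by (intro exI[of _ "A \<inter> T"]) (simp add: openin_subtopology_Int2)
  qed
  fix x assume "x \<in> A"
  then obtain T where T: "openin (mtop M) T" "x \<in> T" "x \<in> A" "smooth_in M N (A \<inter> T) f" using assms by auto
  then obtain U \<phi> V \<psi> where c: "(U, \<phi>) \<in> full_atlas M" "(V, \<psi>) \<in> full_atlas N" "x \<in> U" "f x \<in> V"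
    "smooth_on (\<phi> ` (U \<inter> (A \<inter> T) \<inter> f -` V)) (\<lambda>y. \<psi> (f (inv_into U \<phi> y)))"
    using smooth_inE[OF T(4), of x] by (metis IntI)
  moreover have "U \<inter> (A \<inter> T) \<inter> f -` V = U \<inter> T \<inter> A \<inter> f -` V" by auto
  ultimately show "\<exists>U \<phi> V \<psi> T. (U, \<phi>) \<in> full_atlas M \<and> (V, \<psi>) \<in> full_atlas N \<and> x \<in> U \<and> f x \<in> V \<and>
        openin (mtop M) T \<and> x \<in> T \<and> smooth_on (\<phi> ` (U \<inter> T \<inter> A \<inter> f -` V)) (\<lambda>y. \<psi> (f (inv_into U \<phi> y)))"
    using T c by (intro exI[of _ U] exI[of _ \<phi>] exI[of _ V] exI[of _ \<psi>] exI[of _ T]) simp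
qed

lemma smooth_in_comp:
  assumes M: "smooth_manifold M" and N: "smooth_manifold N" and P: "smooth_manifold P"
    and f: "smooth_in M N A f" and g: "smooth_in N P B g" and sub: "\<And>x. x \<in> A \<Longrightarrow> f x \<in> B"
  shows "smooth_in M P A (\<lambda>x. g (f x))"
proof (rule smooth_inI)
  show A: "A \<subseteq> mspace M" using smooth_in_subset_mspace[OF f] .
  have "continuous_map (subtopology (mtop M) A) (subtopology (mtop N) B) f"
    using smooth_in_continuous[OF f] sub A by (auto simp: continuous_map_in_subtopology)
  then show "continuous_map (subtopology (mtop M) A) (mtop P) (\<lambda>x. g (f x))"
    using continuous_map_compose smooth_in_continuous[OF g] by (fastforce simp: o_def)
  fix x assume x: "x \<in> A"
  obtain U \<phi> where U: "(U, \<phi>) \<in> full_atlas M" "x \<in> U" using atlas_cover[OF M] A x by blast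
  obtain V \<psi> where V: "(V, \<psi>) \<in> full_atlas N" "f x \<in> V"
    using atlas_cover[OF N] smooth_in_image[OF f x] by blast
  obtain Z \<zeta> where Z: "(Z, \<zeta>) \<in> full_atlas P" "g (f x) \<in> Z"
    using atlas_cover[OF P] smooth_in_image[OF g sub[OF x]] by blast
  obtain T where T: "openin (mtop M) T" "A \<inter> f -` V = A \<inter> T"
    using smooth_in_preimage[OF f chart_openin[OF full_atlas_chart[OF V(1)]]] by blast
  note inj = chart_inj[OF full_atlas_chart[OF U(1)]] chart_inj[OF full_atlas_chart[OF V(1)]]
  have fT: "f z \<in> V" if "z \<in> A" "z \<in> T" for z using T(2) that by blast
  let ?S = "\<phi> ` (U \<inter> T \<inter> A \<inter> (\<lambda>x. g (f x)) -` Z)"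
  have "smooth_on ?S (\<lambda>y. \<psi> (f (inv_into U \<phi> y)))"
    by (rule smooth_on_subset[OF smooth_in_charts[OF M N f U(1) V(1)]]) (use fT in auto)
  then have "smooth_on ?S (\<lambda>y. \<zeta> (g (inv_into V \<psi> (\<psi> (f (inv_into U \<phi> y))))))"
    by (rule smooth_on_comp[OF _ smooth_in_charts[OF N P g V(1) Z(1)]])
       (use fT sub in \<open>auto simp: inv_into_f_f[OF inj(1)]\<close>)
  then have "smooth_on ?S (\<lambda>y. \<zeta> (g (f (inv_into U \<phi> y))))"
    by (rule smooth_on_cong) (use fT in \<open>auto simp: inv_into_f_f[OF inj(1)] inv_into_f_f[OF inj(2)]\<close>)
  moreover have "x \<in> T" using T(2) x V(2) by blast
  ultimately show "\<exists>U \<phi> V \<psi> T. (U, \<phi>) \<in> full_atlas M \<and> (V, \<psi>) \<in> full_atlas P \<and> x \<in> U \<and> g (f x) \<in> V \<and>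
        openin (mtop M) T \<and> x \<in> T \<and>
        smooth_on (\<phi> ` (U \<inter> T \<inter> A \<inter> (\<lambda>x. g (f x)) -` V)) (\<lambda>y. \<psi> (g (f (inv_into U \<phi> y))))"
    using U Z T by (intro exI[of _ U] exI[of _ \<phi>] exI[of _ Z] exI[of _ \<zeta>] exI[of _ T]) simp
qed

text \<open>\<open>smooth_map\<close> refers to the charts of the given atlases. One direction
  covers each point by a pair of these, the other is chart independence.\<close>

lemma smooth_map_iff_smooth_in:
  assumes M: "smooth_manifold M" and N: "smooth_manifold N"
  shows "smooth_map M N f \<longleftrightarrow> smooth_in M N (mspace M) f"
proof
  assume f: "smooth_map M N f"
  show "smooth_in M N (mspace M) f"
  proof (rule smooth_inI)
    show "continuous_map (subtopology (mtop M) (mspace M)) (mtop N) f"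
      using f by (simp add: smooth_map_def)
    fix x assume x: "x \<in> mspace M"
    then have "f x \<in> mspace N" using f unfolding smooth_map_def continuous_map_def by (auto simp: Pi_iff)
    then obtain V \<psi> where V: "(V, \<psi>) \<in> matlas N" "(V, \<psi>) \<in> full_atlas N" "f x \<in> V"
      using atlas_cover[OF N] by blast
    obtain U \<phi> where U: "(U, \<phi>) \<in> matlas M" "(U, \<phi>) \<in> full_atlas M" "x \<in> U" using atlas_cover[OF M x] by blast
    have "smooth_on (\<phi> ` (U \<inter> f -` V)) (\<psi> \<circ> f \<circ> inv_into U \<phi>)"
      using f U(1) V(1) unfolding smooth_map_def by auto
    then have "smooth_on (\<phi> ` (U \<inter> f -` V)) (\<lambda>y. \<psi> (f (inv_into U \<phi> y)))" by (simp add: o_def)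
    then have "smooth_on (\<phi> ` (U \<inter> mspace M \<inter> mspace M \<inter> f -` V)) (\<lambda>y. \<psi> (f (inv_into U \<phi> y)))"
      by (rule smooth_on_subset) auto
    then show "\<exists>U \<phi> V \<psi> T. (U, \<phi>) \<in> full_atlas M \<and> (V, \<psi>) \<in> full_atlas N \<and> x \<in> U \<and> f x \<in> V \<and>
        openin (mtop M) T \<and> x \<in> T \<and> smooth_on (\<phi> ` (U \<inter> T \<inter> mspace M \<inter> f -` V)) (\<lambda>y. \<psi> (f (inv_into U \<phi> y)))"
      using U V x openin_topspace[of "mtop M"]
      by (intro exI[of _ U] exI[of _ \<phi>] exI[of _ V] exI[of _ \<psi>] exI[of _ "mspace M"]) simp
  qed simp
next
  assume f: "smooth_in M N (mspace M) f"
  have "smooth_on (\<phi> ` (U \<inter> f -` V)) (\<psi> \<circ> f \<circ> inv_into U \<phi>)"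
    if "(U, \<phi>) \<in> matlas M" "(V, \<psi>) \<in> matlas N" for U \<phi> V \<psi>
  proof -
    have e: "(U, \<phi>) \<in> full_atlas M" "(V, \<psi>) \<in> full_atlas N" using that atlas_subset_full M N by auto
    have "U \<subseteq> mspace M" using openin_subset[OF chart_openin[OF full_atlas_chart[OF e(1)]]] .
    then have "U \<inter> mspace M \<inter> f -` V = U \<inter> f -` V" by auto
    then show ?thesis using smooth_in_charts[OF M N f e] by (simp add: o_def)
  qed
  moreover have "continuous_map (mtop M) (mtop N) f" using smooth_in_continuous[OF f] by simp
  ultimately show "smooth_map M N f" unfolding smooth_map_def by auto
qed

section \<open>Submanifolds and their induced structure\<close>

lemma submfd_simps [simp]:
  "mtop (submfd k M S) = subtopology (mtop M) S" "mdim (submfd k M S) = k"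
  by (simp_all add: submfd_def)

lemma full_atlas_subset_mspace: "(U, \<phi>) \<in> full_atlas M \<Longrightarrow> U \<subseteq> mspace M"
  by (rule openin_subset[OF chart_openin[OF full_atlas_chart]])

lemma full_atlas_inv: "(U, \<phi>) \<in> full_atlas M \<Longrightarrow> x \<in> U \<Longrightarrow> inv_into U \<phi> (\<phi> x) = x"
  by (rule inv_into_f_f[OF chart_inj[OF full_atlas_chart]])

lemma full_atlas_inj: "(U, \<phi>) \<in> full_atlas M \<Longrightarrow> inj_on \<phi> U"
  by (rule chart_inj[OF full_atlas_chart])

lemma matlas_submfd:
  "(Z, \<phi>) \<in> matlas (submfd k M S) \<longleftrightarrow>
     (\<exists>U. Z = U \<inter> S \<and> (U, \<phi>) \<in> full_atlas M \<and> is_chart k (subtopology (mtop M) S) (U \<inter> S, \<phi>))"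
  by (auto simp: submfd_def)

text \<open>The charts of \<open>submfd\<close> are restrictions of charts from the maximal atlas of
  \<open>M\<close>, so they are compatible automatically, and the separation and countability axioms
  are inherited. What remains is that slice charts cover \<open>S\<close>.\<close>

lemma submfd_manifoldI:
  assumes M: "smooth_manifold M" and S: "S \<subseteq> mspace M"
    and ch: "\<And>x. x \<in> S \<Longrightarrow> \<exists>U \<phi>. (U, \<phi>) \<in> full_atlas M \<and> x \<in> U \<and>
       is_chart k (subtopology (mtop M) S) (U \<inter> S, \<phi>)"
  shows "smooth_manifold (submfd k M S)"
  unfolding smooth_manifold_def
proof (intro conjI ballI)
  show "Hausdorff_space (mtop (submfd k M S))" "second_countable (mtop (submfd k M S))"
    using M by (simp_all add: smooth_manifold_def Hausdorff_space_subtopology second_countable_subtopology)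
  have "S \<subseteq> (\<Union>(U, \<phi>)\<in>matlas (submfd k M S). U)"
  proof
    fix x assume x: "x \<in> S"
    then obtain U \<phi> where "(U, \<phi>) \<in> full_atlas M" "x \<in> U" "is_chart k (subtopology (mtop M) S) (U \<inter> S, \<phi>)"
      using ch by metis
    then have "(U \<inter> S, \<phi>) \<in> matlas (submfd k M S)" "x \<in> U \<inter> S" using x by (auto simp: matlas_submfd)
    then show "x \<in> (\<Union>(U, \<phi>)\<in>matlas (submfd k M S). U)" by (intro UN_I[of "(U \<inter> S, \<phi>)"]) auto
  qed
  moreover have "(\<Union>(U, \<phi>)\<in>matlas (submfd k M S). U) \<subseteq> S" by (auto simp: matlas_submfd)
  ultimately show "(\<Union>(U, \<phi>)\<in>matlas (submfd k M S). U) = mspace (submfd k M S)" using S by auto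
  fix c assume c: "c \<in> matlas (submfd k M S)"
  then show "is_chart (mdim (submfd k M S)) (mtop (submfd k M S)) c"
    by (cases c) (auto simp: matlas_submfd)
  fix c' assume c': "c' \<in> matlas (submfd k M S)"
  have *: "smooth_on (\<phi> ` (U \<inter> S \<inter> (V \<inter> S))) (\<psi> \<circ> inv_into (U \<inter> S) \<phi>)"
    if "(U, \<phi>) \<in> full_atlas M" "(V, \<psi>) \<in> full_atlas M" for U V and \<phi> \<psi> :: "'a \<Rightarrow> 'b"
  proof -
    have "smooth_on (\<phi> ` (U \<inter> S \<inter> (V \<inter> S))) (\<lambda>y. \<psi> (inv_into U \<phi> y))"
      by (rule smooth_on_subset[OF full_atlas_compatible[OF M that]]) auto
    then show ?thesis
      by (rule smooth_on_cong)
        (auto simp: full_atlas_inv[OF that(1)] inv_into_f_f[OF inj_on_subset[OF full_atlas_inj[OF that(1)]]])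
  qed
  obtain U \<phi> V \<psi> where "c = (U \<inter> S, \<phi>)" "c' = (V \<inter> S, \<psi>)" "(U, \<phi>) \<in> full_atlas M" "(V, \<psi>) \<in> full_atlas M"
    using c c' by (cases c; cases c') (auto simp: matlas_submfd)
  then show "compatible c c'" unfolding compatible_def using *[of U \<phi> V \<psi>] *[of V \<psi> U \<phi>]
    by (simp add: Int_commute)
qed

text \<open>The conditions on open sets are inherited from the ambient chart, so only the shape of
  the image of \<open>U \<inter> S\<close> has to be checked.\<close>

lemma slice_chart:
  assumes c: "is_chart d X (U, \<phi>)" and V: "subspace V" "dim V = k" "b \<in> V" "open \<Omega>"
    and im: "\<phi> ` (U \<inter> S) = {x \<in> V. 0 \<le> b \<bullet> x} \<inter> \<Omega>"
  shows "chart_data k (subtopology X S) (U \<inter> S) \<phi> V b \<Omega>"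
  unfolding chart_data_def
proof (intro conjI allI impI V im)
  show "openin (subtopology X S) (U \<inter> S)" using chart_openin[OF c] by (simp add: openin_subtopology_Int)
  show "inj_on \<phi> (U \<inter> S)" using inj_on_subset[OF chart_inj[OF c]] by auto
  show "openin (subtopology X S) (U \<inter> S \<inter> \<phi> -` T)" if "open T" for T
  proof -
    have "U \<inter> S \<inter> \<phi> -` T = (U \<inter> \<phi> -` T) \<inter> S" by auto
    then show ?thesis using chart_preimage[OF c that] by (simp add: openin_subtopology_Int)
  qed
  show "\<exists>T'. open T' \<and> \<phi> ` (U \<inter> S \<inter> T) = \<phi> ` (U \<inter> S) \<inter> T'" if "openin (subtopology X S) T" for T
  proof -
    obtain T0 where T0: "openin X T0" "T = T0 \<inter> S" using \<open>openin (subtopology X S) T\<close>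
        by (auto simp: openin_subtopology)
    have "U \<inter> S \<inter> T = U \<inter> S \<inter> T0" using T0 by auto
    then show ?thesis using chart_image_Int[OF c T0(1), of "U \<inter> S"] by auto
  qed
qed

lemma open_part_manifold:
  assumes M: "smooth_manifold M" and S: "openin (mtop M) S"
  shows "smooth_manifold (open_part M S)"
proof (rule submfd_manifoldI[OF M openin_subset[OF S]])
  fix x assume x: "x \<in> S"
  then obtain U \<phi> where U: "(U, \<phi>) \<in> full_atlas M" "x \<in> U"
    using atlas_cover[OF M, of x] openin_subset[OF S] by blast
  obtain V b \<Omega> where "chart_data (mdim M) (mtop M) U \<phi> V b \<Omega>"
    using full_atlas_chart[OF U(1)] is_chart_iff by metis
  then obtain \<Omega>' where d: "chart_data (mdim M) (mtop M) (U \<inter> S) \<phi> V b \<Omega>'"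
    using chart_data_restrict[OF _ S] by metis
  have "is_chart (mdim M) (subtopology (mtop M) S) (U \<inter> S, \<phi>)" unfolding is_chart_iff
    using slice_chart[OF full_atlas_chart[OF U(1)] chart_dataD(5,6,7,8,9)[OF d]] by metis
  then show "\<exists>U \<phi>. (U, \<phi>) \<in> full_atlas M \<and> x \<in> U \<and> is_chart (mdim M) (subtopology (mtop M) S) (U \<inter> S, \<phi>)"
    using U by blast
qed

lemma submfd_cover:
  assumes "smooth_manifold (submfd k M S)" "x \<in> S" "x \<in> mspace M"
  obtains U \<phi> where "(U, \<phi>) \<in> full_atlas M" "(U \<inter> S, \<phi>) \<in> full_atlas (submfd k M S)" "x \<in> U"
proof -
  obtain Z \<phi> where "(Z, \<phi>) \<in> matlas (submfd k M S)" "(Z, \<phi>) \<in> full_atlas (submfd k M S)" "x \<in> Z"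
    using atlas_cover[OF assms(1), of x] assms by auto
  then show thesis using that by (auto simp: matlas_submfd)
qed

text \<open>As the charts of a submanifold are restricted ambient charts, the coordinate expressions
  of \<open>f\<close> for the two structures agree on \<open>A\<close>. Together with
  \<open>smooth_in_submfd_cod\<close> this lets smoothness be checked in the ambient
  manifolds.\<close>

lemma smooth_in_submfd_dom:
  assumes M: "smooth_manifold M" and N: "smooth_manifold N" and S: "smooth_manifold (submfd k M S)"
    and A: "A \<subseteq> S"
  shows "smooth_in (submfd k M S) N A f \<longleftrightarrow> smooth_in M N A f"
proof -
  have top: "subtopology (subtopology (mtop M) S) A = subtopology (mtop M) A"
    using A by (simp add: subtopology_subtopology Int_absorb1)
  have eq: "smooth_on (\<phi> ` (U \<inter> A \<inter> f -` V)) (\<lambda>y. \<psi> (f (inv_into U \<phi> y)))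
     \<longleftrightarrow> smooth_on (\<phi> ` (U \<inter> S \<inter> A \<inter> f -` V)) (\<lambda>y. \<psi> (f (inv_into (U \<inter> S) \<phi> y)))"
    if U: "(U, \<phi>) \<in> full_atlas M" for U \<phi> V and \<psi> :: "'c \<Rightarrow> 'd"
  proof -
    have e: "U \<inter> S \<inter> A \<inter> f -` V = U \<inter> A \<inter> f -` V" using A by auto
    have i: "inv_into (U \<inter> S) \<phi> (\<phi> x) = x" if "x \<in> U" "x \<in> A" for x
      using inv_into_f_f[OF inj_on_subset[OF full_atlas_inj[OF U]], of "U \<inter> S" x] that A by auto
    show ?thesis unfolding e
      by (rule iffI; erule smooth_on_cong) (auto simp: i full_atlas_inv[OF U])
  qed
  show ?thesis
  proof
    assume f: "smooth_in (submfd k M S) N A f"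
    show "smooth_in M N A f"
    proof (rule smooth_inI)
      show A': "A \<subseteq> mspace M" using smooth_in_subset_mspace[OF f] by auto
      show "continuous_map (subtopology (mtop M) A) (mtop N) f"
        using smooth_in_continuous[OF f] top by simp
      fix x assume x: "x \<in> A"
      obtain U \<phi> where U: "(U, \<phi>) \<in> full_atlas M" "(U \<inter> S, \<phi>) \<in> full_atlas (submfd k M S)" "x \<in> U"
        by (rule submfd_cover[OF S, of x]) (use x A A' in auto)
      obtain V \<psi> where V: "(V, \<psi>) \<in> full_atlas N" "f x \<in> V"
        using atlas_cover[OF N smooth_in_image[OF f x]] by blast
      have "smooth_on (\<phi> ` (U \<inter> A \<inter> f -` V)) (\<lambda>y. \<psi> (f (inv_into U \<phi> y)))"
        using smooth_in_charts[OF S N f U(2) V(1)] eq[OF U(1)] by simp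
      then have "smooth_on (\<phi> ` (U \<inter> mspace M \<inter> A \<inter> f -` V)) (\<lambda>y. \<psi> (f (inv_into U \<phi> y)))"
        by (rule smooth_on_subset) auto
      then show "\<exists>U \<phi> V \<psi> T. (U, \<phi>) \<in> full_atlas M \<and> (V, \<psi>) \<in> full_atlas N \<and> x \<in> U \<and> f x \<in> V \<and>
        openin (mtop M) T \<and> x \<in> T \<and> smooth_on (\<phi> ` (U \<inter> T \<inter> A \<inter> f -` V)) (\<lambda>y. \<psi> (f (inv_into U \<phi> y)))"
        using U V x A' by (intro exI[of _ U] exI[of _ \<phi>] exI[of _ V] exI[of _ \<psi>] exI[of _ "mspace M"]) auto
    qed
  next
    assume f: "smooth_in M N A f"
    show "smooth_in (submfd k M S) N A f"
    proof (rule smooth_inI)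
      show A': "A \<subseteq> mspace (submfd k M S)" using smooth_in_subset_mspace[OF f] A by auto
      show "continuous_map (subtopology (mtop (submfd k M S)) A) (mtop N) f"
        using smooth_in_continuous[OF f] top by simp
      fix x assume x: "x \<in> A"
      obtain U \<phi> where U: "(U, \<phi>) \<in> full_atlas M" "(U \<inter> S, \<phi>) \<in> full_atlas (submfd k M S)" "x \<in> U"
        by (rule submfd_cover[OF S, of x]) (use x A A' in auto)
      obtain V \<psi> where V: "(V, \<psi>) \<in> full_atlas N" "f x \<in> V"
        using atlas_cover[OF N smooth_in_image[OF f x]] by blast
      have "smooth_on (\<phi> ` (U \<inter> S \<inter> A \<inter> f -` V)) (\<lambda>y. \<psi> (f (inv_into (U \<inter> S) \<phi> y)))"
        using smooth_in_charts[OF M N f U(1) V(1)] eq[OF U(1)] by simp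
      then show "\<exists>U \<phi> V \<psi> T. (U, \<phi>) \<in> full_atlas (submfd k M S) \<and> (V, \<psi>) \<in> full_atlas N \<and> x \<in> U \<and> f x \<in> V \<and>
        openin (mtop (submfd k M S)) T \<and> x \<in> T \<and>
        smooth_on (\<phi> ` (U \<inter> T \<inter> A \<inter> f -` V)) (\<lambda>y. \<psi> (f (inv_into U \<phi> y)))"
        using U V x A A' chart_openin[OF full_atlas_chart[OF U(2)]]
        by (intro exI[of _ "U \<inter> S"] exI[of _ \<phi>] exI[of _ V] exI[of _ \<psi>]) auto
    qed
  qed
qed

lemma smooth_in_submfd_cod:
  assumes X: "smooth_manifold X" and M: "smooth_manifold M" and S: "smooth_manifold (submfd k M S)"
  shows "smooth_in X (submfd k M S) A f \<longleftrightarrow> smooth_in X M A f \<and> f ` A \<subseteq> S"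
proof
  assume f: "smooth_in X (submfd k M S) A f"
  have im: "f x \<in> S" "f x \<in> mspace M" if "x \<in> A" for x using smooth_in_image[OF f that] by auto
  have "smooth_in X M A f"
  proof (rule smooth_inI)
    show A': "A \<subseteq> mspace X" using smooth_in_subset_mspace[OF f] .
    show "continuous_map (subtopology (mtop X) A) (mtop M) f"
      using smooth_in_continuous[OF f] by (simp add: continuous_map_in_subtopology)
    fix x assume x: "x \<in> A"
    obtain U \<phi> where U: "(U, \<phi>) \<in> full_atlas X" "x \<in> U" using atlas_cover[OF X] x A' by blast
    obtain V \<psi> where V: "(V, \<psi>) \<in> full_atlas M" "(V \<inter> S, \<psi>) \<in> full_atlas (submfd k M S)" "f x \<in> V"
      using submfd_cover[OF S im[OF x]] by blast
    have "smooth_on (\<phi> ` (U \<inter> mspace X \<inter> A \<inter> f -` V)) (\<lambda>y. \<psi> (f (inv_into U \<phi> y)))"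
      by (rule smooth_on_subset[OF smooth_in_charts[OF X S f U(1) V(2)]]) (use im in auto)
    then show "\<exists>U \<phi> V \<psi> T. (U, \<phi>) \<in> full_atlas X \<and> (V, \<psi>) \<in> full_atlas M \<and> x \<in> U \<and> f x \<in> V \<and>
        openin (mtop X) T \<and> x \<in> T \<and> smooth_on (\<phi> ` (U \<inter> T \<inter> A \<inter> f -` V)) (\<lambda>y. \<psi> (f (inv_into U \<phi> y)))"
      using U V x A' by (intro exI[of _ U] exI[of _ \<phi>] exI[of _ V] exI[of _ \<psi>] exI[of _ "mspace X"]) auto
  qed
  then show "smooth_in X M A f \<and> f ` A \<subseteq> S" using im by auto
next
  assume "smooth_in X M A f \<and> f ` A \<subseteq> S"
  then have f: "smooth_in X M A f" and im: "f ` A \<subseteq> S" by auto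
  show "smooth_in X (submfd k M S) A f"
  proof (rule smooth_inI)
    show A': "A \<subseteq> mspace X" using smooth_in_subset_mspace[OF f] .
    show "continuous_map (subtopology (mtop X) A) (mtop (submfd k M S)) f"
      using smooth_in_continuous[OF f] im by (auto simp: continuous_map_in_subtopology)
    fix x assume x: "x \<in> A"
    obtain U \<phi> where U: "(U, \<phi>) \<in> full_atlas X" "x \<in> U" using atlas_cover[OF X] x A' by blast
    obtain V \<psi> where V: "(V, \<psi>) \<in> full_atlas M" "(V \<inter> S, \<psi>) \<in> full_atlas (submfd k M S)" "f x \<in> V"
      using submfd_cover[OF S, of "f x"] im x smooth_in_image[OF f x] by blast
    have "smooth_on (\<phi> ` (U \<inter> mspace X \<inter> A \<inter> f -` (V \<inter> S))) (\<lambda>y. \<psi> (f (inv_into U \<phi> y)))"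
      by (rule smooth_on_subset[OF smooth_in_charts[OF X M f U(1) V(1)]]) auto
    then show "\<exists>U \<phi> V \<psi> T. (U, \<phi>) \<in> full_atlas X \<and> (V, \<psi>) \<in> full_atlas (submfd k M S) \<and> x \<in> U \<and> f x \<in> V \<and>
        openin (mtop X) T \<and> x \<in> T \<and> smooth_on (\<phi> ` (U \<inter> T \<inter> A \<inter> f -` V)) (\<lambda>y. \<psi> (f (inv_into U \<phi> y)))"
      using U V x A' im by (intro exI[of _ U] exI[of _ \<phi>] exI[of _ "V \<inter> S"] exI[of _ \<psi>] exI[of _ "mspace X"]) auto
  qed
qed

section \<open>Maps to and from Euclidean space\<close>

abbreviation real_mfd :: "(real, real) mfd" where
  "real_mfd \<equiv> euclidean_mfd"

lemma euclidean_mfd_simps [simp]: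
  "mtop (euclidean_mfd :: ('e::euclidean_space, 'e) mfd) = euclidean"
  "mdim (euclidean_mfd :: ('e::euclidean_space, 'e) mfd) = DIM('e)"
  "matlas (euclidean_mfd :: ('e::euclidean_space, 'e) mfd) = {(UNIV, id)}"
  by (simp_all add: euclidean_mfd_def)

lemma second_countable_euclidean: "second_countable (euclidean :: 'e::euclidean_space topology)"
proof -
  obtain B :: "'e set set" where B: "countable B" "topological_basis B" using ex_countable_basis by blast
  have "openin euclidean V" if "V \<in> B" for V using topological_basis_open[OF B(2) that] by simp
  moreover have "\<exists>V\<in>B. x \<in> V \<and> V \<subseteq> U" if "openin euclidean U \<and> x \<in> U" for U x
    using topological_basisE[OF B(2), of U x] that by (metis open_openin)
  ultimately show ?thesis unfolding second_countable_def using B(1) by metis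
qed

lemma euclidean_full_chart: "is_chart DIM('e) euclidean (UNIV, id :: 'e::euclidean_space \<Rightarrow> 'e)"
  unfolding is_chart_iff
  by (intro exI[of _ UNIV] exI[of _ 0]) (auto simp: chart_data_def)

lemma euclidean_manifold: "smooth_manifold (euclidean_mfd :: ('e::euclidean_space, 'e) mfd)"
  unfolding smooth_manifold_def
  using euclidean_full_chart
  by (auto simp: second_countable_euclidean compatible_def)

lemma euclidean_full_atlas: "(UNIV, id) \<in> full_atlas (euclidean_mfd :: ('e::euclidean_space, 'e) mfd)"
  using atlas_subset_full[OF euclidean_manifold] by auto

lemma smooth_in_real_chart:
  assumes M: "smooth_manifold M" and f: "smooth_in M euclidean_mfd A f" and U: "(U, \<phi>) \<in> full_atlas M"
  shows "smooth_on (\<phi> ` (U \<inter> A)) (\<lambda>y. f (inv_into U \<phi> y))"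
  using smooth_in_charts[OF M euclidean_manifold f U euclidean_full_atlas] by simp

lemma chart_continuous: 
  assumes c: "is_chart d X (U, \<phi>)" shows "continuous_map (subtopology X U) euclidean \<phi>"
  unfolding continuous_map_def
proof (intro conjI allI impI)
  fix T :: "'b set" assume "openin euclidean T"
  then have "openin X (U \<inter> \<phi> -` T)" using chart_preimage[OF c] by simp
  moreover have "{x \<in> topspace (subtopology X U). \<phi> x \<in> T} = U \<inter> (U \<inter> \<phi> -` T)"
    using openin_subset[OF chart_openin[OF c]] by auto
  ultimately show "openin (subtopology X U) {x \<in> topspace (subtopology X U). \<phi> x \<in> T}"
    by (metis openin_subtopology_Int2)
qed auto

lemma chart_inverse_continuous: 
  assumes c: "is_chart d X (U, \<phi>)" and S: "S \<subseteq> \<phi> ` U"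
  shows "continuous_map (top_of_set S) X (inv_into U \<phi>)"
  unfolding continuous_map_def
proof (intro conjI allI impI)
  have US: "U \<subseteq> topspace X" using openin_subset[OF chart_openin[OF c]] .
  show "inv_into U \<phi> \<in> topspace (top_of_set S) \<rightarrow> topspace X"
    using S US by (auto intro!: subsetD[OF US] inv_into_into)
  fix T assume T: "openin X T"
  obtain T' where T': "open T'" "\<phi> ` (U \<inter> T) = \<phi> ` U \<inter> T'" using chart_image_Int[OF c T, of U] by auto
  have "y \<in> S \<and> inv_into U \<phi> y \<in> T \<longleftrightarrow> y \<in> S \<inter> T'" for y
  proof (cases "y \<in> S")
    case True
    then obtain x where x: "y = \<phi> x" "x \<in> U" using S by auto
    have "x \<in> T \<longleftrightarrow> \<phi> x \<in> \<phi> ` (U \<inter> T)"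
      using x(2) inj_on_image_mem_iff[OF chart_inj[OF c] x(2), of "U \<inter> T"] by auto
    then show ?thesis using x T' True inv_into_f_f[OF chart_inj[OF c] x(2)] by auto
  qed simp
  then have "{y \<in> topspace (top_of_set S). inv_into U \<phi> y \<in> T} = S \<inter> T'" by auto
  then show "openin (top_of_set S) {y \<in> topspace (top_of_set S). inv_into U \<phi> y \<in> T}"
    using T' by (auto simp: openin_open)
qed

text \<open>Continuity comes from smoothness in the charts: locally \<open>f\<close> is a smooth,
  hence continuous, function composed with a chart whose domain is open.\<close>

lemma smooth_in_realI:
  fixes f :: "'a \<Rightarrow> 'f::euclidean_space"
  assumes M: "smooth_manifold M" and A: "A \<subseteq> mspace M"
    and ch: "\<And>x. x \<in> A \<Longrightarrow> \<exists>U \<phi>. (U, \<phi>) \<in> full_atlas M \<and> x \<in> U \<and>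
         smooth_on (\<phi> ` (U \<inter> A)) (\<lambda>y. f (inv_into U \<phi> y))"
  shows "smooth_in M euclidean_mfd A f"
proof (rule smooth_inI[OF A])
  show "continuous_map (subtopology (mtop M) A) (mtop euclidean_mfd) f"
  proof (rule continuous_map_local)
    fix x assume "x \<in> topspace (subtopology (mtop M) A)"
    then have x: "x \<in> A" by simp
    then obtain U \<phi> where U: "(U, \<phi>) \<in> full_atlas M" "x \<in> U"
      "smooth_on (\<phi> ` (U \<inter> A)) (\<lambda>y. f (inv_into U \<phi> y))" using ch[OF x] by metis
    note c = full_atlas_chart[OF U(1)]
    have UM: "U \<subseteq> mspace M" using full_atlas_subset_mspace[OF U(1)] .
    have top: "subtopology (subtopology (mtop M) A) (A \<inter> U) = subtopology (mtop M) (A \<inter> U)"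
      by (simp add: subtopology_subtopology)
    have "continuous_map (subtopology (mtop M) (A \<inter> U)) euclidean \<phi>"
      using continuous_map_from_subtopology_mono[OF chart_continuous[OF c], of "A \<inter> U"] by auto
    then have "continuous_map (subtopology (mtop M) (A \<inter> U)) (top_of_set (\<phi> ` (U \<inter> A))) \<phi>"
      by (auto simp: continuous_map_in_subtopology)
    moreover have "continuous_map (top_of_set (\<phi> ` (U \<inter> A))) euclidean (\<lambda>y. f (inv_into U \<phi> y))"
      using smooth_on_continuous[OF U(3)] by simp
    ultimately have "continuous_map (subtopology (mtop M) (A \<inter> U)) euclidean ((\<lambda>y. f (inv_into U \<phi> y)) \<circ> \<phi>)"
      by (rule continuous_map_compose)
    then have "continuous_map (subtopology (mtop M) (A \<inter> U)) euclidean f"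
      by (rule continuous_map_eq) (auto simp: full_atlas_inv[OF U(1)])
    then show "\<exists>T. openin (subtopology (mtop M) A) T \<and> x \<in> T \<and>
       continuous_map (subtopology (subtopology (mtop M) A) T) (mtop euclidean_mfd) f"
      using x U(2) chart_openin[OF c] by (intro exI[of _ "A \<inter> U"]) (simp add: top openin_subtopology_Int2)
  qed
  fix x assume x: "x \<in> A"
  then obtain U \<phi> where U: "(U, \<phi>) \<in> full_atlas M" "x \<in> U"
    "smooth_on (\<phi> ` (U \<inter> A)) (\<lambda>y. f (inv_into U \<phi> y))" using ch[OF x] by metis
  have "smooth_on (\<phi> ` (U \<inter> mspace M \<inter> A \<inter> f -` UNIV)) (\<lambda>y. id (f (inv_into U \<phi> y)))"
    using smooth_on_subset[OF U(3), of "\<phi> ` (U \<inter> mspace M \<inter> A \<inter> f -` UNIV)"] by auto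
  then show "\<exists>U \<phi> V \<psi> T. (U, \<phi>) \<in> full_atlas M \<and> (V, \<psi>) \<in> full_atlas euclidean_mfd \<and> x \<in> U \<and> f x \<in> V \<and>
        openin (mtop M) T \<and> x \<in> T \<and> smooth_on (\<phi> ` (U \<inter> T \<inter> A \<inter> f -` V)) (\<lambda>y. \<psi> (f (inv_into U \<phi> y)))"
    using U x A euclidean_full_atlas
    by (intro exI[of _ U] exI[of _ \<phi>] exI[of _ UNIV] exI[of _ id] exI[of _ "mspace M"]) auto
qed

lemma smooth_in_euclidean_iff:
  fixes f :: "'e::euclidean_space \<Rightarrow> 'f::euclidean_space"
  shows "smooth_in euclidean_mfd euclidean_mfd A f \<longleftrightarrow> smooth_on A f"
proof
  assume "smooth_in euclidean_mfd euclidean_mfd A f"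
  from smooth_in_real_chart[OF euclidean_manifold this euclidean_full_atlas]
  show "smooth_on A f" by (simp add: inv_id[unfolded id_def] id_def)
next
  assume "smooth_on A f"
  then show "smooth_in euclidean_mfd euclidean_mfd A f"
    by (intro smooth_in_realI[OF euclidean_manifold] exI[of _ UNIV] exI[of _ id])
      (simp_all add: euclidean_full_atlas)
qed

lemma smooth_in_chart:
  assumes M: "smooth_manifold M" and U: "(U, \<phi>) \<in> full_atlas M"
  shows "smooth_in M euclidean_mfd U \<phi>"
proof (rule smooth_in_realI[OF M full_atlas_subset_mspace[OF U]])
  have "smooth_on (\<phi> ` (U \<inter> U)) (\<lambda>y. \<phi> (inv_into U \<phi> y))"
    by (rule smooth_on_cong[OF smooth_on_id(1)]) (auto simp: full_atlas_inv[OF U])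
  then show "\<exists>U' \<phi>'. (U', \<phi>') \<in> full_atlas M \<and> x \<in> U' \<and> smooth_on (\<phi>' ` (U' \<inter> U)) (\<lambda>y. \<phi> (inv_into U' \<phi>' y))"
    if "x \<in> U" for x using U that by blast
qed

lemma smooth_in_chart_inverse:
  assumes M: "smooth_manifold M" and U: "(U, \<phi>) \<in> full_atlas M"
  shows "smooth_in euclidean_mfd M (\<phi> ` U) (inv_into U \<phi>)"
proof (rule smooth_inI)
  show "continuous_map (subtopology (mtop euclidean_mfd) (\<phi> ` U)) (mtop M) (inv_into U \<phi>)"
    using chart_inverse_continuous[OF full_atlas_chart[OF U], of "\<phi> ` U"] by simp
  fix y assume y: "y \<in> \<phi> ` U"
  have "smooth_on (id ` (UNIV \<inter> UNIV \<inter> \<phi> ` U \<inter> inv_into U \<phi> -` U)) (\<lambda>y. \<phi> (inv_into U \<phi> (inv_into UNIV id y)))"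
    by (rule smooth_on_cong[OF smooth_on_id(1)]) (auto simp: full_atlas_inv[OF U])
  then show "\<exists>U' \<phi>' V \<psi> T. (U', \<phi>') \<in> full_atlas euclidean_mfd \<and> (V, \<psi>) \<in> full_atlas M \<and> y \<in> U' \<and> inv_into U \<phi> y \<in> V \<and>
        openin (mtop euclidean_mfd) T \<and> y \<in> T \<and>
        smooth_on (\<phi>' ` (U' \<inter> T \<inter> \<phi> ` U \<inter> inv_into U \<phi> -` V)) (\<lambda>y. \<psi> (inv_into U \<phi> (inv_into U' \<phi>' y)))"
    using U y euclidean_full_atlas
    by (intro exI[of _ UNIV] exI[of _ id] exI[of _ U] exI[of _ \<phi>] exI[of _ UNIV]) (auto simp: inv_into_into)
qed simp

subsection \<open>The boundary\<close>

lemma dim_orthogonal_slice: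
  fixes V :: "'e::euclidean_space set"
  assumes "subspace V" "b \<in> V" "b \<noteq> 0"
  shows "dim {y \<in> V. b \<bullet> y = 0} = dim V - 1"
proof -
  have "span {b} \<subseteq> V" using assms by (intro span_minimal) auto
  from dim_subspace_orthogonal_to_vectors[OF subspace_span assms(1) this]
  have "dim {y \<in> V. \<forall>x\<in>span {b}. orthogonal x y} + dim {b} = dim V" by simp
  moreover have "{y \<in> V. \<forall>x\<in>span {b}. orthogonal x y} = {y \<in> V. b \<bullet> y = 0}"
    by (auto simp: orthogonal_def span_singleton)
  moreover have "dim {b} = 1" using assms(3) dim_eq_card_independent[of "{b}"] by simp
  ultimately show ?thesis by simp
qed

text \<open>Bridge from relative interiors, by which \<open>mboundary\<close> is defined, to the
  equation b.y = 0. If this equation held at a relative interior point with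
  \<open>b \<noteq> 0\<close>, a small inward step would lie in the image, and its reflection would
  lie in the affine hull, hence again in the image, although it violates the half-space
  inequality.\<close>

lemma rel_interior_chart_iff:
  assumes c: "chart_data d X U \<phi> V b \<Omega>" and x: "x \<in> U"
  shows "\<phi> x \<in> rel_interior (\<phi> ` U) \<longleftrightarrow> b = 0 \<or> 0 < b \<bullet> \<phi> x"
proof -
  note c' = chart_dataD[OF c]
  have xV: "\<phi> x \<in> V" "0 \<le> b \<bullet> \<phi> x" "\<phi> x \<in> \<Omega>" using c'(9) x by blast+
  have hull: "affine hull (\<phi> ` U) \<subseteq> V"
    by (rule hull_minimal) (use c'(9) subspace_imp_affine[OF c'(5)] in auto)
  show ?thesis
  proof
    assume "b = 0 \<or> 0 < b \<bullet> \<phi> x"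
    then show "\<phi> x \<in> rel_interior (\<phi> ` U)"
    proof
      assume "b = 0"
      then have "\<Omega> \<inter> V = \<phi> ` U" using c'(9) by auto
      then show ?thesis unfolding mem_rel_interior
        using hull c'(8) x xV by (intro exI[of _ \<Omega>]) auto
    next
      assume b: "0 < b \<bullet> \<phi> x"
      have "open (\<Omega> \<inter> {y. 0 < b \<bullet> y})" using c'(8) by (simp add: open_Int open_halfspace_gt)
      moreover have "\<Omega> \<inter> {y. 0 < b \<bullet> y} \<inter> V \<subseteq> \<phi> ` U" unfolding c'(9) by auto
      ultimately show ?thesis unfolding mem_rel_interior
        using hull x xV b by (intro exI[of _ "\<Omega> \<inter> {y. 0 < b \<bullet> y}"]) auto
    qed
  next
    assume "\<phi> x \<in> rel_interior (\<phi> ` U)"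
    then obtain T where T: "open T" "\<phi> x \<in> T" "T \<inter> affine hull (\<phi> ` U) \<subseteq> \<phi> ` U"
      unfolding mem_rel_interior by blast
    show "b = 0 \<or> 0 < b \<bullet> \<phi> x"
    proof (rule ccontr)
      assume "\<not> ?thesis"
      then have b: "b \<noteq> 0" "b \<bullet> \<phi> x = 0" using xV(2) by auto
      have "open (T \<inter> \<Omega>)" "\<phi> x \<in> T \<inter> \<Omega>" using T c'(8) xV by auto
      then obtain e where e: "e > 0" "cball (\<phi> x) e \<subseteq> T \<inter> \<Omega>" unfolding open_contains_cball by blast
      define v where "v = (e / norm b) *\<^sub>R b"
      have nv: "norm v = e" using b e by (simp add: v_def)
      have vV: "v \<in> V" unfolding v_def by (rule subspace_scale[OF c'(5,7)])
      have bv: "0 < b \<bullet> v" using b e by (simp add: v_def)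
      have "\<phi> x + v \<in> cball (\<phi> x) e" "\<phi> x - v \<in> cball (\<phi> x) e" using nv by (auto simp: dist_norm)
      then have in_TO: "\<phi> x + v \<in> T \<inter> \<Omega>" "\<phi> x - v \<in> T" using e by auto
      then have "\<phi> x + v \<in> \<phi> ` U" unfolding c'(9)
        using xV vV b bv subspace_add[OF c'(5)] by (auto simp: inner_add_right)
      then have h: "\<phi> x + v \<in> affine hull (\<phi> ` U)" "\<phi> x \<in> affine hull (\<phi> ` U)"
        using x by (auto intro: hull_inc)
      have "2 *\<^sub>R \<phi> x + (- 1) *\<^sub>R (\<phi> x + v) \<in> affine hull (\<phi> ` U)"
        by (rule mem_affine[OF affine_affine_hull h(2,1)]) simp
      moreover have "2 *\<^sub>R \<phi> x + (- 1) *\<^sub>R (\<phi> x + v) = \<phi> x - v" by (simp add: scaleR_2)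
      ultimately have "\<phi> x - v \<in> affine hull (\<phi> ` U)" by (simp only:)
      then have "\<phi> x - v \<in> \<phi> ` U" using T in_TO by auto
      then have "0 \<le> b \<bullet> (\<phi> x - v)" unfolding c'(9) by auto
      then show False using b bv by (simp add: inner_diff_right)
    qed
  qed
qed

text \<open>Invariance of domain: in charts, \<open>f\<close> is a continuous injection of a set
  open in \<open>V\<close> into a space \<open>V2\<close> of the same dimension, so the image is
  open in \<open>V2\<close> and the image point is a relative interior point. This makes the
  boundary a topological notion.\<close>

lemma interior_invariance:
  assumes c: "chart_data d X U \<phi> V b \<Omega>" and c2: "chart_data d Y U2 \<phi>2 V2 b2 \<Omega>2"
    and T: "openin X T" "x \<in> T" "x \<in> U" "f x \<in> U2"
    and f: "continuous_map (subtopology X T) Y f" "inj_on f T"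
    and int: "b = 0 \<or> 0 < b \<bullet> \<phi> x"
  shows "b2 = 0 \<or> 0 < b2 \<bullet> \<phi>2 (f x)"
proof -
  note c' = chart_dataD[OF c] and c2' = chart_dataD[OF c2]
  \<comment> \<open>\<open>H\<close> cuts the half-space down to its open part, so that the image of
    \<open>O1\<close> below is open in all of \<open>V\<close>.\<close>
  define H where "H = (if b = 0 then UNIV else {y. 0 < b \<bullet> y})"
  have H: "open H" by (simp add: H_def open_halfspace_gt)
  have TX: "T \<subseteq> topspace X" using openin_subset[OF T(1)] .
  have preT: "openin X (T \<inter> f -` P)" if "openin Y P" for P
  proof -
    have "openin (subtopology X T) {x \<in> topspace (subtopology X T). f x \<in> P}"
      by (rule openin_continuous_map_preimage[OF f(1) that])
    moreover have "{x \<in> topspace (subtopology X T). f x \<in> P} = T \<inter> f -` P" using TX by auto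
    ultimately show ?thesis using T(1) openin_trans_full by metis
  qed
  define O1 where "O1 = (U \<inter> \<phi> -` H) \<inter> (T \<inter> f -` U2)"
  have O1: "openin X O1" unfolding O1_def by (intro openin_Int c'(3) H preT c2'(1))
  have xO1: "x \<in> O1" using T int by (auto simp: O1_def H_def)
  have O1U: "O1 \<subseteq> U" "O1 \<subseteq> T" by (auto simp: O1_def)
  have invO: "inv_into U \<phi> (\<phi> z) = z" if "z \<in> U" for z using inv_into_f_f[OF c'(2) that] .
  obtain T' where T': "open T'" "\<phi> ` (U \<inter> O1) = \<phi> ` U \<inter> T'" using c'(4)[OF O1] by blast
  have im: "\<phi> ` O1 = V \<inter> (\<Omega> \<inter> T' \<inter> H)"
  proof -
    have "\<phi> ` O1 = \<phi> ` U \<inter> T'" using T'(2) O1U(1) by (simp add: Int_absorb1)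
    moreover have "\<phi> ` O1 \<subseteq> H" by (auto simp: O1_def)
    ultimately have "\<phi> ` O1 = \<phi> ` U \<inter> T' \<inter> H" by auto
    also have "\<dots> = V \<inter> (\<Omega> \<inter> T' \<inter> H)" unfolding c'(9) by (auto simp: H_def split: if_splits)
    finally show ?thesis .
  qed
  have ope: "openin (top_of_set V) (\<phi> ` O1)" unfolding im
    using c'(8) T' H by (intro openin_open_Int open_Int)
  have ic: "is_chart d X (U, \<phi>)" using c is_chart_iff by metis
  define g where "g y = \<phi>2 (f (inv_into U \<phi> y))" for y
  have cont: "continuous_on (\<phi> ` O1) g" unfolding continuous_on_open_invariant
  proof (intro allI impI)
    fix B :: "'d set" assume "open B"
    then have "openin X (T \<inter> f -` (U2 \<inter> \<phi>2 -` B))" by (intro preT c2'(3))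
    from chart_image_Int[OF ic this O1U(1)] obtain A where A: "open A" "\<phi> ` (O1 \<inter> (T \<inter> f -` (U2 \<inter> \<phi>2 -` B))) = \<phi> ` O1
        \<inter> A"
      by (elim exE conjE)
    have "g -` B \<inter> \<phi> ` O1 = \<phi> ` (O1 \<inter> (T \<inter> f -` (U2 \<inter> \<phi>2 -` B)))"
    proof (intro equalityI subsetI)
      fix y assume "y \<in> g -` B \<inter> \<phi> ` O1"
      then obtain z where z: "z \<in> O1" "y = \<phi> z" "g y \<in> B" by blast
      then have "\<phi>2 (f z) \<in> B" using invO O1U(1) by (auto simp: g_def)
      then show "y \<in> \<phi> ` (O1 \<inter> (T \<inter> f -` (U2 \<inter> \<phi>2 -` B)))" using z by (auto simp: O1_def)
    next
      fix y assume "y \<in> \<phi> ` (O1 \<inter> (T \<inter> f -` (U2 \<inter> \<phi>2 -` B)))"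
      then obtain z where z: "z \<in> O1" "y = \<phi> z" "\<phi>2 (f z) \<in> B" by blast
      then show "y \<in> g -` B \<inter> \<phi> ` O1" using invO O1U(1) by (auto simp: g_def)
    qed
    then show "\<exists>A. open A \<and> A \<inter> \<phi> ` O1 = g -` B \<inter> \<phi> ` O1" using A by (intro exI[of _ A]) auto
  qed
  have inj: "inj_on g (\<phi> ` O1)"
  proof (rule inj_onI)
    fix y y' assume "y \<in> \<phi> ` O1" "y' \<in> \<phi> ` O1" "g y = g y'"
    then obtain z z' where z: "z \<in> O1" "y = \<phi> z" "z' \<in> O1" "y' = \<phi> z'" by blast
    moreover from z have "z \<in> U" "z' \<in> U" using O1U(1) by auto
    ultimately have "\<phi>2 (f z) = \<phi>2 (f z')" using \<open>g y = g y'\<close> invO by (simp add: g_def)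
    then have "f z = f z'" using inj_onD[OF c2'(2)] z by (auto simp: O1_def)
    then show "y = y'" using inj_onD[OF f(2)] z O1U(2) by auto
  qed
  have gim: "g ` \<phi> ` O1 \<subseteq> \<phi>2 ` U2" using invO O1U(1) by (auto simp: g_def O1_def)
  have "openin (top_of_set V2) (g ` \<phi> ` O1)"
  proof (rule invariance_of_domain_affine_sets[OF ope _ _ _ cont _ inj])
    show "affine V" "affine V2" using c'(5) c2'(5) subspace_imp_affine by auto
    show "aff_dim V2 \<le> aff_dim V" using c'(5,6) c2'(5,6) by (simp add: aff_dim_subspace)
    show "g \<in> \<phi> ` O1 \<rightarrow> V2" using gim unfolding c2'(9) by auto
  qed
  then obtain P where P: "open P" "g ` \<phi> ` O1 = V2 \<inter> P" by (auto simp: openin_open)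
  have "\<phi>2 (f x) \<in> g ` \<phi> ` O1" using xO1 invO O1U(1) by (force simp: g_def)
  moreover have "affine hull (\<phi>2 ` U2) \<subseteq> V2"
    by (rule hull_minimal) (use c2'(9) subspace_imp_affine[OF c2'(5)] in auto)
  ultimately have "\<phi>2 (f x) \<in> rel_interior (\<phi>2 ` U2)"
    unfolding mem_rel_interior using P gim by (intro exI[of _ P]) auto
  then show ?thesis using rel_interior_chart_iff[OF c2 T(4)] by simp
qed

text \<open>\<open>mboundary\<close> is defined by the charts of the atlas. Invariance of domain,
  applied to the identity in both directions, makes every chart decide about a boundary point in the
  same way.\<close>

lemma mboundary_chart_iff:
  assumes M: "smooth_manifold M" and c: "chart_data (mdim M) (mtop M) U \<phi> V b \<Omega>" and x: "x \<in> U"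
  shows "x \<in> mboundary M \<longleftrightarrow> b \<noteq> 0 \<and> b \<bullet> \<phi> x = 0"
proof -
  have xM: "x \<in> mspace M" using x chart_dataD(10)[OF c] by auto
  have nn: "0 \<le> b \<bullet> \<phi> x" using chart_dataD(9)[OF c] x by blast
  have key: "(b = 0 \<or> 0 < b \<bullet> \<phi> x) \<longleftrightarrow> \<phi>' x \<in> rel_interior (\<phi>' ` U')"
    if "(U', \<phi>') \<in> matlas M" "x \<in> U'" for U' \<phi>'
  proof -
    have "is_chart (mdim M) (mtop M) (U', \<phi>')"
      using that M full_atlas_chart atlas_subset_full by blast
    then obtain V' b' \<Omega>' where c': "chart_data (mdim M) (mtop M) U' \<phi>' V' b' \<Omega>'" using is_chart_iff by metis
    have id: "continuous_map (subtopology (mtop M) (mspace M)) (mtop M) (\<lambda>x. x)" by simp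
    show ?thesis unfolding rel_interior_chart_iff[OF c' that(2)]
      using interior_invariance[OF c c' openin_topspace xM x that(2) id]
        interior_invariance[OF c' c openin_topspace xM that(2) x id] by auto
  qed
  show ?thesis
  proof
    assume "x \<in> mboundary M"
    then obtain U' \<phi>' where "(U', \<phi>') \<in> matlas M" "x \<in> U'" "\<phi>' x \<notin> rel_interior (\<phi>' ` U')"
      unfolding mboundary_def by auto
    then have "\<not> (b = 0 \<or> 0 < b \<bullet> \<phi> x)" using key by metis
    then show "b \<noteq> 0 \<and> b \<bullet> \<phi> x = 0" using nn by auto
  next
    assume b: "b \<noteq> 0 \<and> b \<bullet> \<phi> x = 0"
    obtain U' \<phi>' where U': "(U', \<phi>') \<in> matlas M" "x \<in> U'" using atlas_cover[OF M xM] by metis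
    then have "\<phi>' x \<notin> rel_interior (\<phi>' ` U')" using key b by auto
    then show "x \<in> mboundary M" unfolding mboundary_def
      using U' by (intro UN_I[of "(U', \<phi>')"]) auto
  qed
qed

lemma mboundary_subset: 
  assumes "smooth_manifold M" shows "mboundary M \<subseteq> mspace M"
proof
  fix x assume "x \<in> mboundary M"
  then obtain U \<phi> where "(U, \<phi>) \<in> matlas M" "x \<in> U" unfolding mboundary_def by auto
  then show "x \<in> mspace M" using atlas_subset_full[OF assms] full_atlas_subset_mspace by blast
qed

text \<open>Contrapositive of \<open>interior_invariance\<close>: interior points go to interior
  points, so a point that is sent to the boundary comes from the boundary.\<close>

lemma mboundary_embedding:
  assumes M: "smooth_manifold M" and N: "smooth_manifold N" and d: "mdim M = mdim N"
    and T: "openin (mtop M) T" "x \<in> T" and f: "continuous_map (subtopology (mtop M) T) (mtop N) f" "inj_on f T"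
    and b: "f x \<in> mboundary N"
  shows "x \<in> mboundary M"
proof -
  have xM: "x \<in> mspace M" using openin_subset[OF T(1)] T(2) by auto
  obtain U \<phi> where U: "(U, \<phi>) \<in> full_atlas M" "x \<in> U" using atlas_cover[OF M xM] by metis
  obtain U2 \<phi>2 where U2: "(U2, \<phi>2) \<in> full_atlas N" "f x \<in> U2"
    using atlas_cover[OF N] mboundary_subset[OF N] b by (metis subsetD)
  obtain V b \<Omega> where c: "chart_data (mdim M) (mtop M) U \<phi> V b \<Omega>"
    using full_atlas_chart[OF U(1)] is_chart_iff by metis
  obtain V2 b2 \<Omega>2 where c2: "chart_data (mdim M) (mtop N) U2 \<phi>2 V2 b2 \<Omega>2"
    using full_atlas_chart[OF U2(1)] is_chart_iff d by metis
  have nn: "0 \<le> b \<bullet> \<phi> x" using chart_dataD(9)[OF c] U(2) by blast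
  show ?thesis
    using interior_invariance[OF c c2 T(1,2) U(2) U2(2) f] b nn
      mboundary_chart_iff[OF M c U(2)] mboundary_chart_iff[OF N c2[unfolded d] U2(2)] by auto
qed

text \<open>In a half-space chart the boundary is the slice b.y = 0, an open piece of a full
  subspace of dimension one less; hence the slice chart has normal 0.\<close>

lemma slice_boundary:
  assumes M: "smooth_manifold M" and x: "x \<in> mboundary M"
  shows "\<exists>U \<phi>. (U, \<phi>) \<in> full_atlas M \<and> x \<in> U \<and>
       is_chart (mdim M - 1) (subtopology (mtop M) (mboundary M)) (U \<inter> mboundary M, \<phi>)"
proof -
  obtain U \<phi> where U: "(U, \<phi>) \<in> full_atlas M" "x \<in> U"
    using atlas_cover[OF M] mboundary_subset[OF M] x by (metis subsetD)
  obtain V b \<Omega> where c: "chart_data (mdim M) (mtop M) U \<phi> V b \<Omega>"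
    using full_atlas_chart[OF U(1)] is_chart_iff by metis
  note c' = chart_dataD[OF c]
  have b: "b \<noteq> 0" using mboundary_chart_iff[OF M c U(2)] x by simp
  define V' where "V' = {y \<in> V. b \<bullet> y = 0}"
  have V': "subspace V'" unfolding V'_def using c'(5)
    by (auto simp: subspace_def inner_add_right)
  have dimV': "dim V' = mdim M - 1"
  proof -
    show ?thesis unfolding V'_def using dim_orthogonal_slice[OF c'(5,7) b] c'(6) by simp
  qed
  have "\<phi> ` (U \<inter> mboundary M) = {y \<in> V'. 0 \<le> 0 \<bullet> y} \<inter> \<Omega>"
  proof (intro equalityI subsetI)
    fix y assume "y \<in> \<phi> ` (U \<inter> mboundary M)"
    then obtain z where "z \<in> U" "z \<in> mboundary M" "y = \<phi> z" by blast
    then show "y \<in> {y \<in> V'. 0 \<le> 0 \<bullet> y} \<inter> \<Omega>"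
      using mboundary_chart_iff[OF M c] c'(9) by (auto simp: V'_def)
  next
    fix y assume y: "y \<in> {y \<in> V'. 0 \<le> 0 \<bullet> y} \<inter> \<Omega>"
    then have "y \<in> \<phi> ` U" unfolding c'(9) by (auto simp: V'_def)
    then obtain z where z: "z \<in> U" "y = \<phi> z" by blast
    then show "y \<in> \<phi> ` (U \<inter> mboundary M)"
      using mboundary_chart_iff[OF M c z(1)] y b by (auto simp: V'_def)
  qed
  then have "is_chart (mdim M - 1) (subtopology (mtop M) (mboundary M)) (U \<inter> mboundary M, \<phi>)"
    unfolding is_chart_iff using slice_chart[OF full_atlas_chart[OF U(1)] V' dimV' _ c'(8)] subspace_0[OF V']
    by metis
  then show ?thesis using U by blast
qed

lemma bdry_manifold: "smooth_manifold M \<Longrightarrow> smooth_manifold (bdry M)"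
  unfolding bdry_def by (rule submfd_manifoldI[OF _ mboundary_subset slice_boundary])

text \<open>Even without boundary points, a chart may be presented by a half-space whose edge its
  image does not meet. Cutting \<open>\<Omega>\<close> with the open half-space then allows the
  normal 0. Products rely on this, as a half-space times a half-space would be a corner.\<close>

lemma boundaryless_chart_data:
  assumes M: "smooth_manifold M" and b: "mboundary M = {}" and U: "(U, \<phi>) \<in> full_atlas M"
  obtains V \<Omega> where "chart_data (mdim M) (mtop M) U \<phi> V 0 \<Omega>"
proof -
  obtain V b \<Omega> where c: "chart_data (mdim M) (mtop M) U \<phi> V b \<Omega>"
    using full_atlas_chart[OF U] is_chart_iff by metis
  note c' = chart_dataD[OF c]
  show thesis
  proof (cases "b = 0")
    case True then show ?thesis using c that by metis
  next
    case False
    have pos: "0 < b \<bullet> \<phi> x" if "x \<in> U" for x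
    proof -
      have "0 \<le> b \<bullet> \<phi> x" using c'(9) that by blast
      then show ?thesis using mboundary_chart_iff[OF M c that] b False by force
    qed
    then have "\<phi> ` U \<subseteq> {y. 0 < b \<bullet> y}" by auto
    then have "\<phi> ` U = {x \<in> V. 0 \<le> 0 \<bullet> x} \<inter> (\<Omega> \<inter> {y. 0 < b \<bullet> y})" unfolding c'(9) by auto
    moreover have "open (\<Omega> \<inter> {y. 0 < b \<bullet> y})" using c'(8) by (simp add: open_Int open_halfspace_gt)
    ultimately have "chart_data (mdim M) (mtop M) U \<phi> V 0 (\<Omega> \<inter> {y. 0 < b \<bullet> y})"
      using c' subspace_0[OF c'(5)] unfolding chart_data_def by auto
    then show ?thesis by (rule that)
  qed
qed

subsection \<open>Products\<close>

lemma prod_mfd_simps [simp]: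
  "mtop (prod_mfd M N) = prod_topology (mtop M) (mtop N)" "mdim (prod_mfd M N) = mdim M + mdim N"
  by (simp_all add: prod_mfd_def)

lemma matlas_prod:
  "c \<in> matlas (prod_mfd M N) \<longleftrightarrow>
    (\<exists>U \<phi> V \<psi>. c = (U \<times> V, map_prod \<phi> \<psi>) \<and> (U, \<phi>) \<in> matlas M \<and> (V, \<psi>) \<in> matlas N)"
  by (auto simp: prod_mfd_def)

lemma second_countable_prod_topology:
  assumes "second_countable X" "second_countable Y"
  shows "second_countable (prod_topology X Y)"
proof -
  obtain B where B: "countable B" "\<And>V. V \<in> B \<Longrightarrow> openin X V"
    "\<And>U x. openin X U \<Longrightarrow> x \<in> U \<Longrightarrow> \<exists>V\<in>B. x \<in> V \<and> V \<subseteq> U"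
    using assms(1) unfolding second_countable_def by metis
  obtain C where C: "countable C" "\<And>V. V \<in> C \<Longrightarrow> openin Y V"
    "\<And>U x. openin Y U \<Longrightarrow> x \<in> U \<Longrightarrow> \<exists>V\<in>C. x \<in> V \<and> V \<subseteq> U"
    using assms(2) unfolding second_countable_def by metis
  define D where "D = (\<lambda>(V, W). V \<times> W) ` (B \<times> C)"
  have "countable D" unfolding D_def using B(1) C(1) by simp
  moreover have "openin (prod_topology X Y) V" if "V \<in> D" for V
    using that B(2) C(2) by (auto simp: D_def openin_prod_Times_iff)
  moreover have "\<exists>V\<in>D. p \<in> V \<and> V \<subseteq> U" if U: "openin (prod_topology X Y) U \<and> p \<in> U" for U p
  proof -
    obtain x y where p: "p = (x, y)" by (cases p)
    obtain P Q where P: "openin X P" "openin Y Q" "x \<in> P" "y \<in> Q" "P \<times> Q \<subseteq> U"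
      using U p unfolding openin_prod_topology_alt by metis
    obtain V where "V \<in> B" "x \<in> V" "V \<subseteq> P" using B(3)[OF P(1,3)] by metis
    moreover obtain W where "W \<in> C" "y \<in> W" "W \<subseteq> Q" using C(3)[OF P(2,4)] by metis
    ultimately show ?thesis using P(5) p by (intro bexI[of _ "V \<times> W"]) (auto simp: D_def)
  qed
  ultimately show ?thesis unfolding second_countable_def by metis
qed

lemma inv_into_map_prod:
  assumes "inj_on \<phi> U" "inj_on \<psi> V" "x \<in> U" "y \<in> V"
  shows "inv_into (U \<times> V) (map_prod \<phi> \<psi>) (\<phi> x, \<psi> y) = (x, y)"
  using inv_into_f_f[of "map_prod \<phi> \<psi>" "U \<times> V" "(x, y)"] map_prod_inj_on[OF assms(1,2)] assms(3,4) by simp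

text \<open>With one of the normals zero, the vector \<open>(b, b2)\<close> describes the product of
  the two models. With both nonzero it would describe a half-space rather than the corner that the
  product is.\<close>

lemma chart_data_prod:
  assumes c: "chart_data d X U \<phi> V b \<Omega>" and c2: "chart_data d2 Y U2 \<phi>2 V2 b2 \<Omega>2"
    and b: "b = 0 \<or> b2 = 0"
  shows "chart_data (d + d2) (prod_topology X Y) (U \<times> U2) (map_prod \<phi> \<phi>2) (V \<times> V2) (b, b2) (\<Omega> \<times> \<Omega>2)"
  unfolding chart_data_def
proof (intro conjI allI impI)
  note c' = chart_dataD[OF c] and c2' = chart_dataD[OF c2]
  show "openin (prod_topology X Y) (U \<times> U2)" using c'(1) c2'(1) by (simp add: openin_prod_Times_iff)
  show "inj_on (map_prod \<phi> \<phi>2) (U \<times> U2)" by (rule map_prod_inj_on[OF c'(2) c2'(2)])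
  show "subspace (V \<times> V2)" by (rule subspace_Times[OF c'(5) c2'(5)])
  show "dim (V \<times> V2) = d + d2" using dim_Times[OF c'(5) c2'(5)] c'(6) c2'(6) by simp
  show "(b, b2) \<in> V \<times> V2" "open (\<Omega> \<times> \<Omega>2)" using c' c2' by (auto simp: open_Times)
  have "map_prod \<phi> \<phi>2 ` (U \<times> U2) = \<phi> ` U \<times> \<phi>2 ` U2" by (rule map_prod_surj_on) auto
  then show "map_prod \<phi> \<phi>2 ` (U \<times> U2) = {x \<in> V \<times> V2. 0 \<le> (b, b2) \<bullet> x} \<inter> \<Omega> \<times> \<Omega>2"
    using b unfolding c'(9) c2'(9) by (auto simp: inner_prod_def)
  show "openin (prod_topology X Y) (U \<times> U2 \<inter> map_prod \<phi> \<phi>2 -` T)" if T: "open T" for T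
    unfolding openin_prod_topology_alt
  proof (intro allI impI)
    fix x y assume xy: "(x, y) \<in> U \<times> U2 \<inter> map_prod \<phi> \<phi>2 -` T"
    then have "(\<phi> x, \<phi>2 y) \<in> T" by simp
    then obtain A B where AB: "open A" "open B" "(\<phi> x, \<phi>2 y) \<in> A \<times> B" "A \<times> B \<subseteq> T" by (rule open_prod_elim[OF T])
    show "\<exists>P Q. openin X P \<and> openin Y Q \<and> x \<in> P \<and> y \<in> Q \<and> P \<times> Q \<subseteq> U \<times> U2 \<inter> map_prod \<phi> \<phi>2 -` T"
      using c'(3)[OF AB(1)] c2'(3)[OF AB(2)] AB(3,4) xy
      by (intro exI[of _ "U \<inter> \<phi> -` A"] exI[of _ "U2 \<inter> \<phi>2 -` B"]) auto
  qed
  show "\<exists>T'. open T' \<and> map_prod \<phi> \<phi>2 ` (U \<times> U2 \<inter> T) = map_prod \<phi> \<phi>2 ` (U \<times> U2) \<inter> T'"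
    if T: "openin (prod_topology X Y) T" for T
  proof -
    let ?I = "map_prod \<phi> \<phi>2 ` (U \<times> U2)"
    let ?J = "map_prod \<phi> \<phi>2 ` (U \<times> U2 \<inter> T)"
    \<comment> \<open>Around each point \<open>T\<close> contains a box, which gives an open box on
      the chart side. Taking the union of all admissible open sets avoids choosing the
      boxes.\<close>
    define F where "F = {S. open S \<and> ?I \<inter> S \<subseteq> ?J}"
    have "?J \<subseteq> ?I \<inter> \<Union>F"
    proof
      fix p assume "p \<in> ?J"
      then obtain x y where xy: "x \<in> U" "y \<in> U2" "(x, y) \<in> T" "p = (\<phi> x, \<phi>2 y)" by auto
      obtain P Q where P: "openin X P" "openin Y Q" "x \<in> P" "y \<in> Q" "P \<times> Q \<subseteq> T"
        using T xy(3) unfolding openin_prod_topology_alt by metis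
      obtain A where A: "open A" "\<phi> ` (U \<inter> P) = \<phi> ` U \<inter> A" using c'(4)[OF P(1)] by metis
      obtain B where B: "open B" "\<phi>2 ` (U2 \<inter> Q) = \<phi>2 ` U2 \<inter> B" using c2'(4)[OF P(2)] by metis
      have "?I \<inter> A \<times> B \<subseteq> ?J"
      proof
        fix q assume q: "q \<in> ?I \<inter> A \<times> B"
        then have "fst q \<in> \<phi> ` (U \<inter> P)" "snd q \<in> \<phi>2 ` (U2 \<inter> Q)" unfolding A(2) B(2) by auto
        then obtain x' y' where "x' \<in> U" "x' \<in> P" "y' \<in> U2" "y' \<in> Q" "q = (\<phi> x', \<phi>2 y')"
          by (metis IntE imageE prod.collapse)
        then show "q \<in> ?J" using P(5) by (intro image_eqI[of _ _ "(x', y')"]) auto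
      qed
      then have "A \<times> B \<in> F" using A B by (simp add: F_def open_Times)
      moreover have "\<phi> x \<in> A" "\<phi>2 y \<in> B" using A(2) B(2) xy P by blast+
      ultimately show "p \<in> ?I \<inter> \<Union>F" using xy by (auto intro!: image_eqI[of _ _ "(x, y)"])
    qed
    moreover have "?I \<inter> \<Union>F \<subseteq> ?J" by (auto simp: F_def)
    moreover have "open (\<Union>F)" by (auto simp: F_def)
    ultimately show ?thesis by (intro exI[of _ "\<Union>F"]) auto
  qed
qed

text \<open>The charts of the factor without boundary are rewritten with normal 0, after which
  \<open>chart_data_prod\<close> applies; transition maps split into components.\<close>

lemma prod_manifold:
  assumes M: "smooth_manifold M" and N: "smooth_manifold N" and b: "mboundary M = {} \<or> mboundary N = {}"
  shows "smooth_manifold (prod_mfd M N)"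
  unfolding smooth_manifold_def
proof (intro conjI ballI)
  show "Hausdorff_space (mtop (prod_mfd M N))" "second_countable (mtop (prod_mfd M N))"
    using M N by (simp_all add: smooth_manifold_def Hausdorff_space_prod_topology second_countable_prod_topology)
  show "(\<Union>(U, \<phi>)\<in>matlas (prod_mfd M N). U) = mspace (prod_mfd M N)"
  proof (intro equalityI subsetI)
    fix p assume "p \<in> mspace (prod_mfd M N)"
    then obtain x y where p: "p = (x, y)" "x \<in> mspace M" "y \<in> mspace N" by auto
    obtain U \<phi> where U: "(U, \<phi>) \<in> matlas M" "x \<in> U" using atlas_cover[OF M p(2)] by metis
    obtain V \<psi> where V: "(V, \<psi>) \<in> matlas N" "y \<in> V" using atlas_cover[OF N p(3)] by metis
    have "(U \<times> V, map_prod \<phi> \<psi>) \<in> matlas (prod_mfd M N)" using U V by (auto simp: matlas_prod)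
    then show "p \<in> (\<Union>(U, \<phi>)\<in>matlas (prod_mfd M N). U)" using p U V
      by (intro UN_I[of "(U \<times> V, map_prod \<phi> \<psi>)"]) auto
  next
    fix p assume "p \<in> (\<Union>(U, \<phi>)\<in>matlas (prod_mfd M N). U)"
    then obtain U \<phi> V \<psi> where "p \<in> U \<times> V" "(U, \<phi>) \<in> matlas M" "(V, \<psi>) \<in> matlas N"
      by (auto simp: matlas_prod)
    moreover from this have "(U, \<phi>) \<in> full_atlas M" "(V, \<psi>) \<in> full_atlas N"
      using atlas_subset_full[OF M] atlas_subset_full[OF N] by auto
    then have "U \<subseteq> mspace M" "V \<subseteq> mspace N" by (simp_all add: full_atlas_subset_mspace)
    ultimately show "p \<in> mspace (prod_mfd M N)" by auto
  qed
  fix c assume "c \<in> matlas (prod_mfd M N)"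
  then obtain U \<phi> V \<psi> where c: "c = (U \<times> V, map_prod \<phi> \<psi>)" "(U, \<phi>) \<in> matlas M" "(V, \<psi>) \<in> matlas N"
    unfolding matlas_prod by metis
  then have f: "(U, \<phi>) \<in> full_atlas M" "(V, \<psi>) \<in> full_atlas N"
    using atlas_subset_full[OF M] atlas_subset_full[OF N] by auto
  show "is_chart (mdim (prod_mfd M N)) (mtop (prod_mfd M N)) c"
  proof (cases "mboundary M = {}")
    case True
    obtain V1 \<Omega>1 where d1: "chart_data (mdim M) (mtop M) U \<phi> V1 0 \<Omega>1"
      using boundaryless_chart_data[OF M True f(1)] by metis
    obtain V2 b2 \<Omega>2 where d2: "chart_data (mdim N) (mtop N) V \<psi> V2 b2 \<Omega>2"
      using full_atlas_chart[OF f(2)] is_chart_iff by metis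
    have "chart_data (mdim M + mdim N) (prod_topology (mtop M) (mtop N)) (U \<times> V) (map_prod \<phi> \<psi>)
       (V1 \<times> V2) (0, b2) (\<Omega>1 \<times> \<Omega>2)" by (rule chart_data_prod[OF d1 d2]) simp
    then show ?thesis unfolding c(1) prod_mfd_simps is_chart_iff by metis
  next
    case False
    then have e: "mboundary N = {}" using b by simp
    obtain V1 b1 \<Omega>1 where d1: "chart_data (mdim M) (mtop M) U \<phi> V1 b1 \<Omega>1"
      using full_atlas_chart[OF f(1)] is_chart_iff by metis
    obtain V2 \<Omega>2 where d2: "chart_data (mdim N) (mtop N) V \<psi> V2 0 \<Omega>2"
      using boundaryless_chart_data[OF N e f(2)] by metis
    have "chart_data (mdim M + mdim N) (prod_topology (mtop M) (mtop N)) (U \<times> V) (map_prod \<phi> \<psi>)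
       (V1 \<times> V2) (b1, 0) (\<Omega>1 \<times> \<Omega>2)" by (rule chart_data_prod[OF d1 d2]) simp
    then show ?thesis unfolding c(1) prod_mfd_simps is_chart_iff by metis
  qed
  fix c' assume "c' \<in> matlas (prod_mfd M N)"
  then obtain U' \<phi>' V' \<psi>' where c': "c' = (U' \<times> V', map_prod \<phi>' \<psi>')" "(U', \<phi>') \<in> matlas M" "(V', \<psi>') \<in> matlas N"
    unfolding matlas_prod by metis
  then have f': "(U', \<phi>') \<in> full_atlas M" "(V', \<psi>') \<in> full_atlas N"
    using atlas_subset_full[OF M] atlas_subset_full[OF N] by auto
  have *: "smooth_on (map_prod \<phi> \<psi> ` (U \<times> V \<inter> U' \<times> V')) (map_prod \<phi>' \<psi>' \<circ> inv_into (U \<times> V) (map_prod \<phi> \<psi>))"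
    if f: "(U, \<phi>) \<in> full_atlas M" "(V, \<psi>) \<in> full_atlas N" and f': "(U', \<phi>') \<in> full_atlas M" "(V', \<psi>') \<in> full_atlas N"
    for U \<phi> U' \<phi>' V \<psi> V' \<psi>'
  proof -
    let ?S = "map_prod \<phi> \<psi> ` (U \<times> V \<inter> U' \<times> V')"
    have "smooth_on ?S (\<lambda>y. \<phi>' (inv_into U \<phi> (fst y)))"
      by (rule smooth_on_comp[OF smooth_on_fst[OF smooth_on_id(1)] full_atlas_compatible[OF M f(1) f'(1)]]) auto
    moreover have "smooth_on ?S (\<lambda>y. \<psi>' (inv_into V \<psi> (snd y)))"
      by (rule smooth_on_comp[OF smooth_on_snd[OF smooth_on_id(1)] full_atlas_compatible[OF N f(2) f'(2)]]) auto
    ultimately have "smooth_on ?S (\<lambda>y. (\<phi>' (inv_into U \<phi> (fst y)), \<psi>' (inv_into V \<psi> (snd y))))"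
      by (rule smooth_on_Pair)
    then show ?thesis
      by (rule smooth_on_cong)
        (auto simp: full_atlas_inv[OF f(1)] full_atlas_inv[OF f(2)]
          inv_into_map_prod[OF full_atlas_inj[OF f(1)] full_atlas_inj[OF f(2)]])
  qed
  show "compatible c c'" unfolding compatible_def c(1) c'(1)
    using *[OF f f'] *[OF f' f] by (simp add: Int_commute)
qed

text \<open>The normal of the product chart has a zero entry for one factor, so the criterion b.y =
  0 only sees the other one.\<close>

lemma mboundary_prod:
  assumes M: "smooth_manifold M" and N: "smooth_manifold N" and b: "mboundary M = {} \<or> mboundary N = {}"
    and p: "x \<in> mspace M" "y \<in> mspace N"
  shows "(x, y) \<in> mboundary (prod_mfd M N) \<longleftrightarrow> x \<in> mboundary M \<or> y \<in> mboundary N"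
proof -
  obtain U \<phi> where U: "(U, \<phi>) \<in> matlas M" "(U, \<phi>) \<in> full_atlas M" "x \<in> U" using atlas_cover[OF M p(1)] by metis
  obtain V \<psi> where V: "(V, \<psi>) \<in> matlas N" "(V, \<psi>) \<in> full_atlas N" "y \<in> V" using atlas_cover[OF N p(2)] by metis
  obtain V1 b1 \<Omega>1 V2 b2 \<Omega>2 where d1: "chart_data (mdim M) (mtop M) U \<phi> V1 b1 \<Omega>1"
    and d2: "chart_data (mdim N) (mtop N) V \<psi> V2 b2 \<Omega>2" and bb: "b1 = 0 \<or> b2 = 0"
  proof (cases "mboundary M = {}")
    case True
    show thesis
      by (rule boundaryless_chart_data[OF M True U(2)])
        (use full_atlas_chart[OF V(2), unfolded is_chart_iff] that in blast)
  next
    case False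
    then have "mboundary N = {}" using b by simp
    then show thesis
      by (rule boundaryless_chart_data[OF N _ V(2)])
        (use full_atlas_chart[OF U(2), unfolded is_chart_iff] that in blast)
  qed
  have d: "chart_data (mdim (prod_mfd M N)) (mtop (prod_mfd M N)) (U \<times> V) (map_prod \<phi> \<psi>)
       (V1 \<times> V2) (b1, b2) (\<Omega>1 \<times> \<Omega>2)" unfolding prod_mfd_simps by (rule chart_data_prod[OF d1 d2 bb])
  have "(x, y) \<in> U \<times> V" using U V by simp
  from mboundary_chart_iff[OF prod_manifold[OF M N b] d this]
    mboundary_chart_iff[OF M d1 U(3)] mboundary_chart_iff[OF N d2 V(3)] bb
  show ?thesis by (auto simp: zero_prod_def inner_prod_def)
qed

lemma prod_full_chart:
  assumes "smooth_manifold M" "smooth_manifold N" "mboundary M = {} \<or> mboundary N = {}"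
    "(U, \<phi>) \<in> matlas M" "(V, \<psi>) \<in> matlas N"
  shows "(U \<times> V, map_prod \<phi> \<psi>) \<in> full_atlas (prod_mfd M N)"
proof (rule subsetD[OF atlas_subset_full[OF prod_manifold[OF assms(1-3)]]])
  show "(U \<times> V, map_prod \<phi> \<psi>) \<in> matlas (prod_mfd M N)"
    unfolding matlas_prod using assms(4,5) by metis
qed

lemma smooth_in_Pair:
  assumes X: "smooth_manifold X" and M: "smooth_manifold M" and N: "smooth_manifold N"
    and b: "mboundary M = {} \<or> mboundary N = {}"
    and f: "smooth_in X M A f" and g: "smooth_in X N A g"
  shows "smooth_in X (prod_mfd M N) A (\<lambda>x. (f x, g x))"
proof (rule smooth_inI)
  show A: "A \<subseteq> mspace X" using smooth_in_subset_mspace[OF f] .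
  show "continuous_map (subtopology (mtop X) A) (mtop (prod_mfd M N)) (\<lambda>x. (f x, g x))"
    using smooth_in_continuous[OF f] smooth_in_continuous[OF g] by (simp add: continuous_map_paired)
  fix x assume x: "x \<in> A"
  obtain U \<phi> where U: "(U, \<phi>) \<in> full_atlas X" "x \<in> U" using atlas_cover[OF X] x A by (metis subsetD)
  obtain V \<psi> where V: "(V, \<psi>) \<in> matlas M" "(V, \<psi>) \<in> full_atlas M" "f x \<in> V"
    using atlas_cover[OF M smooth_in_image[OF f x]] by metis
  obtain Z \<zeta> where Z: "(Z, \<zeta>) \<in> matlas N" "(Z, \<zeta>) \<in> full_atlas N" "g x \<in> Z"
    using atlas_cover[OF N smooth_in_image[OF g x]] by metis
  let ?S = "\<phi> ` (U \<inter> U \<inter> A \<inter> (\<lambda>x. (f x, g x)) -` (V \<times> Z))"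
  have "smooth_on ?S (\<lambda>y. \<psi> (f (inv_into U \<phi> y)))"
    by (rule smooth_on_subset[OF smooth_in_charts[OF X M f U(1) V(2)]]) auto
  moreover have "smooth_on ?S (\<lambda>y. \<zeta> (g (inv_into U \<phi> y)))"
    by (rule smooth_on_subset[OF smooth_in_charts[OF X N g U(1) Z(2)]]) auto
  ultimately have "smooth_on ?S (\<lambda>y. (\<psi> (f (inv_into U \<phi> y)), \<zeta> (g (inv_into U \<phi> y))))"
    by (rule smooth_on_Pair)
  then have "smooth_on ?S (\<lambda>y. map_prod \<psi> \<zeta> (f (inv_into U \<phi> y), g (inv_into U \<phi> y)))" by simp
  then show "\<exists>U \<phi> V \<psi> T. (U, \<phi>) \<in> full_atlas X \<and> (V, \<psi>) \<in> full_atlas (prod_mfd M N) \<and> x \<in> U \<and> (f x, g x) \<in> V \<and>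
     openin (mtop X) T \<and> x \<in> T \<and>
     smooth_on (\<phi> ` (U \<inter> T \<inter> A \<inter> (\<lambda>x. (f x, g x)) -` V)) (\<lambda>y. \<psi> (f (inv_into U \<phi> y), g (inv_into U \<phi> y)))"
    using U V Z prod_full_chart[OF M N b V(1) Z(1)] chart_openin[OF full_atlas_chart[OF U(1)]]
    by (intro exI[of _ U] exI[of _ \<phi>] exI[of _ "V \<times> Z"] exI[of _ "map_prod \<psi> \<zeta>"]) auto
qed

lemma smooth_in_fst_snd:
  assumes M: "smooth_manifold M" and N: "smooth_manifold N" and b: "mboundary M = {} \<or> mboundary N = {}"
  shows smooth_in_fst: "smooth_in (prod_mfd M N) M (mspace (prod_mfd M N)) fst"
    and smooth_in_snd: "smooth_in (prod_mfd M N) N (mspace (prod_mfd M N)) snd"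
proof -
  note P = prod_manifold[OF M N b]
  show "smooth_in (prod_mfd M N) M (mspace (prod_mfd M N)) fst"
  proof (rule smooth_inI)
    show "continuous_map (subtopology (mtop (prod_mfd M N)) (mspace (prod_mfd M N))) (mtop M) fst"
      by (simp add: continuous_map_from_subtopology continuous_map_fst)
    fix p assume "p \<in> mspace (prod_mfd M N)"
    then obtain x y where p: "p = (x, y)" "x \<in> mspace M" "y \<in> mspace N" by auto
    obtain U \<phi> where U: "(U, \<phi>) \<in> matlas M" "(U, \<phi>) \<in> full_atlas M" "x \<in> U" using atlas_cover[OF M p(2)] by metis
    obtain V \<psi> where V: "(V, \<psi>) \<in> matlas N" "(V, \<psi>) \<in> full_atlas N" "y \<in> V" using atlas_cover[OF N p(3)] by metis
    note c = prod_full_chart[OF M N b U(1) V(1)]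
    let ?S = "map_prod \<phi> \<psi> ` (U \<times> V \<inter> U \<times> V \<inter> mspace (prod_mfd M N) \<inter> fst -` U)"
    have "smooth_on ?S (\<lambda>y. \<phi> (fst (inv_into (U \<times> V) (map_prod \<phi> \<psi>) y)))"
      by (rule smooth_on_cong[OF smooth_on_fst[OF smooth_on_id(1)]])
        (auto simp: inv_into_map_prod[OF full_atlas_inj[OF U(2)] full_atlas_inj[OF V(2)]])
    then show "\<exists>U \<phi> V \<psi> T. (U, \<phi>) \<in> full_atlas (prod_mfd M N) \<and> (V, \<psi>) \<in> full_atlas M \<and> p \<in> U \<and> fst p \<in> V \<and>
       openin (mtop (prod_mfd M N)) T \<and> p \<in> T \<and>
       smooth_on (\<phi> ` (U \<inter> T \<inter> mspace (prod_mfd M N) \<inter> fst -` V)) (\<lambda>y. \<psi> (fst (inv_into U \<phi> y)))"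
      using U V p c chart_openin[OF full_atlas_chart[OF c]]
      by (intro exI[of _ "U \<times> V"] exI[of _ "map_prod \<phi> \<psi>"] exI[of _ U] exI[of _ \<phi>]) auto
  qed simp
  show "smooth_in (prod_mfd M N) N (mspace (prod_mfd M N)) snd"
  proof (rule smooth_inI)
    show "continuous_map (subtopology (mtop (prod_mfd M N)) (mspace (prod_mfd M N))) (mtop N) snd"
      by (simp add: continuous_map_from_subtopology continuous_map_snd)
    fix p assume "p \<in> mspace (prod_mfd M N)"
    then obtain x y where p: "p = (x, y)" "x \<in> mspace M" "y \<in> mspace N" by auto
    obtain U \<phi> where U: "(U, \<phi>) \<in> matlas M" "(U, \<phi>) \<in> full_atlas M" "x \<in> U" using atlas_cover[OF M p(2)] by metis
    obtain V \<psi> where V: "(V, \<psi>) \<in> matlas N" "(V, \<psi>) \<in> full_atlas N" "y \<in> V" using atlas_cover[OF N p(3)] by metis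
    note c = prod_full_chart[OF M N b U(1) V(1)]
    let ?S = "map_prod \<phi> \<psi> ` (U \<times> V \<inter> U \<times> V \<inter> mspace (prod_mfd M N) \<inter> snd -` V)"
    have "smooth_on ?S (\<lambda>y. \<psi> (snd (inv_into (U \<times> V) (map_prod \<phi> \<psi>) y)))"
      by (rule smooth_on_cong[OF smooth_on_snd[OF smooth_on_id(1)]])
        (auto simp: inv_into_map_prod[OF full_atlas_inj[OF U(2)] full_atlas_inj[OF V(2)]])
    then show "\<exists>U \<phi> V \<psi> T. (U, \<phi>) \<in> full_atlas (prod_mfd M N) \<and> (V, \<psi>) \<in> full_atlas N \<and> p \<in> U \<and> snd p \<in> V \<and>
       openin (mtop (prod_mfd M N)) T \<and> p \<in> T \<and>
       smooth_on (\<phi> ` (U \<inter> T \<inter> mspace (prod_mfd M N) \<inter> snd -` V)) (\<lambda>y. \<psi> (snd (inv_into U \<phi> y)))"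
      using U V p c chart_openin[OF full_atlas_chart[OF c]]
      by (intro exI[of _ "U \<times> V"] exI[of _ "map_prod \<phi> \<psi>"] exI[of _ V] exI[of _ \<psi>]) auto
  qed simp
qed

subsection \<open>The circle and real-valued functions\<close>

text \<open>The branch of the logarithm centered at \<open>c\<close> is a chart of the plane that
  carries the unit circle to a segment of the imaginary axis. A chart of the plane is wanted because
  \<open>circle_mfd\<close> takes its structure from slice charts of the plane.\<close>

lemma circle_log_chart:
  assumes c: "norm (c::complex) = 1"
  defines "U \<equiv> {z. z / c \<notin> \<real>\<^sub>\<le>\<^sub>0}" and "\<phi> \<equiv> (\<lambda>z. Ln (z / c))"
  shows "(U, \<phi>) \<in> full_atlas euclidean_mfd"
    and "chart_data 1 (top_of_set (sphere 0 1)) (U \<inter> sphere 0 1) \<phi> {w. Re w = 0} 0 {w. - pi < Im w \<and> Im w < pi}"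
proof -
  have c0: "c \<noteq> 0" using c by auto
  have cont: "continuous_on UNIV (\<lambda>z. z / c)" using c0 by (intro continuous_intros) auto
  have "closed ((\<lambda>z. z / c) -` \<real>\<^sub>\<le>\<^sub>0)"
    by (rule closed_vimage[OF _ cont]) (simp add: closed_nonpos_Reals_complex)
  moreover have "U = - ((\<lambda>z. z / c) -` \<real>\<^sub>\<le>\<^sub>0)" by (auto simp: U_def)
  ultimately have oU: "open U" by (simp add: open_Compl)
  have inv: "c * exp (\<phi> z) = z" if "z \<in> U" for z
  proof -
    have "z / c \<noteq> 0" using that by (auto simp: U_def)
    then show ?thesis using c0 by (simp add: \<phi>_def)
  qed
  have Im: "- pi < Im (\<phi> z) \<and> Im (\<phi> z) < pi" if z: "z \<in> U" for z
  proof -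
    have nz: "z / c \<noteq> 0" and nn: "z / c \<notin> \<real>\<^sub>\<le>\<^sub>0" using z by (auto simp: U_def)
    have "Im (\<phi> z) \<noteq> pi" using nn Im_Ln_eq_pi[OF nz] by (auto simp: \<phi>_def complex_nonpos_Reals_iff)
    then show ?thesis using Im_Ln_le_pi[OF nz] mpi_less_Im_Ln[OF nz] by (auto simp: \<phi>_def)
  qed
  have inv2: "c * exp w \<in> U \<and> \<phi> (c * exp w) = w" if w: "- pi < Im w" "Im w < pi" for w
  proof -
    have e: "c * exp w / c = exp w" using c0 by simp
    have L: "Ln (exp w) = w" using Ln_exp w by simp
    have "exp w \<notin> \<real>\<^sub>\<le>\<^sub>0"
    proof
      assume a: "exp w \<in> \<real>\<^sub>\<le>\<^sub>0"
      then have "Re (exp w) < 0" "Im (exp w) = 0"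
        using exp_not_eq_zero[of w] by (auto simp: complex_nonpos_Reals_iff complex_eq_iff less_le)
      then have "Im (Ln (exp w)) = pi" using Im_Ln_eq_pi[of "exp w"] by simp
      then show False using L w by simp
    qed
    then show ?thesis using e L by (simp add: U_def \<phi>_def)
  qed
  have im: "\<phi> ` U = {w. - pi < Im w \<and> Im w < pi}"
  proof (intro equalityI subsetI)
    fix w assume "w \<in> {w. - pi < Im w \<and> Im w < pi}"
    then show "w \<in> \<phi> ` U" using inv2[of w] by (intro image_eqI[of _ _ "c * exp w"]) auto
  qed (use Im in auto)
  have oI: "open {w::complex. - pi < Im w \<and> Im w < pi}"
    by (intro open_Collect_conj open_halfspace_Im_gt open_halfspace_Im_lt)
  have smooth: "smooth_on U \<phi>" unfolding \<phi>_def
    by (intro smooth_on_Ln smooth_on_divide smooth_on_id(1) smooth_on_const) (use c0 in \<open>auto simp: U_def\<close>)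
  have inj: "inj_on \<phi> U" using inv by (metis inj_onI)
  have inv_eq: "inv_into U \<phi> w = c * exp w" if "w \<in> \<phi> ` U" for w
    using that inv inv_into_f_f[OF inj] by auto
  have "chart_data 2 euclidean U \<phi> UNIV 0 {w. - pi < Im w \<and> Im w < pi}"
    unfolding chart_data_def
  proof (intro conjI allI impI oI inj)
    show "openin euclidean (U \<inter> \<phi> -` T)" if "open T" for T
      using continuous_on_open_vimage[OF oU, of \<phi>] smooth_on_continuous[OF smooth] that
      by (metis Int_commute open_openin)
    show "\<exists>T'. open T' \<and> \<phi> ` (U \<inter> T) = \<phi> ` U \<inter> T'" if "openin euclidean T" for T
    proof (intro exI conjI)
      show "open ((\<lambda>w. c * exp w) -` T)" using that
        by (intro open_vimage) (auto intro!: continuous_intros)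
      show "\<phi> ` (U \<inter> T) = \<phi> ` U \<inter> (\<lambda>w. c * exp w) -` T"
      proof (intro equalityI subsetI)
        fix w assume "w \<in> \<phi> ` U \<inter> (\<lambda>w. c * exp w) -` T"
        then obtain z where "z \<in> U" "w = \<phi> z" "c * exp w \<in> T" by auto
        then show "w \<in> \<phi> ` (U \<inter> T)" using inv[of z] by auto
      qed (use inv in auto)
    qed
  qed (use im oU in auto)
  then have ch: "is_chart 2 euclidean (U, \<phi>)" using is_chart_iff by metis
  show "(U, \<phi>) \<in> full_atlas euclidean_mfd"
  proof (rule full_atlasI)
    show "is_chart (mdim (euclidean_mfd :: (complex, complex) mfd)) (mtop euclidean_mfd) (U, \<phi>)"
      using ch by simp
    fix V \<psi> assume "(V, \<psi>) \<in> matlas (euclidean_mfd :: (complex, complex) mfd)"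
    then have V: "V = UNIV" "\<psi> = id" by auto
    have "smooth_on (\<phi> ` U) (\<lambda>w. c * exp w)"
      by (intro smooth_on_mult smooth_on_const smooth_on_exp smooth_on_id(1))
    then show "smooth_on (\<phi> ` (U \<inter> V)) (\<lambda>y. \<psi> (inv_into U \<phi> y))"
      unfolding V by (simp, rule smooth_on_cong) (simp add: inv_eq)
    show "smooth_on (\<psi> ` (U \<inter> V)) (\<lambda>y. \<phi> (inv_into V \<psi> y))"
      unfolding V using smooth by (simp add: inv_id[unfolded id_def] id_def)
  qed
  show "chart_data 1 (top_of_set (sphere 0 1)) (U \<inter> sphere 0 1) \<phi> {w. Re w = 0} 0 {w. - pi < Im w \<and> Im w < pi}"
  proof (rule slice_chart[OF ch])
    have e: "{w. Re w = 0} = {w::complex. 1 \<bullet> w = 0}" by (simp add: inner_complex_def)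
    show "subspace {w. Re w = 0}" unfolding e by (rule subspace_hyperplane)
    show "dim {w. Re w = 0} = 1" unfolding e by (subst dim_hyperplane) simp_all
    show "open {w::complex. - pi < Im w \<and> Im w < pi}" by (rule oI)
    show "\<phi> ` (U \<inter> sphere 0 1) = {x \<in> {w. Re w = 0}. 0 \<le> 0 \<bullet> x} \<inter> {w. - pi < Im w \<and> Im w < pi}"
    proof (intro equalityI subsetI)
      fix w assume "w \<in> \<phi> ` (U \<inter> sphere 0 1)"
      then obtain z where z: "z \<in> U" "norm z = 1" "w = \<phi> z" by auto
      then have "norm (c * exp w) = 1" using inv by simp
      then have "exp (Re w) = 1" using c by (simp add: norm_mult)
      then show "w \<in> {x \<in> {w. Re w = 0}. 0 \<le> 0 \<bullet> x} \<inter> {w. - pi < Im w \<and> Im w < pi}"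
        using Im z by simp
    next
      fix w :: complex assume "w \<in> {x \<in> {w. Re w = 0}. 0 \<le> 0 \<bullet> x} \<inter> {w. - pi < Im w \<and> Im w < pi}"
      then show "w \<in> \<phi> ` (U \<inter> sphere 0 1)" using inv2[of w] c
        by (intro image_eqI[of _ _ "c * exp w"]) (auto simp: norm_mult)
    qed
  qed simp
qed

lemma circle_cover:
  assumes "norm (c::complex) = 1"
  obtains U \<phi> where "(U, \<phi>) \<in> full_atlas euclidean_mfd" "c \<in> U"
    "chart_data 1 (top_of_set (sphere 0 1)) (U \<inter> sphere 0 1) \<phi> {w. Re w = 0} 0 {w. - pi < Im w \<and> Im w < pi}"
proof -
  have "c / c = 1" using assms by auto
  then have "c \<in> {z. z / c \<notin> \<real>\<^sub>\<le>\<^sub>0}" by simp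
  then show thesis
    by (rule that[OF circle_log_chart(1)[OF assms] _ circle_log_chart(2)[OF assms]])
qed

lemma circle_simps [simp]:
  "mtop circle_mfd = top_of_set (sphere 0 1)" "mdim circle_mfd = 1"
  by (simp_all add: circle_mfd_def)

lemma circle_manifold: "smooth_manifold circle_mfd"
  unfolding circle_mfd_def
proof (rule submfd_manifoldI[OF euclidean_manifold])
  fix c :: complex assume "c \<in> sphere 0 1"
  then have "norm c = 1" by simp
  then obtain U \<phi> where "(U, \<phi>) \<in> full_atlas euclidean_mfd" "c \<in> U"
    "chart_data 1 (top_of_set (sphere 0 1)) (U \<inter> sphere 0 1) \<phi> {w. Re w = 0} 0 {w. - pi < Im w \<and> Im w < pi}"
    by (rule circle_cover)
  then show "\<exists>U \<phi>. (U, \<phi>) \<in> full_atlas euclidean_mfd \<and> c \<in> U \<and>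
      is_chart 1 (subtopology (mtop euclidean_mfd) (sphere 0 1)) (U \<inter> sphere 0 1, \<phi>)"
    unfolding is_chart_iff euclidean_mfd_simps by metis
qed simp

lemma circle_boundary: "mboundary circle_mfd = {}"
proof -
  have "c \<notin> mboundary circle_mfd" if c: "norm c = 1" for c
  proof -
    obtain U \<phi> where U: "c \<in> U" "chart_data 1 (top_of_set (sphere 0 1)) (U \<inter> sphere 0 1) \<phi> {w. Re w = 0} 0 {w. - pi <
        Im w \<and> Im w < pi}"
      by (rule circle_cover[OF c])
    then have "chart_data (mdim circle_mfd) (mtop circle_mfd) (U \<inter> sphere 0 1) \<phi> {w. Re w = 0} 0 {w. - pi < Im w \<and>
        Im w < pi}"
      by simp
    from mboundary_chart_iff[OF circle_manifold this, of c] show ?thesis using U(1) c by simp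
  qed
  moreover have "mboundary circle_mfd \<subseteq> sphere 0 1" using mboundary_subset[OF circle_manifold] by simp
  ultimately show ?thesis by auto
qed

lemma smooth_in_circle_iff:
  assumes "smooth_manifold X"
  shows "smooth_in X circle_mfd A f \<longleftrightarrow> smooth_in X euclidean_mfd A f \<and> f ` A \<subseteq> sphere 0 1"
  using smooth_in_submfd_cod[OF assms euclidean_manifold circle_manifold[unfolded circle_mfd_def]]
  by (simp add: circle_mfd_def)

lemma smooth_in_euclidean_comp:
  assumes M: "smooth_manifold M" and f: "smooth_in M euclidean_mfd A f" and g: "smooth_on S g"
    and sub: "\<And>x. x \<in> A \<Longrightarrow> f x \<in> S"
  shows "smooth_in M euclidean_mfd A (\<lambda>x. g (f x))"
  by (rule smooth_in_comp[OF M euclidean_manifold euclidean_manifold f g[folded smooth_in_euclidean_iff] sub])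

lemma smooth_in_const:
  assumes M: "smooth_manifold M" and "A \<subseteq> mspace M"
  shows "smooth_in M euclidean_mfd A (\<lambda>x. c)"
proof (rule smooth_in_realI[OF assms])
  fix x assume "x \<in> A"
  then have "x \<in> mspace M" using assms(2) by auto
  then obtain U \<phi> where "(U, \<phi>) \<in> full_atlas M" "x \<in> U" using atlas_cover[OF M] by metis
  then show "\<exists>U \<phi>. (U, \<phi>) \<in> full_atlas M \<and> x \<in> U \<and> smooth_on (\<phi> ` (U \<inter> A)) (\<lambda>y. c)" by auto
qed

lemma smooth_in_Pair_euclidean:
  fixes f :: "'a \<Rightarrow> 'f::euclidean_space" and g :: "'a \<Rightarrow> 'g::euclidean_space"
  assumes M: "smooth_manifold M" and f: "smooth_in M euclidean_mfd A f" and g: "smooth_in M euclidean_mfd A g"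
  shows "smooth_in M euclidean_mfd A (\<lambda>x. (f x, g x))"
proof (rule smooth_in_realI[OF M smooth_in_subset_mspace[OF f]])
  fix x assume "x \<in> A"
  then have "x \<in> mspace M" using smooth_in_subset_mspace[OF f] by auto
  then obtain U \<phi> where U: "(U, \<phi>) \<in> full_atlas M" "x \<in> U" using atlas_cover[OF M] by metis
  have "smooth_on (\<phi> ` (U \<inter> A)) (\<lambda>y. (f (inv_into U \<phi> y), g (inv_into U \<phi> y)))"
    by (intro smooth_on_Pair smooth_in_real_chart[OF M f U(1)] smooth_in_real_chart[OF M g U(1)])
  then show "\<exists>U \<phi>. (U, \<phi>) \<in> full_atlas M \<and> x \<in> U \<and>
     smooth_on (\<phi> ` (U \<inter> A)) (\<lambda>y. (f (inv_into U \<phi> y), g (inv_into U \<phi> y)))"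
    using U by (intro exI[of _ U] exI[of _ \<phi>]) simp
qed

lemma smooth_in_comp2:
  fixes f :: "'a \<Rightarrow> 'f::euclidean_space" and g :: "'a \<Rightarrow> 'g::euclidean_space"
  assumes M: "smooth_manifold M" and f: "smooth_in M euclidean_mfd A f" and g: "smooth_in M euclidean_mfd A g"
    and h: "smooth_on S (\<lambda>p. h (fst p) (snd p))" and sub: "\<And>x. x \<in> A \<Longrightarrow> (f x, g x) \<in> S"
  shows "smooth_in M euclidean_mfd A (\<lambda>x. h (f x) (g x))"
  using smooth_in_euclidean_comp[OF M smooth_in_Pair_euclidean[OF M f g] h sub] by simp

lemma smooth_in_mult :
  fixes f g :: "'a \<Rightarrow> 'f::{euclidean_space, real_normed_algebra}"
  assumes M: "smooth_manifold M" and f: "smooth_in M euclidean_mfd A f" and g: "smooth_in M euclidean_mfd A g"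
  shows "smooth_in M euclidean_mfd A (\<lambda>x. f x * g x)"
  by (rule smooth_in_comp2[OF M f g, where S=UNIV])
    (auto intro!: smooth_on_mult smooth_on_fst smooth_on_snd)

lemma smooth_in_add:
  fixes f g :: "'a \<Rightarrow> 'f::euclidean_space"
  assumes M: "smooth_manifold M" and f: "smooth_in M euclidean_mfd A f" and g: "smooth_in M euclidean_mfd A g"
  shows "smooth_in M euclidean_mfd A (\<lambda>x. f x + g x)"
  by (rule smooth_in_comp2[OF M f g, where S=UNIV])
    (auto intro!: smooth_on_add smooth_on_fst smooth_on_snd)

lemma smooth_in_sum:
  fixes f :: "'i \<Rightarrow> 'a \<Rightarrow> 'f::euclidean_space"
  assumes M: "smooth_manifold M" and A: "A \<subseteq> mspace M" and f: "\<And>i. i \<in> I \<Longrightarrow> smooth_in M euclidean_mfd A (f i)"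
  shows "smooth_in M euclidean_mfd A (\<lambda>x. \<Sum>i\<in>I. f i x)"
  using f by (induction I rule: infinite_finite_induct)
    (simp_all add: smooth_in_const[OF M A] smooth_in_add[OF M])

lemma smooth_in_prod:
  fixes f :: "'i \<Rightarrow> 'a \<Rightarrow> 'f::{euclidean_space, real_normed_algebra, comm_ring_1}"
  assumes M: "smooth_manifold M" and A: "A \<subseteq> mspace M" and f: "\<And>i. i \<in> I \<Longrightarrow> smooth_in M euclidean_mfd A (f i)"
  shows "smooth_in M euclidean_mfd A (\<lambda>x. \<Prod>i\<in>I. f i x)"
  using f by (induction I rule: infinite_finite_induct)
    (simp_all add: smooth_in_const[OF M A] smooth_in_mult[OF M])

text \<open>\<open>U\<close> and the complement of \<open>C\<close> are open and cover the manifold,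
  and \<open>f\<close> vanishes on the part of \<open>A\<close> in the second set. Having a closed
  set inside \<open>U\<close>, and not just vanishing off \<open>U\<close>, excludes bad behavior at
  the frontier of \<open>U\<close>.\<close>

lemma smooth_in_extend_by_0:
  fixes f :: "'a \<Rightarrow> 'f::euclidean_space"
  assumes M: "smooth_manifold M" and A: "A \<subseteq> mspace M" and U: "openin (mtop M) U" and C: "closedin (mtop M) C" "C \<subseteq> U"
    and f: "smooth_in M euclidean_mfd (A \<inter> U) f" and z: "\<And>x. x \<in> A \<Longrightarrow> x \<notin> C \<Longrightarrow> f x = 0"
  shows "smooth_in M euclidean_mfd A f"
proof (rule smooth_in_local)
  fix x assume x: "x \<in> A"
  show "\<exists>T. openin (mtop M) T \<and> x \<in> T \<and> smooth_in M euclidean_mfd (A \<inter> T) f"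
  proof (cases "x \<in> U")
    case True then show ?thesis using U f by (intro exI[of _ U]) simp
  next
    case False
    have "smooth_in M euclidean_mfd (A \<inter> (mspace M - C)) f"
      by (rule smooth_in_cong[OF smooth_in_const[OF M, of _ 0]]) (use A z in auto)
    then show ?thesis using False C x A by (intro exI[of _ "mspace M - C"]) (auto simp: closedin_def)
  qed
qed

subsection \<open>Bump functions\<close>

text \<open>The bump is a smooth step of the squared distance in the chart, which unlike the
  distance is smooth at the center. As the ball of radius \<open>e\<close> stays in
  \<open>\<Omega>\<close>, the set \<open>C\<close> corresponds to a compact piece of the closed
  half-space; so it is closed in the Hausdorff space \<open>M\<close>, also when \<open>x\<close> is
  a boundary point.\<close>

lemma chart_bump:
  assumes M: "smooth_manifold M" and U: "(U, \<phi>) \<in> full_atlas M" and c: "chart_data (mdim M) (mtop M) U \<phi> V b \<Omega>"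
    and x: "x \<in> U" and e: "0 < e" "cball (\<phi> x) e \<subseteq> \<Omega>"
  defines "\<beta> \<equiv> (\<lambda>y. if y \<in> U then plateau ((dist (\<phi> x) (\<phi> y))\<^sup>2 / e\<^sup>2) else 0)"
      and "C \<equiv> {y \<in> U. dist (\<phi> x) (\<phi> y) \<le> e}"
  shows "smooth_in M euclidean_mfd (mspace M) \<beta>" "\<And>y. 0 \<le> \<beta> y \<and> \<beta> y \<le> 1"
    "closedin (mtop M) C" "C \<subseteq> U" "\<And>y. y \<notin> C \<Longrightarrow> \<beta> y = 0"
    "\<exists>T. openin (mtop M) T \<and> x \<in> T \<and> (\<forall>y\<in>T. \<beta> y = 1)"
proof -
  note c' = chart_dataD[OF c]
  note ch = full_atlas_chart[OF U]
  show CU: "C \<subseteq> U" by (auto simp: C_def)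
  show "0 \<le> \<beta> y \<and> \<beta> y \<le> 1" for y by (simp add: \<beta>_def plateau_bounds)
  define K where "K = {y \<in> V. 0 \<le> b \<bullet> y} \<inter> cball (\<phi> x) e"
  have "closed {y \<in> V. 0 \<le> b \<bullet> y}"
    using closed_subspace[OF c'(5)] closed_halfspace_ge[of 0 b] by (simp add: Collect_conj_eq closed_Int)
  then have K: "compact K" "K \<subseteq> \<phi> ` U" unfolding K_def c'(9) using e(2) by (auto intro: closed_Int_compact)
  have "compactin (mtop M) (inv_into U \<phi> ` K)"
  proof (rule image_compactin)
    show "compactin (top_of_set K) K" using K(1) by (simp add: compactin_subtopology compactin_euclidean_iff)
    show "continuous_map (top_of_set K) (mtop M) (inv_into U \<phi>)" by (rule chart_inverse_continuous[OF ch K(2)])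
  qed
  moreover have "inv_into U \<phi> ` K = C"
  proof (intro equalityI subsetI)
    fix y assume "y \<in> inv_into U \<phi> ` K"
    then obtain z where z: "z \<in> K" "y = inv_into U \<phi> z" by blast
    then obtain w where "w \<in> U" "z = \<phi> w" using K(2) by blast
    then show "y \<in> C" using z full_atlas_inv[OF U] by (auto simp: C_def K_def)
  next
    fix y assume y: "y \<in> C"
    then have "\<phi> y \<in> \<phi> ` U" by (auto simp: C_def)
    then have "\<phi> y \<in> K" using y unfolding c'(9) by (auto simp: C_def K_def)
    then show "y \<in> inv_into U \<phi> ` K" using y full_atlas_inv[OF U, of y]
        by (auto simp: C_def intro!: image_eqI[of _ _ "\<phi> y"])
  qed
  ultimately show clo: "closedin (mtop M) C"
    using M compactin_imp_closedin by (auto simp: smooth_manifold_def)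
  show zero: "\<beta> y = 0" if "y \<notin> C" for y
  proof (cases "y \<in> U")
    case True
    then have "e < dist (\<phi> x) (\<phi> y)" using that by (simp add: C_def)
    then have "e\<^sup>2 \<le> (dist (\<phi> x) (\<phi> y))\<^sup>2" using e(1) by (intro power_mono) auto
    then show ?thesis using e(1) True by (simp add: \<beta>_def plateau_eq_0)
  qed (simp add: \<beta>_def)
  show "smooth_in M euclidean_mfd (mspace M) \<beta>"
  proof (rule smooth_in_extend_by_0[OF M order_refl c'(1) clo CU])
    have "smooth_on UNIV (\<lambda>y. plateau (((\<phi> x - y) \<bullet> (\<phi> x - y)) / e\<^sup>2))"
      by (intro smooth_on_plateau smooth_on_divide smooth_on_inner smooth_on_diff smooth_on_const smooth_on_id(1))
        (use e in auto)
    from smooth_in_euclidean_comp[OF M smooth_in_chart[OF M U] this]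
    have "smooth_in M euclidean_mfd U (\<lambda>y. plateau (((\<phi> x - \<phi> y) \<bullet> (\<phi> x - \<phi> y)) / e\<^sup>2))" by simp
    then have "smooth_in M euclidean_mfd U \<beta>"
      by (rule smooth_in_cong) (simp add: \<beta>_def dist_norm power2_norm_eq_inner)
    moreover have "mspace M \<inter> U = U" using c'(10) by auto
    ultimately show "smooth_in M euclidean_mfd (mspace M \<inter> U) \<beta>" by simp
  qed (rule zero)
  have "openin (mtop M) (U \<inter> \<phi> -` ball (\<phi> x) (e / 2))" by (rule c'(3)) simp
  moreover have "\<beta> y = 1" if y: "y \<in> U" "dist (\<phi> x) (\<phi> y) < e / 2" for y
  proof -
    have "(dist (\<phi> x) (\<phi> y))\<^sup>2 \<le> (e / 2)\<^sup>2" using y by (intro power_mono) auto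
    then have "(dist (\<phi> x) (\<phi> y))\<^sup>2 \<le> e\<^sup>2 / 4" by (simp add: power_divide)
    with zero_le_power2[of e] have "(dist (\<phi> x) (\<phi> y))\<^sup>2 \<le> e\<^sup>2 / 2" by linarith
    then have "(dist (\<phi> x) (\<phi> y))\<^sup>2 / e\<^sup>2 \<le> 1 / 2" using e by (simp add: field_simps)
    then show ?thesis using y by (simp add: \<beta>_def plateau_eq_1)
  qed
  ultimately show "\<exists>T. openin (mtop M) T \<and> x \<in> T \<and> (\<forall>y\<in>T. \<beta> y = 1)"
    using x e by (intro exI[of _ "U \<inter> \<phi> -` ball (\<phi> x) (e / 2)"]) auto
qed

text \<open>The support condition is phrased by a closed set inside \<open>T\<close> because this is
  what \<open>smooth_in_extend_by_0\<close> takes.\<close>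

definition bump_in :: "('a, 'e::euclidean_space) mfd \<Rightarrow> ('a \<Rightarrow> real) \<Rightarrow> 'a set \<Rightarrow> bool" where
  "bump_in M \<beta> T \<longleftrightarrow> smooth_in M euclidean_mfd (mspace M) \<beta> \<and> (\<forall>y. 0 \<le> \<beta> y \<and> \<beta> y \<le> 1) \<and>
     (\<exists>C. closedin (mtop M) C \<and> C \<subseteq> T \<and> (\<forall>y. y \<notin> C \<longrightarrow> \<beta> y = 0))"

lemma exists_bump:
  assumes M: "smooth_manifold M" and T: "openin (mtop M) T" "x \<in> T"
  obtains \<beta> Z where "bump_in M \<beta> T" "openin (mtop M) Z" "x \<in> Z" "\<And>y. y \<in> Z \<Longrightarrow> \<beta> y = 1"
proof -
  have "x \<in> mspace M" using openin_subset[OF T(1)] T(2) by auto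
  then obtain U0 \<phi> where U0: "(U0, \<phi>) \<in> full_atlas M" "x \<in> U0" using atlas_cover[OF M] by metis
  define U where "U = U0 \<inter> T"
  have U: "(U, \<phi>) \<in> full_atlas M" "x \<in> U" using full_atlas_restrict[OF U0(1) T(1)] U0 T by (auto simp: U_def)
  obtain V b \<Omega> where c: "chart_data (mdim M) (mtop M) U \<phi> V b \<Omega>"
    using full_atlas_chart[OF U(1)] is_chart_iff by metis
  have "\<phi> x \<in> \<Omega>" using chart_dataD(9)[OF c] U(2) by blast
  then obtain e where e: "0 < e" "cball (\<phi> x) e \<subseteq> \<Omega>" using chart_dataD(8)[OF c] open_contains_cball by metis
  note B = chart_bump[OF M U(1) c U(2) e]
  obtain Z where "openin (mtop M) Z" "x \<in> Z" "\<forall>y\<in>Z. (if y \<in> U then plateau ((dist (\<phi> x) (\<phi> y))\<^sup>2 / e\<^sup>2) else 0) = 1"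
    using B(6) by metis
  moreover have "bump_in M (\<lambda>y. if y \<in> U then plateau ((dist (\<phi> x) (\<phi> y))\<^sup>2 / e\<^sup>2) else 0) T"
    unfolding bump_in_def using B(1-5)
    by (intro conjI exI[of _ "{y \<in> U. dist (\<phi> x) (\<phi> y) \<le> e}"]) (auto simp: U_def)
  ultimately show thesis using that[of "\<lambda>y. if y \<in> U then plateau ((dist (\<phi> x) (\<phi> y))\<^sup>2 / e\<^sup>2) else 0" Z] by simp
qed

text \<open>A finite family in which some member equals 1 at each point near \<open>K\<close> is
  used instead of a partition of unity: the product of the factors \<open>1 - \<beta> i\<close>
  vanishes there, and it equals 1 where no bump is active.\<close>

lemma bump_cover:
  assumes M: "smooth_manifold M" and K: "compactin (mtop M) K"
    and T: "\<And>x. x \<in> K \<Longrightarrow> openin (mtop M) (T x) \<and> x \<in> T x"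
  obtains I \<beta> where "finite I" "I \<subseteq> K" "\<And>i. i \<in> I \<Longrightarrow> bump_in M (\<beta> i) (T i)"
    "\<exists>Z. openin (mtop M) Z \<and> K \<subseteq> Z \<and> (\<forall>y\<in>Z. \<exists>i\<in>I. \<beta> i y = 1)"
proof -
  have "\<exists>\<beta> Z. bump_in M \<beta> (T x) \<and> openin (mtop M) Z \<and> x \<in> Z \<and> (\<forall>y\<in>Z. \<beta> y = 1)" if "x \<in> K" for x
    using exists_bump[OF M] T[OF that] by metis
  then obtain \<beta> Z where B: "\<And>x. x \<in> K \<Longrightarrow> bump_in M (\<beta> x) (T x) \<and> openin (mtop M) (Z x) \<and> x \<in> Z x \<and> (\<forall>y\<in>Z x. \<beta> x y = 1)"
    by metis
  have "(\<forall>U\<in>Z ` K. openin (mtop M) U) \<and> K \<subseteq> \<Union>(Z ` K)" using B by auto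
  then obtain F where F: "finite F" "F \<subseteq> Z ` K" "K \<subseteq> \<Union>F"
    using K unfolding compactin_def by metis
  obtain I where I: "finite I" "I \<subseteq> K" "F = Z ` I" using F finite_subset_image[OF F(1,2)] by metis
  show thesis
  proof (rule that[OF I(1,2)])
    show "bump_in M (\<beta> i) (T i)" if "i \<in> I" for i using B I that by auto
    have "openin (mtop M) (\<Union>(Z ` I))" using B I by (intro openin_Union) auto
    moreover have "\<forall>y\<in>\<Union>(Z ` I). \<exists>i\<in>I. \<beta> i y = 1" using B I by blast
    ultimately show "\<exists>Z. openin (mtop M) Z \<and> K \<subseteq> Z \<and> (\<forall>y\<in>Z. \<exists>i\<in>I. \<beta> i y = 1)"
      using F(3) I(3) by (intro exI[of _ "\<Union>(Z ` I)"]) auto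
  qed
qed

lemma bump_mult:
  fixes g :: "'a \<Rightarrow> real"
  assumes M: "smooth_manifold M" and A: "A \<subseteq> mspace M" and T: "openin (mtop M) T"
    and b: "bump_in M \<beta> T" and g: "smooth_in M euclidean_mfd (A \<inter> T) g"
  shows "smooth_in M euclidean_mfd A (\<lambda>x. \<beta> x * g x)"
proof -
  obtain C where C: "closedin (mtop M) C" "C \<subseteq> T" "\<And>y. y \<notin> C \<Longrightarrow> \<beta> y = 0"
    and s: "smooth_in M euclidean_mfd (mspace M) \<beta>" using b unfolding bump_in_def by metis
  have "smooth_in M euclidean_mfd (A \<inter> T) (\<lambda>x. \<beta> x * g x)"
    by (rule smooth_in_mult[OF M smooth_in_subset[OF s] g]) (use A in auto)
  then show ?thesis by (rule smooth_in_extend_by_0[OF M A T C(1,2)]) (simp add: C(3))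
qed

section \<open>Changing coordinates in a chart\<close>

lemma chart_data_compose:
  assumes c: "chart_data d X U \<phi> V b \<Omega>" and PQ: "open P" "open Q"
    and \<Theta>: "continuous_on P \<Theta>" "\<And>y. y \<in> P \<Longrightarrow> \<Theta> y \<in> Q \<and> \<Gamma> (\<Theta> y) = y"
    and \<Gamma>: "continuous_on Q \<Gamma>" "\<And>z. z \<in> Q \<Longrightarrow> \<Gamma> z \<in> P \<and> \<Theta> (\<Gamma> z) = z"
    and V': "subspace V'" "dim V' = d" "b' \<in> V'" "open \<Omega>'"
    and im: "\<Theta> ` (\<phi> ` U \<inter> P) = {x \<in> V'. 0 \<le> b' \<bullet> x} \<inter> \<Omega>'"
  shows "chart_data d X (U \<inter> \<phi> -` P) (\<lambda>x. \<Theta> (\<phi> x)) V' b' \<Omega>'"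
  unfolding chart_data_def
proof (intro conjI allI impI V')
  note c' = chart_dataD[OF c]
  show "openin X (U \<inter> \<phi> -` P)" by (rule c'(3)[OF PQ(1)])
  show "inj_on (\<lambda>x. \<Theta> (\<phi> x)) (U \<inter> \<phi> -` P)"
  proof (rule inj_onI)
    fix x y assume a: "x \<in> U \<inter> \<phi> -` P" "y \<in> U \<inter> \<phi> -` P" "\<Theta> (\<phi> x) = \<Theta> (\<phi> y)"
    then have "\<phi> x = \<phi> y" using \<Theta>(2) by (metis IntD2 vimageD)
    then show "x = y" using inj_onD[OF c'(2)] a by auto
  qed
  have "(\<lambda>x. \<Theta> (\<phi> x)) ` (U \<inter> \<phi> -` P) = \<Theta> ` (\<phi> ` U \<inter> P)" by auto
  then show "(\<lambda>x. \<Theta> (\<phi> x)) ` (U \<inter> \<phi> -` P) = {x \<in> V'. 0 \<le> b' \<bullet> x} \<inter> \<Omega>'" using im by simp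
  show "openin X (U \<inter> \<phi> -` P \<inter> (\<lambda>x. \<Theta> (\<phi> x)) -` T)" if "open T" for T
  proof -
    have "open (P \<inter> \<Theta> -` T)" using continuous_open_preimage[OF \<Theta>(1) PQ(1) that] .
    moreover have "U \<inter> \<phi> -` P \<inter> (\<lambda>x. \<Theta> (\<phi> x)) -` T = U \<inter> \<phi> -` (P \<inter> \<Theta> -` T)" by auto
    ultimately show ?thesis using c'(3) by metis
  qed
  show "\<exists>T'. open T' \<and> (\<lambda>x. \<Theta> (\<phi> x)) ` (U \<inter> \<phi> -` P \<inter> T) = (\<lambda>x. \<Theta> (\<phi> x)) ` (U \<inter> \<phi> -` P) \<inter> T'"
    if "openin X T" for T
  proof -
    obtain T' where T': "open T'" "\<phi> ` (U \<inter> T) = \<phi> ` U \<inter> T'" using c'(4)[OF \<open>openin X T\<close>] by metis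
    have o: "open (Q \<inter> \<Gamma> -` T')" using continuous_open_preimage[OF \<Gamma>(1) PQ(2) T'(1)] .
    have "(\<lambda>x. \<Theta> (\<phi> x)) ` (U \<inter> \<phi> -` P \<inter> T) = (\<lambda>x. \<Theta> (\<phi> x)) ` (U \<inter> \<phi> -` P) \<inter> (Q \<inter> \<Gamma> -` T')"
    proof (intro equalityI subsetI)
      fix y assume "y \<in> (\<lambda>x. \<Theta> (\<phi> x)) ` (U \<inter> \<phi> -` P \<inter> T)"
      then obtain x where x: "x \<in> U" "\<phi> x \<in> P" "x \<in> T" "y = \<Theta> (\<phi> x)" by auto
      then have "\<phi> x \<in> T'" using T'(2) by blast
      then show "y \<in> (\<lambda>x. \<Theta> (\<phi> x)) ` (U \<inter> \<phi> -` P) \<inter> (Q \<inter> \<Gamma> -` T')" using x \<Theta>(2) by auto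
    next
      fix y assume y: "y \<in> (\<lambda>x. \<Theta> (\<phi> x)) ` (U \<inter> \<phi> -` P) \<inter> (Q \<inter> \<Gamma> -` T')"
      then obtain x where x: "x \<in> U" "\<phi> x \<in> P" "y = \<Theta> (\<phi> x)" by auto
      then have "\<phi> x \<in> \<phi> ` U \<inter> T'" using y \<Theta>(2) by auto
      then have "\<phi> x \<in> \<phi> ` (U \<inter> T)" using T'(2) by simp
      then have "x \<in> T" using inj_on_image_mem_iff[OF c'(2) x(1), of "U \<inter> T"] by auto
      then show "y \<in> (\<lambda>x. \<Theta> (\<phi> x)) ` (U \<inter> \<phi> -` P \<inter> T)" using x by auto
    qed
    then show ?thesis using o by metis
  qed
qed

text \<open>Transition maps out of the new chart are those of the old one preceded by
  \<open>\<Gamma>\<close>, transition maps into it are those of the old one followed by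
  \<open>\<Theta>\<close>.\<close>

lemma full_atlas_compose:
  assumes M: "smooth_manifold M" and U: "(U, \<phi>) \<in> full_atlas M"
    and \<Theta>: "smooth_on P \<Theta>" "\<And>y. y \<in> P \<Longrightarrow> \<Theta> y \<in> Q \<and> \<Gamma> (\<Theta> y) = y" and \<Gamma>: "smooth_on Q \<Gamma>"
    and ch: "is_chart (mdim M) (mtop M) (U \<inter> \<phi> -` P, \<lambda>x. \<Theta> (\<phi> x))"
  shows "(U \<inter> \<phi> -` P, \<lambda>x. \<Theta> (\<phi> x)) \<in> full_atlas M"
proof (rule full_atlasI[OF ch])
  fix Z \<psi> assume "(Z, \<psi>) \<in> matlas M"
  then have Z: "(Z, \<psi>) \<in> full_atlas M" using atlas_subset_full[OF M] by auto
  have inv: "inv_into (U \<inter> \<phi> -` P) (\<lambda>x. \<Theta> (\<phi> x)) (\<Theta> (\<phi> x)) = x" if "x \<in> U" "\<phi> x \<in> P" for x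
    using inv_into_f_f[OF chart_inj[OF ch], of x] that by auto
  have "smooth_on ((\<lambda>x. \<Theta> (\<phi> x)) ` (U \<inter> \<phi> -` P \<inter> Z)) (\<lambda>y. \<psi> (inv_into U \<phi> (\<Gamma> y)))"
    by (rule smooth_on_comp[OF smooth_on_subset[OF \<Gamma>] full_atlas_compatible[OF M U Z]])
      (use \<Theta>(2) in auto)
  then show "smooth_on ((\<lambda>x. \<Theta> (\<phi> x)) ` (U \<inter> \<phi> -` P \<inter> Z)) (\<lambda>y. \<psi> (inv_into (U \<inter> \<phi> -` P) (\<lambda>x. \<Theta> (\<phi> x)) y))"
    by (rule smooth_on_cong) (use \<Theta>(2) in \<open>auto simp: inv full_atlas_inv[OF U]\<close>)
  have "smooth_on (\<psi> ` (U \<inter> \<phi> -` P \<inter> Z)) (\<lambda>y. \<phi> (inv_into Z \<psi> y))"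
    by (rule smooth_on_subset[OF full_atlas_compatible[OF M Z U]]) auto
  then show "smooth_on (\<psi> ` (U \<inter> \<phi> -` P \<inter> Z)) (\<lambda>y. \<Theta> (\<phi> (inv_into Z \<psi> y)))"
    by (rule smooth_on_comp[OF _ \<Theta>(1)]) (auto simp: full_atlas_inv[OF Z])
qed

subsection \<open>Submersions to the circle\<close>

text \<open>Regularity of \<open>f\<close> at \<open>x\<close> without tangent spaces: along some
  smooth curve through \<open>x\<close> the argument of \<open>f\<close> moves with nonzero speed
  \<open>d\<close>. At a boundary point the curve has to stay in the boundary, which expresses that
  the restriction of \<open>f\<close> to the boundary is regular as well.\<close>

definition transverse_curve :: "('a, 'e::euclidean_space) mfd \<Rightarrow> ('a \<Rightarrow> complex) \<Rightarrow> 'a \<Rightarrow> bool" where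
  "transverse_curve M f x \<longleftrightarrow> (\<exists>\<eta> \<gamma> u d. 0 < \<eta> \<and> smooth_in euclidean_mfd M {- \<eta><..<\<eta>} \<gamma> \<and> \<gamma> (0::real) = x \<and>
     (x \<in> mboundary M \<longrightarrow> \<gamma> ` {- \<eta><..<\<eta>} \<subseteq> mboundary M) \<and>
     (\<forall>t\<in>{- \<eta><..<\<eta>}. f (\<gamma> t) = f x * cis (u t)) \<and> u 0 = 0 \<and>
     (u has_real_derivative d) (at 0) \<and> d \<noteq> 0)"

text \<open>The normal form of a submersion to the circle: up to a rotation \<open>f\<close> is
  \<open>cis\<close> of the linear coordinate along the unit vector \<open>v\<close>. The condition
  \<open>b \<bullet> v = 0\<close> makes lines in direction \<open>v\<close> parallel to the
  boundary. The bound 1, being below pi, lets the value of \<open>f\<close> determine the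
  coordinate.\<close>

definition adapted_chart ::
  "('a, 'e::euclidean_space) mfd \<Rightarrow> ('a \<Rightarrow> complex) \<Rightarrow> 'a \<Rightarrow> 'a set \<Rightarrow> ('a \<Rightarrow> 'e) \<Rightarrow> 'e set \<Rightarrow> 'e \<Rightarrow> 'e \<Rightarrow> 'e set \<Rightarrow> bool"
  where
  "adapted_chart M f x U \<phi> V b v \<Omega> \<longleftrightarrow> (U, \<phi>) \<in> full_atlas M \<and> x \<in> U \<and>
     chart_data (mdim M) (mtop M) U \<phi> V b \<Omega> \<and> v \<in> V \<and> norm v = 1 \<and> b \<bullet> v = 0 \<and> v \<bullet> \<phi> x = 0 \<and>
     (\<forall>y\<in>U. f y = f x * cis (v \<bullet> \<phi> y) \<and> \<bar>v \<bullet> \<phi> y\<bar> < 1) \<and> (b = 0 \<or> x \<in> mboundary M)"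

text \<open>At an interior point the chart domain is cut with the open half-space, after which the
  normal can be replaced by 0.\<close>

lemma interior_chart:
  assumes M: "smooth_manifold M" and x: "x \<in> mspace M"
  obtains U \<phi> V b \<Omega> where "(U, \<phi>) \<in> full_atlas M" "x \<in> U" "chart_data (mdim M) (mtop M) U \<phi> V b \<Omega>"
    "b = 0 \<or> x \<in> mboundary M"
proof -
  obtain U \<phi> where U: "(U, \<phi>) \<in> full_atlas M" "x \<in> U" using atlas_cover[OF M x] by metis
  obtain V b \<Omega> where c: "chart_data (mdim M) (mtop M) U \<phi> V b \<Omega>"
    using full_atlas_chart[OF U(1)] is_chart_iff by metis
  note c' = chart_dataD[OF c]
  show thesis
  proof (cases "b = 0 \<or> x \<in> mboundary M")
    case True then show ?thesis using that U c by metis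
  next
    case False
    have "0 \<le> b \<bullet> \<phi> x" using c'(9) U(2) by blast
    then have pos: "0 < b \<bullet> \<phi> x" using mboundary_chart_iff[OF M c U(2)] False by auto
    define T where "T = U \<inter> \<phi> -` {y. 0 < b \<bullet> y}"
    have T: "openin (mtop M) T" unfolding T_def by (rule c'(3)) (rule open_halfspace_gt)
    have fT: "(T, \<phi>) \<in> full_atlas M" using full_atlas_restrict[OF U(1) T]
        by (simp add: T_def Int_absorb1 Int_left_absorb)
    obtain \<Omega>' where d: "chart_data (mdim M) (mtop M) (U \<inter> T) \<phi> V b \<Omega>'"
      using chart_data_restrict[OF c T] by metis
    have UT: "U \<inter> T = T" by (auto simp: T_def)
    note d' = chart_dataD[OF d[unfolded UT]]
    have "\<phi> ` T \<subseteq> {y. 0 < b \<bullet> y}" by (auto simp: T_def)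
    then have "\<phi> ` T = {y \<in> V. 0 \<le> 0 \<bullet> y} \<inter> (\<Omega>' \<inter> {y. 0 < b \<bullet> y})" unfolding d'(9) by auto
    moreover have "open (\<Omega>' \<inter> {y. 0 < b \<bullet> y})" using d'(8) by (simp add: open_Int open_halfspace_gt)
    ultimately have "chart_data (mdim M) (mtop M) T \<phi> V 0 (\<Omega>' \<inter> {y. 0 < b \<bullet> y})"
      using d' subspace_0[OF d'(5)] unfolding chart_data_def by auto
    then show ?thesis using that[OF fT, of V 0] U(2) pos by (simp add: T_def)
  qed
qed

lemma Ln_norm_1:
  assumes "norm (z::complex) = 1" shows "z = cis (Im (Ln z))"
proof -
  have z: "z \<noteq> 0" using assms by auto
  then have "Re (Ln z) = 0" using assms by simp
  then have "Ln z = \<i> * complex_of_real (Im (Ln z))" by (simp add: complex_eq_iff)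
  then show ?thesis using exp_Ln[OF z] by (metis cis_conv_exp)
qed

lemma Ln_cis: "\<bar>t\<bar> < pi \<Longrightarrow> Ln (cis t) = \<i> * complex_of_real t"
  unfolding cis_conv_exp by (rule Ln_exp) auto

text \<open>The derivative is a limit of difference quotients, which lie in the closed set
  \<open>V\<close>.\<close>

lemma vector_derivative_in_subspace:
  fixes g :: "real \<Rightarrow> 'e::euclidean_space"
  assumes V: "subspace V" and g: "(g has_vector_derivative w) (at 0)" and "open T" "0 \<in> T" "\<And>t. t \<in> T \<Longrightarrow> g t \<in> V"
  shows "w \<in> V"
proof -
  have lim: "((\<lambda>t. (g (0 + t) - g 0) /\<^sub>R t) \<longlongrightarrow> w) (at 0)"
  proof -
    have "((\<lambda>t. norm (g (0 + t) - g 0 - t *\<^sub>R w) / norm t) \<longlongrightarrow> 0) (at 0)"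
      using g unfolding has_vector_derivative_def has_derivative_at by simp
    then have "((\<lambda>t. norm ((g (0 + t) - g 0) /\<^sub>R t - w)) \<longlongrightarrow> 0) (at 0)"
    proof (rule Lim_transform_eventually)
      have "norm (g (0 + t) - g 0 - t *\<^sub>R w) / norm t = norm ((g (0 + t) - g 0) /\<^sub>R t - w)" if "t \<noteq> 0" for t
      proof -
        have "(g (0 + t) - g 0) /\<^sub>R t - w = (g (0 + t) - g 0 - t *\<^sub>R w) /\<^sub>R t"
          using that by (simp add: scaleR_diff_right)
        then show ?thesis by (simp add: divide_inverse mult.commute)
      qed
      then show "\<forall>\<^sub>F t in at 0. norm (g (0 + t) - g 0 - t *\<^sub>R w) / norm t = norm ((g (0 + t) - g 0) /\<^sub>R t - w)"
        by (auto simp: eventually_at_filter)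
    qed
    then show ?thesis by (rule LIM_zero_cancel[OF tendsto_norm_zero_cancel])
  qed
  show ?thesis
  proof (rule Lim_in_closed_set[OF closed_subspace[OF V] _ _ lim])
    show "\<forall>\<^sub>F t in at 0. (g (0 + t) - g 0) /\<^sub>R t \<in> V"
      unfolding eventually_at_topological
      using assms(3-5) subspace_diff[OF V] subspace_scale[OF V] by (intro exI[of _ T]) auto
  qed simp
qed

text \<open>The velocity of the transverse curve, read in a chart, is a vector of \<open>V\<close>
  orthogonal to \<open>b\<close> along which the argument of \<open>f\<close> has nonzero
  derivative. Replacing the coordinate in this direction by that argument gives the adapted
  chart.\<close>

lemma adapted_chart_exists:
  assumes M: "smooth_manifold M" and f: "smooth_in M circle_mfd (mspace M) f"
    and x: "x \<in> mspace M" and tc: "transverse_curve M f x"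
  shows "\<exists>U \<phi> V b v \<Omega>. adapted_chart M f x U \<phi> V b v \<Omega>"
proof -
  obtain \<eta> \<gamma> u d where \<eta>: "0 < \<eta>" and \<gamma>: "smooth_in euclidean_mfd M {- \<eta><..<\<eta>} \<gamma>" "\<gamma> (0::real) = x"
    and \<gamma>b: "x \<in> mboundary M \<longrightarrow> \<gamma> ` {- \<eta><..<\<eta>} \<subseteq> mboundary M"
    and fu: "\<And>t. t \<in> {- \<eta><..<\<eta>} \<Longrightarrow> f (\<gamma> t) = f x * cis (u t)"
    and u: "u 0 = 0" "(u has_real_derivative d) (at 0)" "d \<noteq> 0"
    using tc unfolding transverse_curve_def by (elim exE conjE) blast
  have fC: "smooth_in M euclidean_mfd (mspace M) f" and f1: "\<And>y. y \<in> mspace M \<Longrightarrow> norm (f y) = 1"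
    using f unfolding smooth_in_circle_iff[OF M] by auto
  have nfx: "norm (f x) = 1" "f x \<noteq> 0" using f1[OF x] by auto
  obtain U0 \<phi> V b \<Omega>0 where U0: "(U0, \<phi>) \<in> full_atlas M" "x \<in> U0"
    and c0: "chart_data (mdim M) (mtop M) U0 \<phi> V b \<Omega>0" and b0: "b = 0 \<or> x \<in> mboundary M"
    by (rule interior_chart[OF M x])
  \<comment> \<open>On \<open>H\<close> the quotient by \<open>f x\<close> has positive real part,
    so the principal logarithm is smooth there.\<close>
  define H where "H = {z. 0 < Re (z / f x)}"
  have oH: "open H" unfolding H_def by (intro open_Collect_less continuous_intros) (use nfx in auto)
  obtain TT where TT: "openin (mtop M) TT" "mspace M \<inter> f -` H = mspace M \<inter> TT"
    using smooth_in_preimage[OF fC, of H] oH by auto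
  define U where "U = U0 \<inter> TT"
  have TTiff: "y \<in> TT \<longleftrightarrow> f y \<in> H" if "y \<in> mspace M" for y
  proof -
    have "y \<in> mspace M \<inter> f -` H \<longleftrightarrow> y \<in> mspace M \<inter> TT" by (simp only: TT(2))
    then show ?thesis using that by simp
  qed
  have xTT: "x \<in> TT" using TTiff[OF x] nfx by (simp add: H_def)
  have U: "(U, \<phi>) \<in> full_atlas M" "x \<in> U" using full_atlas_restrict[OF U0(1) TT(1)] xTT U0 by (auto simp: U_def)
  obtain \<Omega> where c: "chart_data (mdim M) (mtop M) U \<phi> V b \<Omega>"
    using chart_data_restrict[OF c0 TT(1)] U_def by metis
  note c' = chart_dataD[OF c]
  have UM: "U \<subseteq> mspace M" by (rule c'(10))
  have fH: "f y \<in> H" if "y \<in> U" for y using TTiff[of y] that UM by (auto simp: U_def)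
  have slit: "f y / f x \<notin> \<real>\<^sub>\<le>\<^sub>0" if "y \<in> U" for y
    using fH[OF that] by (auto simp: H_def complex_nonpos_Reals_iff)
  define g where "g y = Im (Ln (f y / f x))" for y
  have fg: "f y = f x * cis (g y)" if "y \<in> U" for y
  proof -
    have "norm (f y / f x) = 1" using f1 that UM nfx by (auto simp: norm_divide)
    from Ln_norm_1[OF this] show ?thesis using nfx by (simp add: g_def field_simps)
  qed
  have gx: "g x = 0" using nfx by (simp add: g_def)
  have "smooth_on (\<phi> ` (U \<inter> mspace M)) (\<lambda>y. f (inv_into U \<phi> y))"
    by (rule smooth_in_real_chart[OF M fC U(1)])
  then have s: "smooth_on (\<phi> ` U) (\<lambda>y. f (inv_into U \<phi> y))" using UM by (simp add: Int_absorb2)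
  have "smooth_on (\<phi> ` U) (\<lambda>y. Im (Ln (f (inv_into U \<phi> y) / f x)))"
    by (intro smooth_on_Im smooth_on_Ln smooth_on_divide smooth_on_const s)
      (use slit nfx full_atlas_inv[OF U(1)] in auto)
  then obtain S G where S: "open S" "\<phi> x \<in> S" "\<And>k. Ck_on k G S"
    "\<forall>y\<in>S \<inter> \<phi> ` U. G y = Im (Ln (f (inv_into U \<phi> y) / f x))"
    unfolding smooth_on_def using U(2) by blast
  have GS: "smooth_on S G" by (rule smooth_on_CkI[OF S(1,3)])
  have Gg: "G (\<phi> y) = g y" if "y \<in> U" "\<phi> y \<in> S" for y
    using S(4) that full_atlas_inv[OF U(1) that(1)] by (auto simp: g_def)
  \<comment> \<open>the velocity of the curve in the chart is tangent to the boundary and not in the kernel of \<open>dG\<close>\<close>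
  have "openin (mtop M) (U \<inter> \<phi> -` S)" by (rule c'(3)[OF S(1)])
  then obtain T0 where T0: "open T0" "{- \<eta><..<\<eta>} \<inter> \<gamma> -` (U \<inter> \<phi> -` S) = {- \<eta><..<\<eta>} \<inter> T0"
    using smooth_in_preimage[OF \<gamma>(1)] by (metis euclidean_mfd_simps(1) open_openin)
  define T where "T = {- \<eta><..<\<eta>} \<inter> T0"
  have T: "open T" "0 \<in> T" "T \<subseteq> {- \<eta><..<\<eta>}" and \<gamma>T: "\<And>t. t \<in> T \<Longrightarrow> \<gamma> t \<in> U \<and> \<phi> (\<gamma> t) \<in> S"
  proof -
    have iff: "t \<in> T0 \<longleftrightarrow> \<gamma> t \<in> U \<inter> \<phi> -` S" if "t \<in> {- \<eta><..<\<eta>}" for t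
    proof -
      have "t \<in> {- \<eta><..<\<eta>} \<inter> \<gamma> -` (U \<inter> \<phi> -` S) \<longleftrightarrow> t \<in> {- \<eta><..<\<eta>} \<inter> T0" by (simp only: T0(2))
      then show ?thesis using that by simp
    qed
    show "open T" "T \<subseteq> {- \<eta><..<\<eta>}" using T0(1) by (auto simp: T_def)
    show "0 \<in> T" using iff[of 0] \<eta> \<gamma>(2) U(2) S(2) by (simp add: T_def)
    show "\<gamma> t \<in> U \<and> \<phi> (\<gamma> t) \<in> S" if "t \<in> T" for t using iff[of t] that by (simp add: T_def)
  qed
  define c1 where "c1 t = \<phi> (\<gamma> t)" for t
  have "smooth_in euclidean_mfd euclidean_mfd T c1" unfolding c1_def
    by (rule smooth_in_comp[OF euclidean_manifold M euclidean_manifold smooth_in_subset[OF \<gamma>(1) T(3)]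
        smooth_in_chart[OF M U(1)]])
      (use \<gamma>T in auto)
  then have "smooth_on T c1" by (simp add: smooth_in_euclidean_iff)
  then have dc1: "(c1 has_derivative frechet_derivative c1 (at 0)) (at 0)"
      by (rule smooth_on_deriv(1)[OF T(1) _ T(2)])
  define w0 where "w0 = frechet_derivative c1 (at 0) 1"
  have vc1: "(c1 has_vector_derivative w0) (at 0)"
  proof -
    interpret bounded_linear "frechet_derivative c1 (at 0)" using dc1 by (rule has_derivative_bounded_linear)
    have "frechet_derivative c1 (at 0) = (\<lambda>t. t *\<^sub>R w0)"
    proof
      fix t show "frechet_derivative c1 (at 0) t = t *\<^sub>R w0" using scaleR[of t 1] by (simp add: w0_def)
    qed
    then show ?thesis using dc1 by (simp add: has_vector_derivative_def)
  qed
  have "w0 \<in> {y \<in> V. b \<bullet> y = 0}"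
  proof (rule vector_derivative_in_subspace[OF _ vc1 T(1,2)])
    show "subspace {y \<in> V. b \<bullet> y = 0}" using c'(5) by (auto simp: subspace_def inner_add_right)
    fix t assume t: "t \<in> T"
    have "b \<bullet> c1 t = 0"
    proof (cases "b = 0")
      case False
      then have "\<gamma> t \<in> mboundary M" using b0 \<gamma>b T(3) t by auto
      then show ?thesis using mboundary_chart_iff[OF M c] \<gamma>T[OF t] by (auto simp: c1_def)
    qed simp
    moreover have "c1 t \<in> V" using \<gamma>T[OF t] c'(9) by (auto simp: c1_def)
    ultimately show "c1 t \<in> {y \<in> V. b \<bullet> y = 0}" by simp
  qed
  then have w0: "w0 \<in> V" "b \<bullet> w0 = 0" by auto
  define D where "D = frechet_derivative G (at (\<phi> x))"
  have dG: "(G has_derivative D) (at (\<phi> x))" unfolding D_def by (rule smooth_on_deriv(1)[OF S(1) GS S(2)])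
  then interpret D: bounded_linear D by (rule has_derivative_bounded_linear)
  have Dw0: "D w0 \<noteq> 0"
  proof -
    have c10: "c1 0 = \<phi> x" by (simp add: c1_def \<gamma>(2))
    have "((\<lambda>t. G (c1 t)) has_derivative (\<lambda>t. D (t *\<^sub>R w0))) (at 0)"
      using diff_chain_at[of c1 "\<lambda>t. t *\<^sub>R w0" 0 G D] vc1 dG c10
      by (simp add: has_vector_derivative_def o_def)
    then have "((\<lambda>t. G (c1 t)) has_vector_derivative D w0) (at 0)"
      by (simp add: has_vector_derivative_def D.scaleR)
    moreover have "(u has_vector_derivative d) (at 0)" using u(2)
        by (simp add: has_real_derivative_iff_has_vector_derivative)
    \<comment> \<open>Both functions are the argument of \<open>f (\<gamma> t) / f x\<close>; they
      agree as long as \<open>u\<close> stays within (-pi, pi).\<close>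
    moreover have "\<forall>\<^sub>F t in nhds 0. G (c1 t) = u t"
    proof -
      have "isCont u 0" using u(2) DERIV_isCont by blast
      then have "\<forall>\<^sub>F t in nhds 0. \<bar>u t\<bar> < 1"
        using u(1) unfolding isCont_def tendsto_iff eventually_at_filter
        by (auto simp: dist_real_def dest!: spec[of _ 1] elim!: eventually_mono)
      moreover have "\<forall>\<^sub>F t in nhds 0. t \<in> T" using T by (simp add: eventually_nhds_in_open)
      ultimately show ?thesis
      proof eventually_elim
        case (elim t)
        have "f (\<gamma> t) / f x = cis (u t)" using fu[of t] elim(2) T(3) nfx by auto
        then have "g (\<gamma> t) = u t" using elim(1) pi_gt3 by (simp add: g_def Ln_cis)
        then show ?case using Gg \<gamma>T[OF elim(2)] by (simp add: c1_def)
      qed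
    qed
    ultimately have "(u has_vector_derivative D w0) (at 0)"
      using has_vector_derivative_cong_ev[where S=UNIV and x=0 and f="\<lambda>t. G (c1 t)" and g=u and f'="D w0"]
        eventually_nhds_x_imp_x[of "\<lambda>t. G (c1 t) = u t" 0] by simp
    then have "D w0 = d"
      using vector_derivative_unique_at \<open>(u has_vector_derivative d) (at 0)\<close> by blast
    then show ?thesis using u(3) by simp
  qed
  have w0n: "w0 \<noteq> 0" using Dw0 D.zero by auto
  define w where "w = w0 /\<^sub>R norm w0"
  have w: "w \<in> V" "b \<bullet> w = 0" "norm w = 1" "D w \<noteq> 0"
    using w0 w0n Dw0 subspace_scale[OF c'(5)] by (auto simp: w_def D.scaleR)
  have ww: "w \<bullet> w = 1" using w(3) by (simp add: dot_square_norm)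
  obtain P Q \<Gamma> where PQ: "open P" "\<phi> x \<in> P" "P \<subseteq> S" "open Q" "smooth_on Q \<Gamma>"
    "\<And>y. y \<in> P \<Longrightarrow> y + (G y - w \<bullet> y) *\<^sub>R w \<in> Q \<and> \<Gamma> (y + (G y - w \<bullet> y) *\<^sub>R w) = y"
    "\<And>z. z \<in> Q \<Longrightarrow> \<Gamma> z \<in> P \<and> \<Gamma> z + (G (\<Gamma> z) - w \<bullet> \<Gamma> z) *\<^sub>R w = z"
  proof (rule smooth_replace_coordinate[OF S(1,2) GS w(3) w(4)[unfolded D_def]])
    fix P Q \<Gamma>
    assume a: "open P" "\<phi> x \<in> P" "P \<subseteq> S" "open Q" "smooth_on Q \<Gamma>"
      "\<And>y. y \<in> P \<Longrightarrow> y + (G y - w \<bullet> y) *\<^sub>R w \<in> Q \<and> \<Gamma> (y + (G y - w \<bullet> y) *\<^sub>R w) = y"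
      "\<And>z. z \<in> Q \<Longrightarrow> \<Gamma> z \<in> P \<and> \<Gamma> z + (G (\<Gamma> z) - w \<bullet> \<Gamma> z) *\<^sub>R w = z"
    show thesis by (rule that[OF a])
  qed
  \<comment> \<open>\<open>\<Theta>\<close> moves points along \<open>w\<close> only. Since
    \<open>w\<close> lies in \<open>V\<close> and is orthogonal to \<open>b\<close>, it preserves
    membership in \<open>V\<close> and the value of b.y, hence the half-space and its edge.\<close>
  define \<Theta> where "\<Theta> y = y + (G y - w \<bullet> y) *\<^sub>R w" for y
  note \<Theta>1 = PQ(6)[folded \<Theta>_def] and \<Theta>2 = PQ(7)[folded \<Theta>_def]
  have s\<Theta>: "smooth_on P \<Theta>" unfolding \<Theta>_def
    by (intro smooth_on_add smooth_on_id(1) smooth_on_scaleR smooth_on_diff smooth_on_inner smooth_on_const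
        smooth_on_subset[OF GS PQ(3)])
  have \<Theta>V: "\<Theta> y \<in> V \<longleftrightarrow> y \<in> V" for y
  proof
    assume "\<Theta> y \<in> V"
    then have "\<Theta> y - (G y - w \<bullet> y) *\<^sub>R w \<in> V" using subspace_diff[OF c'(5)] subspace_scale[OF c'(5)] w(1) by blast
    then show "y \<in> V" by (simp add: \<Theta>_def)
  qed (use subspace_add[OF c'(5)] subspace_scale[OF c'(5)] w(1) in \<open>auto simp: \<Theta>_def\<close>)
  have \<Theta>b: "b \<bullet> \<Theta> y = b \<bullet> y" for y using w(2) by (simp add: \<Theta>_def inner_add_right)
  have \<Theta>w: "w \<bullet> \<Theta> y = G y" for y using ww by (simp add: \<Theta>_def inner_add_right)
  have im: "\<Theta> ` (\<phi> ` U \<inter> P) = {y \<in> V. 0 \<le> b \<bullet> y} \<inter> (Q \<inter> \<Gamma> -` \<Omega>)"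
  proof (intro equalityI subsetI)
    fix z assume "z \<in> \<Theta> ` (\<phi> ` U \<inter> P)"
    then obtain y where y: "y \<in> \<phi> ` U" "y \<in> P" "z = \<Theta> y" by blast
    then show "z \<in> {y \<in> V. 0 \<le> b \<bullet> y} \<inter> (Q \<inter> \<Gamma> -` \<Omega>)"
      using \<Theta>1[OF y(2)] \<Theta>V \<Theta>b unfolding c'(9) by auto
  next
    fix z assume z: "z \<in> {y \<in> V. 0 \<le> b \<bullet> y} \<inter> (Q \<inter> \<Gamma> -` \<Omega>)"
    then have "\<Gamma> z \<in> P" "\<Theta> (\<Gamma> z) = z" using \<Theta>2 by auto
    moreover then have "\<Gamma> z \<in> \<phi> ` U" unfolding c'(9) using z \<Theta>V[of "\<Gamma> z"] \<Theta>b[of "\<Gamma> z"] by auto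
    ultimately show "z \<in> \<Theta> ` (\<phi> ` U \<inter> P)" by (metis IntI image_eqI)
  qed
  have o\<Omega>: "open (Q \<inter> \<Gamma> -` \<Omega>)"
    using continuous_open_preimage[OF smooth_on_continuous[OF PQ(5)] PQ(4) c'(8)] .
  have c2: "chart_data (mdim M) (mtop M) (U \<inter> \<phi> -` P) (\<lambda>x. \<Theta> (\<phi> x)) V b (Q \<inter> \<Gamma> -` \<Omega>)"
    by (rule chart_data_compose[OF c PQ(1,4) smooth_on_continuous[OF s\<Theta>] \<Theta>1 smooth_on_continuous[OF PQ(5)] \<Theta>2
         c'(5,6,7) o\<Omega> im])
  have f2: "(U \<inter> \<phi> -` P, \<lambda>x. \<Theta> (\<phi> x)) \<in> full_atlas M"
    by (rule full_atlas_compose[OF M U(1) s\<Theta> \<Theta>1 PQ(5)]) (assumption, unfold is_chart_iff, intro exI, rule c2)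
  define T2 where "T2 = (U \<inter> \<phi> -` P) \<inter> (\<lambda>x. \<Theta> (\<phi> x)) -` {z. \<bar>w \<bullet> z\<bar> < 1}"
  have oT2: "openin (mtop M) T2" unfolding T2_def
    by (rule chart_dataD(3)[OF c2]) (intro open_Collect_less continuous_intros)
  have e2: "U \<inter> \<phi> -` P \<inter> T2 = T2" by (auto simp: T2_def)
  obtain \<Omega>3 where c3: "chart_data (mdim M) (mtop M) T2 (\<lambda>x. \<Theta> (\<phi> x)) V b \<Omega>3"
    using chart_data_restrict[OF c2 oT2] e2 by metis
  have wg: "w \<bullet> \<Theta> (\<phi> y) = g y" if "y \<in> U" "\<phi> y \<in> P" for y
    unfolding \<Theta>w using Gg that PQ(3) by auto
  have "adapted_chart M f x T2 (\<lambda>x. \<Theta> (\<phi> x)) V b w \<Omega>3"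
    unfolding adapted_chart_def
  proof (intro conjI ballI c3 w b0)
    show "(T2, \<lambda>x. \<Theta> (\<phi> x)) \<in> full_atlas M" using full_atlas_restrict[OF f2 oT2] e2 by simp
    show "w \<bullet> \<Theta> (\<phi> x) = 0" using wg[of x] U(2) PQ(2) gx by simp
    then show "x \<in> T2" using U(2) PQ(2) by (auto simp: T2_def)
    fix y assume "y \<in> T2"
    then have y: "y \<in> U" "\<phi> y \<in> P" "\<bar>w \<bullet> \<Theta> (\<phi> y)\<bar> < 1" by (auto simp: T2_def)
    show "f y = f x * cis (w \<bullet> \<Theta> (\<phi> y))" using fg[OF y(1)] wg[OF y(1,2)] by simp
    show "\<bar>w \<bullet> \<Theta> (\<phi> y)\<bar> < 1" by (rule y(3))
  qed
  then show ?thesis by blast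
qed

lemma smooth_onE:
  assumes "smooth_on S f" "x \<in> S"
  obtains U g where "open U" "smooth_on U g" "x \<in> U" "\<forall>y\<in>U \<inter> S. g y = f y"
proof -
  obtain U g where U: "open U" "x \<in> U" "\<forall>k. Ck_on k g U" "\<forall>y\<in>U \<inter> S. g y = f y"
    using bspec[OF assms(1)[unfolded smooth_on_def] assms(2)] by (elim exE conjE)
  have "smooth_on U g" by (rule smooth_on_CkI[OF U(1)]) (rule spec[OF U(3)])
  from that[OF U(1) this U(2,4)] show thesis .
qed

section \<open>Solving an equation along parallel lines\<close>

text \<open>\<open>h\<close> is only given on a piece of a half-space, so its derivatives come from
  local smooth extensions. In direction \<open>v\<close>, which is tangent to \<open>V\<close> and
  to the edge, short segments stay inside the piece; so the derivative depends on \<open>h\<close>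
  alone, and the local ones fit together to a smooth \<open>h'\<close>.\<close>

lemma vertical_derivative:
  fixes h :: "'e::euclidean_space \<Rightarrow> real"
  assumes V: "subspace V" "v \<in> V" "b \<bullet> v = 0" and \<Omega>: "open \<Omega>"
    and h: "smooth_on ({z \<in> V. 0 \<le> b \<bullet> z} \<inter> \<Omega>) h"
  obtains h' where "smooth_on ({z \<in> V. 0 \<le> b \<bullet> z} \<inter> \<Omega>) h'"
    "\<And>q. q \<in> {z \<in> V. 0 \<le> b \<bullet> z} \<inter> \<Omega> \<Longrightarrow> ((\<lambda>y. h (q + y *\<^sub>R v)) has_real_derivative h' q) (at 0)"
    "\<And>q O' g. \<lbrakk>open O'; smooth_on O' g; q \<in> O'; q \<in> {z \<in> V. 0 \<le> b \<bullet> z} \<inter> \<Omega>;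
        \<forall>y\<in>O' \<inter> ({z \<in> V. 0 \<le> b \<bullet> z} \<inter> \<Omega>). g y = h y\<rbrakk> \<Longrightarrow> frechet_derivative g (at q) v = h' q"
proof -
  let ?S = "{z \<in> V. 0 \<le> b \<bullet> z} \<inter> \<Omega>"
  define h' where "h' q = deriv (\<lambda>y. h (q + y *\<^sub>R v)) 0" for q
  have key: "((\<lambda>y. h (q + y *\<^sub>R v)) has_real_derivative frechet_derivative g (at q) v) (at 0)"
    if g: "open O'" "smooth_on O' g" "q \<in> O'" "q \<in> ?S" "\<forall>y\<in>O' \<inter> ?S. g y = h y" for O' g q
  proof -
    have dg: "(g has_derivative frechet_derivative g (at q)) (at q)" by (rule smooth_on_deriv(1)[OF g(1,2,3)])
    interpret bounded_linear "frechet_derivative g (at q)" using dg by (rule has_derivative_bounded_linear)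
    have "((\<lambda>y::real. q + y *\<^sub>R v) has_derivative (\<lambda>y. y *\<^sub>R v)) (at 0)" by (auto intro!: derivative_eq_intros)
    then have "((\<lambda>y::real. g (q + y *\<^sub>R v)) has_derivative (\<lambda>y. frechet_derivative g (at q) (y *\<^sub>R v))) (at 0)"
      using diff_chain_at[of "\<lambda>y::real. q + y *\<^sub>R v" "\<lambda>y. y *\<^sub>R v" 0 g] dg by (simp add: o_def)
    then have 1: "((\<lambda>y::real. g (q + y *\<^sub>R v)) has_real_derivative frechet_derivative g (at q) v) (at 0)"
      by (rule has_derivative_imp_has_field_derivative) (simp add: scaleR mult.commute)
    have "open ((\<lambda>y::real. q + y *\<^sub>R v) -` (O' \<inter> \<Omega>))"
      by (intro open_vimage open_Int g(1) \<Omega> continuous_intros)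
    then show ?thesis
    proof (rule has_field_derivative_transform_within_open[OF 1])
      show "0 \<in> (\<lambda>y::real. q + y *\<^sub>R v) -` (O' \<inter> \<Omega>)" using g by auto
      fix y :: real assume "y \<in> (\<lambda>y::real. q + y *\<^sub>R v) -` (O' \<inter> \<Omega>)"
      then have "q + y *\<^sub>R v \<in> O' \<inter> ?S"
        using g(4) V subspace_add[OF V(1)] subspace_scale[OF V(1)] by (auto simp: inner_add_right)
      then show "g (q + y *\<^sub>R v) = h (q + y *\<^sub>R v)" using g(5) by blast
    qed
  qed
  have key2: "frechet_derivative g (at q) v = h' q"
    if "open O'" "smooth_on O' g" "q \<in> O'" "q \<in> ?S" "\<forall>y\<in>O' \<inter> ?S. g y = h y" for O' g q
    using DERIV_imp_deriv[OF key[OF that]] by (simp add: h'_def)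
  show thesis
  proof (rule that[OF _ _ key2])
    show "smooth_on ?S h'"
    proof (rule smooth_on_local)
      fix q assume q: "q \<in> ?S"
      obtain O' g where g: "open O'" "smooth_on O' g" "q \<in> O'" "\<forall>y\<in>O' \<inter> ?S. g y = h y"
        by (rule smooth_onE[OF h q])
      have "smooth_on (?S \<inter> O') (\<lambda>q. frechet_derivative g (at q) v)"
        by (rule smooth_on_subset[OF smooth_on_deriv(2)[OF g(1,2)]]) auto
      then have "smooth_on (?S \<inter> O') h'"
        by (rule smooth_on_cong) (use key2[OF g(1,2) _ _ g(4)] in auto)
      then show "\<exists>O'. open O' \<and> q \<in> O' \<and> smooth_on (?S \<inter> O') h'" using g(1,3) by (intro exI[of _ O'] conjI)
    qed
    show "((\<lambda>y. h (q + y *\<^sub>R v)) has_real_derivative h' q) (at 0)" if q: "q \<in> ?S" for q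
    proof -
      obtain O' g where g: "open O'" "smooth_on O' g" "q \<in> O'" "\<forall>y\<in>O' \<inter> ?S. g y = h y"
        by (rule smooth_onE[OF h q])
      show ?thesis using key[OF g(1-3) q g(4)] key2[OF g(1-3) q g(4)] by simp
    qed
  qed
qed

text \<open>For fixed \<open>z\<close> and small \<open>e\<close> the function y - e h(z + y v) of y
  is strictly increasing, because the derivative of \<open>h\<close> along \<open>v\<close> is
  bounded on the compact set of relevant points. So y = e h(z + y v) has exactly one solution, and
  \<bar>y\<bar> \<le> \<bar>e\<bar> because \<open>h\<close> takes values in [0, 1]. Smooth
  dependence on (z, e) comes from making v.p - e h(p) a coordinate.\<close>

lemma vertical_solution:
  fixes h :: "'e::euclidean_space \<Rightarrow> real"
  assumes V: "subspace V" "v \<in> V" "b \<bullet> v = 0" "norm v = 1" and \<Omega>: "open \<Omega>"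
    and h: "smooth_on ({z \<in> V. 0 \<le> b \<bullet> z} \<inter> \<Omega>) h"
    and h01: "\<And>q. q \<in> {z \<in> V. 0 \<le> b \<bullet> z} \<inter> \<Omega> \<Longrightarrow> 0 \<le> h q \<and> h q \<le> 1"
    and a: "0 < a" "cball c (4 * a) \<subseteq> \<Omega>"
  defines "E \<equiv> {z \<in> V. 0 \<le> b \<bullet> z \<and> v \<bullet> z = 0 \<and> dist c z \<le> 2 * a}"
  obtains \<delta> Y where "0 < \<delta>" "\<delta> \<le> a" "smooth_on (E \<times> {- \<delta><..<\<delta>}) (\<lambda>q. Y (fst q) (snd q))"
    "\<And>z e. z \<in> E \<Longrightarrow> \<bar>e\<bar> < \<delta> \<Longrightarrow> \<bar>Y z e\<bar> \<le> \<bar>e\<bar> \<and> Y z e = e * h (z + Y z e *\<^sub>R v)"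
    "\<And>z e y. z \<in> E \<Longrightarrow> \<bar>e\<bar> < \<delta> \<Longrightarrow> \<bar>y\<bar> \<le> 2 * a \<Longrightarrow> y = e * h (z + y *\<^sub>R v) \<Longrightarrow> y = Y z e"
proof -
  let ?S = "{z \<in> V. 0 \<le> b \<bullet> z} \<inter> \<Omega>"
  obtain h' where h': "smooth_on ?S h'"
    "\<And>q. q \<in> ?S \<Longrightarrow> ((\<lambda>y. h (q + y *\<^sub>R v)) has_real_derivative h' q) (at 0)"
    "\<And>q O' g. \<lbrakk>open O'; smooth_on O' g; q \<in> O'; q \<in> ?S; \<forall>y\<in>O' \<inter> ?S. g y = h y\<rbrakk>
        \<Longrightarrow> frechet_derivative g (at q) v = h' q"
  proof (rule vertical_derivative[OF V(1-3) \<Omega> h])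
    fix h' assume a: "smooth_on ?S h'"
    "\<And>q. q \<in> ?S \<Longrightarrow> ((\<lambda>y. h (q + y *\<^sub>R v)) has_real_derivative h' q) (at 0)"
    "\<And>q O' g. \<lbrakk>open O'; smooth_on O' g; q \<in> O'; q \<in> ?S; \<forall>y\<in>O' \<inter> ?S. g y = h y\<rbrakk>
        \<Longrightarrow> frechet_derivative g (at q) v = h' q"
    show thesis by (rule that[OF a])
  qed
  have vv: "v \<bullet> v = 1" using V(4) by (simp add: dot_square_norm)
  \<comment> \<open>\<open>z\<close> is within \<open>2 * a\<close> of \<open>c\<close>, and the
    step along \<open>v\<close> has length at most \<open>2 * a\<close>; this is the origin of the
    radius \<open>4 * a\<close>.\<close>
  have inS: "z + y *\<^sub>R v \<in> ?S" if "z \<in> E" "\<bar>y\<bar> \<le> 2 * a" for z y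
  proof -
    have "dist c (z + y *\<^sub>R v) \<le> dist c z + dist z (z + y *\<^sub>R v)" by (rule dist_triangle)
    also have "dist z (z + y *\<^sub>R v) = \<bar>y\<bar>" by (simp add: dist_norm V(4))
    finally have "dist c (z + y *\<^sub>R v) \<le> 4 * a" using that by (simp add: E_def)
    then have "z + y *\<^sub>R v \<in> \<Omega>" using a(2) by auto
    then show ?thesis using that V subspace_add[OF V(1)] subspace_scale[OF V(1)]
      by (auto simp: E_def inner_add_right)
  qed
  have cE: "compact E"
  proof -
    have e: "E = V \<inter> {z. 0 \<le> b \<bullet> z} \<inter> {z. v \<bullet> z = 0} \<inter> cball c (2 * a)" by (auto simp: E_def)
    show ?thesis unfolding e using closed_subspace[OF V(1)] closed_halfspace_ge[of 0 b] closed_hyperplane[of v 0]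
      by (intro closed_Int_compact closed_Int compact_cball) auto
  qed
  have "compact ((\<lambda>p. fst p + snd p *\<^sub>R v) ` (E \<times> {- 2 * a..2 * a}))"
    by (intro compact_continuous_image compact_Times cE continuous_intros compact_Icc)
  moreover have "(\<lambda>p. fst p + snd p *\<^sub>R v) ` (E \<times> {- 2 * a..2 * a}) \<subseteq> ?S" using inS by auto
  ultimately have "bounded (h' ` (\<lambda>p. fst p + snd p *\<^sub>R v) ` (E \<times> {- 2 * a..2 * a}))"
    using smooth_on_continuous[OF h'(1)] by (meson compact_continuous_image compact_imp_bounded continuous_on_subset)
  then obtain K where K: "0 < K" "\<And>z y. z \<in> E \<Longrightarrow> \<bar>y\<bar> \<le> 2 * a \<Longrightarrow> \<bar>h' (z + y *\<^sub>R v)\<bar> \<le> K"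
    unfolding bounded_pos by force
  \<comment> \<open>The bound \<open>a\<close> keeps the solutions, of size at most
    \<open>\<bar>e\<bar>\<close>, inside the range \<open>2 * a\<close>; the other one keeps e h'
    below 1, so that the slope is positive.\<close>
  define \<delta> where "\<delta> = min a (1 / (2 * K))"
  have \<delta>: "0 < \<delta>" "\<delta> \<le> a" "\<And>e. \<bar>e\<bar> < \<delta> \<Longrightarrow> \<bar>e\<bar> * K < 1"
  proof -
    show "0 < \<delta>" "\<delta> \<le> a" using a K by (auto simp: \<delta>_def)
    fix e assume "\<bar>e\<bar> < \<delta>"
    then have "\<bar>e\<bar> < 1 / (2 * K)" by (simp add: \<delta>_def)
    then have "\<bar>e\<bar> * (2 * K) < 1" using K(1) by (simp add: pos_less_divide_eq)
    then show "\<bar>e\<bar> * K < 1" using K(1) using mult_nonneg_nonneg[of "\<bar>e\<bar>" K] by linarith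
  qed
  have slope: "e * h' (z + y *\<^sub>R v) < 1" if "z \<in> E" "\<bar>e\<bar> < \<delta>" "\<bar>y\<bar> \<le> 2 * a" for z e y
  proof -
    have "e * h' (z + y *\<^sub>R v) \<le> \<bar>e\<bar> * \<bar>h' (z + y *\<^sub>R v)\<bar>" by (metis abs_ge_self abs_mult)
    also have "\<dots> \<le> \<bar>e\<bar> * K" using K(2)[OF that(1,3)] by (simp add: mult_left_mono)
    finally show ?thesis using \<delta>(3)[OF that(2)] by simp
  qed
  have der: "((\<lambda>y. y - e * h (z + y *\<^sub>R v)) has_real_derivative 1 - e * h' (z + y *\<^sub>R v)) (at y)"
    if "z \<in> E" "\<bar>y\<bar> \<le> 2 * a" for z e y
  proof -
    have "((\<lambda>t. h ((z + y *\<^sub>R v) + t *\<^sub>R v)) has_real_derivative h' (z + y *\<^sub>R v)) (at 0)"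
      by (rule h'(2)[OF inS[OF that]])
    then have "((\<lambda>t. h (z + (t + y) *\<^sub>R v)) has_real_derivative h' (z + y *\<^sub>R v)) (at 0)"
      by (simp add: algebra_simps)
    then have "((\<lambda>t. h (z + t *\<^sub>R v)) has_real_derivative h' (z + y *\<^sub>R v)) (at y)"
      using DERIV_shift[of "\<lambda>t. h (z + t *\<^sub>R v)" "h' (z + y *\<^sub>R v)" 0 y] by simp
    then show ?thesis by (auto intro!: derivative_eq_intros)
  qed
  have mono: "y1 - e * h (z + y1 *\<^sub>R v) < y2 - e * h (z + y2 *\<^sub>R v)"
    if "z \<in> E" "\<bar>e\<bar> < \<delta>" "\<bar>y1\<bar> \<le> 2 * a" "\<bar>y2\<bar> \<le> 2 * a" "y1 < y2" for z e y1 y2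
  proof (rule DERIV_pos_imp_increasing[OF that(5)])
    fix y assume "y1 \<le> y" "y \<le> y2"
    then have y: "\<bar>y\<bar> \<le> 2 * a" using that by linarith
    show "\<exists>d. ((\<lambda>y. y - e * h (z + y *\<^sub>R v)) has_real_derivative d) (at y) \<and> 0 < d"
      using der[OF that(1) y] slope[OF that(1,2) y] by (intro exI[of _ "1 - e * h' (z + y *\<^sub>R v)"]) simp
  qed
  have uniq: "y1 = y2" if "z \<in> E" "\<bar>e\<bar> < \<delta>" "\<bar>y1\<bar> \<le> 2 * a" "\<bar>y2\<bar> \<le> 2 * a"
    "y1 = e * h (z + y1 *\<^sub>R v)" "y2 = e * h (z + y2 *\<^sub>R v)" for z e y1 y2
    using mono[OF that(1-4)] mono[OF that(1,2,4,3)] that(5,6) by (metis diff_self less_irrefl linorder_neqE)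
  have ex: "\<exists>y. \<bar>y\<bar> \<le> \<bar>e\<bar> \<and> y = e * h (z + y *\<^sub>R v)" if z: "z \<in> E" and e: "\<bar>e\<bar> < \<delta>" for z e
  proof -
    have e2: "\<bar>e\<bar> \<le> 2 * a" using e \<delta> a by linarith
    have bnd: "\<bar>e * h (z + y *\<^sub>R v)\<bar> \<le> \<bar>e\<bar>" if "\<bar>y\<bar> \<le> 2 * a" for y
      using h01[OF inS[OF z that]] by (simp add: abs_mult mult_left_le)
    have "\<exists>y\<ge>- \<bar>e\<bar>. y \<le> \<bar>e\<bar> \<and> y - e * h (z + y *\<^sub>R v) = 0"
    proof (rule IVT')
      show "- \<bar>e\<bar> - e * h (z + (- \<bar>e\<bar>) *\<^sub>R v) \<le> 0" using bnd[of "- \<bar>e\<bar>"] e2 by (simp add: abs_le_iff)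
      show "0 \<le> \<bar>e\<bar> - e * h (z + \<bar>e\<bar> *\<^sub>R v)" using bnd[of "\<bar>e\<bar>"] e2 by (simp add: abs_le_iff)
      show "continuous_on {- \<bar>e\<bar>..\<bar>e\<bar>} (\<lambda>y. y - e * h (z + y *\<^sub>R v))"
        by (rule DERIV_continuous_on) (rule has_field_derivative_at_within[OF der[OF z]], use e2 in auto)
    qed simp
    then show ?thesis by (auto intro: exI simp: abs_le_iff)
  qed
  define Y where "Y z e = (SOME y. \<bar>y\<bar> \<le> \<bar>e\<bar> \<and> y = e * h (z + y *\<^sub>R v))" for z e
  have Y: "\<bar>Y z e\<bar> \<le> \<bar>e\<bar> \<and> Y z e = e * h (z + Y z e *\<^sub>R v)" if "z \<in> E" "\<bar>e\<bar> < \<delta>" for z e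
    unfolding Y_def by (rule someI_ex[OF ex[OF that]])
  have Yu: "y = Y z e" if "z \<in> E" "\<bar>e\<bar> < \<delta>" "\<bar>y\<bar> \<le> 2 * a" "y = e * h (z + y *\<^sub>R v)" for z e y
  proof (rule uniq[OF that(1-3) _ that(4)])
    show "\<bar>Y z e\<bar> \<le> 2 * a" "Y z e = e * h (z + Y z e *\<^sub>R v)"
      using Y[OF that(1,2)] that(2) \<delta>(2) a(1) by auto
  qed
  have "smooth_on (E \<times> {- \<delta><..<\<delta>}) (\<lambda>q. Y (fst q) (snd q))"
  proof (rule smooth_on_local)
    fix q assume "q \<in> E \<times> {- \<delta><..<\<delta>}"
    then obtain z1 e1 where q: "q = (z1, e1)" "z1 \<in> E" "\<bar>e1\<bar> < \<delta>" by auto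
    define y1 where "y1 = Y z1 e1"
    define p1 where "p1 = z1 + y1 *\<^sub>R v"
    have y1: "\<bar>y1\<bar> \<le> \<bar>e1\<bar>" "y1 = e1 * h p1" using Y[OF q(2,3)] by (auto simp: y1_def p1_def)
    have y1a: "\<bar>y1\<bar> < 2 * a" using y1(1) q(3) \<delta>(2) a(1) by linarith
    have p1S: "p1 \<in> ?S" unfolding p1_def by (rule inS[OF q(2)]) (use y1a in simp)
    obtain O' g where O'0: "open O'" "smooth_on O' g" "p1 \<in> O'" "\<forall>y\<in>O' \<inter> ?S. g y = h y"
      by (rule smooth_onE[OF h p1S])
    note O' = O'0(1,3) TrueI O'0(4) and sg = O'0(2)
    have gp1: "g p1 = h p1" by (rule bspec[OF O'0(4) IntI[OF O'0(3) p1S]])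
    \<comment> \<open>Replacing the \<open>v\<close>-component of (p, e) by this function is the map
      (p, e) |-> (p - e g(p) v, e), see \<open>eqT\<close>. Its inverse takes (z, e) to (z + y v,
      e), where y solves the equation.\<close>
    define G where "G p = v \<bullet> fst p - snd p * g (fst p)" for p :: "'e \<times> real"
    have sG: "smooth_on (O' \<times> UNIV) G" unfolding G_def
      by (intro smooth_on_diff smooth_on_inner smooth_on_const smooth_on_mult smooth_on_fst smooth_on_snd
          smooth_on_id(1) smooth_on_comp[OF smooth_on_fst[OF smooth_on_id(1)] sg]) auto
    have oO: "open (O' \<times> (UNIV :: real set))" by (intro open_Times O'(1) open_UNIV)
    have inO: "(p1, e1) \<in> O' \<times> UNIV" using O' by simp
    have "frechet_derivative G (at (p1, e1)) (v, 0) = 1 - e1 * h' p1"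
    proof -
      have dg: "(g has_derivative frechet_derivative g (at p1)) (at p1)"
          by (rule smooth_on_deriv(1)[OF O'(1) sg O'(2)])
      have dgf: "((\<lambda>p. g (fst p)) has_derivative (\<lambda>p. frechet_derivative g (at p1) (fst p))) (at (p1, e1))"
        using diff_chain_at[of fst fst "(p1, e1)" g "frechet_derivative g (at p1)"] dg
        by (simp add: o_def has_derivative_fst[OF has_derivative_ident])
      have "(G has_derivative (\<lambda>p. v \<bullet> fst p - (e1 * frechet_derivative g (at p1) (fst p) + snd p * g p1))) (at (p1,
          e1))"
        unfolding G_def by (rule derivative_eq_intros dgf | simp)+
      then have "frechet_derivative G (at (p1, e1)) = (\<lambda>p. v \<bullet> fst p - (e1 * frechet_derivative g (at p1) (fst p) +
          snd p * g p1))"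
        by (rule frechet_derivative_at[symmetric])
      then show ?thesis using h'(3)[OF O'(1) sg O'(2) p1S O'(4)] vv by simp
    qed
    moreover have "e1 * h' p1 < 1" unfolding p1_def by (rule slope[OF q(2,3)]) (use y1a in simp)
    ultimately have nz: "frechet_derivative G (at (p1, e1)) (v, 0) \<noteq> 0" by simp
    have nw: "norm (v, 0::real) = 1" by (simp add: norm_Pair V(4))
    obtain P Q \<Gamma> where PQ: "open P" "(p1, e1) \<in> P" "P \<subseteq> O' \<times> UNIV" "open Q" "smooth_on Q \<Gamma>"
      "\<And>y. y \<in> P \<Longrightarrow> y + (G y - (v, 0) \<bullet> y) *\<^sub>R (v, 0) \<in> Q \<and> \<Gamma> (y + (G y - (v, 0) \<bullet> y) *\<^sub>R (v, 0)) = y"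
      "\<And>z. z \<in> Q \<Longrightarrow> \<Gamma> z \<in> P \<and> \<Gamma> z + (G (\<Gamma> z) - (v, 0) \<bullet> \<Gamma> z) *\<^sub>R (v, 0) = z"
    proof (rule smooth_replace_coordinate[OF oO inO sG nw nz])
      fix P Q \<Gamma>
      assume a: "open P" "(p1, e1) \<in> P" "P \<subseteq> O' \<times> UNIV" "open Q" "smooth_on Q \<Gamma>"
      "\<And>y. y \<in> P \<Longrightarrow> y + (G y - (v, 0) \<bullet> y) *\<^sub>R (v, 0) \<in> Q \<and> \<Gamma> (y + (G y - (v, 0) \<bullet> y) *\<^sub>R (v, 0)) = y"
      "\<And>z. z \<in> Q \<Longrightarrow> \<Gamma> z \<in> P \<and> \<Gamma> z + (G (\<Gamma> z) - (v, 0) \<bullet> \<Gamma> z) *\<^sub>R (v, 0) = z"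
      show thesis by (rule that[OF a])
    qed
    have eqT: "y + (G y - (v, 0) \<bullet> y) *\<^sub>R (v, 0) = (fst y - (snd y * g (fst y)) *\<^sub>R v, snd y)" for y
      by (cases y) (simp add: G_def inner_prod_def)
    have zQ: "(z1, e1) \<in> Q" "\<Gamma> (z1, e1) = (p1, e1)"
    proof -
      have eq: "p1 - (e1 * g p1) *\<^sub>R v = z1" unfolding gp1 y1(2)[symmetric] by (simp add: p1_def)
      show "(z1, e1) \<in> Q" "\<Gamma> (z1, e1) = (p1, e1)"
        using PQ(6)[OF PQ(2), unfolded eqT fst_conv snd_conv eq] by simp_all
    qed
    \<comment> \<open>Uniqueness of the solution is available for \<bar>y\<bar> at most
      \<open>2 * a\<close> only; on \<open>N\<close> the value read off from \<open>\<Gamma>\<close>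
      obeys this bound.\<close>
    define N where "N = Q \<inter> (\<lambda>q. v \<bullet> fst (\<Gamma> q)) -` {- 2 * a<..<2 * a}"
    have "continuous_on Q (\<lambda>q. v \<bullet> fst (\<Gamma> q))"
      by (intro continuous_intros smooth_on_continuous[OF PQ(5)])
    then have oN: "open N" unfolding N_def using continuous_open_preimage PQ(4) open_greaterThanLessThan by blast
    have vp1: "v \<bullet> p1 = y1" using q(2) vv by (simp add: p1_def inner_add_right E_def)
    have qN: "q \<in> N" using zQ vp1 y1a by (auto simp: N_def q(1))
    have Yr: "v \<bullet> fst (\<Gamma> r) = Y (fst r) (snd r)" if "r \<in> E \<times> {- \<delta><..<\<delta>} \<inter> N" for r
    proof -
      obtain z e where r: "r = (z, e)" "z \<in> E" "\<bar>e\<bar> < \<delta>" "(z, e) \<in> N" using \<open>r \<in> E \<times> {- \<delta><..<\<delta>} \<inter> N\<close> by auto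
      then have rQ: "(z, e) \<in> Q" by (simp add: N_def)
      obtain p e' where pe: "\<Gamma> (z, e) = (p, e')" by (cases "\<Gamma> (z, e)")
      have "(p - (e' * g p) *\<^sub>R v, e') = (z, e)" using PQ(7)[OF rQ] unfolding eqT pe by (simp only: fst_conv snd_conv)
      then have p0: "e' = e" "p - (e' * g p) *\<^sub>R v = z" by blast+
      note p = p0(1) p0(2)[unfolded p0(1)]
      have "v \<bullet> (p - (e * g p) *\<^sub>R v) = 0" unfolding p(2) using r(2) by (simp add: E_def)
      then have vp: "v \<bullet> p = e * g p" by (simp add: inner_diff_right vv)
      have y: "z + (v \<bullet> p) *\<^sub>R v = p" unfolding vp p(2)[symmetric] by simp
      have bnd: "\<bar>v \<bullet> p\<bar> \<le> 2 * a" using r(4) by (simp add: N_def pe abs_le_iff)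
      have "p \<in> O'" using PQ(7)[OF rQ] PQ(3) pe by auto
      moreover have "p \<in> ?S" using inS[OF r(2) bnd] unfolding y .
      ultimately have "g p = h p" using bspec[OF O'(4), of p] by simp
      then have "v \<bullet> p = e * h (z + (v \<bullet> p) *\<^sub>R v)" unfolding y using vp by simp
      from Yu[OF r(2,3) bnd this] show ?thesis by (simp add: r(1) pe)
    qed
    have sN: "smooth_on (E \<times> {- \<delta><..<\<delta>} \<inter> N) (\<lambda>q. v \<bullet> fst (\<Gamma> q))"
      by (intro smooth_on_inner smooth_on_const smooth_on_fst smooth_on_subset[OF PQ(5)]) (auto simp: N_def)
    have "smooth_on (E \<times> {- \<delta><..<\<delta>} \<inter> N) (\<lambda>q. Y (fst q) (snd q))"
      by (rule smooth_on_cong[OF sN Yr])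
    then show "\<exists>O'. open O' \<and> q \<in> O' \<and> smooth_on (E \<times> {- \<delta><..<\<delta>} \<inter> O') (\<lambda>q. Y (fst q) (snd q))"
      using oN qN by (intro exI[of _ N]) simp
  qed
  from that[OF \<delta>(1,2) this Y Yu] show thesis .
qed

subsection \<open>Ehresmann's theorem over the circle\<close>

lemma euclidean_boundary: "mboundary (euclidean_mfd :: ('e::euclidean_space, 'e) mfd) = {}"
  by (simp add: mboundary_def)

lemma prod_real_manifold:
  "smooth_manifold M \<Longrightarrow> smooth_manifold (prod_mfd M real_mfd)"
  by (rule prod_manifold[OF _ euclidean_manifold]) (simp_all add: euclidean_boundary)

lemma cis_eq_iff_small:
  assumes "\<bar>s\<bar> < 1" "\<bar>t\<bar> < 1" "cis s = cis t" shows "s = t"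
proof -
  have "\<bar>s\<bar> < pi" "\<bar>t\<bar> < pi" using assms(1,2) pi_gt3 by linarith+
  then have "\<i> * complex_of_real s = \<i> * complex_of_real t"
    using Ln_cis[of s] Ln_cis[of t] assms(3) by (simp only:)
  then show ?thesis by simp
qed

lemma adapted_chartD:
  assumes "adapted_chart M f x U \<phi> V b v \<Omega>"
  shows "(U, \<phi>) \<in> full_atlas M" "x \<in> U" "chart_data (mdim M) (mtop M) U \<phi> V b \<Omega>"
    "v \<in> V" "norm v = 1" "b \<bullet> v = 0" "v \<bullet> \<phi> x = 0"
    "\<And>z. z \<in> U \<Longrightarrow> f z = f x * cis (v \<bullet> \<phi> z) \<and> \<bar>v \<bullet> \<phi> z\<bar> < 1" "b = 0 \<or> x \<in> mboundary M"
proof -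
  note a = assms[unfolded adapted_chart_def]
  show "(U, \<phi>) \<in> full_atlas M" "x \<in> U" "chart_data (mdim M) (mtop M) U \<phi> V b \<Omega>"
    "v \<in> V" "norm v = 1" "b \<bullet> v = 0" "v \<bullet> \<phi> x = 0" "b = 0 \<or> x \<in> mboundary M"
    by (rule conjunct1[OF a], rule conjunct1[OF conjunct2[OF a]], rule conjunct1[OF conjunct2[OF conjunct2[OF a]]],
        rule conjunct1[OF conjunct2[OF conjunct2[OF conjunct2[OF a]]]], rule conjunct1[OF conjunct2[OF conjunct2[OF
        conjunct2[OF conjunct2[OF a]]]]], rule conjunct1[OF conjunct2[OF conjunct2[OF conjunct2[OF conjunct2[OF
        conjunct2[OF a]]]]]], rule conjunct1[OF conjunct2[OF conjunct2[OF conjunct2[OF conjunct2[OF conjunct2[OF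
        conjunct2[OF a]]]]]]], rule conjunct2[OF conjunct2[OF conjunct2[OF conjunct2[OF conjunct2[OF conjunct2[OF
        conjunct2[OF conjunct2[OF a]]]]]]]])
  have "\<forall>z\<in>U. f z = f x * cis (v \<bullet> \<phi> z) \<and> \<bar>v \<bullet> \<phi> z\<bar> < 1" by (rule conjunct1[OF conjunct2[OF conjunct2[OF conjunct2[OF
      conjunct2[OF conjunct2[OF conjunct2[OF conjunct2[OF a]]]]]]]])
  then show "\<And>z. z \<in> U \<Longrightarrow> f z = f x * cis (v \<bullet> \<phi> z) \<and> \<bar>v \<bullet> \<phi> z\<bar> < 1" by (rule bspec)
qed

text \<open>In an adapted chart the fiber is the slice v.z = 0, because the argument of
  \<open>f\<close> is small enough to be determined by the value. As \<open>b\<close> is orthogonal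
  to \<open>v\<close>, it lies in the slice, which is therefore again a half-space with normal
  \<open>b\<close>, or a full subspace if \<open>b = 0\<close>.\<close>

lemma fiber_submanifold:
  assumes M: "smooth_manifold M"
    and ad: "\<And>x. x \<in> mspace M \<Longrightarrow> \<exists>U \<phi> V b v \<Omega>. adapted_chart M f x U \<phi> V b v \<Omega>"
    and f0: "\<And>x. x \<in> mspace M \<Longrightarrow> f x \<noteq> 0"
  shows "smooth_manifold (submfd (mdim M - 1) M (fiber M f y))"
proof (rule submfd_manifoldI[OF M])
  show "fiber M f y \<subseteq> mspace M" by (auto simp: fiber_def)
  fix x assume "x \<in> fiber M f y"
  then have x: "x \<in> mspace M" "f x = y" by (auto simp: fiber_def)
  obtain U \<phi> V b v \<Omega> where "adapted_chart M f x U \<phi> V b v \<Omega>" using ad[OF x(1)] by (elim exE)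
  note A = adapted_chartD[OF this]
  note U = A(1,2) and c = A(3) and v = A(4,5,6) and fU = A(8)
  note c' = chart_dataD[OF c]
  have "v \<noteq> 0" using v by auto
  have iff: "f z = y \<longleftrightarrow> v \<bullet> \<phi> z = 0" if "z \<in> U" for z
  proof
    assume "f z = y"
    then have "f x * cis (v \<bullet> \<phi> z) = f x * 1" using fU[OF that] x(2) by simp
    then have "cis (v \<bullet> \<phi> z) = cis 0" using f0[OF x(1)] by simp
    then show "v \<bullet> \<phi> z = 0" using cis_eq_iff_small[of "v \<bullet> \<phi> z" 0] fU[OF that] by simp
  next
    assume "v \<bullet> \<phi> z = 0"
    then show "f z = y" using fU[OF that] x(2) by simp
  qed
  have "is_chart (mdim M - 1) (subtopology (mtop M) (fiber M f y)) (U \<inter> fiber M f y, \<phi>)"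
    unfolding is_chart_iff
  proof (intro exI, rule slice_chart[OF full_atlas_chart[OF U(1)]])
    show "subspace {z \<in> V. v \<bullet> z = 0}" using c'(5) by (auto simp: subspace_def inner_add_right)
    show "dim {z \<in> V. v \<bullet> z = 0} = mdim M - 1" using dim_orthogonal_slice[OF c'(5) v(1) \<open>v \<noteq> 0\<close>] c'(6) by simp
    show "b \<in> {z \<in> V. v \<bullet> z = 0}" using c'(7) v(3) by (simp add: inner_commute)
    show "open \<Omega>" by (rule c'(8))
    show "\<phi> ` (U \<inter> fiber M f y) = {x \<in> {z \<in> V. v \<bullet> z = 0}. 0 \<le> b \<bullet> x} \<inter> \<Omega>"
    proof (intro equalityI subsetI)
      fix p assume "p \<in> \<phi> ` (U \<inter> fiber M f y)"
      then obtain z where z: "z \<in> U" "f z = y" "p = \<phi> z" by (auto simp: fiber_def)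
      then have "p \<in> \<phi> ` U" by simp
      then show "p \<in> {x \<in> {z \<in> V. v \<bullet> z = 0}. 0 \<le> b \<bullet> x} \<inter> \<Omega>" unfolding c'(9) using iff[OF z(1)] z by auto
    next
      fix p assume p: "p \<in> {x \<in> {z \<in> V. v \<bullet> z = 0}. 0 \<le> b \<bullet> x} \<inter> \<Omega>"
      then have "p \<in> \<phi> ` U" unfolding c'(9) by auto
      then obtain z where z: "z \<in> U" "p = \<phi> z" by auto
      then have "f z = y" using iff p by auto
      then show "p \<in> \<phi> ` (U \<inter> fiber M f y)" using z c'(10) by (auto simp: fiber_def)
    qed
  qed
  then show "\<exists>U \<phi>. (U, \<phi>) \<in> full_atlas M \<and> x \<in> U \<and> is_chart (mdim M - 1) (subtopology (mtop M) (fiber M f y)) (U \<inter>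
      fiber M f y, \<phi>)"
    using U by (intro exI[of _ U] exI[of _ \<phi>]) simp
qed

section \<open>Deforming level sets\<close>

text \<open>For \<open>s\<close> constantly 1 this is the tube around the fiber over
  \<open>y0\<close>, with the angle as second entry. Where \<open>s\<close> vanishes it is a piece
  of the fiber times an interval.\<close>

definition level :: "('a, 'e::euclidean_space) mfd \<Rightarrow> ('a \<Rightarrow> complex) \<Rightarrow> complex \<Rightarrow> ('a \<Rightarrow> real) \<Rightarrow> real \<Rightarrow> ('a \<times> real) set"
    where
  "level M f y0 s \<delta> = {(x, e). x \<in> mspace M \<and> \<bar>e\<bar> < \<delta> \<and> f x = y0 * cis (e * s x)}"

text \<open>Mutually inverse smooth maps between two such sets that keep the parameter
  \<open>e\<close>. Only their components in \<open>M\<close> are recorded.\<close>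

definition level_map ::
  "('a, 'e::euclidean_space) mfd \<Rightarrow> ('a \<Rightarrow> complex) \<Rightarrow> complex \<Rightarrow> ('a \<Rightarrow> real) \<Rightarrow> ('a \<Rightarrow> real) \<Rightarrow> real \<Rightarrow>
    ('a \<times> real \<Rightarrow> 'a) \<Rightarrow> ('a \<times> real \<Rightarrow> 'a) \<Rightarrow> bool" where
  "level_map M f y0 s s' \<delta> Q Q' \<longleftrightarrow>
     smooth_in (prod_mfd M real_mfd) M (level M f y0 s \<delta>) Q \<and>
     smooth_in (prod_mfd M real_mfd) M (level M f y0 s' \<delta>) Q' \<and>
     (\<forall>x e. (x, e) \<in> level M f y0 s \<delta> \<longrightarrow> (Q (x, e), e) \<in> level M f y0 s' \<delta> \<and> Q' (Q (x, e), e) = x) \<and>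
     (\<forall>x e. (x, e) \<in> level M f y0 s' \<delta> \<longrightarrow> (Q' (x, e), e) \<in> level M f y0 s \<delta> \<and> Q (Q' (x, e), e) = x)"

text \<open>This replaces the flow in the usual proof of Ehresmann's theorem: deforming \<open>s\<close> from the constant \<open>1\<close> to a
  function vanishing near the fiber, one chart at a time, trivializes \<open>f\<close> near that fiber.\<close>

definition level_equiv ::
  "('a, 'e::euclidean_space) mfd \<Rightarrow> ('a \<Rightarrow> complex) \<Rightarrow> complex \<Rightarrow> ('a \<Rightarrow> real) \<Rightarrow> ('a \<Rightarrow> real) \<Rightarrow> bool" where
  "level_equiv M f y0 s s' \<longleftrightarrow> (\<exists>\<delta> Q Q'. 0 < \<delta> \<and> level_map M f y0 s s' \<delta> Q Q')"

lemma level_mono: "\<delta>' \<le> \<delta> \<Longrightarrow> level M f y0 s \<delta>' \<subseteq> level M f y0 s \<delta>"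
  by (auto simp: level_def)

lemma level_subset: "level M f y0 s \<delta> \<subseteq> mspace (prod_mfd M real_mfd)"
  by (auto simp: level_def)

lemma smooth_in_fst_real:
  "smooth_manifold M \<Longrightarrow> A \<subseteq> mspace (prod_mfd M real_mfd) \<Longrightarrow>
    smooth_in (prod_mfd M real_mfd) M A fst"
  by (rule smooth_in_subset[OF smooth_in_fst]) (simp_all add: euclidean_manifold euclidean_boundary)

lemma smooth_in_snd_real:
  "smooth_manifold M \<Longrightarrow> A \<subseteq> mspace (prod_mfd M real_mfd) \<Longrightarrow>
    smooth_in (prod_mfd M real_mfd) euclidean_mfd A snd"
  by (rule smooth_in_subset[OF smooth_in_snd]) (simp_all add: euclidean_manifold euclidean_boundary)

lemma level_mapD:
  assumes "level_map M f y0 s s' \<delta> Q Q'"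
  shows "smooth_in (prod_mfd M real_mfd) M (level M f y0 s \<delta>) Q"
    "smooth_in (prod_mfd M real_mfd) M (level M f y0 s' \<delta>) Q'"
    "\<And>x e. (x, e) \<in> level M f y0 s \<delta> \<Longrightarrow> (Q (x, e), e) \<in> level M f y0 s' \<delta> \<and> Q' (Q (x, e), e) = x"
    "\<And>x e. (x, e) \<in> level M f y0 s' \<delta> \<Longrightarrow> (Q' (x, e), e) \<in> level M f y0 s \<delta> \<and> Q (Q' (x, e), e) = x"
proof -
  note a = assms[unfolded level_map_def]
  show "smooth_in (prod_mfd M real_mfd) M (level M f y0 s \<delta>) Q"
    "smooth_in (prod_mfd M real_mfd) M (level M f y0 s' \<delta>) Q'"
    by (rule conjunct1[OF a], rule conjunct1[OF conjunct2[OF a]])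
  have 3: "\<forall>x e. (x, e) \<in> level M f y0 s \<delta> \<longrightarrow> (Q (x, e), e) \<in> level M f y0 s' \<delta> \<and> Q' (Q (x, e), e) = x"
    and 4: "\<forall>x e. (x, e) \<in> level M f y0 s' \<delta> \<longrightarrow> (Q' (x, e), e) \<in> level M f y0 s \<delta> \<and> Q (Q' (x, e), e) = x"
    by (rule conjunct1[OF conjunct2[OF conjunct2[OF a]]], rule conjunct2[OF conjunct2[OF conjunct2[OF a]]])
  show "(Q (x, e), e) \<in> level M f y0 s' \<delta> \<and> Q' (Q (x, e), e) = x" if "(x, e) \<in> level M f y0 s \<delta>" for x e
    by (rule 3[rule_format, OF that])
  show "(Q' (x, e), e) \<in> level M f y0 s \<delta> \<and> Q (Q' (x, e), e) = x" if "(x, e) \<in> level M f y0 s' \<delta>" for x e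
    by (rule 4[rule_format, OF that])
qed

lemma level_map_mono:
  assumes "level_map M f y0 s s' \<delta> Q Q'" "\<delta>' \<le> \<delta>"
  shows "level_map M f y0 s s' \<delta>' Q Q'"
proof -
  note d = level_mapD[OF assms(1)]
  have lv: "(x, e) \<in> level M f y0 t \<delta>' \<longleftrightarrow> \<bar>e\<bar> < \<delta>' \<and> (x, e) \<in> level M f y0 t \<delta>" for x e t
    using assms(2) by (auto simp: level_def)
  show ?thesis unfolding level_map_def
  proof (intro conjI)
    show "smooth_in (prod_mfd M real_mfd) M (level M f y0 s \<delta>') Q"
      by (rule smooth_in_subset[OF d(1) level_mono[OF assms(2)]])
    show "smooth_in (prod_mfd M real_mfd) M (level M f y0 s' \<delta>') Q'"
      by (rule smooth_in_subset[OF d(2) level_mono[OF assms(2)]])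
    show "\<forall>x e. (x, e) \<in> level M f y0 s \<delta>' \<longrightarrow> (Q (x, e), e) \<in> level M f y0 s' \<delta>' \<and> Q' (Q (x, e), e) = x"
      "\<forall>x e. (x, e) \<in> level M f y0 s' \<delta>' \<longrightarrow> (Q' (x, e), e) \<in> level M f y0 s \<delta>' \<and> Q (Q' (x, e), e) = x"
      unfolding lv using d(3,4) by simp_all
  qed
qed

lemma level_equiv_refl:
  assumes M: "smooth_manifold M" shows "level_equiv M f y0 s s"
  unfolding level_equiv_def level_map_def
proof (intro exI conjI)
  show "smooth_in (prod_mfd M real_mfd) M (level M f y0 s 1) fst"
    "smooth_in (prod_mfd M real_mfd) M (level M f y0 s 1) fst"
    by (rule smooth_in_fst_real[OF M level_subset])+
qed simp_all

lemma level_equiv_trans: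
  assumes M: "smooth_manifold M" and 1: "level_equiv M f y0 s1 s2" and 2: "level_equiv M f y0 s2 s3"
  shows "level_equiv M f y0 s1 s3"
proof -
  let ?P = "prod_mfd M real_mfd"
  obtain d1 Q Q' where d1: "0 < d1" "level_map M f y0 s1 s2 d1 Q Q'" using 1 unfolding level_equiv_def
      by (elim exE conjE)
  obtain d2 R R' where d2: "0 < d2" "level_map M f y0 s2 s3 d2 R R'" using 2 unfolding level_equiv_def
      by (elim exE conjE)
  define \<delta> where "\<delta> = min d1 d2"
  have \<delta>: "0 < \<delta>" "\<delta> \<le> d1" "\<delta> \<le> d2" using d1(1) d2(1) by (auto simp: \<delta>_def)
  note q = level_mapD[OF level_map_mono[OF d1(2) \<delta>(2)]] and r = level_mapD[OF level_map_mono[OF d2(2) \<delta>(3)]]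
  note P = prod_real_manifold[OF M]
  have pair: "smooth_in ?P ?P A (\<lambda>p. (h p, snd p))" if "smooth_in ?P M A h" for A h
    by (rule smooth_in_Pair[OF P M euclidean_manifold _ that smooth_in_snd_real[OF M smooth_in_subset_mspace[OF
        that]]])
      (simp add: euclidean_boundary)
  show ?thesis unfolding level_equiv_def level_map_def
  proof (intro exI conjI allI impI)
    show "0 < \<delta>" by (rule \<delta>(1))
    show "smooth_in ?P M (level M f y0 s1 \<delta>) (\<lambda>p. R (Q p, snd p))"
      by (rule smooth_in_comp[OF P P M pair[OF q(1)] r(1)]) (use q(3) in auto)
    show "smooth_in ?P M (level M f y0 s3 \<delta>) (\<lambda>p. Q' (R' p, snd p))"
      by (rule smooth_in_comp[OF P P M pair[OF r(2)] q(2)]) (use r(4) in auto)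
  qed (use q(3,4) r(3,4) in auto)
qed

text \<open>\<open>s\<close> and \<open>s'\<close> differ only inside a ball of an adapted chart. On
  a line z + y v there, the points of the two level sets with parameter \<open>e\<close> are the
  unique solutions of y = e s(z + y v) and of y = e s'(z + y v). Exchanging the solutions along each
  line gives the two maps; at a point where \<open>s = s'\<close>, the map is the identity by
  uniqueness.\<close>

lemma level_equiv_step:
  fixes \<phi> :: "'a \<Rightarrow> 'e::euclidean_space"
  assumes M: "smooth_manifold M" and ac: "adapted_chart M f x0 U \<phi> V b v \<Omega>"
    and a: "0 < a" "cball (\<phi> x0) (4 * a) \<subseteq> \<Omega>"
    and s: "smooth_in M euclidean_mfd (mspace M) s" "\<And>x. 0 \<le> s x \<and> s x \<le> 1"
    and s': "smooth_in M euclidean_mfd (mspace M) s'" "\<And>x. 0 \<le> s' x \<and> s' x \<le> (1::real)"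
    and C: "closedin (mtop M) C" "C \<subseteq> {y \<in> U. dist (\<phi> x0) (\<phi> y) \<le> a}" and eq: "\<And>x. x \<notin> C \<Longrightarrow> s x = s' x"
    and fx0: "f x0 \<noteq> 0"
  shows "level_equiv M f (f x0) s s'"
proof -
  note A = adapted_chartD[OF ac]
  note U = A(1,2) and c = A(3) and v = A(4-7) and fU = A(8)
  note c' = chart_dataD[OF c] and inv = full_atlas_inv[OF U(1)]
  let ?S = "{z \<in> V. 0 \<le> b \<bullet> z} \<inter> \<Omega>"
  have vv: "v \<bullet> v = 1" using v(2) by (simp add: dot_square_norm)
  define E where "E = {z \<in> V. 0 \<le> b \<bullet> z \<and> v \<bullet> z = 0 \<and> dist (\<phi> x0) z \<le> 2 * a}"
  define pr where "pr p = p - (v \<bullet> p) *\<^sub>R v" for p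
  have vpr: "v \<bullet> pr p = 0" for p by (simp add: pr_def inner_diff_right vv)
  have pr_add: "pr p + (v \<bullet> p) *\<^sub>R v = p" for p by (simp add: pr_def)
  have pr_add2: "pr (z + y *\<^sub>R v) = z" "v \<bullet> (z + y *\<^sub>R v) = y" if "v \<bullet> z = 0" for z y
    using that by (simp_all add: pr_def inner_add_right vv)
  have spr: "smooth_on A pr" for A unfolding pr_def
    by (intro smooth_on_diff smooth_on_scaleR smooth_on_inner smooth_on_const smooth_on_id(1))
  \<comment> \<open>An open box that contains \<open>C\<close>, is preserved by the moves below, and
    lies in the range where solutions are unique.\<close>
  define B where "B = U \<inter> \<phi> -` {p. \<bar>v \<bullet> p\<bar> < 2 * a \<and> dist (\<phi> x0) (pr p) < 2 * a}"
  have "continuous_on UNIV pr" using smooth_on_continuous[OF spr] .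
  then have oB: "openin (mtop M) B" unfolding B_def
    by (intro c'(3) open_Collect_conj open_Collect_less continuous_intros)
  have prE: "pr (\<phi> x) \<in> E" if "x \<in> B" for x
  proof -
    have "\<phi> x \<in> V" "0 \<le> b \<bullet> \<phi> x" using that c'(9) unfolding B_def by blast+
    then have "pr (\<phi> x) \<in> V" "0 \<le> b \<bullet> pr (\<phi> x)"
      using subspace_diff[OF c'(5)] subspace_scale[OF c'(5) v(1)] v(3) by (auto simp: pr_def inner_diff_right)
    then show ?thesis using vpr that by (auto simp: E_def B_def)
  qed
  have CB: "C \<subseteq> B"
  proof
    fix x assume "x \<in> C"
    then have x: "x \<in> U" "norm (\<phi> x0 - \<phi> x) \<le> a" using C(2) by (auto simp: dist_norm)
    have "\<bar>v \<bullet> \<phi> x\<bar> = \<bar>v \<bullet> (\<phi> x0 - \<phi> x)\<bar>" using v(4) by (simp add: inner_diff_right)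
    also have "\<dots> \<le> norm v * norm (\<phi> x0 - \<phi> x)" by (rule Cauchy_Schwarz_ineq2)
    finally have 1: "\<bar>v \<bullet> \<phi> x\<bar> \<le> a" using x v(2) by simp
    have "\<phi> x0 - pr (\<phi> x) = pr (\<phi> x0 - \<phi> x)" using v(4) by (simp add: pr_def inner_diff_right)
    moreover have "norm (pr (\<phi> x0 - \<phi> x)) \<le> norm (\<phi> x0 - \<phi> x)"
    proof -
      have "pr q \<bullet> pr q \<le> q \<bullet> q" for q
      proof -
        have "pr q \<bullet> pr q = q \<bullet> q - (v \<bullet> q)\<^sup>2"
          by (simp add: pr_def inner_diff_left inner_diff_right vv inner_commute power2_eq_square)
        then show ?thesis by simp
      qed
      then show ?thesis by (simp add: norm_le)
    qed
    ultimately have "dist (\<phi> x0) (pr (\<phi> x)) \<le> a" using x by (simp add: dist_norm)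
    then show "x \<in> B" using 1 x a(1) by (simp add: B_def)
  qed
  have inU: "z + y *\<^sub>R v \<in> \<phi> ` U" if "z \<in> E" "\<bar>y\<bar> \<le> 2 * a" for z y
  proof -
    have "dist (\<phi> x0) (z + y *\<^sub>R v) \<le> dist (\<phi> x0) z + dist z (z + y *\<^sub>R v)" by (rule dist_triangle)
    also have "dist z (z + y *\<^sub>R v) = \<bar>y\<bar>" by (simp add: dist_norm v(2))
    finally have "dist (\<phi> x0) (z + y *\<^sub>R v) \<le> 4 * a" using that by (simp add: E_def)
    then have "z + y *\<^sub>R v \<in> \<Omega>" using a(2) by auto
    then show ?thesis unfolding c'(9) using that v subspace_add[OF c'(5)] subspace_scale[OF c'(5)]
      by (auto simp: E_def inner_add_right)
  qed
  have sol: "\<exists>\<delta>>0. \<delta> \<le> a \<and> (\<exists>Y. smooth_on (E \<times> {- \<delta><..<\<delta>}) (\<lambda>q. Y (fst q) (snd q)) \<and>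
     (\<forall>z e. z \<in> E \<longrightarrow> \<bar>e\<bar> < \<delta> \<longrightarrow> \<bar>Y z e\<bar> \<le> \<bar>e\<bar> \<and> Y z e = e * t (inv_into U \<phi> (z + Y z e *\<^sub>R v))) \<and>
     (\<forall>z e y. z \<in> E \<longrightarrow> \<bar>e\<bar> < \<delta> \<longrightarrow> \<bar>y\<bar> \<le> 2 * a \<longrightarrow> y = e * t (inv_into U \<phi> (z + y *\<^sub>R v)) \<longrightarrow> y = Y z e))"
    if t: "smooth_in M euclidean_mfd (mspace M) t" "\<And>x. 0 \<le> t x \<and> t x \<le> (1::real)" for t
  proof -
    have "smooth_on (\<phi> ` (U \<inter> mspace M)) (\<lambda>y. t (inv_into U \<phi> y))" by (rule smooth_in_real_chart[OF M t(1) U(1)])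
    then have "smooth_on ?S (\<lambda>y. t (inv_into U \<phi> y))" using c'(9,10) by (simp add: Int_absorb2)
    then show ?thesis
    proof (rule vertical_solution[OF c'(5) v(1,3,2) c'(8) _ _ a, folded E_def])
      show "0 \<le> t (inv_into U \<phi> q) \<and> t (inv_into U \<phi> q) \<le> 1" for q by (rule t(2))
      fix \<delta> Y assume as: "0 < \<delta>" "\<delta> \<le> a" "smooth_on (E \<times> {- \<delta><..<\<delta>}) (\<lambda>q. Y (fst q) (snd q))"
        "\<And>z e. z \<in> E \<Longrightarrow> \<bar>e\<bar> < \<delta> \<Longrightarrow> \<bar>Y z e\<bar> \<le> \<bar>e\<bar> \<and> Y z e = e * t (inv_into U \<phi> (z + Y z e *\<^sub>R v))"
        "\<And>z e y. z \<in> E \<Longrightarrow> \<bar>e\<bar> < \<delta> \<Longrightarrow> \<bar>y\<bar> \<le> 2 * a \<Longrightarrow> y = e * t (inv_into U \<phi> (z + y *\<^sub>R v)) \<Longrightarrow> y = Y z e"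
      have F1: "\<forall>z e. z \<in> E \<longrightarrow> \<bar>e\<bar> < \<delta> \<longrightarrow> \<bar>Y z e\<bar> \<le> \<bar>e\<bar> \<and> Y z e = e * t (inv_into U \<phi> (z + Y z e *\<^sub>R v))"
        by (intro allI impI, rule as(4))
      have F2: "\<forall>z e y. z \<in> E \<longrightarrow> \<bar>e\<bar> < \<delta> \<longrightarrow> \<bar>y\<bar> \<le> 2 * a \<longrightarrow> y = e * t (inv_into U \<phi> (z + y *\<^sub>R v)) \<longrightarrow> y = Y z e"
        by (intro allI impI, rule as(5))
      show ?thesis by (intro exI[of _ \<delta>] conjI exI[of _ Y] as(1-3) F1 F2)
    qed
  qed
  obtain d1 Y where d1: "0 < d1" "d1 \<le> a" "smooth_on (E \<times> {- d1<..<d1}) (\<lambda>q. Y (fst q) (snd q))"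
    "\<forall>z e. z \<in> E \<longrightarrow> \<bar>e\<bar> < d1 \<longrightarrow> \<bar>Y z e\<bar> \<le> \<bar>e\<bar> \<and> Y z e = e * s (inv_into U \<phi> (z + Y z e *\<^sub>R v))"
    "\<forall>z e y. z \<in> E \<longrightarrow> \<bar>e\<bar> < d1 \<longrightarrow> \<bar>y\<bar> \<le> 2 * a \<longrightarrow> y = e * s (inv_into U \<phi> (z + y *\<^sub>R v)) \<longrightarrow> y = Y z e"
    using sol[OF s] by (elim exE conjE)
  obtain d2 Y' where d2: "0 < d2" "d2 \<le> a" "smooth_on (E \<times> {- d2<..<d2}) (\<lambda>q. Y' (fst q) (snd q))"
    "\<forall>z e. z \<in> E \<longrightarrow> \<bar>e\<bar> < d2 \<longrightarrow> \<bar>Y' z e\<bar> \<le> \<bar>e\<bar> \<and> Y' z e = e * s' (inv_into U \<phi> (z + Y' z e *\<^sub>R v))"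
    "\<forall>z e y. z \<in> E \<longrightarrow> \<bar>e\<bar> < d2 \<longrightarrow> \<bar>y\<bar> \<le> 2 * a \<longrightarrow> y = e * s' (inv_into U \<phi> (z + y *\<^sub>R v)) \<longrightarrow> y = Y' z e"
    using sol[OF s'] by (elim exE conjE)
  \<comment> \<open>The bound 1 makes e s(x) small enough to be recovered from its
    \<open>cis\<close>.\<close>
  define \<delta> where "\<delta> = min (min d1 d2) 1"
  have \<delta>: "0 < \<delta>" "\<delta> \<le> d1" "\<delta> \<le> d2" "\<delta> \<le> a" "\<delta> \<le> 1" using d1 d2 by (auto simp: \<delta>_def)
  let ?P = "prod_mfd M real_mfd"
  note P = prod_real_manifold[OF M]
  \<comment> \<open>everything is symmetric in \<open>s\<close> and \<open>s'\<close>, so one direction of the diffeomorphism suffices\<close>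
  define mv where "mv Y p = (if fst p \<in> B then inv_into U \<phi> (pr (\<phi> (fst p)) + Y (pr (\<phi> (fst p))) (snd p) *\<^sub>R v) else
      fst p)"
    for Y :: "'e \<Rightarrow> real \<Rightarrow> real" and p
  have half: "smooth_in ?P M (level M f (f x0) s \<delta>) (mv Y') \<and>
      (\<forall>x e. (x, e) \<in> level M f (f x0) s \<delta> \<longrightarrow> (mv Y' (x, e), e) \<in> level M f (f x0) s' \<delta> \<and> mv Y (mv Y' (x, e), e) = x)"
    if s: "\<And>x. 0 \<le> s x \<and> s x \<le> 1" and s': "\<And>x. 0 \<le> s' x \<and> s' x \<le> 1"
    and eq: "\<And>x. x \<notin> C \<Longrightarrow> s x = s' x"
    and Y: "\<forall>z e y. z \<in> E \<longrightarrow> \<bar>e\<bar> < d1 \<longrightarrow> \<bar>y\<bar> \<le> 2 * a \<longrightarrow> y = e * s (inv_into U \<phi> (z + y *\<^sub>R v)) \<longrightarrow> y = Y z e"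
    and sY': "smooth_on (E \<times> {- d2<..<d2}) (\<lambda>q. Y' (fst q) (snd q))"
    and Y': "\<forall>z e. z \<in> E \<longrightarrow> \<bar>e\<bar> < d2 \<longrightarrow> \<bar>Y' z e\<bar> \<le> \<bar>e\<bar> \<and> Y' z e = e * s' (inv_into U \<phi> (z + Y' z e *\<^sub>R v))"
      "\<forall>z e y. z \<in> E \<longrightarrow> \<bar>e\<bar> < d2 \<longrightarrow> \<bar>y\<bar> \<le> 2 * a \<longrightarrow> y = e * s' (inv_into U \<phi> (z + y *\<^sub>R v)) \<longrightarrow> y = Y' z e"
    and d: "\<delta> \<le> d1" "\<delta> \<le> d2"
    for s s' :: "'a \<Rightarrow> real" and Y Y' d1 d2
  proof -
    have small: "v \<bullet> \<phi> x = e * r x" if "x \<in> B" "(x, e) \<in> level M f (f x0) r \<delta>" "\<And>x. 0 \<le> r x \<and> r x \<le> 1" for x e r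
    proof -
      have xU: "x \<in> U" using that(1) by (simp add: B_def)
      have "\<bar>e * r x\<bar> \<le> \<bar>e\<bar>" using that(3)[of x] by (simp add: abs_mult mult_left_le)
      then have "\<bar>e * r x\<bar> < 1" using that(2) \<delta>(5) by (auto simp: level_def)
      moreover have "f x0 * cis (v \<bullet> \<phi> x) = f x0 * cis (e * r x)"
        using fU[OF xU] that(2) by (simp add: level_def)
      ultimately show ?thesis using cis_eq_iff_small fU[OF xU] fx0 by auto
    qed
    have e\<delta>: "\<bar>e\<bar> < \<delta>" "x \<in> mspace M" if "(x, e) \<in> level M f (f x0) r \<delta>" for x e r using that
        by (auto simp: level_def)
    have inB: "mv Y' (x, e) \<in> B \<and> \<phi> (mv Y' (x, e)) = pr (\<phi> x) + Y' (pr (\<phi> x)) e *\<^sub>R v \<and>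
        f (mv Y' (x, e)) = f x0 * cis (e * s' (mv Y' (x, e))) \<and> mv Y' (x, e) \<in> mspace M \<and>
            pr (\<phi> (mv Y' (x, e))) = pr (\<phi> x)"
      if x: "x \<in> B" "\<bar>e\<bar> < \<delta>" for x e
    proof -
      let ?z = "pr (\<phi> x)" and ?x = "mv Y' (x, e)"
      have z: "?z \<in> E" "dist (\<phi> x0) ?z < 2 * a" using prE[OF x(1)] x(1) by (auto simp: B_def)
      have y: "\<bar>Y' ?z e\<bar> \<le> \<bar>e\<bar>" "Y' ?z e = e * s' (inv_into U \<phi> (?z + Y' ?z e *\<^sub>R v))"
        using Y'(1) z x(2) d(2) by auto
      then have y2: "\<bar>Y' ?z e\<bar> < 2 * a" using x(2) \<delta>(4) a(1) by linarith
      have "?z + Y' ?z e *\<^sub>R v \<in> \<phi> ` U" using inU[OF z(1)] y2 by simp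
      then obtain w where w: "w \<in> U" "\<phi> w = ?z + Y' ?z e *\<^sub>R v" by (metis imageE)
      have xw: "?x = w" using x(1) inv[OF w(1)] w(2) by (simp add: mv_def)
      have vw: "v \<bullet> \<phi> w = Y' ?z e" "pr (\<phi> w) = ?z" unfolding w(2) using pr_add2[OF vpr] by simp_all
      have "w \<in> B" using w(1) y2 z(2) vw by (simp add: B_def)
      moreover have "f w = f x0 * cis (e * s' w)"
        using fU[OF w(1)] y(2) inv[OF w(1)] vw(1) w(2) by (metis (no_types))
      ultimately show ?thesis using xw w vw c'(10) by auto
    qed
    have fwd: "(mv Y' (x, e), e) \<in> level M f (f x0) s' \<delta> \<and> mv Y (mv Y' (x, e), e) = x"
      if x: "(x, e) \<in> level M f (f x0) s \<delta>" for x e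
    proof (cases "x \<in> B")
      case True
      note i = inB[OF True e\<delta>(1)[OF x]]
      have vx: "v \<bullet> \<phi> x = e * s x" by (rule small[OF True x s])
      have "v \<bullet> \<phi> x = e * s (inv_into U \<phi> (pr (\<phi> x) + (v \<bullet> \<phi> x) *\<^sub>R v))"
        unfolding pr_add using vx inv[of x] True by (simp add: B_def)
      moreover have "\<bar>v \<bullet> \<phi> x\<bar> \<le> 2 * a" using True by (simp add: B_def)
      ultimately have "v \<bullet> \<phi> x = Y (pr (\<phi> x)) e" using Y prE[OF True] e\<delta>(1)[OF x] d(1) by auto
      then have "mv Y (mv Y' (x, e), e) = inv_into U \<phi> (pr (\<phi> x) + (v \<bullet> \<phi> x) *\<^sub>R v)"
      proof -
        have "mv Y' (x, e) \<in> B" "pr (\<phi> (mv Y' (x, e))) = pr (\<phi> x)" using i by blast+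
        then show ?thesis unfolding mv_def[of Y] fst_conv snd_conv \<open>v \<bullet> \<phi> x = Y (pr (\<phi> x)) e\<close> by simp
      qed
      then have "mv Y (mv Y' (x, e), e) = x" unfolding pr_add using inv[of x] True by (simp add: B_def)
      then show ?thesis using i e\<delta>[OF x] by (simp add: level_def)
    next
      case False
      then have "x \<notin> C" using CB by auto
      then show ?thesis using x eq False by (simp add: mv_def level_def)
    qed
    have "smooth_in ?P M (level M f (f x0) s \<delta>) (mv Y')"
    proof (rule smooth_in_local)
      fix p assume p: "p \<in> level M f (f x0) s \<delta>"
      obtain x e where xe: "p = (x, e)" by (cases p)
      let ?L = "level M f (f x0) s \<delta>"
      show "\<exists>T. openin (mtop ?P) T \<and> p \<in> T \<and> smooth_in ?P M (?L \<inter> T) (mv Y')"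
      proof (cases "x \<in> B")
        case True
        let ?A = "?L \<inter> B \<times> UNIV"
        have A: "?A \<subseteq> mspace ?P" using level_subset by blast
        have f1: "smooth_in ?P euclidean_mfd ?A (\<lambda>p. \<phi> (fst p))"
          by (rule smooth_in_comp[OF P M euclidean_manifold smooth_in_fst_real[OF M A] smooth_in_chart[OF M U(1)]])
            (auto simp: B_def)
        have sub: "smooth_on {q. pr (fst q) \<in> E \<and> \<bar>snd q\<bar> < \<delta>} (\<lambda>q. pr (fst q) + Y' (pr (fst q)) (snd q) *\<^sub>R v)"
        proof -
          have 1: "smooth_on {q. pr (fst q) \<in> E \<and> \<bar>snd q\<bar> < \<delta>} (\<lambda>q::'e \<times> real. pr (fst q))"
            by (rule smooth_on_comp[OF smooth_on_fst[OF smooth_on_id(1)] spr[of UNIV]]) simp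
          have "smooth_on {q. pr (fst q) \<in> E \<and> \<bar>snd q\<bar> < \<delta>} (\<lambda>q::'e \<times> real. (pr (fst q), snd q))"
            by (rule smooth_on_Pair[OF 1 smooth_on_snd[OF smooth_on_id(1)]])
          then have "smooth_on {q. pr (fst q) \<in> E \<and> \<bar>snd q\<bar> < \<delta>}
              (\<lambda>q::'e \<times> real. Y' (fst (pr (fst q), snd q)) (snd (pr (fst q), snd q)))"
            by (rule smooth_on_comp[OF _ sY']) (use d(2) in auto)
          then have 2: "smooth_on {q. pr (fst q) \<in> E \<and> \<bar>snd q\<bar> < \<delta>} (\<lambda>q::'e \<times> real. Y' (pr (fst q)) (snd q))"
            by simp
          show ?thesis by (intro smooth_on_add smooth_on_scaleR smooth_on_const 1 2)
        qed
        have f2: "smooth_in ?P euclidean_mfd ?A (\<lambda>p. pr (\<phi> (fst p)) + Y' (pr (\<phi> (fst p))) (snd p) *\<^sub>R v)"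
          by (rule smooth_in_comp2[OF P f1 smooth_in_snd_real[OF M A] sub]) (use prE e\<delta> in auto)
        have "smooth_in ?P M ?A (\<lambda>p. inv_into U \<phi> (pr (\<phi> (fst p)) + Y' (pr (\<phi> (fst p))) (snd p) *\<^sub>R v))"
        proof (rule smooth_in_comp[OF P euclidean_manifold M f2 smooth_in_chart_inverse[OF M U(1)]])
          fix q assume "q \<in> ?A"
          then obtain x e where q: "q = (x, e)" "x \<in> B" "\<bar>e\<bar> < \<delta>" using e\<delta> by (cases q) auto
          have "\<bar>Y' (pr (\<phi> x)) e\<bar> \<le> \<bar>e\<bar>" using Y'(1) prE[OF q(2)] q(3) d(2) by auto
          then have "\<bar>Y' (pr (\<phi> x)) e\<bar> \<le> 2 * a" using q(3) \<delta>(4) a(1) by linarith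
          from inU[OF prE[OF q(2)] this] show "pr (\<phi> (fst q)) + Y' (pr (\<phi> (fst q))) (snd q) *\<^sub>R v \<in> \<phi> ` U"
            by (simp add: q(1))
        qed
        then have "smooth_in ?P M ?A (mv Y')" by (rule smooth_in_cong) (auto simp: mv_def)
        moreover have "openin (mtop ?P) (B \<times> UNIV)" using oB by (simp add: openin_prod_Times_iff)
        ultimately show ?thesis using True xe by (intro exI[of _ "B \<times> UNIV"]) simp
      next
        case False
        \<comment> \<open>Off \<open>C\<close> the move is the identity even at points of
          \<open>B\<close>, so this piece overlaps the previous one and the two cover the level
          set.\<close>
        let ?A = "?L \<inter> (mspace M - C) \<times> UNIV"
        have A: "?A \<subseteq> mspace ?P" using level_subset by blast
        have "smooth_in ?P M ?A (mv Y')"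
        proof (rule smooth_in_cong[OF smooth_in_fst_real[OF M A]])
          fix q assume "q \<in> ?A"
          then obtain x e where q: "q = (x, e)" "(x, e) \<in> ?L" "x \<notin> C" by (cases q) auto
          show "fst q = mv Y' q"
          proof (cases "x \<in> B")
            case True
            have "(x, e) \<in> level M f (f x0) s' \<delta>" using q(2) eq[OF q(3)] by (simp add: level_def)
            then have vx: "v \<bullet> \<phi> x = e * s' x" by (rule small[OF True _ s'])
            have "v \<bullet> \<phi> x = e * s' (inv_into U \<phi> (pr (\<phi> x) + (v \<bullet> \<phi> x) *\<^sub>R v))"
              unfolding pr_add using vx inv[of x] True by (simp add: B_def)
            moreover have "\<bar>v \<bullet> \<phi> x\<bar> \<le> 2 * a" using True by (simp add: B_def)
            ultimately have "v \<bullet> \<phi> x = Y' (pr (\<phi> x)) e" using Y'(2) prE[OF True] e\<delta>(1)[OF q(2)] d(2) by auto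
            then have "mv Y' q = inv_into U \<phi> (pr (\<phi> x) + (v \<bullet> \<phi> x) *\<^sub>R v)"
              using True by (simp add: mv_def q(1))
            then show ?thesis unfolding pr_add using inv[of x] True by (simp add: B_def q(1))
          qed (simp add: mv_def q(1))
        qed
        moreover have "openin (mtop ?P) ((mspace M - C) \<times> UNIV)" using C(1)
            by (simp add: openin_prod_Times_iff closedin_def)
        moreover have "p \<in> (mspace M - C) \<times> UNIV" using False CB xe e\<delta>(2) p by auto
        ultimately show ?thesis by (intro exI[of _ "(mspace M - C) \<times> UNIV"]) simp
      qed
    qed
    then show ?thesis using fwd by simp
  qed
  have eq': "s' x = s x" if "x \<notin> C" for x using eq[OF that] by simp
  note h1 = half[OF s(2) s'(2) eq d1(5) d2(3,4,5) \<delta>(2,3)] and h2 = half[OF s'(2) s(2) eq' d2(5) d1(3,4,5) \<delta>(3,2)]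
  show ?thesis unfolding level_equiv_def level_map_def
    by (intro exI[of _ \<delta>] exI[of _ "mv Y'"] exI[of _ "mv Y"] conjI \<delta>(1))
      (use h1 h2 in auto)
qed

lemma smooth_in_id:
  assumes M: "smooth_manifold M" and A: "A \<subseteq> mspace M"
  shows "smooth_in M M A (\<lambda>x. x)"
proof (rule smooth_inI[OF A])
  show "continuous_map (subtopology (mtop M) A) (mtop M) (\<lambda>x. x)"
    by (rule continuous_map_from_subtopology) simp
  fix x assume "x \<in> A"
  then have "x \<in> mspace M" using A by auto
  then obtain U \<phi> where U: "(U, \<phi>) \<in> full_atlas M" "x \<in> U" using atlas_cover[OF M] by metis
  have "smooth_on (\<phi> ` (U \<inter> U \<inter> A \<inter> (\<lambda>x. x) -` U)) (\<lambda>y. \<phi> (inv_into U \<phi> y))"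
    by (rule smooth_on_subset[OF full_atlas_compatible[OF M U(1) U(1)]]) auto
  then show "\<exists>U \<phi> V \<psi> T. (U, \<phi>) \<in> full_atlas M \<and> (V, \<psi>) \<in> full_atlas M \<and> x \<in> U \<and> x \<in> V \<and>
     openin (mtop M) T \<and> x \<in> T \<and> smooth_on (\<phi> ` (U \<inter> T \<inter> A \<inter> (\<lambda>x. x) -` V)) (\<lambda>y. \<psi> (inv_into U \<phi> y))"
    using U chart_openin[OF full_atlas_chart[OF U(1)]]
    by (intro exI[of _ U] exI[of _ \<phi>] exI[of _ U] exI[of _ \<phi>] exI[of _ U]) simp
qed

lemma open_part_boundary:
  assumes M: "smooth_manifold M" and S: "openin (mtop M) S" and x: "x \<in> mboundary (open_part M S)"
  shows "x \<in> mboundary M"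
proof -
  note N = open_part_manifold[OF M S]
  have "x \<in> S" using mboundary_subset[OF N] x by auto
  show ?thesis
    by (rule mboundary_embedding[OF M N _ S \<open>x \<in> S\<close>, of "\<lambda>x. x"]) (use x in auto)
qed

lemma compact_space_pos_min:
  assumes X: "compactin X K" and g: "continuous_map (subtopology X K) euclideanreal g" and pos: "\<And>x. x \<in> K \<Longrightarrow> 0 < g x"
  obtains m where "0 < m" "\<And>x. x \<in> K \<Longrightarrow> m \<le> g x"
proof (cases "K = {}")
  case True then show ?thesis using that[of 1] by simp
next
  case False
  have "compactin (subtopology X K) K" using X by (simp add: compactin_subtopology)
  then have "compact (g ` K)" using image_compactin[OF _ g] by simp
  then obtain m where "m \<in> g ` K" "\<And>y. y \<in> g ` K \<Longrightarrow> m \<le> y"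
    using compact_attains_inf[of "g ` K"] False by auto
  then show ?thesis using that[of m] pos by auto
qed

text \<open>\<open>A\<close> is the angle relative to \<open>y0\<close>, given by the principal
  logarithm on a half-plane. The arc stays in this half-plane because its angles are below 1, hence
  below pi/2.\<close>

lemma arc_chart:
  assumes y0: "norm y0 = 1" and d: "0 < \<delta>" "\<delta> \<le> 1"
  obtains A H where "smooth_on H A" "openin (top_of_set (sphere 0 1)) {y. \<exists>t. \<bar>t\<bar> < \<delta> \<and> y = y0 * cis t}"
    "{y. \<exists>t. \<bar>t\<bar> < \<delta> \<and> y = y0 * cis t} \<subseteq> H" "\<And>t. \<bar>t\<bar> < \<delta> \<Longrightarrow> A (y0 * cis t) = (t::real)"
proof -
  let ?H = "{z. 0 < Re (z / y0)}"
  let ?A = "\<lambda>z. Im (Ln (z / y0))"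
  have nz: "y0 \<noteq> 0" using y0 by auto
  have sA: "smooth_on ?H ?A"
    by (intro smooth_on_Im smooth_on_Ln smooth_on_divide smooth_on_id(1) smooth_on_const)
      (use nz in \<open>auto simp: complex_nonpos_Reals_iff\<close>)
  have oH: "open ?H" by (intro open_Collect_less continuous_intros) (use nz in auto)
  have val: "y0 * cis t \<in> ?H \<and> ?A (y0 * cis t) = t" if "\<bar>t\<bar> < \<delta>" for t
  proof -
    have t: "\<bar>t\<bar> < 1" using that d by linarith
    then have "0 < cos t" by (intro cos_gt_zero_pi) (use pi_gt3 in linarith)+
    moreover have "\<bar>t\<bar> < pi" using t pi_gt3 by linarith
    ultimately show ?thesis using nz by (simp add: Ln_cis)
  qed
  have "open (?H \<inter> ?A -` {- \<delta><..<\<delta>})"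
    by (rule continuous_open_preimage[OF smooth_on_continuous[OF sA] oH]) simp
  moreover have "{y. \<exists>t. \<bar>t\<bar> < \<delta> \<and> y = y0 * cis t} = sphere 0 1 \<inter> (?H \<inter> ?A -` {- \<delta><..<\<delta>})"
  proof (intro equalityI subsetI)
    fix y assume "y \<in> {y. \<exists>t. \<bar>t\<bar> < \<delta> \<and> y = y0 * cis t}"
    then obtain t where t: "\<bar>t\<bar> < \<delta>" "y = y0 * cis t" by auto
    have "norm y = 1" using t(2) y0 by (simp add: norm_mult)
    then show "y \<in> sphere 0 1 \<inter> (?H \<inter> ?A -` {- \<delta><..<\<delta>})" using val[OF t(1)] t by auto
  next
    fix y assume y: "y \<in> sphere 0 1 \<inter> (?H \<inter> ?A -` {- \<delta><..<\<delta>})"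
    then have "norm (y / y0) = 1" using y0 by (simp add: norm_divide)
    then have "y = y0 * cis (?A y)" using Ln_norm_1[of "y / y0"] nz by (simp add: field_simps)
    moreover have "\<bar>?A y\<bar> < \<delta>" using y by auto
    ultimately show "y \<in> {y. \<exists>t. \<bar>t\<bar> < \<delta> \<and> y = y0 * cis t}" by blast
  qed
  ultimately have "openin (top_of_set (sphere 0 1)) {y. \<exists>t. \<bar>t\<bar> < \<delta> \<and> y = y0 * cis t}"
    by (metis openin_open_Int)
  moreover have "{y. \<exists>t. \<bar>t\<bar> < \<delta> \<and> y = y0 * cis t} \<subseteq> ?H"
  proof
    fix y assume "y \<in> {y. \<exists>t. \<bar>t\<bar> < \<delta> \<and> y = y0 * cis t}"
    then obtain t where "\<bar>t\<bar> < \<delta>" "y = y0 * cis t" by auto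
    then show "y \<in> ?H" using conjunct1[OF val] by (simp only:)
  qed
  ultimately show thesis using that[OF sA _ _ conjunct2[OF val]] by (simp only:)
qed

text \<open>Multiplication by \<open>1 - \<beta>\<close> changes \<open>s\<close> only in the
  support of the bump, so it is one application of \<open>level_equiv_step\<close>; afterwards the
  function vanishes near \<open>x\<close>. The same \<open>\<beta>\<close> works for every
  \<open>s\<close>, which allows the steps to be iterated.\<close>

lemma level_equiv_shrink:
  assumes M: "smooth_manifold M" and ac: "adapted_chart M f x U \<phi> V b v \<Omega>" and fx: "f x \<noteq> 0"
  obtains \<beta> T where "openin (mtop M) T" "x \<in> T" "\<And>y. y \<in> T \<Longrightarrow> \<beta> y = 1"
    "smooth_in M euclidean_mfd (mspace M) \<beta>" "\<And>y. 0 \<le> \<beta> y \<and> \<beta> y \<le> 1"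
    "\<And>s. smooth_in M euclidean_mfd (mspace M) s \<Longrightarrow> (\<And>y. 0 \<le> s y \<and> s y \<le> 1) \<Longrightarrow>
       level_equiv M f (f x) s (\<lambda>y. (1 - \<beta> y) * s y :: real)"
proof -
  note A = adapted_chartD[OF ac]
  have "\<phi> x \<in> \<Omega>" using chart_dataD(9)[OF A(3)] A(2) by blast
  then obtain e where e: "0 < e" "cball (\<phi> x) e \<subseteq> \<Omega>"
    using chart_dataD(8)[OF A(3)] open_contains_cball by metis
  \<comment> \<open>\<open>level_equiv_step\<close> needs a ball of radius \<open>4 * a\<close>
    inside \<open>\<Omega>\<close>, while the bump is supported in radius \<open>a\<close>.\<close>
  define a where "a = e / 4"
  have a: "0 < a" "cball (\<phi> x) (4 * a) \<subseteq> \<Omega>" "cball (\<phi> x) a \<subseteq> \<Omega>"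
    using e subset_cball[of a e "\<phi> x"] by (auto simp: a_def)
  define \<beta> where "\<beta> = (\<lambda>y. if y \<in> U then plateau ((dist (\<phi> x) (\<phi> y))\<^sup>2 / a\<^sup>2) else 0)"
  note B0 = chart_bump[OF M A(1,3,2) a(1,3)]
  have B1: "smooth_in M euclidean_mfd (mspace M) \<beta>" unfolding \<beta>_def by (rule B0(1))
  have B2: "0 \<le> \<beta> y \<and> \<beta> y \<le> 1" for y unfolding \<beta>_def by (rule B0(2))
  have B5: "\<beta> y = 0" if "y \<notin> {y \<in> U. dist (\<phi> x) (\<phi> y) \<le> a}" for y unfolding \<beta>_def by (rule B0(5)[OF that])
  have "\<exists>T. openin (mtop M) T \<and> x \<in> T \<and> (\<forall>y\<in>T. \<beta> y = 1)" unfolding \<beta>_def by (rule B0(6))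
  then obtain T where T: "openin (mtop M) T" "x \<in> T" "\<forall>y\<in>T. \<beta> y = 1" by (elim exE conjE)
  have "level_equiv M f (f x) s (\<lambda>y. (1 - \<beta> y) * s y)"
    if s: "smooth_in M euclidean_mfd (mspace M) s" "\<And>y. 0 \<le> s y \<and> s y \<le> 1" for s
  proof (rule level_equiv_step[OF M ac a(1,2) s _ _ B0(3) order_refl _ fx])
    have 1: "smooth_in M euclidean_mfd (mspace M) (\<lambda>y. 1 - \<beta> y)"
      by (rule smooth_in_comp2[OF M smooth_in_const[OF M order_refl] B1, where S=UNIV])
        (auto intro!: smooth_on_diff smooth_on_fst smooth_on_snd)
    show "smooth_in M euclidean_mfd (mspace M) (\<lambda>y. (1 - \<beta> y) * s y)" by (rule smooth_in_mult[OF M 1 s(1)])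
    show "0 \<le> (1 - \<beta> y) * s y \<and> (1 - \<beta> y) * s y \<le> 1" for y
      using B2[of y] s(2)[of y] by (auto intro: mult_le_one)
    show "s y = (1 - \<beta> y) * s y" if "y \<notin> {y \<in> U. dist (\<phi> x) (\<phi> y) \<le> a}" for y
      using B5[OF that] by simp
  qed
  from that[OF T(1,2) bspec[OF T(3)] B1 B2 this] show thesis .
qed

text \<open>The fiber is compact. Shrinking at finitely many of its points, one after the other and
  starting from the constant 1, ends with a product of factors \<open>1 - \<beta> i\<close>, which
  is zero near the fiber.\<close>

lemma level_equiv_vanishing:
  assumes M: "smooth_manifold M" and comp: "compact_space (mtop M)"
    and f: "smooth_in M circle_mfd (mspace M) f"
    and ad: "\<And>x. x \<in> mspace M \<Longrightarrow> \<exists>U \<phi> V b v \<Omega>. adapted_chart M f x U \<phi> V b v \<Omega>"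
    and y0: "norm y0 = 1"
  obtains \<sigma> Z where "level_equiv M f y0 (\<lambda>_. 1) \<sigma>" "openin (mtop M) Z" "fiber M f y0 \<subseteq> Z" "\<And>x. x \<in> Z \<Longrightarrow> \<sigma> x = 0"
    "\<And>x. 0 \<le> \<sigma> x \<and> \<sigma> x \<le> 1"
proof -
  let ?F = "fiber M f y0"
  \<comment> \<open>Bundles the output of \<open>level_equiv_shrink\<close>, so that bumps can be
    chosen for all points of the fiber at once.\<close>
  define ok where "ok x \<beta> T \<longleftrightarrow> openin (mtop M) T \<and> x \<in> T \<and> (\<forall>y\<in>T. \<beta> y = 1) \<and>
    smooth_in M euclidean_mfd (mspace M) \<beta> \<and> (\<forall>y. 0 \<le> \<beta> y \<and> \<beta> y \<le> (1::real)) \<and>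
    (\<forall>s. smooth_in M euclidean_mfd (mspace M) s \<longrightarrow> (\<forall>y. 0 \<le> s y \<and> s y \<le> 1) \<longrightarrow>
       level_equiv M f y0 s (\<lambda>y. (1 - \<beta> y) * s y))" for x \<beta> T
  have "\<exists>\<beta> T. ok x \<beta> T" if x: "x \<in> ?F" for x
  proof -
    have xM: "x \<in> mspace M" and fx: "f x = y0" using x by (auto simp: fiber_def)
    obtain U \<phi> V b v \<Omega> where ac: "adapted_chart M f x U \<phi> V b v \<Omega>" using ad[OF xM] by (elim exE)
    have "f x \<noteq> 0" using fx y0 by auto
    show ?thesis
    proof (rule level_equiv_shrink[OF M ac \<open>f x \<noteq> 0\<close>])
      fix \<beta> T assume a: "openin (mtop M) T" "x \<in> T" "\<And>y. y \<in> T \<Longrightarrow> \<beta> y = 1"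
        "smooth_in M euclidean_mfd (mspace M) \<beta>" "\<And>y. 0 \<le> \<beta> y \<and> \<beta> y \<le> 1"
        "\<And>s. smooth_in M euclidean_mfd (mspace M) s \<Longrightarrow> (\<And>y. 0 \<le> s y \<and> s y \<le> 1) \<Longrightarrow>
          level_equiv M f (f x) s (\<lambda>y. (1 - \<beta> y) * s y :: real)"
      have "ok x \<beta> T" unfolding ok_def
      proof (intro conjI ballI allI impI)
        fix s assume "smooth_in M euclidean_mfd (mspace M) s" "\<forall>y. 0 \<le> s y \<and> s y \<le> (1::real)"
        then show "level_equiv M f y0 s (\<lambda>y. (1 - \<beta> y) * s y)" using a(6)[unfolded fx] by simp
      qed (use a(1-5) in simp_all)
      then show ?thesis by (intro exI)
    qed
  qed
  then obtain \<beta> T where bT: "\<And>x. x \<in> ?F \<Longrightarrow> ok x (\<beta> x) (T x)" by metis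
  have "closedin (mtop M) {x \<in> mspace M. f x \<in> {y0}}"
    by (rule closedin_continuous_map_preimage[OF smooth_in_continuous[OF f, simplified]]) (use y0 in simp)
  then have "closedin (mtop M) ?F" by (simp add: fiber_def)
  then have cF: "compactin (mtop M) ?F" using comp closedin_compact_space by blast
  have "(\<forall>U\<in>T ` ?F. openin (mtop M) U) \<and> ?F \<subseteq> \<Union>(T ` ?F)" using bT by (auto simp: ok_def)
  then obtain G where G: "finite G" "G \<subseteq> T ` ?F" "?F \<subseteq> \<Union>G" using cF unfolding compactin_def by metis
  obtain I where I: "finite I" "I \<subseteq> ?F" "G = T ` I" using finite_subset_image[OF G(1,2)] by metis
  define \<sigma> where "\<sigma> J y = (\<Prod>i\<in>J. 1 - \<beta> i y)" for J y
  have ok1: "0 \<le> \<beta> i y \<and> \<beta> i y \<le> 1" if "i \<in> I" for i y using bT[of i] I(2) that by (auto simp: ok_def)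
  have oks: "smooth_in M euclidean_mfd (mspace M) (\<beta> i)" if "i \<in> I" for i using bT[of i] I(2) that
      by (auto simp: ok_def)
  have \<sigma>1: "0 \<le> \<sigma> J y \<and> \<sigma> J y \<le> 1" if "J \<subseteq> I" for J y
    unfolding \<sigma>_def using ok1 that by (auto intro!: prod_nonneg prod_le_1)
  have \<sigma>s: "smooth_in M euclidean_mfd (mspace M) (\<sigma> J)" if "J \<subseteq> I" for J
    unfolding \<sigma>_def
  proof (rule smooth_in_prod[OF M order_refl])
    fix i assume "i \<in> J"
    then have s: "smooth_in M euclidean_mfd (mspace M) (\<beta> i)" using oks that by auto
    show "smooth_in M euclidean_mfd (mspace M) (\<lambda>y. 1 - \<beta> i y)"
      by (rule smooth_in_comp2[OF M smooth_in_const[OF M order_refl] s, where S=UNIV])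
        (auto intro!: smooth_on_diff smooth_on_fst smooth_on_snd)
  qed
  have "level_equiv M f y0 (\<lambda>_. 1) (\<sigma> J)" if "J \<subseteq> I" for J
    using finite_subset[OF that I(1)] that
  proof (induction J rule: finite_induct)
    case empty
    then show ?case using level_equiv_refl[OF M, of f y0 "\<lambda>_. 1"] by (simp add: \<sigma>_def)
  next
    case (insert i J)
    have i: "i \<in> I" "J \<subseteq> I" using insert.prems by auto
    have "\<forall>s. smooth_in M euclidean_mfd (mspace M) s \<longrightarrow> (\<forall>y. 0 \<le> s y \<and> s y \<le> 1) \<longrightarrow>
       level_equiv M f y0 s (\<lambda>y. (1 - \<beta> i y) * s y)" using bT[of i] i I(2) unfolding ok_def by blast
    from this[rule_format, OF \<sigma>s[OF i(2)]] \<sigma>1[OF i(2)]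
    have "level_equiv M f y0 (\<sigma> J) (\<lambda>y. (1 - \<beta> i y) * \<sigma> J y)" by simp
    moreover have "(\<lambda>y. (1 - \<beta> i y) * \<sigma> J y) = \<sigma> (insert i J)" using insert.hyps by (simp add: \<sigma>_def fun_eq_iff)
    ultimately show ?case using level_equiv_trans[OF M insert.IH[OF i(2)]] by simp
  qed
  then have e: "level_equiv M f y0 (\<lambda>_. 1) (\<sigma> I)" by simp
  show thesis
  proof (rule that[OF e, of "\<Union>(T ` I)"])
    show "openin (mtop M) (\<Union>(T ` I))" using bT I(2) by (intro openin_Union) (auto simp: ok_def)
    show "fiber M f y0 \<subseteq> \<Union>(T ` I)" using G(3) I(3) by simp
    show "0 \<le> \<sigma> I x \<and> \<sigma> I x \<le> 1" for x by (rule \<sigma>1) simp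
    fix x assume "x \<in> \<Union>(T ` I)"
    then obtain i where i: "i \<in> I" "x \<in> T i" by auto
    then have "\<beta> i x = 1" using bT[of i] I(2) by (auto simp: ok_def)
    then show "\<sigma> I x = 0" unfolding \<sigma>_def using i I(1) by (intro prod_zero) auto
  qed
qed

text \<open>Off a neighborhood \<open>Z\<close> of the fiber on which \<sigma> vanishes,
  \<open>f\<close> keeps a positive distance from \<open>y0\<close> by compactness. So for small
  \<open>e\<close> every point of the level set of \<sigma> lies in \<open>Z\<close>, hence in the
  fiber, and this level set is the fiber times an interval. The level set of 1 is the tube over an
  arc, and the equivalence between the two is the local trivialization.\<close>

theorem fibration_of_adapted_charts:
  assumes M: "smooth_manifold M" and comp: "compact_space (mtop M)"
    and f: "smooth_in M circle_mfd (mspace M) f" and surj: "f ` mspace M = sphere 0 1"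
    and ad: "\<And>x. x \<in> mspace M \<Longrightarrow> \<exists>U \<phi> V b v \<Omega>. adapted_chart M f x U \<phi> V b v \<Omega>"
  shows "fibration M circle_mfd f"
proof -
  have f1: "norm (f x) = 1" if "x \<in> mspace M" for x using surj that by auto
  have fC: "smooth_in M euclidean_mfd (mspace M) f" using f unfolding smooth_in_circle_iff[OF M] by simp
  have fib: "smooth_manifold (submfd (mdim M - 1) M (fiber M f y))" for y
  proof (rule fiber_submanifold[OF M ad])
    fix x assume "x \<in> mspace M"
    then show "f x \<noteq> 0" using f1[of x] by auto
  qed
  have triv: "\<exists>U h. openin (mtop circle_mfd) U \<and> y0 \<in> U \<and>
           diffeo (open_part M {x \<in> mspace M. f x \<in> U})
                  (prod_mfd (open_part circle_mfd U) (submfd (mdim M - 1) M (fiber M f y0))) h \<and>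
           (\<forall>x\<in>mspace M. f x \<in> U \<longrightarrow> fst (h x) = f x)" if y0: "norm y0 = 1" for y0
  proof -
    let ?F = "fiber M f y0"
    have y0nz: "y0 \<noteq> 0" using y0 by auto
    obtain \<sigma> Z where \<sigma>: "level_equiv M f y0 (\<lambda>_. 1) \<sigma>" and Z: "openin (mtop M) Z" "?F \<subseteq> Z"
      and \<sigma>Z: "\<And>x. x \<in> Z \<Longrightarrow> \<sigma> x = 0" and \<sigma>1: "\<And>x. 0 \<le> \<sigma> x \<and> \<sigma> x \<le> 1"
      using level_equiv_vanishing[OF M comp f ad y0] by blast
    have "continuous_map (mtop M) euclidean f" using smooth_in_continuous[OF fC] by simp
    then have "continuous_map (mtop M) euclideanreal (\<lambda>x. norm (f x - y0))"
      by (intro continuous_map_norm continuous_map_diff) auto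
    then have c1: "continuous_map (subtopology (mtop M) (mspace M - Z)) euclideanreal (\<lambda>x. norm (f x - y0))"
      by (rule continuous_map_from_subtopology)
    have c2: "compactin (mtop M) (mspace M - Z)" using comp Z(1) closedin_compact_space by blast
    have c3: "0 < norm (f x - y0)" if "x \<in> mspace M - Z" for x using that Z(2) by (auto simp: fiber_def)
    obtain m where m: "0 < m" "\<And>x. x \<in> mspace M - Z \<Longrightarrow> m \<le> norm (f x - y0)"
      using compact_space_pos_min[OF c2 c1 c3] by blast
    have "continuous_on UNIV (\<lambda>t. norm (y0 * cis t - y0))" by (intro continuous_intros)
    then have "open {t. norm (y0 * cis t - y0) < m}" by (intro open_Collect_less continuous_intros)
    moreover have "0 \<in> {t. norm (y0 * cis t - y0) < m}" using m by simp
    ultimately obtain d0 where d0': "0 < d0" "ball 0 d0 \<subseteq> {t. norm (y0 * cis t - y0) < m}"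
      by (meson open_contains_ball_eq)
    have d0: "0 < d0" "\<And>t. \<bar>t\<bar> < d0 \<Longrightarrow> norm (y0 * cis t - y0) < m"
      using d0' by (auto simp: subset_iff dist_real_def)
    obtain d1 Q Q' where d1: "0 < d1" "level_map M f y0 (\<lambda>_. 1) \<sigma> d1 Q Q'"
      using \<sigma> unfolding level_equiv_def by (elim exE conjE)
    define \<delta> where "\<delta> = min (min d0 d1) 1"
    have \<delta>: "0 < \<delta>" "\<delta> \<le> 1" "\<delta> \<le> d0" "\<delta> \<le> d1" using d0 d1 by (auto simp: \<delta>_def)
    note L = level_mapD[OF level_map_mono[OF d1(2) \<delta>(4)]]
    let ?L1 = "level M f y0 (\<lambda>_. 1) \<delta>" and ?L0 = "level M f y0 \<sigma> \<delta>"
    have L1: "(x, e) \<in> ?L1 \<longleftrightarrow> x \<in> mspace M \<and> \<bar>e\<bar> < \<delta> \<and> f x = y0 * cis e" for x e by (auto simp: level_def)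
    have L0: "(x, e) \<in> ?L0 \<longleftrightarrow> x \<in> ?F \<and> \<bar>e\<bar> < \<delta>" for x e
    proof
      assume a: "(x, e) \<in> ?L0"
      then have x: "x \<in> mspace M" "\<bar>e\<bar> < \<delta>" "f x = y0 * cis (e * \<sigma> x)" by (auto simp: level_def)
      have "\<bar>e * \<sigma> x\<bar> \<le> \<bar>e\<bar>" using \<sigma>1[of x] by (simp add: abs_mult mult_left_le)
      then have "norm (f x - y0) < m" unfolding x(3) using x(2) \<delta>(3) by (intro d0(2)) linarith
      then have "x \<in> Z" using m(2)[of x] x(1) by force
      then show "x \<in> ?F \<and> \<bar>e\<bar> < \<delta>" using x \<sigma>Z by (simp add: fiber_def)
    next
      assume a: "x \<in> ?F \<and> \<bar>e\<bar> < \<delta>"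
      then have "\<sigma> x = 0" using Z(2) \<sigma>Z by auto
      then show "(x, e) \<in> ?L0" using a by (simp add: level_def fiber_def)
    qed
    define U where "U = {y. \<exists>t. \<bar>t\<bar> < \<delta> \<and> y = y0 * cis t}"
    obtain A H where A: "smooth_on H A" "openin (top_of_set (sphere 0 1)) U" "U \<subseteq> H"
      "\<And>t. \<bar>t\<bar> < \<delta> \<Longrightarrow> A (y0 * cis t) = t"
    proof (rule arc_chart[OF y0 \<delta>(1,2)])
      fix A H assume a: "smooth_on H A" "openin (top_of_set (sphere 0 1)) {y. \<exists>t. \<bar>t\<bar> < \<delta> \<and> y = y0 * cis t}"
        "{y. \<exists>t. \<bar>t\<bar> < \<delta> \<and> y = y0 * cis t} \<subseteq> H" "\<And>t. \<bar>t\<bar> < \<delta> \<Longrightarrow> A (y0 * cis t) = (t::real)"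
      show thesis by (rule that[unfolded U_def, OF a])
    qed
    have AU: "\<bar>A y\<bar> < \<delta> \<and> y = y0 * cis (A y)" if "y \<in> U" for y using that A(4) by (auto simp: U_def)
    have US: "U \<subseteq> sphere 0 1" using openin_subset[OF A(2)] by simp
    define P where "P = {x \<in> mspace M. f x \<in> U}"
    have oP: "openin (mtop M) P" unfolding P_def
      using openin_continuous_map_preimage[OF smooth_in_continuous[OF f, simplified] A(2)] by simp
    have PM: "P \<subseteq> mspace M" by (auto simp: P_def)
    have oU: "openin (mtop circle_mfd) U" using A(2) by simp
    note MP = open_part_manifold[OF M oP] and CU = open_part_manifold[OF circle_manifold oU] and MF = fib[of y0]
    have bU: "mboundary (open_part circle_mfd U) = {}"
      using open_part_boundary[OF circle_manifold oU] circle_boundary by auto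
    let ?B = "prod_mfd (open_part circle_mfd U) (submfd (mdim M - 1) M ?F)"
    have B: "smooth_manifold ?B" by (rule prod_manifold[OF CU MF]) (rule disjI1[OF bU])
    let ?R = "prod_mfd M real_mfd"
    note R = prod_real_manifold[OF M]
    \<comment> \<open>The angle \<open>A (f x)\<close> places \<open>x\<close> on the level set of
      1, and \<open>Q\<close> moves it into the fiber over \<open>y0\<close>. Keeping
      \<open>f x\<close> as first component makes \<open>h\<close> a map over the base.\<close>
    define h where "h x = (f x, Q (x, A (f x)))" for x
    define g where "g p = Q' (snd p, A (fst p))" for p
    have inL1: "(x, A (f x)) \<in> ?L1" if "x \<in> P" for x
      unfolding L1 using that AU[of "f x"] by (simp add: P_def)
    have hF: "Q (x, A (f x)) \<in> ?F" if "x \<in> P" for x using L(3)[OF inL1[OF that]] L0 by simp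
    have mB: "mspace ?B = U \<times> ?F" using US by (auto simp: fiber_def)
    have sf: "smooth_in M circle_mfd P f" by (rule smooth_in_subset[OF f PM])
    have sfC: "smooth_in M euclidean_mfd P f" by (rule smooth_in_subset[OF fC PM])
    have sA: "smooth_in M euclidean_mfd P (\<lambda>x. A (f x))"
      by (rule smooth_in_euclidean_comp[OF M sfC A(1)]) (use A(3) in \<open>auto simp: P_def\<close>)
    have sp: "smooth_in M ?R P (\<lambda>x. (x, A (f x)))"
      by (rule smooth_in_Pair[OF M M euclidean_manifold _ smooth_in_id[OF M PM] sA]) (simp add: euclidean_boundary)
    have sQ: "smooth_in M M P (\<lambda>x. Q (x, A (f x)))"
      by (rule smooth_in_comp[OF M R M sp L(1) inL1])
    have h1: "smooth_in (open_part M P) (open_part circle_mfd U) P f"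
      unfolding smooth_in_submfd_cod[OF MP circle_manifold CU] smooth_in_submfd_dom[OF M circle_manifold MP
          order_refl]
      using sf by (auto simp: P_def)
    have h2: "smooth_in (open_part M P) (submfd (mdim M - 1) M ?F) P (\<lambda>x. Q (x, A (f x)))"
      unfolding smooth_in_submfd_cod[OF MP M MF] smooth_in_submfd_dom[OF M M MP order_refl]
      using sQ hF by auto
    have "smooth_in (open_part M P) ?B P h" unfolding h_def
      by (rule smooth_in_Pair[OF MP CU MF _ h1 h2]) (rule disjI1[OF bU])
    moreover have "mspace (open_part M P) = P" using PM by auto
    ultimately have sh: "smooth_map (open_part M P) ?B h" using smooth_map_iff_smooth_in[OF MP B] by simp
    have p1: "smooth_in ?B (open_part circle_mfd U) (mspace ?B) fst"
      by (rule smooth_in_fst[OF CU MF]) (rule disjI1[OF bU])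
    have p2: "smooth_in ?B (submfd (mdim M - 1) M ?F) (mspace ?B) snd"
      by (rule smooth_in_snd[OF CU MF]) (rule disjI1[OF bU])
    have p1': "smooth_in ?B euclidean_mfd (mspace ?B) fst"
      using p1 unfolding smooth_in_submfd_cod[OF B circle_manifold CU] smooth_in_circle_iff[OF B] by simp
    have p2': "smooth_in ?B M (mspace ?B) snd"
      using p2 unfolding smooth_in_submfd_cod[OF B M MF] by simp
    have pA: "smooth_in ?B euclidean_mfd (mspace ?B) (\<lambda>p. A (fst p))"
      by (rule smooth_in_euclidean_comp[OF B p1' A(1)]) (use A(3) mB in auto)
    have pp: "smooth_in ?B ?R (mspace ?B) (\<lambda>p. (snd p, A (fst p)))"
      by (rule smooth_in_Pair[OF B M euclidean_manifold _ p2' pA]) (simp add: euclidean_boundary)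
    have inL0: "(snd p, A (fst p)) \<in> ?L0" if "p \<in> mspace ?B" for p
      unfolding L0 using that AU mB by auto
    have "smooth_in ?B M (mspace ?B) g" unfolding g_def
      by (rule smooth_in_comp[OF B R M pp L(2) inL0])
    moreover have gL: "(g p, A (fst p)) \<in> ?L1 \<and> Q (g p, A (fst p)) = snd p" if "p \<in> mspace ?B" for p
      using L(4)[OF inL0[OF that]] by (simp add: g_def)
    moreover have gf: "f (g p) = fst p" if "p \<in> mspace ?B" for p
      using gL[OF that] AU[of "fst p"] that mB by (auto simp: L1)
    moreover have gP: "g p \<in> P" if "p \<in> mspace ?B" for p
      using gL[OF that] gf[OF that] that mB by (auto simp: L1 P_def)
    ultimately have "smooth_in ?B (open_part M P) (mspace ?B) g"
      unfolding smooth_in_submfd_cod[OF B M MP] by auto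
    then have sg: "smooth_map ?B (open_part M P) g" using smooth_map_iff_smooth_in[OF B MP] by simp
    have gh: "g (h x) = x" if "x \<in> P" for x using L(3)[OF inL1[OF that]] by (simp add: g_def h_def)
    have hg: "h (g p) = p" if "p \<in> mspace ?B" for p
      using gL[OF that] gf[OF that] by (simp add: h_def)
    have "diffeo (open_part M P) ?B h" unfolding diffeo_def
      using sh sg gh hg PM by (intro conjI exI[of _ g]) auto
    moreover have "y0 \<in> U" unfolding U_def using \<delta>(1) by (intro CollectI exI[of _ 0]) simp
    ultimately show ?thesis using oU by (intro exI[of _ U] exI[of _ h]) (simp add: P_def h_def)
  qed
  show ?thesis unfolding fibration_def
  proof (intro conjI ballI)
    show "smooth_map M circle_mfd f" using f smooth_map_iff_smooth_in[OF M circle_manifold] by simp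
    show "f ` mspace M = mspace circle_mfd" using surj by simp
    fix y assume "y \<in> mspace circle_mfd"
    then have y: "norm y = 1" by simp
    show "embedded_submanifold (mdim M - mdim circle_mfd) M (fiber M f y)"
      using fib[of y] by (auto simp: embedded_submanifold_def fiber_def)
    show "\<exists>U h. openin (mtop circle_mfd) U \<and> y \<in> U \<and>
           diffeo (open_part M {x \<in> mspace M. f x \<in> U})
                  (prod_mfd (open_part circle_mfd U) (submfd (mdim M - mdim circle_mfd) M (fiber M f y))) h \<and>
           (\<forall>x\<in>mspace M. f x \<in> U \<longrightarrow> fst (h x) = f x)"
      using triv[OF y] by simp
  qed
qed

subsection \<open>Knot exteriors and curves transverse to the fibers\<close>

lemma full_dim_subspace:
  fixes V :: "'e::euclidean_space set"
  assumes "subspace V" "dim V = DIM('e)" shows "V = UNIV"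
  using assms dim_eq_full span_eq_iff by metis

text \<open>\<open>N\<close> is closed, so near \<open>x\<close> the exterior is all of
  \<open>Y\<close> and a restricted chart serves.\<close>

lemma exterior_chart_off:
  assumes Y: "smooth_manifold Y" and N: "closedin (mtop Y) N" and x: "x \<in> mspace Y" "x \<notin> N"
    and E: "E = mspace Y - (mtop Y interior_of N)"
  shows "\<exists>U \<phi>. (U, \<phi>) \<in> full_atlas Y \<and> x \<in> U \<and> is_chart (mdim Y) (subtopology (mtop Y) E) (U \<inter> E, \<phi>)"
proof -
  obtain U \<phi> where U: "(U, \<phi>) \<in> full_atlas Y" "x \<in> U" using atlas_cover[OF Y x(1)] by metis
  have o: "openin (mtop Y) (mspace Y - N)" using N by (simp add: closedin_def)
  obtain V b \<Omega> where c: "chart_data (mdim Y) (mtop Y) U \<phi> V b \<Omega>"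
    using full_atlas_chart[OF U(1)] is_chart_iff by metis
  obtain \<Omega>' where d: "chart_data (mdim Y) (mtop Y) (U \<inter> (mspace Y - N)) \<phi> V b \<Omega>'"
    using chart_data_restrict[OF c o] by metis
  have f: "(U \<inter> (mspace Y - N), \<phi>) \<in> full_atlas Y" by (rule full_atlas_restrict[OF U(1) o])
  have e: "U \<inter> (mspace Y - N) \<inter> E = U \<inter> (mspace Y - N)" unfolding E using interior_of_subset by fastforce
  have im: "\<phi> ` (U \<inter> (mspace Y - N) \<inter> E) = {x \<in> V. 0 \<le> b \<bullet> x} \<inter> \<Omega>'"
    unfolding e by (rule chart_dataD(9)[OF d])
  have "is_chart (mdim Y) (subtopology (mtop Y) E) (U \<inter> (mspace Y - N) \<inter> E, \<phi>)"
    unfolding is_chart_iff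
    by (intro exI, rule slice_chart[OF full_atlas_chart[OF f] chart_dataD(5,6,7,8)[OF d] im])
  then show ?thesis using f U(2) x by (intro exI[of _ "U \<inter> (mspace Y - N)"] exI[of _ \<phi>]) simp
qed

text \<open>A chart of the codimension-zero submanifold \<open>N\<close> at a frontier point
  presents \<open>N\<close> as b1.y \<ge> 0, where b1 is nonzero because the point is not interior.
  The interior of \<open>N\<close> is then b1.y > 0, so the exterior is the opposite half-space,
  with normal -b1.\<close>

lemma exterior_chart_on:
  fixes Y :: "('a, 'e::euclidean_space) mfd"
  assumes Y: "smooth_manifold Y" and b: "mboundary Y = {}" and d: "mdim Y = DIM('e)"
    and N: "smooth_manifold (submfd (mdim Y) Y N)" and x: "x \<in> N" "x \<in> mspace Y" "x \<notin> mtop Y interior_of N"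
    and E: "E = mspace Y - (mtop Y interior_of N)"
  shows "\<exists>U \<phi>. (U, \<phi>) \<in> full_atlas Y \<and> x \<in> U \<and> is_chart (mdim Y) (subtopology (mtop Y) E) (U \<inter> E, \<phi>)"
proof -
  obtain U \<phi> where U: "(U, \<phi>) \<in> full_atlas Y" "(U \<inter> N, \<phi>) \<in> full_atlas (submfd (mdim Y) Y N)" "x \<in> U"
    by (rule submfd_cover[OF N x(1,2)])
  obtain V0 \<Omega> where c0: "chart_data (mdim Y) (mtop Y) U \<phi> V0 0 \<Omega>" by (rule boundaryless_chart_data[OF Y b U(1)])
  note c = chart_dataD[OF c0]
  \<comment> \<open>The chart space has the dimension of \<open>Y\<close>, so the models of full
    dimension are not proper subspaces.\<close>
  have "V0 = UNIV" using full_dim_subspace[OF c(5)] c(6) d by simp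
  then have im: "\<phi> ` U = \<Omega>" using c(9) by simp
  obtain V1 b1 \<Omega>1 where c1: "chart_data (mdim Y) (subtopology (mtop Y) N) (U \<inter> N) \<phi> V1 b1 \<Omega>1"
    using full_atlas_chart[OF U(2)] unfolding is_chart_iff submfd_simps by (elim exE)
  note c1' = chart_dataD[OF c1]
  have "V1 = UNIV" using full_dim_subspace[OF c1'(5)] c1'(6) d by simp
  then have im1: "\<phi> ` (U \<inter> N) = {y. 0 \<le> b1 \<bullet> y} \<inter> \<Omega>1" using c1'(9) by simp
  define U' where "U' = U \<inter> \<phi> -` \<Omega>1"
  have oU': "openin (mtop Y) U'" unfolding U'_def by (rule c(3)[OF c1'(8)])
  have "\<phi> x \<in> \<phi> ` (U \<inter> N)" using U(3) x(1) by auto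
  then have xU': "x \<in> U'" using U(3) im1 by (auto simp: U'_def)
  have Niff: "y \<in> N \<longleftrightarrow> 0 \<le> b1 \<bullet> \<phi> y" if "y \<in> U'" for y
  proof -
    have y: "y \<in> U" "\<phi> y \<in> \<Omega>1" using that by (auto simp: U'_def)
    have "y \<in> N \<longleftrightarrow> \<phi> y \<in> \<phi> ` (U \<inter> N)"
      using inj_on_image_mem_iff[OF c(2) y(1), of "U \<inter> N"] y(1) by auto
    then show ?thesis using im1 y by simp
  qed
  have int1: "y \<in> mtop Y interior_of N" if "y \<in> U'" "0 < b1 \<bullet> \<phi> y" for y
  proof -
    have "openin (mtop Y) (U' \<inter> (U \<inter> \<phi> -` {z. 0 < b1 \<bullet> z}))"
      by (intro openin_Int oU' c(3) open_halfspace_gt)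
    moreover have "U' \<inter> (U \<inter> \<phi> -` {z. 0 < b1 \<bullet> z}) \<subseteq> N" using Niff by auto
    moreover have "y \<in> U' \<inter> (U \<inter> \<phi> -` {z. 0 < b1 \<bullet> z})" using that by (auto simp: U'_def)
    ultimately show ?thesis unfolding interior_of_def by blast
  qed
  have int2: "0 < b1 \<bullet> \<phi> y" if y: "y \<in> U'" "y \<in> mtop Y interior_of N" and nz: "b1 \<noteq> 0" for y
  proof -
    obtain T where T: "openin (mtop Y) T" "T \<subseteq> N" "y \<in> T" using y(2) unfolding interior_of_def by blast
    obtain T' where T': "open T'" "\<phi> ` (U \<inter> (T \<inter> U')) = \<phi> ` U \<inter> T'"
      using c(4)[OF openin_Int[OF T(1) oU']] by blast
    have "\<phi> y \<in> \<phi> ` (U \<inter> (T \<inter> U'))" using y T by (auto simp: U'_def)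
    then have "\<phi> y \<in> \<Omega> \<inter> T'" unfolding T'(2) im .
    moreover have "open (\<Omega> \<inter> T')" using T' c(8) by auto
    ultimately obtain e where e: "0 < e" "cball (\<phi> y) e \<subseteq> \<Omega> \<inter> T'" unfolding open_contains_cball by blast
    \<comment> \<open>A small step against \<open>b1\<close> from an interior point stays in
      \<open>N\<close>, where b1.w \<ge> 0; so the value at \<open>y\<close> is strictly larger than
      0.\<close>
    define w where "w = \<phi> y - (e / norm b1) *\<^sub>R b1"
    have "dist (\<phi> y) w = e" using nz e by (simp add: w_def dist_norm)
    then have "w \<in> \<phi> ` (U \<inter> (T \<inter> U'))" unfolding T'(2) im using e by auto
    then obtain z where "z \<in> T" "z \<in> U'" "w = \<phi> z" by auto
    then have "0 \<le> b1 \<bullet> w" using Niff T(2) by auto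
    moreover have "b1 \<bullet> w < b1 \<bullet> \<phi> y" using nz e by (simp add: w_def inner_diff_right)
    ultimately show ?thesis by linarith
  qed
  have b1: "b1 \<noteq> 0"
  proof
    assume z: "b1 = 0"
    have "U' \<subseteq> N" using Niff z by auto
    then show False using x(3) xU' oU' unfolding interior_of_def by blast
  qed
  have f: "(U', \<phi>) \<in> full_atlas Y" using full_atlas_restrict[OF U(1) oU']
      by (simp add: U'_def Int_absorb1 Int_left_absorb)
  have im2: "\<phi> ` (U' \<inter> E) = {y \<in> UNIV. 0 \<le> (- b1) \<bullet> y} \<inter> (\<Omega> \<inter> \<Omega>1)"
  proof (intro equalityI subsetI)
    fix y assume "y \<in> \<phi> ` (U' \<inter> E)"
    then obtain z where z: "z \<in> U'" "z \<notin> mtop Y interior_of N" "y = \<phi> z" by (auto simp: E)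
    then show "y \<in> {y \<in> UNIV. 0 \<le> (- b1) \<bullet> y} \<inter> (\<Omega> \<inter> \<Omega>1)" using int1[OF z(1)] im by (force simp: U'_def)
  next
    fix y assume y: "y \<in> {y \<in> UNIV. 0 \<le> (- b1) \<bullet> y} \<inter> (\<Omega> \<inter> \<Omega>1)"
    then have "y \<in> \<phi> ` U" using im by simp
    then obtain z where z: "z \<in> U" "y = \<phi> z" by blast
    then have zU': "z \<in> U'" using y by (simp add: U'_def)
    then have "z \<notin> mtop Y interior_of N" using int2[OF zU' _ b1] y z(2) by force
    then show "y \<in> \<phi> ` (U' \<inter> E)" using z zU' c(10) by (auto simp: E)
  qed
  have "is_chart (mdim Y) (subtopology (mtop Y) E) (U' \<inter> E, \<phi>)" unfolding is_chart_iff
    by (intro exI, rule slice_chart[OF full_atlas_chart[OF f] subspace_UNIV _ _ _ im2])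
      (use d c(8) c1'(8) in auto)
  then show ?thesis using f xU' by (intro exI[of _ U'] exI[of _ \<phi>]) simp
qed

lemma diffeo_continuous:
  assumes "diffeo M N f"
  obtains g where "continuous_map (mtop M) (mtop N) f" "continuous_map (mtop N) (mtop M) g"
    "\<And>x. x \<in> mspace M \<Longrightarrow> g (f x) = x" "\<And>y. y \<in> mspace N \<Longrightarrow> f (g y) = y"
  using assms unfolding diffeo_def smooth_map_def by (elim exE conjE) blast

text \<open>The tubular neighborhood is the image of a compact solid torus, hence closed in the
  Hausdorff space \<open>Y\<close>. Each point of the exterior is then either off \<open>N\<close>
  or in \<open>N\<close> without being interior, and the two preceding lemmas supply the
  charts.\<close>

lemma exterior_manifold:
  fixes Y :: "('a, real ^ 3) mfd"
  assumes Y: "closed_manifold Y" and d: "mdim Y = 3" and N: "tubular_nbhd Y K N"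
  shows "smooth_manifold (exterior Y N)" "compact_space (mtop (exterior Y N))"
proof -
  have M: "smooth_manifold Y" and comp: "compact_space (mtop Y)" and b: "mboundary Y = {}"
    using Y by (auto simp: closed_manifold_def)
  have NM: "smooth_manifold (submfd 3 Y N)" and NY: "N \<subseteq> mspace Y"
    using N by (auto simp: tubular_nbhd_def embedded_submanifold_def)
  obtain \<tau> where "diffeo (prod_mfd circle_mfd disc_mfd) (submfd 3 Y N) \<tau>" using N by (auto simp: tubular_nbhd_def)
  then obtain g where g: "continuous_map (mtop (prod_mfd circle_mfd disc_mfd)) (mtop (submfd 3 Y N)) \<tau>"
    "continuous_map (mtop (submfd 3 Y N)) (mtop (prod_mfd circle_mfd disc_mfd)) g"
    "\<And>y. y \<in> mspace (submfd 3 Y N) \<Longrightarrow> \<tau> (g y) = y" by (rule diffeo_continuous) blast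
  have mt: "mtop (prod_mfd circle_mfd disc_mfd) = prod_topology (top_of_set (sphere 0 1)) (top_of_set (cball 0 1))"
    by (simp add: disc_mfd_def)
  have "compactin (prod_topology (top_of_set (sphere (0::complex) 1)) (top_of_set (cball (0::complex) 1)))
     (sphere 0 1 \<times> cball 0 1)" by (simp add: compactin_Times compactin_subtopology compact_Times)
  then have "compactin (mtop (submfd 3 Y N)) (\<tau> ` (sphere 0 1 \<times> cball 0 1))"
    using image_compactin g(1) unfolding mt by blast
  moreover have "\<tau> ` (sphere 0 1 \<times> cball 0 1) = N"
  proof (intro equalityI subsetI)
    fix y assume "y \<in> \<tau> ` (sphere 0 1 \<times> cball 0 1)"
    then show "y \<in> N" using g(1) unfolding mt continuous_map_def by auto
  next
    fix y assume y: "y \<in> N"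
    then have "y \<in> mspace (submfd 3 Y N)" using NY by auto
    then have "\<tau> (g y) = y" "g y \<in> sphere 0 1 \<times> cball 0 1"
      using g(2,3) unfolding mt continuous_map_def by auto
    then show "y \<in> \<tau> ` (sphere 0 1 \<times> cball 0 1)" by (metis image_eqI)
  qed
  ultimately have "compactin (mtop Y) N" by (simp add: compactin_subtopology)
  then have cN: "closedin (mtop Y) N" using compactin_imp_closedin M by (auto simp: smooth_manifold_def)
  define E where "E = mspace Y - (mtop Y interior_of N)"
  have "\<exists>U \<phi>. (U, \<phi>) \<in> full_atlas Y \<and> x \<in> U \<and> is_chart 3 (subtopology (mtop Y) E) (U \<inter> E, \<phi>)" if x: "x \<in> E" for x
  proof (cases "x \<in> N")
    case True
    show ?thesis using exterior_chart_on[OF M b _ _ True _ _ E_def] x NM d by (simp add: E_def)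
  next
    case False
    show ?thesis using exterior_chart_off[OF M cN _ False E_def] x d by (simp add: E_def)
  qed
  then show "smooth_manifold (exterior Y N)" unfolding exterior_def E_def[symmetric]
    by (intro submfd_manifoldI[OF M]) (auto simp: E_def)
  have "closedin (mtop Y) E" unfolding E_def by (simp add: closedin_diff)
  then have "compactin (mtop Y) E" using comp closedin_compact_space by blast
  then show "compact_space (mtop (exterior Y N))" unfolding exterior_def E_def[symmetric]
    by (simp add: compact_space_subtopology)
qed

lemma smooth_in_constant:
  assumes M: "smooth_manifold M" and N: "smooth_manifold N" and A: "A \<subseteq> mspace M" and c: "c \<in> mspace N"
  shows "smooth_in M N A (\<lambda>x. c)"
proof (rule smooth_inI[OF A])
  show "continuous_map (subtopology (mtop M) A) (mtop N) (\<lambda>x. c)" using c by simp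
  fix x assume "x \<in> A"
  then have "x \<in> mspace M" using A by auto
  then obtain U \<phi> where U: "(U, \<phi>) \<in> full_atlas M" "x \<in> U" using atlas_cover[OF M] by metis
  obtain V \<psi> where V: "(V, \<psi>) \<in> full_atlas N" "c \<in> V" using atlas_cover[OF N c] by metis
  show "\<exists>U \<phi> V \<psi> T. (U, \<phi>) \<in> full_atlas M \<and> (V, \<psi>) \<in> full_atlas N \<and> x \<in> U \<and> c \<in> V \<and>
     openin (mtop M) T \<and> x \<in> T \<and> smooth_on (\<phi> ` (U \<inter> T \<inter> A \<inter> (\<lambda>x. c) -` V)) (\<lambda>y. \<psi> c)"
    using U V chart_openin[OF full_atlas_chart[OF U(1)]]
    by (intro exI[of _ U] exI[of _ \<phi>] exI[of _ V] exI[of _ \<psi>] exI[of _ U]) simp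
qed

lemma mboundary_homeo:
  assumes M: "smooth_manifold M" and N: "smooth_manifold N" and d: "mdim M = mdim N"
    and f: "continuous_map (mtop M) (mtop N) f" and g: "continuous_map (mtop N) (mtop M) g"
    and gf: "\<And>x. x \<in> mspace M \<Longrightarrow> g (f x) = x" and fg: "\<And>y. y \<in> mspace N \<Longrightarrow> f (g y) = y"
    and x: "x \<in> mspace M"
  shows "f x \<in> mboundary N \<longleftrightarrow> x \<in> mboundary M"
proof
  assume "f x \<in> mboundary N"
  then show "x \<in> mboundary M"
    using mboundary_embedding[OF M N d openin_topspace x, of f] f inj_on_inverseI[of "mspace M" g f] gf by simp
next
  assume b: "x \<in> mboundary M"
  have fx: "f x \<in> mspace N" using f x by (auto simp: continuous_map_def)
  show "f x \<in> mboundary N"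
    using mboundary_embedding[OF N M d[symmetric] openin_topspace fx, of g] g inj_on_inverseI[of "mspace N"
        f g] fg gf[OF x] b by simp
qed

lemma open_part_boundary_iff:
  assumes M: "smooth_manifold M" and S: "openin (mtop M) S" and x: "x \<in> S"
  shows "x \<in> mboundary (open_part M S) \<longleftrightarrow> x \<in> mboundary M"
proof
  assume b: "x \<in> mboundary M"
  note N = open_part_manifold[OF M S]
  have SM: "S \<subseteq> mspace M" using openin_subset[OF S] .
  show "x \<in> mboundary (open_part M S)"
    by (rule mboundary_embedding[OF N M _ openin_topspace, of x "\<lambda>x. x"])
      (use b x SM in \<open>auto simp: continuous_map_from_subtopology\<close>)
qed (rule open_part_boundary[OF M S])

text \<open>In a local trivialization, keep the fiber component fixed and rotate the base component.
  The boundary of the product is the base times the boundary of the fiber, so a curve that starts in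
  the boundary remains there.\<close>

lemma fibration_curve:
  assumes M: "smooth_manifold M" and fib: "fibration M circle_mfd f" and d: "1 \<le> mdim M" and x: "x \<in> mspace M"
  obtains \<eta> \<gamma> where "0 < \<eta>" "smooth_in euclidean_mfd M {- \<eta><..<\<eta>} \<gamma>" "\<gamma> (0::real) = x"
    "x \<in> mboundary M \<Longrightarrow> \<gamma> ` {- \<eta><..<\<eta>} \<subseteq> mboundary M"
    "\<And>t. t \<in> {- \<eta><..<\<eta>} \<Longrightarrow> f (\<gamma> t) = f x * cis t"
proof -
  let ?y = "f x"
  have yS: "?y \<in> mspace circle_mfd" using fib x unfolding fibration_def by blast
  then have ny: "norm ?y = 1" by simp
  have fc: "continuous_map (mtop M) (mtop circle_mfd) f" using fib unfolding fibration_def smooth_map_def by simp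
  let ?F = "fiber M f ?y"
  have MF: "smooth_manifold (submfd (mdim M - 1) M ?F)"
    using fib yS unfolding fibration_def embedded_submanifold_def by simp
  have "\<exists>U h. openin (mtop circle_mfd) U \<and> ?y \<in> U \<and>
           diffeo (open_part M {x \<in> mspace M. f x \<in> U})
                  (prod_mfd (open_part circle_mfd U) (submfd (mdim M - mdim circle_mfd) M ?F)) h \<and>
           (\<forall>x\<in>mspace M. f x \<in> U \<longrightarrow> fst (h x) = f x)"
    using fib yS unfolding fibration_def by blast
  then obtain U h where U: "openin (mtop circle_mfd) U" "?y \<in> U"
    and h: "diffeo (open_part M {x \<in> mspace M. f x \<in> U})
                  (prod_mfd (open_part circle_mfd U) (submfd (mdim M - mdim circle_mfd) M ?F)) h"
    and hf: "\<forall>x\<in>mspace M. f x \<in> U \<longrightarrow> fst (h x) = f x" by (elim exE conjE)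
  define P where "P = {x \<in> mspace M. f x \<in> U}"
  have oP: "openin (mtop M) P" unfolding P_def by (rule openin_continuous_map_preimage[OF fc U(1)])
  have xP: "x \<in> P" using x U(2) by (simp add: P_def)
  let ?B = "prod_mfd (open_part circle_mfd U) (submfd (mdim M - 1) M ?F)"
  have h: "diffeo (open_part M P) ?B h" using h by (simp add: P_def)
  note MP = open_part_manifold[OF M oP] and CU = open_part_manifold[OF circle_manifold U(1)]
  have bU: "mboundary (open_part circle_mfd U) = {}"
    using open_part_boundary[OF circle_manifold U(1)] circle_boundary by auto
  have B: "smooth_manifold ?B" by (rule prod_manifold[OF CU MF]) (rule disjI1[OF bU])
  obtain g where hs: "smooth_map (open_part M P) ?B h" and gs: "smooth_map ?B (open_part M P) g"
    and gh: "\<forall>x\<in>mspace (open_part M P). g (h x) = x" and hg: "\<forall>y\<in>mspace ?B. h (g y) = y"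
    using h unfolding diffeo_def by (elim exE conjE)
  have PM: "P \<subseteq> mspace M" by (auto simp: P_def)
  have US: "U \<subseteq> sphere 0 1" using openin_subset[OF U(1)] by simp
  have mP: "mspace (open_part M P) = P" and mB: "mspace ?B = U \<times> ?F" using PM US by (auto simp: fiber_def)
  have hcont: "continuous_map (mtop (open_part M P)) (mtop ?B) h"
      and gcont: "continuous_map (mtop ?B) (mtop (open_part M P)) g"
    using hs gs by (simp_all add: smooth_map_def)
  define z where "z = snd (h x)"
  have "h x \<in> mspace ?B" using hcont xP mP unfolding continuous_map_def by blast
  then have hx: "h x = (?y, z)" "z \<in> ?F" using mB hf x U(2) by (auto simp: z_def prod_eq_iff)
  have gsm: "smooth_in ?B (open_part M P) (mspace ?B) g" using gs smooth_map_iff_smooth_in[OF B MP] by simp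
  have gM: "smooth_in ?B M (mspace ?B) g" and gP: "g ` mspace ?B \<subseteq> P"
    using gsm unfolding smooth_in_submfd_cod[OF B M MP] by auto
  obtain T where T: "open T" "U = sphere 0 1 \<inter> T" using U(1) by (auto simp: openin_open)
  have "open ((\<lambda>t. ?y * cis t) -` T)" by (intro open_vimage T continuous_intros)
  moreover have "0 \<in> (\<lambda>t. ?y * cis t) -` T" using U(2) T by simp
  ultimately obtain \<eta> where \<eta>: "0 < \<eta>" "ball 0 \<eta> \<subseteq> (\<lambda>t. ?y * cis t) -` T" by (meson open_contains_ball_eq)
  let ?I = "{- \<eta><..<\<eta>}"
  have tU: "?y * cis t \<in> U" if "t \<in> ?I" for t
    using \<eta>(2) that T(2) ny by (auto simp: subset_iff dist_real_def norm_mult)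
  have c1: "smooth_in euclidean_mfd (open_part circle_mfd U) ?I (\<lambda>t::real. ?y * cis t)"
    unfolding smooth_in_submfd_cod[OF euclidean_manifold circle_manifold CU] smooth_in_circle_iff[OF
        euclidean_manifold]
      smooth_in_euclidean_iff
    using tU US by (auto intro!: smooth_on_mult smooth_on_const smooth_on_cis smooth_on_id(1))
  have zm: "z \<in> mspace (submfd (mdim M - 1) M ?F)" using hx(2) by (auto simp: fiber_def)
  have c2: "smooth_in euclidean_mfd (submfd (mdim M - 1) M ?F) ?I (\<lambda>t::real. z)"
    by (rule smooth_in_constant[OF euclidean_manifold MF _ zm]) simp
  have c3: "smooth_in euclidean_mfd ?B ?I (\<lambda>t::real. (?y * cis t, z))"
    by (rule smooth_in_Pair[OF euclidean_manifold CU MF disjI1[OF bU] c1 c2])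
  have inB: "(?y * cis t, z) \<in> mspace ?B" if "t \<in> ?I" for t using tU[OF that] hx(2) mB by auto
  have c4: "smooth_in euclidean_mfd M ?I (\<lambda>t::real. g (?y * cis t, z))"
    by (rule smooth_in_comp[OF euclidean_manifold B M c3 gM inB])
  have g0: "g (?y * cis 0, z) = x" using gh xP mP hx(1) by (metis cis_zero mult.right_neutral)
  have gf: "f (g (?y * cis t, z)) = ?y * cis t" if "t \<in> ?I" for t
  proof -
    have "g (?y * cis t, z) \<in> P" using gP inB[OF that] by blast
    then have "fst (h (g (?y * cis t, z))) = f (g (?y * cis t, z))" using hf by (simp add: P_def)
    then show ?thesis using hg inB[OF that] by simp
  qed
  have dB: "mdim (open_part M P) = mdim ?B" using d by simp
  have bd: "g (?y * cis t, z) \<in> mboundary M" if xb: "x \<in> mboundary M" and t: "t \<in> ?I" for t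
  proof -
    have "x \<in> mboundary (open_part M P)" using open_part_boundary_iff[OF M oP xP] xb by simp
    then have "h x \<in> mboundary ?B"
      using mboundary_homeo[OF MP B dB hcont gcont] gh hg xP mP by blast
    then have "z \<in> mboundary (submfd (mdim M - 1) M ?F)"
      using mboundary_prod[OF CU MF disjI1[OF bU], of ?y z] bU U(2) US zm unfolding hx(1) by auto
    then have "(?y * cis t, z) \<in> mboundary ?B"
      using mboundary_prod[OF CU MF disjI1[OF bU], of "?y * cis t" z] tU[OF t] US zm by auto
    then have "g (?y * cis t, z) \<in> mboundary (open_part M P)"
      using mboundary_homeo[OF B MP dB[symmetric] gcont hcont] gh hg inB[OF t] by blast
    then show ?thesis by (rule open_part_boundary[OF M oP])
  qed
  show thesis
    by (rule that[OF \<eta>(1) c4 g0 _ gf]) (use bd in auto)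
qed

text \<open>Meant for the map \<open>\<Phi>\<close> of the mapping torus: it shows that exactly the
  points over \<partial>F are sent to the boundary of the exterior.\<close>

lemma local_diffeo_boundary:
  assumes M: "smooth_manifold M" and N: "smooth_manifold N" and d: "mdim M = mdim N"
    and f: "local_diffeo M N f"
  shows "continuous_map (mtop M) (mtop N) f" "\<And>x. x \<in> mspace M \<Longrightarrow> f x \<in> mboundary N \<longleftrightarrow> x \<in> mboundary M"
proof -
  have key: "\<exists>U. openin (mtop M) U \<and> x \<in> U \<and> continuous_map (subtopology (mtop M) U) (mtop N) f \<and>
     (f x \<in> mboundary N \<longleftrightarrow> x \<in> mboundary M)" if x: "x \<in> mspace M" for x
  proof -
    obtain U where U: "openin (mtop M) U" "x \<in> U" "openin (mtop N) (f ` U)"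
      "diffeo (open_part M U) (open_part N (f ` U)) f" using f x unfolding local_diffeo_def by metis
    have sub: "U \<subseteq> mspace M" "f ` U \<subseteq> mspace N" using openin_subset U(1,3) by auto
    obtain g where g: "continuous_map (mtop (open_part M U)) (mtop (open_part N (f ` U))) f"
      "continuous_map (mtop (open_part N (f ` U))) (mtop (open_part M U)) g"
      "\<And>x. x \<in> mspace (open_part M U) \<Longrightarrow> g (f x) = x"
      "\<And>y. y \<in> mspace (open_part N (f ` U)) \<Longrightarrow> f (g y) = y" by (rule diffeo_continuous[OF U(4)]) blast
    have xm: "x \<in> mspace (open_part M U)" using U(2) sub by auto
    have "f x \<in> mboundary (open_part N (f ` U)) \<longleftrightarrow> x \<in> mboundary (open_part M U)"
      by (rule mboundary_homeo[OF open_part_manifold[OF M U(1)] open_part_manifold[OF N U(3)] _ g xm]) (use d in simp)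
    then have "f x \<in> mboundary N \<longleftrightarrow> x \<in> mboundary M"
      using open_part_boundary_iff[OF M U(1,2)] open_part_boundary_iff[OF N U(3), of "f x"] U(2) by simp
    moreover have "continuous_map (subtopology (mtop M) U) (mtop N) f"
      using g(1) by (simp add: continuous_map_in_subtopology)
    ultimately show ?thesis using U by metis
  qed
  show "continuous_map (mtop M) (mtop N) f" by (rule continuous_map_local) (use key in metis)
  show "f x \<in> mboundary N \<longleftrightarrow> x \<in> mboundary M" if "x \<in> mspace M" for x using key[OF that] by metis
qed

subsection \<open>Maps from the boundary torus to the circle\<close>

lemma cis_eq_1D: "cis a = 1 \<Longrightarrow> \<exists>n::int. a = 2 * pi * of_int n"
  unfolding cis_conv_exp exp_eq_1 by (auto simp: algebra_simps)

text \<open>A continuous function on a connected set with values in the discrete set 2 pi Z is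
  constant. The degrees below arise in this way.\<close>

lemma cis_const:
  fixes f :: "'x::real_normed_vector \<Rightarrow> real"
  assumes S: "connected S" and f: "continuous_on S f" and c: "\<And>x. x \<in> S \<Longrightarrow> cis (f x) = 1"
  shows "\<exists>n::int. \<forall>x\<in>S. f x = 2 * pi * of_int n"
proof (cases "S = {}")
  case False
  then obtain x0 where x0: "x0 \<in> S" by auto
  have "f constant_on S"
  proof (rule continuous_discrete_range_constant[OF S f])
    fix x assume x: "x \<in> S"
    obtain n :: int where n: "f x = 2 * pi * of_int n" using cis_eq_1D[OF c[OF x]] by auto
    have "2 * pi \<le> norm (f y - f x)" if y: "y \<in> S" "f y \<noteq> f x" for y
    proof -
      obtain m :: int where m: "f y = 2 * pi * of_int m" using cis_eq_1D[OF c[OF y(1)]] by auto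
      have "m \<noteq> n" using y(2) n m by auto
      then have "1 \<le> \<bar>real_of_int (m - n)\<bar>" by linarith
      moreover have "f y - f x = 2 * pi * of_int (m - n)" using n m by (simp add: algebra_simps)
      ultimately show ?thesis by (simp add: abs_mult)
    qed
    then show "\<exists>e>0. \<forall>y. y \<in> S \<and> f y \<noteq> f x \<longrightarrow> e \<le> norm (f y - f x)" using pi_gt_zero by (intro exI[of _ "2 * pi"]) auto
  qed
  then obtain k where k: "\<And>x. x \<in> S \<Longrightarrow> f x = k" unfolding constant_on_def by auto
  obtain n :: int where "f x0 = 2 * pi * of_int n" using cis_eq_1D[OF c[OF x0]] by auto
  then show ?thesis using k x0 by (intro exI[of _ n]) simp
qed simp

lemma cis_lift:
  fixes f :: "'x::real_normed_vector \<Rightarrow> complex"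
  assumes "continuous_on UNIV f" "\<And>x. norm (f x) = 1"
  obtains L where "continuous_on UNIV L" "\<And>x. f x = cis (L x)"
proof -
  have "\<And>z. z \<in> UNIV \<Longrightarrow> f z \<noteq> 0" using assms(2) by (metis norm_zero zero_neq_one)
  then obtain g where g: "continuous_on UNIV g" "\<And>x. x \<in> UNIV \<Longrightarrow> f x = exp (g x)"
    using continuous_logarithm_on_contractible[OF assms(1) contractible_UNIV] by metis
  have "f x = cis (Im (g x))" for x
  proof -
    have "exp (Re (g x)) = 1" using assms(2)[of x] g(2)[of x] by simp
    then have "g x = \<i> * complex_of_real (Im (g x))" by (simp add: complex_eq_iff)
    then show ?thesis using g(2)[of x] by (simp add: cis_conv_exp)
  qed
  moreover have "continuous_on UNIV (\<lambda>x. Im (g x))" by (intro continuous_intros g)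
  ultimately show thesis using that by metis
qed

lemma periodic_cis:
  fixes G :: "real \<Rightarrow> 'b"
  assumes p: "\<And>x. G (x + 2 * pi) = G x" and c: "cis x = cis y"
  shows "G x = G y"
proof -
  have nat: "G (x + 2 * pi * real n) = G x" for x n
  proof (induction n)
    case (Suc n)
    have "G (x + 2 * pi * real (Suc n)) = G ((x + 2 * pi * real n) + 2 * pi)" by (simp add: algebra_simps)
    then show ?case using Suc p by simp
  qed simp
  have "cis (x - y) = 1" using c by (simp add: cis_divide[symmetric])
  then obtain n :: int where n: "x - y = 2 * pi * of_int n" using cis_eq_1D by blast
  show ?thesis
  proof (cases "0 \<le> n")
    case True
    then have "x = y + 2 * pi * real (nat n)" using n by simp
    then show ?thesis using nat[of y "nat n"] by simp
  next
    case False
    then have "y = x + 2 * pi * real (nat (- n))" using n by simp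
    then show ?thesis using nat[of x "nat (- n)"] by simp
  qed
qed

lemma cis_powi: "cis a powi n = cis (of_int n * a)"
proof (cases "0 \<le> n")
  case True
  then show ?thesis using Complex.DeMoivre[of a "nat n"] by (simp add: power_int_def)
next
  case False
  then show ?thesis using Complex.DeMoivre[of "- a" "nat (- n)"] by (simp add: power_int_def)
qed

text \<open>Homotopy classes of maps from the three-torus to the circle are given by three degrees.  The degree along the
  curve \<open>l\<close> vanishes by the last assumption.\<close>

lemma suspension_torus_map:
  fixes XF XE :: "'a topology" and \<Phi> :: "'a \<times> real \<Rightarrow> 'a" and f :: "complex \<times> 'a \<Rightarrow> complex" and l :: "complex \<Rightarrow> 'a"
  assumes l: "continuous_map (top_of_set (sphere 0 1)) XF l" "continuous_map XF (top_of_set (sphere 0 1)) l'"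
      "\<And>x. x \<in> topspace XF \<Longrightarrow> l (l' x) = x" "\<And>z. norm z = 1 \<Longrightarrow> l' (l z) = z"
    and \<phi>: "continuous_map XF XF \<phi>" "\<And>y. y \<in> topspace XF \<Longrightarrow> \<exists>x\<in>topspace XF. \<phi> x = y"
    and \<Phi>: "continuous_map (prod_topology XF euclideanreal) XE \<Phi>"
      "\<And>x. x \<in> topspace XE \<Longrightarrow> \<exists>y\<in>topspace XF. \<exists>t. \<Phi> (y, t) = x"
      "\<And>x y s t. x \<in> topspace XF \<Longrightarrow> y \<in> topspace XF \<Longrightarrow> \<Phi> (x, s) = \<Phi> (y, t) \<longleftrightarrow>
            (\<exists>n::nat. s = t + real n \<and> y = (\<phi> ^^ n) x \<or> t = s + real n \<and> x = (\<phi> ^^ n) y)"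
      "\<And>x t. x \<in> topspace XF \<Longrightarrow> p (\<Phi> (x, t)) = c * cis (2 * pi * t)"
    and c: "c \<noteq> 0" and H: "Hausdorff_space XE"
    and f: "continuous_map (prod_topology (top_of_set (sphere 0 1)) XE) (top_of_set (sphere 0 1)) f"
    and s: "norm s = 1" and fs: "\<And>x. x \<in> topspace XF \<Longrightarrow> f (s, \<Phi> (x, 0)) = k"
  obtains a b :: int and h where
    "continuous_map (prod_topology (top_of_set (sphere 0 1)) XE) euclideanreal h"
    "\<And>\<theta> x. norm \<theta> = 1 \<Longrightarrow> x \<in> topspace XE \<Longrightarrow> f (\<theta>, x) = \<theta> powi a * (p x / c) powi b * cis (h (\<theta>, x))"
proof -
  let ?Z = "prod_topology (top_of_set (sphere (0::complex) 1)) XE"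
  \<comment> \<open>Parametrization of the circle times the mapping torus by R^3: the coordinates
    are the angle in the circle factor, the angle along \<open>l\<close>, and the suspension
    time.\<close>
  define \<kappa> where "\<kappa> q = (cis (fst q), \<Phi> (l (cis (fst (snd q))), snd (snd q)))" for q :: "real \<times> real \<times> real"
  have cc: "continuous_map euclidean (top_of_set (sphere 0 1)) (\<lambda>q. cis (g q))"
    if "continuous_on UNIV g" for g :: "'z::topological_space \<Rightarrow> real"
  proof -
    have "continuous_on UNIV (\<lambda>q. cis (g q))" by (intro continuous_intros that)
    then show ?thesis by (auto simp: continuous_map_in_subtopology)
  qed
  have cl: "continuous_map euclidean XF (\<lambda>q. l (cis (g q)))" if "continuous_on UNIV g"
      for g :: "'z::topological_space \<Rightarrow> real"
    using continuous_map_compose[OF cc[OF that] l(1)] by (simp add: o_def)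
  have lF: "l (cis v) \<in> topspace XF" for v using l(1) by (auto simp: continuous_map_def)
  have "continuous_map euclidean (prod_topology XF euclideanreal) (\<lambda>q::real \<times> real \<times> real. (l (cis (fst (snd q))), snd
      (snd q)))"
    unfolding continuous_map_paired by (intro conjI cl) (auto intro!: continuous_intros)
  then have "continuous_map euclidean XE (\<lambda>q::real \<times> real \<times> real. \<Phi> (l (cis (fst (snd q))), snd (snd q)))"
    using continuous_map_compose[OF _ \<Phi>(1)] by (fastforce simp: o_def)
  then have c\<kappa>: "continuous_map euclidean ?Z \<kappa>" unfolding \<kappa>_def continuous_map_paired
    by (intro conjI cc) (auto intro!: continuous_intros)
  have "continuous_map euclidean (top_of_set (sphere 0 1)) (f \<circ> \<kappa>)" by (rule continuous_map_compose[OF c\<kappa> f])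
  then have \<psi>: "continuous_on UNIV (\<lambda>q. f (\<kappa> q))" "\<And>q. norm (f (\<kappa> q)) = 1"
    by (auto simp: continuous_map_in_subtopology o_def)
  obtain L where L: "continuous_on UNIV L" "\<And>q. f (\<kappa> q) = cis (L q)" by (rule cis_lift[OF \<psi>]) blast
  have Lc: "continuous_on UNIV (\<lambda>q. L (g q))" if "continuous_on UNIV g"
      for g :: "'z::topological_space \<Rightarrow> real \<times> real \<times> real"
    using continuous_on_compose2[OF L(1) that] by simp
  have diff1: "cis (L q - L q') = 1" if "\<kappa> q = \<kappa> q'" for q q'
    using L(2)[of q] L(2)[of q'] that by (simp add: cis_divide[symmetric])
  \<comment> \<open>\<open>L\<close> is a real lift of \<open>f\<close>; its change under a full
    turn of the circle factor is 2 pi times the degree \<open>a\<close>.\<close>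
  have "\<exists>n::int. \<forall>q\<in>UNIV. L (fst q + 2 * pi, snd q) - L q = 2 * pi * of_int n"
  proof (rule cis_const)
    show "continuous_on UNIV (\<lambda>q. L (fst q + 2 * pi, snd q) - L q)" by (intro continuous_intros Lc L(1))
    show "cis (L (fst q + 2 * pi, snd q) - L q) = 1" for q
      by (rule diff1) (simp add: \<kappa>_def cis.ctr)
  qed (rule connected_UNIV)
  then obtain a :: int where a: "\<And>u v t. L (u + 2 * pi, v, t) = L (u, v, t) + 2 * pi * of_int a"
    by (force simp: algebra_simps)
  have "\<exists>n::int. \<forall>q\<in>UNIV. L (fst q, fst (snd q) + 2 * pi, snd (snd q)) - L q = 2 * pi * of_int n"
  proof (rule cis_const)
    show "continuous_on UNIV (\<lambda>q. L (fst q, fst (snd q) + 2 * pi, snd (snd q)) - L q)"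
        by (intro continuous_intros Lc L(1))
    show "cis (L (fst q, fst (snd q) + 2 * pi, snd (snd q)) - L q) = 1" for q
      by (rule diff1) (simp add: \<kappa>_def cis.ctr)
  qed (rule connected_UNIV)
  then obtain k2 :: int where k2: "\<And>u v t. L (u, v + 2 * pi, t) = L (u, v, t) + 2 * pi * of_int k2"
    by (force simp: algebra_simps)
  obtain u0 where u0: "s = cis u0" using s by (metis Ln_norm_1)
  \<comment> \<open>Over \<open>s\<close>, at time 0, \<open>f\<close> is constant along the curve
    \<open>l\<close>, so the degree \<open>k2\<close> along it is zero.\<close>
  have "\<exists>n::int. \<forall>v\<in>UNIV. L (u0, v, 0) - L (u0, 0, 0) = 2 * pi * of_int n"
  proof (rule cis_const)
    show "continuous_on UNIV (\<lambda>v. L (u0, v, 0) - L (u0, 0, 0))" by (intro continuous_intros Lc)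
    have "cis (L (u0, v, 0)) = k" for v using L(2)[of "(u0, v, 0)"] fs[OF lF] u0 by (simp add: \<kappa>_def)
    then have "cis (L (u0, v, 0)) = cis (L (u0, 0, 0))" for v by simp
    then show "cis (L (u0, v, 0) - L (u0, 0, 0)) = 1" for v by (simp add: cis_divide[symmetric])
  qed (rule connected_UNIV)
  then obtain n :: int where n: "\<And>v. L (u0, v, 0) - L (u0, 0, 0) = 2 * pi * of_int n" by auto
  have "L (u0, 2 * pi, 0) = L (u0, 0, 0)" using n[of "2 * pi"] n[of 0] by simp
  then have "k2 = 0" using k2[of u0 0 0] by simp
  then have v_per: "\<And>u v t. L (u, v + 2 * pi, t) = L (u, v, t)" using k2 by simp
  \<comment> \<open>\<open>m\<close> lifts the return map \<open>\<phi>\<close>, read in the angle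
    along \<open>l\<close>, to the real line. Comparing time t + 1 at angle v with time t at angle
    \<open>m v\<close> then gives the remaining degree \<open>b\<close>.\<close>
  have "continuous_map euclidean (top_of_set (sphere 0 1)) (\<lambda>v. l' (\<phi> (l (cis v))))"
    using continuous_map_compose[OF continuous_map_compose[OF cl[OF continuous_on_id] \<phi>(1)] l(2)] by (simp add: o_def)
  then have "continuous_on UNIV (\<lambda>v. l' (\<phi> (l (cis v))))" "\<And>v. norm (l' (\<phi> (l (cis v)))) = 1"
    by (auto simp: continuous_map_in_subtopology)
  then obtain m where m: "continuous_on UNIV m" "\<And>v::real. l' (\<phi> (l (cis v))) = cis (m v)" by (rule cis_lift) blast
  have \<phi>F: "\<phi> x \<in> topspace XF" if "x \<in> topspace XF" for x using \<phi>(1) that by (auto simp: continuous_map_def)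
  have lm: "l (cis (m v)) = \<phi> (l (cis v))" for v using m(2)[of v] l(3)[OF \<phi>F[OF lF]] by metis
  have \<Phi>shift: "\<Phi> (x, t + 1) = \<Phi> (\<phi> x, t)" if "x \<in> topspace XF" for x t
    unfolding \<Phi>(3)[OF that \<phi>F[OF that]] by (intro exI[of _ 1]) simp
  have "\<exists>n::int. \<forall>q\<in>UNIV. L (fst q, fst (snd q), snd (snd q) + 1) - L (fst q, m (fst (snd q)), snd (snd q)) = 2 * pi *
      of_int n"
  proof (rule cis_const)
    have "continuous_on UNIV (\<lambda>q::real \<times> real \<times> real. m (fst (snd q)))"
      by (rule continuous_on_compose2[OF m(1)]) (auto intro!: continuous_intros)
    then show "continuous_on UNIV (\<lambda>q. L (fst q, fst (snd q), snd (snd q) + 1) - L (fst q, m (fst (snd q)), snd (snd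
        q)))"
      by (intro continuous_intros Lc)
    show "cis (L (fst q, fst (snd q), snd (snd q) + 1) - L (fst q, m (fst (snd q)), snd (snd q))) = 1" for q
      by (rule diff1) (simp add: \<kappa>_def lm \<Phi>shift[OF lF])
  qed (rule connected_UNIV)
  then obtain b :: int where b: "\<And>u v t. L (u, v, t + 1) = L (u, m v, t) + 2 * pi * of_int b"
    by (force simp: algebra_simps)
  \<comment> \<open>After the linear parts are subtracted, \<open>G\<close> respects all
    identifications made by \<open>\<kappa>\<close> and descends to \<open>h\<close>. The linear
    part in time corresponds to the power of \<open>p x / c\<close>, as \<open>p\<close> turns once
    per unit of time.\<close>
  define G where "G u v t = L (u, v, t) - of_int a * u - 2 * pi * of_int b * t" for u v t
  have G1: "G u v t = G u' v t" if "cis u = cis u'" for u u' v t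
    by (rule periodic_cis[OF _ that]) (unfold G_def a, simp add: algebra_simps)
  have G2: "G u v t = G u v' t" if "cis v = cis v'" for u v v' t
    by (rule periodic_cis[OF _ that]) (simp add: G_def v_per)
  have G3: "G u v (t + 1) = G u (m v) t" for u v t by (unfold G_def b, simp add: algebra_simps)
  have \<phi>n: "(\<phi> ^^ n) x \<in> topspace XF" if "x \<in> topspace XF" for n x by (induction n) (simp_all add: that \<phi>F)
  have G2': "G u v t = G u v' t" if "l (cis v) = l (cis v')" for u v v' t
  proof (rule G2)
    have "cis v = l' (l (cis v))" by (rule l(4)[symmetric]) simp
    also have "\<dots> = cis v'" unfolding that by (rule l(4)) simp
    finally show "cis v = cis v'" .
  qed
  have Gn: "G u v (t + real n) = G u v' t" if "l (cis v') = (\<phi> ^^ n) (l (cis v))" for u v v' t n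
    using that
  proof (induction n arbitrary: v)
    case 0
    then show ?case using G2'[of v v'] by simp
  next
    case (Suc n)
    have "l (cis v') = (\<phi> ^^ n) (l (cis (m v)))" using Suc.prems lm by (simp add: funpow_swap1)
    have "G u v (t + real (Suc n)) = G u v ((t + real n) + 1)" by (simp add: ac_simps)
    also have "\<dots> = G u (m v) (t + real n)" by (rule G3)
    also have "\<dots> = G u v' t" by (rule Suc.IH) fact
    finally show ?case .
  qed
  have wd: "G u v t = G u' v' t'" if e: "\<kappa> (u, v, t) = \<kappa> (u', v', t')" for u v t u' v' t'
  proof -
    have "cis u = cis u'" and "\<Phi> (l (cis v), t) = \<Phi> (l (cis v'), t')" using e by (simp_all add: \<kappa>_def)
    then obtain n where "t = t' + real n \<and> l (cis v') = (\<phi> ^^ n) (l (cis v)) \<or> t' = t + real n \<and>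
        l (cis v) = (\<phi> ^^ n) (l (cis v'))"
      using \<Phi>(3)[OF lF lF] by blast
    then have "G u v t = G u v' t'"
    proof (elim disjE conjE)
      assume "t = t' + real n" "l (cis v') = (\<phi> ^^ n) (l (cis v))"
      then show ?thesis using Gn[of v' n v u t'] by simp
    next
      assume "t' = t + real n" "l (cis v) = (\<phi> ^^ n) (l (cis v'))"
      then show ?thesis using Gn[of v n v' u t] by simp
    qed
    then show ?thesis using G1[OF \<open>cis u = cis u'\<close>] by simp
  qed
  \<comment> \<open>A compact set that \<open>\<kappa>\<close> maps onto the whole space: angles
    within a full turn, time reduced to its fractional part. From a compact to a Hausdorff space
    \<open>\<kappa>\<close> is a closed map, hence a quotient map, which is what gives continuity of
    \<open>h\<close>.\<close>
  define D where "D = {0..2 * pi} \<times> {0..2 * pi} \<times> {0..1::real}"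
  have cov: "\<exists>q\<in>D. \<kappa> q = z" if z: "z \<in> topspace ?Z" for z
  proof -
    obtain \<theta> x where zx: "z = (\<theta>, x)" "norm \<theta> = 1" "x \<in> topspace XE" using z by auto
    have ang: "\<exists>u\<in>{0..2 * pi}. \<theta> = cis u" if "norm \<theta> = 1" for \<theta>
      using complex_norm_eq_1_exp[of \<theta>] Arg2pi[of \<theta>] that
      by (intro bexI[of _ "Arg2pi \<theta>"]) (auto simp: cis_conv_exp less_imp_le)
    obtain u where u: "u \<in> {0..2 * pi}" "\<theta> = cis u" using ang[OF zx(2)] by blast
    obtain y t where y: "y \<in> topspace XF" "\<Phi> (y, t) = x" using \<Phi>(2)[OF zx(3)] by blast
    have "\<exists>y'\<in>topspace XF. \<Phi> (y', frac t) = x"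
    proof (cases "0 \<le> \<lfloor>t\<rfloor>")
      case True
      have "\<Phi> (y, t) = \<Phi> ((\<phi> ^^ nat \<lfloor>t\<rfloor>) y, frac t)"
        unfolding \<Phi>(3)[OF y(1) \<phi>n[OF y(1)]] using True by (intro exI[of _ "nat \<lfloor>t\<rfloor>"]) (simp add: frac_def)
      then show ?thesis using y \<phi>n[OF y(1)] by metis
    next
      case False
      define n where "n = nat (- \<lfloor>t\<rfloor>)"
      \<comment> \<open>To raise a negative time one has to go back along \<open>\<phi>\<close>,
        which is possible by surjectivity.\<close>
      have "\<exists>y'\<in>topspace XF. (\<phi> ^^ n) y' = y" for n
        using y(1)
      proof (induction n arbitrary: y)
        case (Suc n)
        obtain x where x: "x \<in> topspace XF" "\<phi> x = y" using \<phi>(2)[OF Suc.prems] by blast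
        obtain y' where "y' \<in> topspace XF" "(\<phi> ^^ n) y' = x" using Suc.IH[OF x(1)] by blast
        then show ?case using x by (intro bexI[of _ y']) auto
      qed auto
      then obtain y' where y': "y' \<in> topspace XF" "(\<phi> ^^ n) y' = y" by blast
      have "\<Phi> (y', frac t) = \<Phi> (y, t)"
        unfolding \<Phi>(3)[OF y'(1) y(1)] using False y'(2) by (intro exI[of _ n]) (simp add: frac_def n_def)
      then show ?thesis using y' y(2) by metis
    qed
    then obtain y' where y': "y' \<in> topspace XF" "\<Phi> (y', frac t) = x" by blast
    have "norm (l' y') = 1" using l(2) y'(1) by (auto simp: continuous_map_def)
    then obtain v where v: "v \<in> {0..2 * pi}" "l' y' = cis v" using ang by blast
    have "l (cis v) = y'" using l(3)[OF y'(1)] v(2) by simp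
    then have "\<kappa> (u, v, frac t) = z" using y'(2) u(2) zx(1) by (simp add: \<kappa>_def)
    moreover have "(u, v, frac t) \<in> D" using u(1) v(1) frac_lt_1[of t] by (simp add: D_def less_imp_le)
    ultimately show ?thesis by blast
  qed
  define h where "h z = (case (SOME q. \<kappa> q = z) of (u, v, t) \<Rightarrow> G u v t)" for z
  have h\<kappa>: "h (\<kappa> q) = G (fst q) (fst (snd q)) (snd (snd q))" for q
  proof -
    have "\<kappa> (SOME q'. \<kappa> q' = \<kappa> q) = \<kappa> q" by (rule someI[of "\<lambda>q'. \<kappa> q' = \<kappa> q" q]) simp
    then show ?thesis unfolding h_def using wd by (metis (no_types, lifting) case_prod_beta prod.collapse)
  qed
  have cD: "continuous_map (top_of_set D) ?Z \<kappa>" by (rule continuous_map_from_subtopology[OF c\<kappa>])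
  have "compact D" unfolding D_def by (intro compact_Times compact_Icc)
  then have "compact_space (top_of_set D)" by (simp add: compact_space_subtopology)
  moreover have "kc_space ?Z" by (rule Hausdorff_imp_kc_space) (simp add: Hausdorff_space_prod_topology
      Hausdorff_space_subtopology H)
  ultimately have "closed_map (top_of_set D) ?Z \<kappa>" using continuous_imp_closed_map_gen cD by blast
  moreover have "\<kappa> ` topspace (top_of_set D) = topspace ?Z"
  proof (intro equalityI subsetI)
    fix z assume "z \<in> \<kappa> ` topspace (top_of_set D)"
    then show "z \<in> topspace ?Z" using cD unfolding continuous_map_def by blast
  next
    fix z assume "z \<in> topspace ?Z"
    then obtain q where "q \<in> D" "\<kappa> q = z" using cov by blast
    then show "z \<in> \<kappa> ` topspace (top_of_set D)" by auto
  qed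
  ultimately have q: "quotient_map (top_of_set D) ?Z \<kappa>" by (rule continuous_closed_imp_quotient_map[OF cD])
  have "continuous_on UNIV (\<lambda>q. G (fst q) (fst (snd q)) (snd (snd q)))"
    unfolding G_def by (intro continuous_intros Lc)
  then have "continuous_on D (h \<circ> \<kappa>)" unfolding o_def h\<kappa> by (rule continuous_on_subset) simp
  then have "continuous_map (top_of_set D) euclideanreal (h \<circ> \<kappa>)" by simp
  then have ch: "continuous_map ?Z euclideanreal h" by (rule continuous_compose_quotient_map[OF q])
  show thesis
  proof (rule that[OF ch, of a b])
    fix \<theta> :: complex and x assume z: "norm \<theta> = 1" "x \<in> topspace XE"
    then have "(\<theta>, x) \<in> topspace ?Z" by simp
    then obtain q where "\<kappa> q = (\<theta>, x)" using cov by blast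
    then obtain u v t where q: "\<kappa> (u, v, t) = (\<theta>, x)" by (cases q) auto
    have \<theta>: "\<theta> = cis u" "x = \<Phi> (l (cis v), t)" using q by (simp_all add: \<kappa>_def)
    have "p x / c = cis (2 * pi * t)" using \<Phi>(4)[OF lF] c \<theta>(2) by simp
    moreover have "h (\<theta>, x) = L (u, v, t) - of_int a * u - 2 * pi * of_int b * t"
      using h\<kappa>[of "(u, v, t)"] q by (simp add: G_def)
    moreover have "f (\<theta>, x) = cis (L (u, v, t))" using L(2)[of "(u, v, t)"] q by simp
    ultimately show "f (\<theta>, x) = \<theta> powi a * (p x / c) powi b * cis (h (\<theta>, x))"
      by (simp add: \<theta>(1) cis_powi cis_mult algebra_simps)
  qed
qed

subsection \<open>Functions decaying in a collar\<close>

lemma mboundary_closed: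
  assumes M: "smooth_manifold M" shows "closedin (mtop M) (mboundary M)"
proof -
  have "\<exists>T. openin (mtop M) T \<and> y \<in> T \<and> T \<subseteq> mspace M - mboundary M" if y: "y \<in> mspace M - mboundary M" for y
  proof -
    have yM: "y \<in> mspace M" using y by simp
    obtain U \<phi> V b \<Omega> where "(U, \<phi>) \<in> full_atlas M" and U: "y \<in> U" "chart_data (mdim M) (mtop M) U \<phi> V b \<Omega>"
        "b = 0 \<or> y \<in> mboundary M"
      by (rule interior_chart[OF M yM])
    have "b = 0" using U(3) y by simp
    then have "z \<notin> mboundary M" if "z \<in> U" for z using mboundary_chart_iff[OF M U(2) that] by simp
    then show ?thesis using chart_dataD(1,10)[OF U(2)] U(1) by blast
  qed
  then have "openin (mtop M) (mspace M - mboundary M)" by (subst openin_subopen) blast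
  then show ?thesis using mboundary_subset[OF M] by (simp add: closedin_def)
qed

lemma mboundary_compact:
  assumes M: "smooth_manifold M" and "compact_space (mtop M)" shows "compactin (mtop M) (mboundary M)"
  using closedin_compact_space[OF assms(2) mboundary_closed[OF M]] .

section \<open>Extending positive functions from the boundary\<close>

text \<open>The product is the weight of the constant 1: it equals 1 where no bump is active, and
  otherwise some term of the sum is positive. This keeps glued functions positive on the whole
  manifold.\<close>

lemma bump_sum_pos:
  fixes \<beta> f :: "'i \<Rightarrow> real"
  assumes I: "finite I" and \<beta>: "\<And>i. i \<in> I \<Longrightarrow> 0 \<le> \<beta> i \<and> \<beta> i \<le> 1" and f: "\<And>i. i \<in> I \<Longrightarrow> \<beta> i \<noteq> 0 \<Longrightarrow> 0 < f i"
  shows "0 < (\<Sum>i\<in>I. \<beta> i * f i) + (\<Prod>i\<in>I. 1 - \<beta> i)"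
proof (cases "\<exists>i\<in>I. \<beta> i \<noteq> 0")
  case True
  then obtain i where i: "i \<in> I" "\<beta> i \<noteq> 0" by blast
  have nn: "0 \<le> \<beta> j * f j" if "j \<in> I" for j using \<beta>[OF that] f[OF that] by (cases "\<beta> j = 0") auto
  have "0 < \<beta> i * f i" using \<beta>[OF i(1)] f[OF i] i(2) by auto
  then have "0 < (\<Sum>i\<in>I. \<beta> i * f i)" by (rule sum_pos2[OF I i(1)]) (rule nn)
  moreover have "0 \<le> (\<Prod>i\<in>I. 1 - \<beta> i)" by (rule prod_nonneg) (use \<beta> in auto)
  ultimately show ?thesis by linarith
next
  case False
  then have "\<And>i. i \<in> I \<Longrightarrow> \<beta> i = 0" by blast
  then show ?thesis by simp
qed

lemma bump_inD:
  assumes "bump_in M \<beta> T"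
  shows "smooth_in M euclidean_mfd (mspace M) \<beta>" "0 \<le> \<beta> y" "\<beta> y \<le> 1" "\<beta> y \<noteq> 0 \<Longrightarrow> y \<in> T"
  using assms unfolding bump_in_def by blast+

text \<open>A local smooth extension of the coordinate expression, restricted to the open set on
  which it is positive.\<close>

lemma positive_local_extension:
  assumes M: "smooth_manifold M" and h: "smooth_in M euclidean_mfd S h" and x: "x \<in> S" "0 < h x"
  shows "\<exists>T g. openin (mtop M) T \<and> x \<in> T \<and> smooth_in M euclidean_mfd T g \<and> (\<forall>y\<in>T. 0 < g y) \<and>
     (\<forall>y\<in>T \<inter> S. g y = (h y :: real))"
proof -
  have "x \<in> mspace M" using x smooth_in_subset_mspace[OF h] by auto
  then obtain U \<phi> where U: "(U, \<phi>) \<in> full_atlas M" "x \<in> U" using atlas_cover[OF M] by metis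
  have "\<phi> x \<in> \<phi> ` (U \<inter> S)" using U x by auto
  then obtain G g where G: "open G" "smooth_on G g" "\<phi> x \<in> G" "\<forall>y\<in>G \<inter> \<phi> ` (U \<inter> S). g y = h (inv_into U \<phi> y)"
    by (rule smooth_onE[OF smooth_in_real_chart[OF M h U(1)]])
  define T where "T = U \<inter> \<phi> -` (G \<inter> g -` {0<..})"
  have eq: "g (\<phi> y) = h y" if "y \<in> U" "\<phi> y \<in> G" "y \<in> S" for y
    using G(4) that full_atlas_inv[OF U(1) that(1)] by auto
  have "open (G \<inter> g -` {0<..})" by (rule continuous_open_preimage[OF smooth_on_continuous[OF G(2)] G(1)]) simp
  then have oT: "openin (mtop M) T" unfolding T_def by (rule chart_preimage[OF full_atlas_chart[OF U(1)]])
  have "smooth_in M euclidean_mfd T \<phi>" by (rule smooth_in_subset[OF smooth_in_chart[OF M U(1)]]) (auto simp: T_def)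
  then have "smooth_in M euclidean_mfd T (\<lambda>y. g (\<phi> y))"
    by (rule smooth_in_euclidean_comp[OF M _ G(2)]) (auto simp: T_def)
  then show ?thesis using oT eq eq[OF U(2) G(3) x(1)] U x G(3)
    by (intro exI[of _ T] exI[of _ "\<lambda>y. g (\<phi> y)"]) (auto simp: T_def)
qed

text \<open>The quotient \<open>N y / D y\<close> is the average of the local extensions
  \<open>g i\<close> with weights \<open>\<beta> i\<close> and of the constant 1 with weight
  \<open>q\<close>. All averaged values are positive; on \<open>S\<close> the weight
  \<open>q\<close> vanishes, and every active \<open>g i\<close> equals \<open>h\<close>.\<close>

lemma positive_extension:
  assumes M: "smooth_manifold M" and K: "compactin (mtop M) S" and h: "smooth_in M euclidean_mfd S h"
    and pos: "\<And>x. x \<in> S \<Longrightarrow> 0 < (h x :: real)"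
  obtains k where "smooth_in M euclidean_mfd (mspace M) k" "\<And>x. x \<in> mspace M \<Longrightarrow> 0 < k x" "\<And>x. x \<in> S \<Longrightarrow> k x = h x"
proof -
  have "\<forall>x\<in>S. \<exists>T g. openin (mtop M) T \<and> x \<in> T \<and> smooth_in M euclidean_mfd T g \<and> (\<forall>y\<in>T. 0 < g y) \<and>
     (\<forall>y\<in>T \<inter> S. g y = h y)"
    by (intro ballI positive_local_extension[OF M h] pos)
  from bchoice[OF this] obtain T where "\<forall>x\<in>S. \<exists>g. openin (mtop M) (T x) \<and> x \<in> T x \<and>
      smooth_in M euclidean_mfd (T x) g \<and> (\<forall>y\<in>T x. 0 < g y) \<and>
     (\<forall>y\<in>T x \<inter> S. g y = h y)" by (elim exE)
  from bchoice[OF this] obtain g where "\<forall>x\<in>S. openin (mtop M) (T x) \<and> x \<in> T x \<and>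
      smooth_in M euclidean_mfd (T x) (g x) \<and> (\<forall>y\<in>T x. 0 < g x y) \<and>
     (\<forall>y\<in>T x \<inter> S. g x y = h y)" by (elim exE)
  then have T: "\<And>x. x \<in> S \<Longrightarrow> openin (mtop M) (T x)" "\<And>x. x \<in> S \<Longrightarrow> x \<in> T x"
    and g: "\<And>x. x \<in> S \<Longrightarrow> smooth_in M euclidean_mfd (T x) (g x)" "\<And>x y. x \<in> S \<Longrightarrow> y \<in> T x \<Longrightarrow> 0 < g x y"
       "\<And>x y. x \<in> S \<Longrightarrow> y \<in> T x \<Longrightarrow> y \<in> S \<Longrightarrow> g x y = h y" by simp_all
  obtain I \<beta> where I: "finite I" "I \<subseteq> S" and \<beta>: "\<And>i. i \<in> I \<Longrightarrow> bump_in M (\<beta> i) (T i)"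
    and Z: "\<exists>Z. openin (mtop M) Z \<and> S \<subseteq> Z \<and> (\<forall>y\<in>Z. \<exists>i\<in>I. \<beta> i y = 1)"
    by (rule bump_cover[OF M K, of T]) (use T in auto)
  define q where "q y = (\<Prod>i\<in>I. 1 - \<beta> i y)" for y
  define N where "N y = (\<Sum>i\<in>I. \<beta> i y * g i y) + q y" for y
  define D where "D y = (\<Sum>i\<in>I. \<beta> i y * 1) + q y" for y
  have iS: "i \<in> S" if "i \<in> I" for i using I that by auto
  note \<beta>s = bump_inD(1)[OF \<beta>]
  have "smooth_in M euclidean_mfd (mspace M) (\<lambda>y. 1 - \<beta> i y)" if "i \<in> I" for i
    by (rule smooth_in_euclidean_comp[OF M \<beta>s[OF that], of UNIV])
      (auto intro!: smooth_on_diff smooth_on_const smooth_on_id)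
  then have sq: "smooth_in M euclidean_mfd (mspace M) q" unfolding q_def by (rule smooth_in_prod[OF M subset_refl])
  have sb: "smooth_in M euclidean_mfd (mspace M) (\<lambda>y. \<beta> i y * g i y)" if "i \<in> I" for i
    by (rule bump_mult[OF M subset_refl T(1)[OF iS[OF that]] \<beta>[OF that]])
      (rule smooth_in_subset[OF g(1)[OF iS[OF that]]], simp)
  have sN: "smooth_in M euclidean_mfd (mspace M) N" unfolding N_def
    by (intro smooth_in_add[OF M] smooth_in_sum[OF M subset_refl] sb sq)
  have sD: "smooth_in M euclidean_mfd (mspace M) D" unfolding D_def
    by (intro smooth_in_add[OF M] smooth_in_sum[OF M subset_refl] smooth_in_mult[OF M] \<beta>s smooth_in_const[OF M] sq
        subset_refl)
  have Npos: "0 < N y" for y unfolding N_def q_def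
    by (rule bump_sum_pos[OF I(1)]) (use bump_inD(2-4)[OF \<beta>] g(2)[OF iS] in auto)
  have Dpos: "0 < D y" for y unfolding D_def q_def
    by (rule bump_sum_pos[OF I(1)]) (use bump_inD(2-4)[OF \<beta>] in auto)
  show thesis
  proof (rule that[of "\<lambda>y. N y / D y"])
    show "smooth_in M euclidean_mfd (mspace M) (\<lambda>y. N y / D y)"
      by (rule smooth_in_comp2[OF M sN sD, of "{p. snd p \<noteq> 0}"])
        (use Dpos in \<open>auto intro!: smooth_on_divide smooth_on_fst smooth_on_snd simp: less_imp_neq[symmetric] simp
            del: zero_neq_one\<close>)
    show "0 < N y / D y" for y using Npos Dpos by simp
    fix y assume y: "y \<in> S"
    have "\<exists>i\<in>I. \<beta> i y = 1" using Z y by blast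
    then have q0: "q y = 0" unfolding q_def by (simp add: I(1))
    have "\<beta> i y * g i y = \<beta> i y * h y" if "i \<in> I" for i
      using g(3)[OF iS[OF that], of y] bump_inD(4)[OF \<beta>[OF that], of y] y by (cases "\<beta> i y = 0") auto
    then have "(\<Sum>i\<in>I. \<beta> i y * g i y) = (\<Sum>i\<in>I. \<beta> i y * h y)" by (rule sum.cong[OF refl])
    then have "N y = h y * D y" unfolding N_def D_def q0 by (simp add: sum_distrib_left[symmetric] mult.commute)
    then show "N y / D y = h y" using Dpos[of y] by simp
  qed
qed

section \<open>A defining function of the boundary\<close>

text \<open>\<open>r\<close> sums the normal coordinates b.\<phi> of finitely many boundary charts,
  weighted by bumps, plus a term that is 1 away from them. The predicate \<open>P\<close> carries
  along a property of the charts: the chart obtained at \<open>x\<close> is the member of the finite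
  cover whose bump is 1 at \<open>x\<close>, not the one that \<open>ch\<close> gives at
  \<open>x\<close>. The lower bound is later turned into a positive normal derivative of
  \<open>r\<close>.\<close>

lemma defining_function:
  assumes M: "smooth_manifold M" and comp: "compact_space (mtop M)"
    and ch: "\<And>x. x \<in> mboundary M \<Longrightarrow> \<exists>U \<phi> V b \<Omega>. (U, \<phi>) \<in> full_atlas M \<and> x \<in> U \<and>
       chart_data (mdim M) (mtop M) U \<phi> V b \<Omega> \<and> P U \<phi> b"
  obtains r where "smooth_in M euclidean_mfd (mspace M) r" "\<And>x. x \<in> mboundary M \<Longrightarrow> r x = 0"
     "\<And>x. x \<in> mspace M \<Longrightarrow> x \<notin> mboundary M \<Longrightarrow> 0 < (r x :: real)"
     "\<And>x. x \<in> mboundary M \<Longrightarrow> \<exists>U \<phi> V b \<Omega> T. (U, \<phi>) \<in> full_atlas M \<and> x \<in> U \<and>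
       chart_data (mdim M) (mtop M) U \<phi> V b \<Omega> \<and> P U \<phi> b \<and> openin (mtop M) T \<and> x \<in> T \<and>
       (\<forall>y\<in>U \<inter> T. (b \<bullet> \<phi> y) / 2 \<le> r y)"
proof -
  obtain U \<phi> V b \<Omega> where C0: "\<And>x. x \<in> mboundary M \<Longrightarrow> (U x, \<phi> x) \<in> full_atlas M \<and> x \<in> U x \<and>
       chart_data (mdim M) (mtop M) (U x) (\<phi> x) (V x) (b x) (\<Omega> x) \<and> P (U x) (\<phi> x) (b x)" 
    using ch by metis
  then have C: "\<And>x. x \<in> mboundary M \<Longrightarrow> (U x, \<phi> x) \<in> full_atlas M" "\<And>x. x \<in> mboundary M \<Longrightarrow> x \<in> U x"
    "\<And>x. x \<in> mboundary M \<Longrightarrow> chart_data (mdim M) (mtop M) (U x) (\<phi> x) (V x) (b x) (\<Omega> x)"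
    "\<And>x. x \<in> mboundary M \<Longrightarrow> P (U x) (\<phi> x) (b x)" by simp_all
  note oU = chart_dataD(1)[OF C(3)]
  obtain I \<beta> where I: "finite I" "I \<subseteq> mboundary M" and \<beta>: "\<And>i. i \<in> I \<Longrightarrow> bump_in M (\<beta> i) (U i)"
    and Z: "\<exists>Z. openin (mtop M) Z \<and> mboundary M \<subseteq> Z \<and> (\<forall>y\<in>Z. \<exists>i\<in>I. \<beta> i y = 1)"
    by (rule bump_cover[OF M mboundary_compact[OF M comp], of U]) (use C(2) oU in auto)
  have iB: "i \<in> mboundary M" if "i \<in> I" for i using I that by auto
  define q where "q y = (\<Prod>i\<in>I. 1 - \<beta> i y)" for y
  define r where "r y = (\<Sum>i\<in>I. \<beta> i y * (b i \<bullet> \<phi> i y)) + q y" for y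
  note \<beta>s = bump_inD(1)[OF \<beta>]
  have "smooth_in M euclidean_mfd (mspace M) (\<lambda>y. 1 - \<beta> i y)" if "i \<in> I" for i
    by (rule smooth_in_euclidean_comp[OF M \<beta>s[OF that], of UNIV])
      (auto intro!: smooth_on_diff smooth_on_const smooth_on_id)
  then have sq: "smooth_in M euclidean_mfd (mspace M) q" unfolding q_def by (rule smooth_in_prod[OF M subset_refl])
  have sb: "smooth_in M euclidean_mfd (mspace M) (\<lambda>y. \<beta> i y * (b i \<bullet> \<phi> i y))" if "i \<in> I" for i
  proof (rule bump_mult[OF M subset_refl oU[OF iB[OF that]] \<beta>[OF that]])
    have "smooth_in M euclidean_mfd (mspace M \<inter> U i) (\<phi> i)"
      by (rule smooth_in_subset[OF smooth_in_chart[OF M C(1)[OF iB[OF that]]]]) simp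
    then show "smooth_in M euclidean_mfd (mspace M \<inter> U i) (\<lambda>y. b i \<bullet> \<phi> i y)"
      by (rule smooth_in_euclidean_comp[OF M _ smooth_on_linear[OF bounded_linear_inner_right], of _ _ UNIV]) simp
  qed
  have nn: "0 \<le> \<beta> i y * (b i \<bullet> \<phi> i y)" if "i \<in> I" for i y
  proof (cases "\<beta> i y = 0")
    case False
    have "\<phi> i y \<in> \<phi> i ` U i" by (rule imageI, rule bump_inD(4)[OF \<beta>[OF that] False])
    then show ?thesis unfolding chart_dataD(9)[OF C(3)[OF iB[OF that]]] using bump_inD(2)[OF \<beta>[OF that], of y] by simp
  qed simp
  have q0: "0 \<le> q y" for y unfolding q_def by (rule prod_nonneg) (use bump_inD(3)[OF \<beta>] in auto)
  show thesis
  proof (rule that[of r])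
    show "smooth_in M euclidean_mfd (mspace M) r" unfolding r_def
      by (intro smooth_in_add[OF M] smooth_in_sum[OF M subset_refl] sb sq)
  next
    fix x assume x: "x \<in> mboundary M"
    then obtain i where i: "i \<in> I" "\<beta> i x = 1" using Z by blast
    then have qx: "q x = 0" unfolding q_def using I(1) by auto
    have "\<beta> i x * (b i \<bullet> \<phi> i x) = 0" if "i \<in> I" for i
      using bump_inD(4)[OF \<beta>[OF that], of x] mboundary_chart_iff[OF M C(3)[OF iB[OF that]], of x] x by auto
    then have "(\<Sum>i\<in>I. \<beta> i x * (b i \<bullet> \<phi> i x)) = 0" by (rule sum.neutral[OF ballI])
    then show "r x = 0" unfolding r_def qx by simp
    have xU: "x \<in> U i" by (rule bump_inD(4)[OF \<beta>[OF i(1)]]) (simp add: i(2))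
    \<comment> \<open>\<open>T\<close> is the part where the bump exceeds 1/2, whence the factor 1/2
      in the bound; all other terms of \<open>r\<close> are nonnegative.\<close>
    obtain T where T: "openin (mtop M) T" "mspace M \<inter> \<beta> i -` {1/2<..} = mspace M \<inter> T"
      by (rule smooth_in_preimage[OF \<beta>s[OF i(1)], of "{1/2<..}"]) auto
    have Tiff: "y \<in> T \<longleftrightarrow> 1/2 < \<beta> i y" if "y \<in> mspace M" for y
    proof -
      have "y \<in> mspace M \<inter> \<beta> i -` {1/2<..} \<longleftrightarrow> y \<in> mspace M \<inter> T" by (simp only: T(2))
      then show ?thesis using that by simp
    qed
    have xM: "x \<in> mspace M" using x mboundary_subset[OF M] by auto
    have "(b i \<bullet> \<phi> i y) / 2 \<le> r y" if y: "y \<in> U i \<inter> T" for y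
    proof -
      have yU: "y \<in> U i" using y by simp
      have yM: "y \<in> mspace M" using yU chart_dataD(10)[OF C(3)[OF iB[OF i(1)]]] by auto
      have b0: "0 \<le> b i \<bullet> \<phi> i y" using chart_dataD(9)[OF C(3)[OF iB[OF i(1)]]] yU by auto
      have "1 / 2 \<le> \<beta> i y" using Tiff[OF yM] y by simp
      then have "1 / 2 * (b i \<bullet> \<phi> i y) \<le> \<beta> i y * (b i \<bullet> \<phi> i y)" using b0 by (rule mult_right_mono)
      also have "\<dots> \<le> (\<Sum>i\<in>I. \<beta> i y * (b i \<bullet> \<phi> i y))" by (rule member_le_sum[OF i(1) _ I(1)]) (rule nn, simp)
      finally show ?thesis using q0[of y] by (simp add: r_def)
    qed
    then show "\<exists>U \<phi> V b \<Omega> T. (U, \<phi>) \<in> full_atlas M \<and> x \<in> U \<and>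
       chart_data (mdim M) (mtop M) U \<phi> V b \<Omega> \<and> P U \<phi> b \<and> openin (mtop M) T \<and> x \<in> T \<and>
       (\<forall>y\<in>U \<inter> T. (b \<bullet> \<phi> y) / 2 \<le> r y)"
      using C(1,3,4)[OF iB[OF i(1)]] xU T(1) Tiff[OF xM] i(2)
      by (intro exI[of _ "U i"] exI[of _ "\<phi> i"] exI[of _ "V i"] exI[of _ "b i"] exI[of _ "\<Omega> i"] exI[of _ T]) simp
  next
    fix x assume x: "x \<in> mspace M" "x \<notin> mboundary M"
    show "0 < r x" unfolding r_def q_def
    proof (rule bump_sum_pos[OF I(1)])
      fix i assume i: "i \<in> I"
      show "0 \<le> \<beta> i x \<and> \<beta> i x \<le> 1" using bump_inD(2,3)[OF \<beta>[OF i]] by simp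
      assume "\<beta> i x \<noteq> 0"
      then have xU: "x \<in> U i" by (rule bump_inD(4)[OF \<beta>[OF i]])
      have "b i \<noteq> 0" using mboundary_chart_iff[OF M C(3)[OF iB[OF i]] C(2)[OF iB[OF i]]] iB[OF i] by simp
      moreover have "0 \<le> b i \<bullet> \<phi> i x" using chart_dataD(9)[OF C(3)[OF iB[OF i]]] xU by auto
      ultimately show "0 < b i \<bullet> \<phi> i x" using mboundary_chart_iff[OF M C(3)[OF iB[OF i]] xU] x(2) by simp
    qed
  qed
qed

section \<open>Steep decay along normal lines\<close>

text \<open>e^(-1/u) has derivative u^(-2) e^(-1/u), at least its own value for 0 < u \<le> 1. So
  the decrease of the second factor contributes at least c C \<alpha> times this value, the
  variation of \<open>k\<close> at most \<open>K\<close> times it. The value cancels from the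
  comparison, so the estimate also holds where the product is tiny.\<close>

lemma flat_product_decreasing:
  fixes k g :: "real \<Rightarrow> real"
  assumes k: "(k has_real_derivative B) (at 0)" and g: "(g has_real_derivative A) (at 0)"
    and "\<bar>B\<bar> \<le> K" "c \<le> k 0" "0 < c" "\<alpha> \<le> A" "0 < \<alpha>" "0 < C" "0 \<le> g 0" "C * g 0 < 1" "K < c * C * \<alpha>"
  shows "\<exists>d<0. ((\<lambda>t. k t * flat 0 (1 - C * g t)) has_real_derivative d) (at 0)"
proof -
  let ?u = "1 - C * g 0"
  have u: "0 < ?u" "?u \<le> 1" using assms by simp_all
  have f2: "flat 0 ?u \<le> flat 2 ?u" using u by (simp add: flat_def divide_right_mono one_le_inverse)
  have f0: "0 < flat 0 ?u" using u(1) flat_pos_iff by blast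
  have fd: "(flat 0 has_real_derivative flat 2 ?u) (at ?u)" using flat_DERIV[of 0 ?u] by (simp add: numeral_2_eq_2)
  have "((\<lambda>t. 1 - C * g t) has_real_derivative - (C * A)) (at 0)" using g by (auto intro!: derivative_eq_intros)
  from DERIV_chain2[OF fd this] have "((\<lambda>t. flat 0 (1 - C * g t)) has_real_derivative flat 2 ?u * - (C * A)) (at 0)" .
  from DERIV_mult[OF k this]
  have d: "((\<lambda>t. k t * flat 0 (1 - C * g t)) has_real_derivative B * flat 0 ?u + flat 2 ?u * - (C * A) * k 0) (at 0)"
      .
  have "c * (C * \<alpha>) \<le> k 0 * (C * A)" by (rule mult_mono) (use assms in auto)
  then have "c * (C * \<alpha>) * flat 0 ?u \<le> k 0 * (C * A) * flat 2 ?u"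
    by (rule mult_mono[OF _ f2]) (use assms f0 in auto)
  then have "c * C * \<alpha> * flat 0 ?u \<le> k 0 * (C * A) * flat 2 ?u" by (simp only: mult.assoc)
  moreover have "B * flat 0 ?u \<le> K * flat 0 ?u" using assms f0 by (intro mult_right_mono) auto
  moreover have "K * flat 0 ?u < c * C * \<alpha> * flat 0 ?u" using assms f0 by (intro mult_strict_right_mono) auto
  ultimately have "B * flat 0 ?u + flat 2 ?u * - (C * A) * k 0 < 0" by (simp add: algebra_simps)
  then show ?thesis using d by blast
qed

text \<open>The derivative is that of a local smooth extension, so it depends continuously on the
  point up to the boundary. At a boundary point only the part of the line inside the chart is
  meaningful, hence the derivative within this part.\<close>

lemma chart_line_derivative:
  fixes f :: "'a \<Rightarrow> real"
  assumes M: "smooth_manifold M" and U: "(U, \<phi>) \<in> full_atlas M" and f: "smooth_in M euclidean_mfd U f" and w: "w \<in> U"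
  obtains G D where "open G" "\<phi> w \<in> G" "continuous_on G D"
    "\<And>y. y \<in> U \<Longrightarrow> \<phi> y \<in> G \<Longrightarrow>
       ((\<lambda>t. f (inv_into U \<phi> (\<phi> y + t *\<^sub>R b))) has_real_derivative D (\<phi> y)) (at 0 within {t. \<phi> y + t *\<^sub>R b \<in> \<phi> ` U})"
proof -
  have s: "smooth_on (\<phi> ` U) (\<lambda>z. f (inv_into U \<phi> z))" using smooth_in_real_chart[OF M f U] by simp
  obtain G g where G: "open G" "smooth_on G g" "\<phi> w \<in> G" "\<forall>z\<in>G \<inter> \<phi> ` U. g z = f (inv_into U \<phi> z)"
    by (rule smooth_onE[OF s imageI[OF w]])
  have "Ck_on (Suc 0) g G" using spec[OF iffD1[OF smooth_on_open_iff[OF G(1)] G(2)]] .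
  then obtain g' where g': "\<forall>x\<in>G. (g has_derivative g' x) (at x)" "\<forall>v. continuous_on G (\<lambda>x. g' x v)" by auto
  show thesis
  proof (rule that[OF G(1,3)])
    show "continuous_on G (\<lambda>x. g' x b)" using g'(2) by simp
    fix y assume y: "y \<in> U" "\<phi> y \<in> G"
    let ?S = "{t. \<phi> y + t *\<^sub>R b \<in> \<phi> ` U}"
    have gd: "(g has_derivative g' (\<phi> y)) (at (\<phi> y + 0 *\<^sub>R b))" using g'(1) y(2) by simp
    have "((\<lambda>t. \<phi> y + t *\<^sub>R b) has_derivative (\<lambda>t. t *\<^sub>R b)) (at 0 within ?S)"
      by (auto intro!: derivative_eq_intros)
    from has_derivative_compose[OF this gd]
    have "((\<lambda>t. g (\<phi> y + t *\<^sub>R b)) has_derivative (\<lambda>t. g' (\<phi> y) (t *\<^sub>R b))) (at 0 within ?S)" .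
    then have d: "((\<lambda>t. g (\<phi> y + t *\<^sub>R b)) has_real_derivative g' (\<phi> y) b) (at 0 within ?S)"
      unfolding has_field_derivative_def
      by (rule has_derivative_eq_rhs) (simp add: fun_eq_iff linear_cmul[OF has_derivative_linear[OF bspec[OF g'(1)
          y(2)]]] mult.commute)
    have "open ((\<lambda>t. \<phi> y + t *\<^sub>R b) -` G)" by (rule open_vimage[OF G(1)]) (auto intro!: continuous_intros)
    then obtain \<delta> where \<delta>: "0 < \<delta>" "\<And>t. dist t 0 < \<delta> \<Longrightarrow> \<phi> y + t *\<^sub>R b \<in> G"
      unfolding open_dist using y(2) by (auto dest!: bspec[of _ _ 0])
    show "((\<lambda>t. f (inv_into U \<phi> (\<phi> y + t *\<^sub>R b))) has_real_derivative g' (\<phi> y) b) (at 0 within ?S)"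
      by (rule has_field_derivative_transform_within[OF d \<delta>(1)]) (use y \<delta>(2) G(4) in auto)
  qed
qed

lemma chart_line:
  assumes c: "chart_data d X U \<phi> V b \<Omega>" and y: "y \<in> U"
  obtains \<delta> where "0 < \<delta>" "\<And>t. 0 \<le> t \<Longrightarrow> t < \<delta> \<Longrightarrow> \<phi> y + t *\<^sub>R b \<in> \<phi> ` U"
    "\<And>t. 0 < b \<bullet> \<phi> y \<Longrightarrow> \<bar>t\<bar> < \<delta> \<Longrightarrow> \<phi> y + t *\<^sub>R b \<in> \<phi> ` U"
proof -
  note c' = chart_dataD[OF c]
  have py: "\<phi> y \<in> V" "0 \<le> b \<bullet> \<phi> y" "\<phi> y \<in> \<Omega>" using c'(9) y by auto
  define P where "P = (if 0 < b \<bullet> \<phi> y then \<Omega> \<inter> {z. 0 < b \<bullet> z} else \<Omega>)"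
  have "open P" using c'(8) by (auto simp: P_def open_halfspace_gt)
  then have "open ((\<lambda>t. \<phi> y + t *\<^sub>R b) -` P)" by (rule open_vimage) (auto intro!: continuous_intros)
  moreover have "0 \<in> (\<lambda>t. \<phi> y + t *\<^sub>R b) -` P" using py by (auto simp: P_def)
  ultimately obtain \<delta> where \<delta>: "0 < \<delta>" "\<And>t. dist t 0 < \<delta> \<Longrightarrow> t \<in> (\<lambda>t. \<phi> y + t *\<^sub>R b) -` P"
    unfolding open_dist by blast
  have V: "\<phi> y + t *\<^sub>R b \<in> V" for t using c'(5,7) py(1) by (simp add: subspace_add subspace_scale)
  show thesis
  proof (rule that[OF \<delta>(1)])
    fix t :: real assume t: "0 \<le> t" "t < \<delta>"
    have "0 \<le> b \<bullet> (\<phi> y + t *\<^sub>R b)" using t py by (simp add: inner_add_right)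
    moreover have "\<phi> y + t *\<^sub>R b \<in> \<Omega>" using \<delta>(2)[of t] t by (auto simp: P_def split: if_splits)
    ultimately show "\<phi> y + t *\<^sub>R b \<in> \<phi> ` U" unfolding c'(9) using V by simp
  next
    fix t :: real assume t: "0 < b \<bullet> \<phi> y" "\<bar>t\<bar> < \<delta>"
    have "\<phi> y + t *\<^sub>R b \<in> \<Omega> \<inter> {z. 0 < b \<bullet> z}" using \<delta>(2)[of t] t by (auto simp: P_def)
    then show "\<phi> y + t *\<^sub>R b \<in> \<phi> ` U" unfolding c'(9) using V by simp
  qed
qed

text \<open>Along the inward ray from \<open>w\<close> the normal coordinate is t (b.b), so
  \<open>r\<close> grows at least like t (b.b) / 2; a nonpositive slope would contradict this for
  small t.\<close>

lemma defining_function_derivative: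
  assumes M: "smooth_manifold M" and c: "chart_data (mdim M) (mtop M) U \<phi> V b \<Omega>" and w: "w \<in> mboundary M" "w \<in> U"
    and T: "openin (mtop M) T" "w \<in> T" "\<And>y. y \<in> U \<inter> T \<Longrightarrow> (b \<bullet> \<phi> y) / 2 \<le> r y" and rw: "r w = 0"
    and D: "((\<lambda>t. r (inv_into U \<phi> (\<phi> w + t *\<^sub>R b))) has_real_derivative A) (at 0 within {t. \<phi> w + t *\<^sub>R b \<in> \<phi> ` U})"
  shows "0 < A"
proof (rule ccontr)
  assume "\<not> 0 < A"
  have b: "b \<noteq> 0" "b \<bullet> \<phi> w = 0" using mboundary_chart_iff[OF M c w(2)] w(1) by auto
  obtain \<Omega>' where c2: "chart_data (mdim M) (mtop M) (U \<inter> T) \<phi> V b \<Omega>'" using chart_data_restrict[OF c T(1)] by metis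
  have wUT: "w \<in> U \<inter> T" using w T by simp
  obtain \<delta> where \<delta>: "0 < \<delta>" "\<And>t. 0 \<le> t \<Longrightarrow> t < \<delta> \<Longrightarrow> \<phi> w + t *\<^sub>R b \<in> \<phi> ` (U \<inter> T)" by (rule chart_line[OF c2 wUT]) blast
  have inj: "inv_into U \<phi> (\<phi> x) = x" if "x \<in> U" for x using inv_into_f_f[OF chart_dataD(2)[OF c] that] .
  have "{0..<\<delta>} \<subseteq> {t. \<phi> w + t *\<^sub>R b \<in> \<phi> ` U}" using \<delta>(2) by force
  note dr = has_field_derivative_subset[OF D this]
  have "((\<lambda>t. r (inv_into U \<phi> (\<phi> w + t *\<^sub>R b)) - t * ((b \<bullet> b) / 2)) has_real_derivative A - (b \<bullet> b) / 2) (at 0 within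
      {0..<\<delta>})"
    using dr by (auto intro!: derivative_eq_intros)
  moreover have "A - (b \<bullet> b) / 2 < 0" using \<open>\<not> 0 < A\<close> b(1) by (simp add: not_less add_nonpos_neg field_simps) (smt
      (verit) inner_gt_zero_iff)
  ultimately obtain e where e: "0 < e" "\<And>h. 0 < h \<Longrightarrow> 0 + h \<in> {0..<\<delta>} \<Longrightarrow> h < e \<Longrightarrow>
      r (inv_into U \<phi> (\<phi> w + (0 + h) *\<^sub>R b)) - (0 + h) * ((b \<bullet> b) / 2) < r (inv_into U \<phi> (\<phi> w + 0 *\<^sub>R b)) - 0 * ((b \<bullet>
          b) / 2)"
    using has_real_derivative_neg_dec_right by blast
  define t where "t = min \<delta> e / 2"
  have t: "0 < t" "t < \<delta>" "t < e" using \<delta>(1) e(1) by (auto simp: t_def)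
  obtain x where x: "x \<in> U \<inter> T" "\<phi> w + t *\<^sub>R b = \<phi> x" using \<delta>(2)[of t] t by auto
  have "r x - t * ((b \<bullet> b) / 2) < 0" using e(2)[of t] t x inj[of x] inj[OF w(2)] rw by simp
  moreover have "b \<bullet> \<phi> x = t * (b \<bullet> b)" unfolding x(2)[symmetric] by (simp add: inner_add_right b(2))
  ultimately show False using T(3)[OF x(1)] by simp
qed

text \<open>By continuity, near a boundary point the normal derivatives satisfy \<bar>k'\<bar> < K
  and r' > A/2, and k exceeds half of its value at \<open>w\<close>. \<open>C0\<close> is a
  steepness from which on \<open>flat_product_decreasing\<close> applies with these constants,
  uniformly in the neighborhood \<open>Q\<close>.\<close>

lemma collar_estimate:
  fixes k r :: "'a \<Rightarrow> real"
  assumes M: "smooth_manifold M" and U: "(U, \<phi>) \<in> full_atlas M" and c: "chart_data (mdim M) (mtop M) U \<phi> V b \<Omega>"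
    and w: "w \<in> mboundary M" "w \<in> U"
    and k: "smooth_in M euclidean_mfd (mspace M) k" "0 < k w" and r: "smooth_in M euclidean_mfd (mspace M) r"
    and rw: "r w = 0" and rpos: "\<And>x. x \<in> mspace M \<Longrightarrow> 0 \<le> r x"
    and T: "openin (mtop M) T" "w \<in> T" "\<And>y. y \<in> U \<inter> T \<Longrightarrow> (b \<bullet> \<phi> y) / 2 \<le> r y"
  obtains Q C0 where "openin (mtop M) Q" "w \<in> Q" "Q \<subseteq> U"
    "\<And>y C. y \<in> Q \<Longrightarrow> y \<notin> mboundary M \<Longrightarrow> C0 \<le> C \<Longrightarrow> C * r y < 1 \<Longrightarrow>
       0 < b \<bullet> \<phi> y \<and> (\<exists>d<0. ((\<lambda>t. k (inv_into U \<phi> (\<phi> y + t *\<^sub>R b)) * flat 0 (1 - C * r (inv_into U \<phi> (\<phi> y + t *\<^sub>R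
           b))))
          has_real_derivative d) (at 0))"
proof -
  note UM = chart_dataD(10)[OF c]
  obtain G1 D1 where D1: "open G1" "\<phi> w \<in> G1" "continuous_on G1 D1"
    "\<And>y. y \<in> U \<Longrightarrow> \<phi> y \<in> G1 \<Longrightarrow>
       ((\<lambda>t. k (inv_into U \<phi> (\<phi> y + t *\<^sub>R b))) has_real_derivative D1 (\<phi> y)) (at 0 within {t. \<phi> y + t *\<^sub>R b \<in> \<phi> ` U})"
    by (rule chart_line_derivative[OF M U smooth_in_subset[OF k(1) UM] w(2), of b]) (rule that)
  obtain G2 D2 where D2: "open G2" "\<phi> w \<in> G2" "continuous_on G2 D2"
    "\<And>y. y \<in> U \<Longrightarrow> \<phi> y \<in> G2 \<Longrightarrow>
       ((\<lambda>t. r (inv_into U \<phi> (\<phi> y + t *\<^sub>R b))) has_real_derivative D2 (\<phi> y)) (at 0 within {t. \<phi> y + t *\<^sub>R b \<in> \<phi> ` U})"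
    by (rule chart_line_derivative[OF M U smooth_in_subset[OF r UM] w(2), of b]) (rule that)
  define A where "A = D2 (\<phi> w)"
  have A: "0 < A" unfolding A_def
    by (rule defining_function_derivative[OF M c w T rw D2(4)[OF w(2) D2(2)]])
  define K where "K = \<bar>D1 (\<phi> w)\<bar> + 1"
  define G where "G = (G1 \<inter> D1 -` {- K<..<K}) \<inter> (G2 \<inter> D2 -` {A / 2<..})"
  have oG: "open G" unfolding G_def
    by (intro open_Int continuous_open_preimage D1 D2) auto
  have wG: "\<phi> w \<in> G" using D1(2) D2(2) A by (auto simp: G_def K_def A_def)
  obtain T' where T': "openin (mtop M) T'" "mspace M \<inter> k -` {k w / 2<..} = mspace M \<inter> T'"
    by (rule smooth_in_preimage[OF k(1), of "{k w / 2<..}"]) auto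
  have T'iff: "y \<in> T' \<longleftrightarrow> k w / 2 < k y" if "y \<in> mspace M" for y
  proof -
    have "y \<in> mspace M \<inter> k -` {k w / 2<..} \<longleftrightarrow> y \<in> mspace M \<inter> T'" by (simp only: T'(2))
    then show ?thesis using that by simp
  qed
  define Q where "Q = (U \<inter> \<phi> -` G) \<inter> T'"
  define c0 where "c0 = k w / 2 * (A / 2)"
  have c0: "0 < c0" using A k(2) by (simp add: c0_def)
  define C0 where "C0 = (K + 1) / c0"
  have K: "0 < K" by (simp add: K_def add_nonneg_pos)
  show thesis
  proof (rule that[of Q C0])
    show "openin (mtop M) Q" unfolding Q_def by (intro openin_Int T' chart_dataD(3)[OF c oG])
    show "w \<in> Q" using w wG UM T'iff k(2) by (auto simp: Q_def)
    show "Q \<subseteq> U" by (auto simp: Q_def)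
    fix y C assume y: "y \<in> Q" "y \<notin> mboundary M" and C: "C0 \<le> C" "C * r y < 1"
    have yU: "y \<in> U" "\<phi> y \<in> G" using y(1) by (auto simp: Q_def)
    have ky: "k w / 2 < k y" using T'iff y(1) UM by (auto simp: Q_def)
    have "b \<noteq> 0" using mboundary_chart_iff[OF M c w(2)] w(1) by simp
    moreover have "0 \<le> b \<bullet> \<phi> y" using chart_dataD(9)[OF c] yU(1) by auto
    ultimately have pos: "0 < b \<bullet> \<phi> y" using mboundary_chart_iff[OF M c yU(1)] y(2) by simp
    obtain \<delta> where \<delta>: "0 < \<delta>" "\<And>t. 0 < b \<bullet> \<phi> y \<Longrightarrow> \<bar>t\<bar> < \<delta> \<Longrightarrow> \<phi> y + t *\<^sub>R b \<in> \<phi> ` U"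
        by (rule chart_line[OF c yU(1)]) blast
    have at: "at 0 within {t. \<phi> y + t *\<^sub>R b \<in> \<phi> ` U} = at 0"
    proof (rule at_within_interior)
      have "{- \<delta><..<\<delta>} \<subseteq> {t. \<phi> y + t *\<^sub>R b \<in> \<phi> ` U}" using \<delta>(2)[OF pos] by auto
      then show "0 \<in> interior {t. \<phi> y + t *\<^sub>R b \<in> \<phi> ` U}" using \<delta>(1) by (intro interiorI[of "{- \<delta><..<\<delta>}"]) auto
    qed
    have inv: "inv_into U \<phi> (\<phi> y + 0 *\<^sub>R b) = y" using full_atlas_inv[OF U yU(1)] by simp
    have C0: "0 < C0" using K c0 by (simp add: C0_def)
    have "K < C0 * c0" using c0 by (simp add: C0_def)
    also have "\<dots> \<le> C * c0" using C(1) c0 by (simp add: mult_right_mono)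
    finally have KC: "K < k w / 2 * C * (A / 2)" by (simp add: c0_def mult_ac)
    have "\<exists>d<0. ((\<lambda>t. k (inv_into U \<phi> (\<phi> y + t *\<^sub>R b)) * flat 0 (1 - C * r (inv_into U \<phi> (\<phi> y + t *\<^sub>R b))))
          has_real_derivative d) (at 0)"
    proof (rule flat_product_decreasing)
      show "((\<lambda>t. k (inv_into U \<phi> (\<phi> y + t *\<^sub>R b))) has_real_derivative D1 (\<phi> y)) (at 0)"
        using D1(4)[OF yU(1)] yU(2) unfolding at by (auto simp: G_def)
      show "((\<lambda>t. r (inv_into U \<phi> (\<phi> y + t *\<^sub>R b))) has_real_derivative D2 (\<phi> y)) (at 0)"
        using D2(4)[OF yU(1)] yU(2) unfolding at by (auto simp: G_def)
      show "\<bar>D1 (\<phi> y)\<bar> \<le> K" "A / 2 \<le> D2 (\<phi> y)" using yU(2) by (auto simp: G_def)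
      show "k w / 2 \<le> k (inv_into U \<phi> (\<phi> y + 0 *\<^sub>R b))" unfolding inv using ky by simp
      show "0 \<le> r (inv_into U \<phi> (\<phi> y + 0 *\<^sub>R b))" unfolding inv using rpos yU(1) UM by auto
      show "C * r (inv_into U \<phi> (\<phi> y + 0 *\<^sub>R b)) < 1" unfolding inv by (rule C(2))
    qed (use k(2) A C0 C(1) KC in auto)
    then show "0 < b \<bullet> \<phi> y \<and> (\<exists>d<0. ((\<lambda>t. k (inv_into U \<phi> (\<phi> y + t *\<^sub>R b)) * flat 0 (1 - C * r (inv_into U \<phi> (\<phi> y + t
        *\<^sub>R b))))
          has_real_derivative d) (at 0))" using pos by simp
  qed
qed

text \<open>The extension is k e^(-1/(1 - C r)), cut off to 0 where C r \<ge> 1. On the boundary r =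
  0, so \<open>k\<close> is prescribed there as \<open>h\<close> divided by the value of the flat
  function at 1. \<open>P\<close> is passed on from the charts supplied to the charts in which the
  decrease is seen.\<close>

lemma collar_extension:
  assumes M: "smooth_manifold M" and comp: "compact_space (mtop M)"
    and ch: "\<And>x. x \<in> mboundary M \<Longrightarrow> \<exists>U \<phi> V b \<Omega>. (U, \<phi>) \<in> full_atlas M \<and> x \<in> U \<and>
       chart_data (mdim M) (mtop M) U \<phi> V b \<Omega> \<and> P U \<phi> b"
    and h: "smooth_in M euclidean_mfd (mboundary M) h" and hpos: "\<And>x. x \<in> mboundary M \<Longrightarrow> 0 < (h x :: real)"
  obtains H where "smooth_in M euclidean_mfd (mspace M) H" "\<And>x. x \<in> mboundary M \<Longrightarrow> H x = h x"
    "\<And>x. x \<in> mspace M \<Longrightarrow> 0 \<le> H x"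
    "\<And>x. x \<in> mspace M \<Longrightarrow> x \<notin> mboundary M \<Longrightarrow> 0 < H x \<Longrightarrow> \<exists>U \<phi> V b \<Omega> d. (U, \<phi>) \<in> full_atlas M \<and> x \<in> U \<and>
       chart_data (mdim M) (mtop M) U \<phi> V b \<Omega> \<and> P U \<phi> b \<and> 0 < b \<bullet> \<phi> x \<and> d < 0 \<and>
       ((\<lambda>t. H (inv_into U \<phi> (\<phi> x + t *\<^sub>R b))) has_real_derivative d) (at 0)"
proof -
  have f1: "0 < flat 0 1" using flat_pos_iff[of 0 1] by simp
  have h': "smooth_in M euclidean_mfd (mboundary M) (\<lambda>x. h x * inverse (flat 0 1))"
    by (intro smooth_in_mult[OF M] h smooth_in_const[OF M] mboundary_subset[OF M])
  have hpos': "0 < h x * inverse (flat 0 1)" if "x \<in> mboundary M" for x using hpos[OF that] f1 by simp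
  obtain k where k: "smooth_in M euclidean_mfd (mspace M) k" "\<And>x. x \<in> mspace M \<Longrightarrow> 0 < k x"
    "\<And>x. x \<in> mboundary M \<Longrightarrow> k x = h x * inverse (flat 0 1)"
    by (rule positive_extension[OF M mboundary_compact[OF M comp] h' hpos']) (assumption, rule that)
  obtain r where r: "smooth_in M euclidean_mfd (mspace M) r" "\<And>x. x \<in> mboundary M \<Longrightarrow> r x = 0"
     "\<And>x. x \<in> mspace M \<Longrightarrow> x \<notin> mboundary M \<Longrightarrow> 0 < (r x :: real)"
     "\<And>x. x \<in> mboundary M \<Longrightarrow> \<exists>U \<phi> V b \<Omega> T. (U, \<phi>) \<in> full_atlas M \<and> x \<in> U \<and>
       chart_data (mdim M) (mtop M) U \<phi> V b \<Omega> \<and> P U \<phi> b \<and> openin (mtop M) T \<and> x \<in> T \<and>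
       (\<forall>y\<in>U \<inter> T. (b \<bullet> \<phi> y) / 2 \<le> r y)"
    using defining_function[OF M comp, of P, OF ch] by blast
  have r0: "0 \<le> r x" if "x \<in> mspace M" for x using r(2,3) that by (cases "x \<in> mboundary M") (auto intro: less_imp_le)
  define R where "R y C \<longleftrightarrow> (\<exists>U \<phi> V b \<Omega> d. (U, \<phi>) \<in> full_atlas M \<and> y \<in> U \<and> chart_data (mdim M) (mtop M) U \<phi> V b \<Omega> \<and>
      P U \<phi> b \<and> 0 < b \<bullet> \<phi> y \<and> d < 0 \<and>
       ((\<lambda>t. k (inv_into U \<phi> (\<phi> y + t *\<^sub>R b)) * flat 0 (1 - C * r (inv_into U \<phi> (\<phi> y + t *\<^sub>R b)))) has_real_derivative
           d) (at 0))" for y C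
  have "\<exists>Q C0. openin (mtop M) Q \<and> w \<in> Q \<and> (\<forall>y\<in>Q. \<forall>C\<ge>C0. y \<notin> mboundary M \<and> C * r y < 1 \<longrightarrow> R y C)"
    if w: "w \<in> mboundary M" for w
  proof -
    obtain U \<phi> V b \<Omega> T where c: "(U, \<phi>) \<in> full_atlas M" "w \<in> U"
       "chart_data (mdim M) (mtop M) U \<phi> V b \<Omega>" "P U \<phi> b" and T: "openin (mtop M) T" "w \<in> T"
       "\<forall>y\<in>U \<inter> T. (b \<bullet> \<phi> y) / 2 \<le> r y" using r(4)[OF w] by (elim exE conjE)
    have kw: "0 < k w" using k(2) w mboundary_subset[OF M] by auto
    obtain Q C0 where Q: "openin (mtop M) Q" "w \<in> Q" "Q \<subseteq> U" 
      "\<And>y C. y \<in> Q \<Longrightarrow> y \<notin> mboundary M \<Longrightarrow> C0 \<le> C \<Longrightarrow> C * r y < 1 \<Longrightarrow>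
       0 < b \<bullet> \<phi> y \<and> (\<exists>d<0. ((\<lambda>t. k (inv_into U \<phi> (\<phi> y + t *\<^sub>R b)) * flat 0 (1 - C * r (inv_into U \<phi> (\<phi> y + t *\<^sub>R
           b))))
          has_real_derivative d) (at 0))"
      by (rule collar_estimate[OF M c(1,3) w c(2) k(1) kw r(1) r(2)[OF w] r0 T(1,2) bspec[OF T(3)]]) (assumption+,
          rule that)
    show ?thesis
    proof (rule exI[of _ Q], rule exI[of _ C0], intro conjI ballI allI impI Q(1,2), elim conjE)
      fix y C assume y: "y \<in> Q" "C0 \<le> C" "y \<notin> mboundary M" "C * r y < 1"
      note q = Q(4)[OF y(1,3,2,4)]
      from conjunct2[OF q] obtain d where d: "d < 0" "((\<lambda>t. k (inv_into U \<phi> (\<phi> y + t *\<^sub>R b)) * flat 0 (1 - C * r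
          (inv_into U \<phi> (\<phi> y + t *\<^sub>R b)))) has_real_derivative d) (at 0)"
        by (elim exE conjE)
      show "R y C" unfolding R_def
        by (rule exI[of _ U], rule exI[of _ \<phi>], rule exI[of _ V], rule exI[of _ b], rule exI[of _ \<Omega>], rule exI[of _
            d],
            intro conjI c d conjunct1[OF q] subsetD[OF Q(3) y(1)])
    qed
  qed
  then have "\<forall>w\<in>mboundary M. \<exists>Q C0. openin (mtop M) Q \<and> w \<in> Q \<and> (\<forall>y\<in>Q. \<forall>C\<ge>C0. y \<notin> mboundary M \<and> C * r y < 1 \<longrightarrow> R y C)"
    by (rule ballI)
  from bchoice[OF this] obtain Q where "\<forall>w\<in>mboundary M. \<exists>C0. openin (mtop M) (Q w) \<and> w \<in> Q w \<and>
      (\<forall>y\<in>Q w. \<forall>C\<ge>C0. y \<notin> mboundary M \<and> C * r y < 1 \<longrightarrow> R y C)"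
    by (rule exE)
  from bchoice[OF this] obtain C0 where Q: "\<forall>w\<in>mboundary M. openin (mtop M) (Q w) \<and> w \<in> Q w \<and>
      (\<forall>y\<in>Q w. \<forall>C\<ge>C0 w. y \<notin> mboundary M \<and> C * r y < 1 \<longrightarrow> R y C)"
    by (rule exE)
  have Qo: "\<And>w. w \<in> mboundary M \<Longrightarrow> openin (mtop M) (Q w)" "\<And>w. w \<in> mboundary M \<Longrightarrow> w \<in> Q w" using Q by simp_all
  have "(\<forall>U\<in>Q ` mboundary M. openin (mtop M) U) \<and> mboundary M \<subseteq> \<Union>(Q ` mboundary M)" using Qo by auto
  then obtain F where F: "finite F" "F \<subseteq> Q ` mboundary M" "mboundary M \<subseteq> \<Union>F"
    using mboundary_compact[OF M comp] unfolding compactin_def by metis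
  obtain J where J: "finite J" "J \<subseteq> mboundary M" "F = Q ` J" using F finite_subset_image[OF F(1,2)] by metis
  have oX: "openin (mtop M) (\<Union>(Q ` J))" using Qo(1) J(2) by (intro openin_Union) auto
  have "compactin (mtop M) (mspace M - \<Union>(Q ` J))" by (rule closedin_compact_space[OF comp]) (simp add: closedin_diff
      oX)
  then obtain m where m: "0 < m" "\<And>x. x \<in> mspace M - \<Union>(Q ` J) \<Longrightarrow> m \<le> r x"
  proof (rule compact_space_pos_min)
    have "smooth_in M euclidean_mfd (mspace M - \<Union>(Q ` J)) r" by (rule smooth_in_subset[OF r(1)]) auto
    then show "continuous_map (subtopology (mtop M) (mspace M - \<Union>(Q ` J))) euclideanreal r"
      using smooth_in_continuous by fastforce
    show "0 < r x" if "x \<in> mspace M - \<Union>(Q ` J)" for x using r(3)[of x] that F(3) J(3) by auto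
  qed (rule that)
  \<comment> \<open>\<open>C\<close> at least 1/m keeps the set where H is positive inside the
    finite cover, as r \<ge> m off it; \<open>C\<close> at least every \<open>C0 j\<close> makes all
    the local estimates valid.\<close>
  define C where "C = Max (insert (1 / m) (C0 ` J))"
  have C: "1 / m \<le> C" "\<And>j. j \<in> J \<Longrightarrow> C0 j \<le> C" using J(1) by (auto simp: C_def)
  have C1: "0 < C" using C(1) m(1) by (meson less_le_trans zero_less_divide_1_iff)
  define H where "H x = k x * flat 0 (1 - C * r x)" for x
  show thesis
  proof (rule that[of H])
    show "smooth_in M euclidean_mfd (mspace M) H" unfolding H_def
      by (rule smooth_in_comp2[OF M k(1) r(1), of UNIV])
        (auto intro!: smooth_on_mult smooth_on_fst smooth_on_snd smooth_on_flat smooth_on_diff smooth_on_const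
            smooth_on_id)
    show "H x = h x" if "x \<in> mboundary M" for x using f1 k(3)[OF that] r(2)[OF that] by (simp add: H_def)
    show "0 \<le> H x" if "x \<in> mspace M" for x using k(2)[OF that] flat_nonneg[of 0] by (simp add: H_def)
    fix x assume x: "x \<in> mspace M" "x \<notin> mboundary M" "0 < H x"
    have "0 < flat 0 (1 - C * r x)" using x(3) k(2)[OF x(1)] by (simp add: H_def zero_less_mult_iff)
    then have Cr: "C * r x < 1" unfolding flat_pos_iff by simp
    have "x \<in> \<Union>(Q ` J)"
    proof (rule ccontr)
      assume "x \<notin> \<Union>(Q ` J)"
      then have "m \<le> r x" using m(2) x(1) by simp
      then have "1 / m * m \<le> C * r x" by (intro mult_mono) (use C(1) C1 m(1) in auto)
      then show False using Cr m(1) by simp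
    qed
    then obtain j where j: "j \<in> J" "x \<in> Q j" by blast
    have jB: "j \<in> mboundary M" using j(1) J(2) by auto
    have "\<forall>y\<in>Q j. \<forall>C\<ge>C0 j. y \<notin> mboundary M \<and> C * r y < 1 \<longrightarrow>
      R y C"
      using conjunct2[OF conjunct2[OF bspec[OF Q jB]]] .
    from mp[OF mp[OF spec[OF bspec[OF this j(2)], of C] C(2)[OF j(1)]] conjI[OF x(2) Cr]]
    show "\<exists>U \<phi> V b \<Omega> d. (U, \<phi>) \<in> full_atlas M \<and> x \<in> U \<and>
       chart_data (mdim M) (mtop M) U \<phi> V b \<Omega> \<and> P U \<phi> b \<and> 0 < b \<bullet> \<phi> x \<and> d < 0 \<and>
       ((\<lambda>t. H (inv_into U \<phi> (\<phi> x + t *\<^sub>R b))) has_real_derivative d) (at 0)"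
      unfolding H_def R_def .
  qed
qed

subsection \<open>Extending the fibration\<close>

text \<open>Near \<open>x\<close>, \<open>h\<close> is h(x) plus the principal argument of f / cis
  (h x), because continuity keeps \<open>h\<close> within distance 1 < pi of h(x).\<close>

lemma smooth_lift:
  assumes M: "smooth_manifold M" and S: "S \<subseteq> mspace M" and f: "smooth_in M euclidean_mfd S f"
    and h: "continuous_map (subtopology (mtop M) S) euclideanreal h" and fh: "\<And>x. x \<in> S \<Longrightarrow> f x = cis (h x)"
  shows "smooth_in M euclidean_mfd S h"
proof (rule smooth_in_local)
  fix x assume x: "x \<in> S"
  have "openin (subtopology (mtop M) S) {y \<in> topspace (subtopology (mtop M) S). h y \<in> ball (h x) 1}"
    by (rule openin_continuous_map_preimage[OF h]) simp
  then obtain T where T: "openin (mtop M) T" "{y \<in> topspace (subtopology (mtop M) S). h y \<in> ball (h x) 1} = T \<inter> S"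
    unfolding openin_subtopology by blast
  have Tiff: "y \<in> T \<longleftrightarrow> \<bar>h y - h x\<bar> < 1" if "y \<in> S" for y
  proof -
    have "y \<in> T \<inter> S \<longleftrightarrow> y \<in> {y \<in> topspace (subtopology (mtop M) S). h y \<in> ball (h x) 1}" by (simp only: T(2))
    then show ?thesis using that S by (auto simp: dist_real_def abs_minus_commute)
  qed
  have f1: "f y / cis (h x) = cis (h y - h x)" if "y \<in> S" for y using fh[OF that] by (simp add: cis_divide)
  have "smooth_in M euclidean_mfd (S \<inter> T) (\<lambda>y. h x + Im (Ln (f y / cis (h x))))"
  proof (rule smooth_in_euclidean_comp[OF M smooth_in_subset[OF f]])
    show "smooth_on {z. z / cis (h x) \<notin> \<real>\<^sub>\<le>\<^sub>0} (\<lambda>z. h x + Im (Ln (z / cis (h x))))"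
      by (intro smooth_on_add smooth_on_const smooth_on_linear_comp[OF bounded_linear_Im] smooth_on_Ln
          smooth_on_divide smooth_on_id) auto
    fix y assume y: "y \<in> S \<inter> T"
    then have "\<bar>h y - h x\<bar> < 1" using Tiff[of y] by simp
    then have "0 < Re (cis (h y - h x))" using pi_gt3 by (auto intro!: cos_gt_zero_pi)
    then show "f y \<in> {z. z / cis (h x) \<notin> \<real>\<^sub>\<le>\<^sub>0}" using f1[of y] y by (auto simp: complex_nonpos_Reals_iff)
  qed simp
  then have "smooth_in M euclidean_mfd (S \<inter> T) h"
  proof (rule smooth_in_cong)
    fix y assume y: "y \<in> S \<inter> T"
    then have "\<bar>h y - h x\<bar> < pi" using Tiff[of y] pi_gt3 by simp
    then show "h x + Im (Ln (f y / cis (h x))) = h y" using f1[of y] y Ln_cis by simp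
  qed
  then show "\<exists>T. openin (mtop M) T \<and> x \<in> T \<and> smooth_in M euclidean_mfd (S \<inter> T) h"
    using T(1) Tiff[OF x] by (intro exI[of _ T]) simp
qed

lemma compactin_real_attains:
  assumes K: "compactin X K" and h: "continuous_map (subtopology X K) euclideanreal h" and "K \<noteq> {}"
  obtains x where "x \<in> K" "\<And>y. y \<in> K \<Longrightarrow> h y \<le> h x"
proof -
  have "compactin (subtopology X K) K" using K by (simp add: compactin_subtopology)
  then have "compact (h ` K)" using image_compactin[OF _ h] by simp
  from compact_attains_sup[OF this] show thesis using assms(3) that by auto
qed

lemma smooth_on_field_derivative:
  fixes f :: "real \<Rightarrow> real"
  assumes "open S" "smooth_on S f" "x \<in> S"
  obtains d where "(f has_real_derivative d) (at x)"
proof -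
  have "Ck_on (Suc 0) f S" using spec[OF iffD1[OF smooth_on_open_iff[OF assms(1)] assms(2)]] .
  then obtain f' where "(f has_derivative f' x) (at x)" using assms(3) by auto
  then obtain d where "(f has_real_derivative d) (at x)" using has_derivative_imp_has_field_derivative
    by (metis has_field_derivative_def differentiable_def real_differentiable_def)
  then show thesis by (rule that)
qed

text \<open>\<open>prod_full_chart\<close> covers products of charts from the two given atlases.
  Adapted charts belong to the maximal atlas only, so this more general form is needed.\<close>

lemma full_atlas_prod:
  assumes M: "smooth_manifold M" and N: "smooth_manifold N" and b: "mboundary M = {}"
    and U: "(U, \<phi>) \<in> full_atlas M" and V: "(V, \<psi>) \<in> full_atlas N"
  shows "(U \<times> V, map_prod \<phi> \<psi>) \<in> full_atlas (prod_mfd M N)"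
proof (rule full_atlasI)
  obtain V1 \<Omega>1 where c: "chart_data (mdim M) (mtop M) U \<phi> V1 0 \<Omega>1" by (rule boundaryless_chart_data[OF M b U])
  obtain V2 b2 \<Omega>2 where c2: "chart_data (mdim N) (mtop N) V \<psi> V2 b2 \<Omega>2" using full_atlas_chart[OF V] is_chart_iff
      by metis
  show "is_chart (mdim (prod_mfd M N)) (mtop (prod_mfd M N)) (U \<times> V, map_prod \<phi> \<psi>)"
    unfolding is_chart_iff prod_mfd_simps using chart_data_prod[OF c c2 disjI1[OF refl]] by blast
  have tr: "smooth_on (map_prod \<phi> \<psi> ` (U \<times> V \<inter> U' \<times> V')) (\<lambda>y. map_prod \<phi>' \<psi>' (inv_into (U \<times> V) (map_prod \<phi> \<psi>) y))"
    if U: "(U, \<phi>) \<in> full_atlas M" and V: "(V, \<psi>) \<in> full_atlas N" and U': "(U', \<phi>') \<in> full_atlas M"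
        and V': "(V', \<psi>') \<in> full_atlas N"
    for U \<phi> V \<psi> U' \<phi>' V' \<psi>'
  proof -
    let ?S = "map_prod \<phi> \<psi> ` (U \<times> V \<inter> U' \<times> V')"
    have "smooth_on ?S (\<lambda>y. (\<phi>' (inv_into U \<phi> (fst y)), \<psi>' (inv_into V \<psi> (snd y))))"
    proof (rule smooth_on_Pair)
      show "smooth_on ?S (\<lambda>y. \<phi>' (inv_into U \<phi> (fst y)))"
        by (rule smooth_on_comp[OF smooth_on_fst[OF smooth_on_id(1)] full_atlas_compatible[OF M U U']]) auto
      show "smooth_on ?S (\<lambda>y. \<psi>' (inv_into V \<psi> (snd y)))"
        by (rule smooth_on_comp[OF smooth_on_snd[OF smooth_on_id(1)] full_atlas_compatible[OF N V V']]) auto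
    qed
    then show ?thesis
    proof (rule smooth_on_cong)
      fix y assume "y \<in> ?S"
      then obtain x z where xz: "x \<in> U" "z \<in> V" "y = (\<phi> x, \<psi> z)" by auto
      show "(\<phi>' (inv_into U \<phi> (fst y)), \<psi>' (inv_into V \<psi> (snd y))) = map_prod \<phi>' \<psi>' (inv_into (U \<times> V) (map_prod \<phi> \<psi>)
          y)"
        unfolding xz(3) inv_into_map_prod[OF full_atlas_inj[OF U] full_atlas_inj[OF V] xz(1,2)]
        using full_atlas_inv[OF U xz(1)] full_atlas_inv[OF V xz(2)] by simp
    qed
  qed
  fix Z and \<chi>1 :: "'a \<times> 'c \<Rightarrow> 'b \<times> 'd" assume "(Z, \<chi>1) \<in> matlas (prod_mfd M N)"
  then obtain U' \<phi>' V' \<psi>' where Z: "Z = U' \<times> V'" "\<chi>1 = map_prod \<phi>' \<psi>'" and m: "(U', \<phi>') \<in> matlas M"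
      "(V', \<psi>') \<in> matlas N"
    unfolding matlas_prod prod.inject by (elim exE conjE)
  note f = subsetD[OF atlas_subset_full[OF M] m(1)] subsetD[OF atlas_subset_full[OF N] m(2)]
  show "smooth_on (map_prod \<phi> \<psi> ` (U \<times> V \<inter> Z)) (\<lambda>y. \<chi>1 (inv_into (U \<times> V) (map_prod \<phi> \<psi>) y))"
    unfolding Z by (rule tr[OF U V f])
  show "smooth_on (\<chi>1 ` (U \<times> V \<inter> Z)) (\<lambda>y. map_prod \<phi> \<psi> (inv_into Z \<chi>1 y))"
    unfolding Z Int_commute[of "U \<times> V"] by (rule tr[OF f U V])
qed

lemma bdry_simps: "mtop (bdry M) = subtopology (mtop M) (mboundary M)" "mdim (bdry M) = mdim M - 1"
  by (simp_all add: bdry_def)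

section \<open>Correcting a model map to the prescribed boundary values\<close>

text \<open>\<open>ch\<close> supplies boundary charts in which \<open>q\<close> is constant along
  the normal lines; this is the property that is passed as \<open>P\<close> to
  \<open>collar_extension\<close>. \<open>cur\<close> expresses regularity of \<open>q\<close> at
  interior points by explicit curves. Each of the resulting curves becomes a
  \<open>transverse_curve\<close> of the corrected map, which then has adapted charts.\<close>

lemma fibration_extension:
  assumes M: "smooth_manifold M" and comp: "compact_space (mtop M)" and dim: "2 \<le> mdim M"
    and q: "smooth_in M circle_mfd (mspace M) q"
    and ch: "\<And>x. x \<in> mboundary M \<Longrightarrow> \<exists>U \<phi> V b \<Omega>. (U, \<phi>) \<in> full_atlas M \<and> x \<in> U \<and>
       chart_data (mdim M) (mtop M) U \<phi> V b \<Omega> \<and>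
       (\<forall>y\<in>U. \<forall>t. \<phi> y + t *\<^sub>R b \<in> \<phi> ` U \<longrightarrow> q (inv_into U \<phi> (\<phi> y + t *\<^sub>R b)) = q y)"
    and cur: "\<And>x. x \<in> mspace M \<Longrightarrow> x \<notin> mboundary M \<Longrightarrow> \<exists>\<eta> \<gamma> d. 0 < \<eta> \<and> smooth_in euclidean_mfd M {- \<eta><..<\<eta>} \<gamma> \<and>
       \<gamma> (0::real) = x \<and> (\<forall>t\<in>{- \<eta><..<\<eta>}. q (\<gamma> t) = q x * cis (d * t)) \<and> d \<noteq> 0"
    and fib: "fibration (bdry M) circle_mfd f"
    and h: "continuous_map (mtop (bdry M)) euclideanreal h"
    and fqh: "\<And>x. x \<in> mboundary M \<Longrightarrow> f x = q x * cis (h x)"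
  shows "\<exists>f'. fibration M circle_mfd f' \<and> (\<forall>x\<in>mboundary M. f' x = f x)"
proof -
  note B = mboundary_subset[OF M] and MB = bdry_manifold[OF M]
  have mB: "mspace (bdry M) = mboundary M" using B by (auto simp: bdry_simps)
  have qC: "smooth_in M euclidean_mfd (mspace M) q" and q1: "\<And>y. y \<in> mspace M \<Longrightarrow> norm (q y) = 1"
    using q unfolding smooth_in_circle_iff[OF M] by auto
  have q0: "q y \<noteq> 0" if "y \<in> mspace M" for y using q1[OF that] by auto
  have fsurj: "f ` mboundary M = sphere 0 1" using fib by (simp add: fibration_def mB)
  have "smooth_in (bdry M) circle_mfd (mspace (bdry M)) f"
    using fib smooth_map_iff_smooth_in[OF MB circle_manifold] by (simp add: fibration_def)
  then have "smooth_in (bdry M) euclidean_mfd (mboundary M) f" unfolding mB smooth_in_circle_iff[OF MB] by simp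
  then have sf: "smooth_in M euclidean_mfd (mboundary M) f" unfolding bdry_def
    by (rule iffD1[OF smooth_in_submfd_dom[OF M euclidean_manifold MB[unfolded bdry_def] subset_refl]])
  have "(1::complex) \<in> sphere 0 1" by simp
  then have Bne: "mboundary M \<noteq> {}" using fsurj by blast
  have hc: "continuous_map (subtopology (mtop M) (mboundary M)) euclideanreal h" using h by (simp add: bdry_simps)
  have "continuous_map (subtopology (mtop M) (mboundary M)) euclideanreal (\<lambda>x. - h x)" using hc
      by (rule continuous_map_minus)
  then obtain x0 where x0: "x0 \<in> mboundary M" "\<And>y. y \<in> mboundary M \<Longrightarrow> - h y \<le> - h x0"
    by (rule compactin_real_attains[OF mboundary_compact[OF M comp] _ Bne]) (rule that)
  \<comment> \<open>-h(x0) is the maximum of -h on the compact boundary, so adding 2 pi n makes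
    \<open>h\<close> positive there without changing \<open>cis h\<close>.\<close>
  obtain n :: nat where n: "- h x0 < real n" using reals_Archimedean2 by blast
  define h' where "h' x = h x + 2 * pi * real n" for x
  have h'pos: "0 < h' x" if "x \<in> mboundary M" for x
  proof -
    have "real n * 1 \<le> real n * (2 * pi)" using pi_gt3 by (intro mult_left_mono) auto
    then show ?thesis using x0(2)[OF that] n by (simp add: h'_def mult_ac)
  qed
  have cish': "cis (h' x) = cis (h x)" for x
    by (simp add: h'_def cis_mult[symmetric])
  have h'c: "continuous_map (subtopology (mtop M) (mboundary M)) euclideanreal h'" unfolding h'_def
    by (intro continuous_map_add hc) simp
  have sq: "smooth_in M euclidean_mfd (mboundary M) q" by (rule smooth_in_subset[OF qC B])
  have "smooth_in M euclidean_mfd (mboundary M) (\<lambda>x. f x / q x)"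
    by (rule smooth_in_comp2[OF M sf sq, of "{p. snd p \<noteq> 0}"])
      (use q0 B in \<open>auto intro!: smooth_on_divide smooth_on_fst smooth_on_snd smooth_on_id\<close>)
  \<comment> \<open>\<open>h'\<close> is only known to be continuous, but its \<open>cis\<close> is
    the smooth quotient f / q.\<close>
  then have sh': "smooth_in M euclidean_mfd (mboundary M) h'"
    by (rule smooth_lift[OF M B _ h'c]) (use fqh cish' q0 B in auto)
  obtain H where H: "smooth_in M euclidean_mfd (mspace M) H" "\<And>x. x \<in> mboundary M \<Longrightarrow> H x = h' x"
    "\<And>x. x \<in> mspace M \<Longrightarrow> 0 \<le> H x"
    "\<And>x. x \<in> mspace M \<Longrightarrow> x \<notin> mboundary M \<Longrightarrow> 0 < H x \<Longrightarrow> \<exists>U \<phi> V b \<Omega> d. (U, \<phi>) \<in> full_atlas M \<and> x \<in> U \<and>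
       chart_data (mdim M) (mtop M) U \<phi> V b \<Omega> \<and> (\<forall>y\<in>U. \<forall>t. \<phi> y + t *\<^sub>R b \<in> \<phi> ` U \<longrightarrow>
           q (inv_into U \<phi> (\<phi> y + t *\<^sub>R b)) = q y)
       \<and> 0 < b \<bullet> \<phi> x \<and> d < 0 \<and>
       ((\<lambda>t. H (inv_into U \<phi> (\<phi> x + t *\<^sub>R b))) has_real_derivative d) (at 0)"
    by (rule collar_extension[where M=M and h=h' and P="\<lambda>U \<phi> b. \<forall>y\<in>U. \<forall>t. \<phi> y + t *\<^sub>R b \<in> \<phi> ` U \<longrightarrow>
        q (inv_into U \<phi> (\<phi> y + t *\<^sub>R b)) = q y"])
      (rule M, rule comp, erule ch, rule sh', erule h'pos, rule that)
  define f' where "f' x = q x * cis (H x)" for x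
  have f'B: "f' x = f x" if "x \<in> mboundary M" for x using fqh[OF that] H(2)[OF that] cish' by (simp add: f'_def)
  have "smooth_in M euclidean_mfd (mspace M) (\<lambda>x. cis (H x))"
    by (rule smooth_in_euclidean_comp[OF M H(1), of UNIV]) (simp_all add: smooth_on_cis)
  then have "smooth_in M euclidean_mfd (mspace M) f'" unfolding f'_def by (rule smooth_in_mult[OF M qC])
  moreover have f'1: "f' ` mspace M \<subseteq> sphere 0 1" using q1 by (auto simp: f'_def norm_mult)
  ultimately have sf': "smooth_in M circle_mfd (mspace M) f'" unfolding smooth_in_circle_iff[OF M] by simp
  have "f' ` mboundary M = sphere 0 1" using fsurj f'B by simp
  then have surj: "f' ` mspace M = sphere 0 1" using f'1 B by blast
  have tc: "transverse_curve M f' x" if x: "x \<in> mspace M" for x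
  proof (cases "x \<in> mboundary M")
    case True
    have "x \<in> mspace (bdry M)" using True mB by simp
    moreover have "1 \<le> mdim (bdry M)" using dim by (simp add: bdry_simps)
    ultimately obtain \<eta> \<gamma> where g: "0 < \<eta>" "smooth_in euclidean_mfd (bdry M) {- \<eta><..<\<eta>} \<gamma>" "\<gamma> (0::real) = x"
      "\<And>t. t \<in> {- \<eta><..<\<eta>} \<Longrightarrow> f (\<gamma> t) = f x * cis t"
      using fibration_curve[OF MB fib] by metis
    have gM: "smooth_in euclidean_mfd M {- \<eta><..<\<eta>} \<gamma>" "\<gamma> ` {- \<eta><..<\<eta>} \<subseteq> mboundary M"
      using iffD1[OF smooth_in_submfd_cod[OF euclidean_manifold M MB[unfolded bdry_def]] g(2)[unfolded bdry_def]]
          by simp_all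
    have "\<forall>t\<in>{- \<eta><..<\<eta>}. f' (\<gamma> t) = f' x * cis t" using g(4) f'B[OF True] f'B gM(2) by (auto simp: image_subset_iff)
    then show ?thesis unfolding transverse_curve_def using g(1,3) gM
      by (intro exI[of _ \<eta>] exI[of _ \<gamma>] exI[of _ "\<lambda>t. t"] exI[of _ 1]) simp
  next
    case False
    show ?thesis
    proof (cases "0 < H x")
      case True
      obtain U \<phi> V b \<Omega> d where U: "(U, \<phi>) \<in> full_atlas M" "x \<in> U" and c: "chart_data (mdim M) (mtop M) U \<phi> V b \<Omega>"
        and P: "\<forall>y\<in>U. \<forall>t. \<phi> y + t *\<^sub>R b \<in> \<phi> ` U \<longrightarrow> q (inv_into U \<phi> (\<phi> y + t *\<^sub>R b)) = q y"
        and b: "0 < b \<bullet> \<phi> x" and d: "d < 0" "((\<lambda>t. H (inv_into U \<phi> (\<phi> x + t *\<^sub>R b))) has_real_derivative d) (at 0)"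
        using H(4)[OF x False True] by (elim exE conjE)
      obtain \<delta> where \<delta>: "0 < \<delta>" "\<And>t. 0 < b \<bullet> \<phi> x \<Longrightarrow> \<bar>t\<bar> < \<delta> \<Longrightarrow> \<phi> x + t *\<^sub>R b \<in> \<phi> ` U"
          by (rule chart_line[OF c U(2)]) blast
      define \<gamma> where "\<gamma> t = inv_into U \<phi> (\<phi> x + t *\<^sub>R b)" for t
      have "smooth_on {- \<delta><..<\<delta>} (\<lambda>t. \<phi> x + t *\<^sub>R b)"
        by (intro smooth_on_add smooth_on_const smooth_on_linear bounded_linear_scaleR_left)
      then have s: "smooth_in euclidean_mfd euclidean_mfd {- \<delta><..<\<delta>} (\<lambda>t. \<phi> x + t *\<^sub>R b)"
          unfolding smooth_in_euclidean_iff .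
      have "smooth_in euclidean_mfd M {- \<delta><..<\<delta>} \<gamma>" unfolding \<gamma>_def
        by (rule smooth_in_comp[OF euclidean_manifold euclidean_manifold M s smooth_in_chart_inverse[OF M U(1)]]) (use
            \<delta>(2)[OF b] in auto)
      moreover have g0: "\<gamma> 0 = x" using full_atlas_inv[OF U] by (simp add: \<gamma>_def)
      \<comment> \<open>\<open>q\<close> is constant on the line, so the argument of f' moves
        exactly as \<open>H\<close> does.\<close>
      moreover have "f' (\<gamma> t) = f' x * cis (H (\<gamma> t) - H x)" if "t \<in> {- \<delta><..<\<delta>}" for t
      proof -
        have "q (\<gamma> t) = q x" unfolding \<gamma>_def using P U(2) \<delta>(2)[OF b, of t] that by auto
        then show ?thesis by (simp add: f'_def cis_mult)
      qed
      moreover have "((\<lambda>t. H (\<gamma> t) - H x) has_real_derivative d) (at 0)"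
        using DERIV_diff[OF d(2) DERIV_const[of "H x"]] by (simp add: \<gamma>_def)
      ultimately show ?thesis unfolding transverse_curve_def using \<delta>(1) d(1) False
        by (intro exI[of _ \<delta>] exI[of _ \<gamma>] exI[of _ "\<lambda>t. H (\<gamma> t) - H x"] exI[of _ d]) simp
    next
      case H0: False
      then have Hx: "H x = 0" using H(3)[OF x] by simp
      obtain \<eta> \<gamma> d where g: "0 < \<eta>" "smooth_in euclidean_mfd M {- \<eta><..<\<eta>} \<gamma>" "\<gamma> (0::real) = x"
        "\<forall>t\<in>{- \<eta><..<\<eta>}. q (\<gamma> t) = q x * cis (d * t)" "d \<noteq> 0" using cur[OF x False] by (elim exE conjE)
      have gM: "\<gamma> t \<in> mspace M" if "t \<in> {- \<eta><..<\<eta>}" for t by (rule smooth_in_image[OF g(2) that])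
      have "smooth_in euclidean_mfd euclidean_mfd {- \<eta><..<\<eta>} (\<lambda>t. H (\<gamma> t))"
        by (rule smooth_in_comp[OF euclidean_manifold M euclidean_manifold g(2) H(1) gM])
      then have "smooth_on {- \<eta><..<\<eta>} (\<lambda>t. H (\<gamma> t))" unfolding smooth_in_euclidean_iff .
      then obtain e where e: "((\<lambda>t. H (\<gamma> t)) has_real_derivative e) (at 0)"
        by (rule smooth_on_field_derivative[rotated, of _ _ 0]) (use g(1) in auto)
      \<comment> \<open>\<open>H\<close> is nonnegative and vanishes at \<open>x\<close>, so its
        derivative along the curve is 0 and the argument of f' moves with the speed \<open>d\<close>
        of \<open>q\<close>.\<close>
      have "e = 0" by (rule DERIV_local_min[OF e g(1)]) (use H(3)[OF gM] g(3) Hx in \<open>auto simp: abs_less_iff\<close>)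
      then have "((\<lambda>t. d * t + H (\<gamma> t)) has_real_derivative d) (at 0)" using e by (auto intro!: derivative_eq_intros)
      moreover have "\<forall>t\<in>{- \<eta><..<\<eta>}. f' (\<gamma> t) = f' x * cis (d * t + H (\<gamma> t))"
        using g(4) by (simp add: f'_def Hx cis_mult[symmetric])
      ultimately show ?thesis unfolding transverse_curve_def using g False Hx
        by (intro exI[of _ \<eta>] exI[of _ \<gamma>] exI[of _ "\<lambda>t. d * t + H (\<gamma> t)"] exI[of _ d]) simp
    qed
  qed
  have "fibration M circle_mfd f'"
    by (rule fibration_of_adapted_charts[OF M comp sf' surj adapted_chart_exists[OF M sf' _ tc]])
  then show ?thesis using f'B by blast
qed

text \<open>On a short curve along which \<open>f\<close> turns with unit speed, a continuous real
  lift increases by t: the difference lies in 2 pi Z and vanishes at t = 0. So a lift could not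
  attain a maximum, although the manifold is compact.\<close>

lemma no_lift_of_fibration:
  assumes M: "smooth_manifold M" and comp: "compact_space (mtop M)" and d: "1 \<le> mdim M"
    and fib: "fibration M circle_mfd f" and h: "continuous_map (mtop M) euclideanreal h"
  shows "\<exists>x\<in>mspace M. f x \<noteq> cis (h x)"
proof (rule ccontr)
  assume "\<not> ?thesis"
  then have fh: "\<And>x. x \<in> mspace M \<Longrightarrow> f x = cis (h x)" by blast
  have "f ` mspace M = sphere 0 1" using fib by (simp add: fibration_def)
  moreover have "(1::complex) \<in> sphere 0 1" by simp
  ultimately have ne: "mspace M \<noteq> {}" by blast
  have "continuous_map (subtopology (mtop M) (mspace M)) euclideanreal h" using h by simp
  then obtain x where x: "x \<in> mspace M" "\<And>y. y \<in> mspace M \<Longrightarrow> h y \<le> h x"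
    by (rule compactin_real_attains[OF _ _ ne, of "mtop M", rotated]) (use comp in \<open>auto simp: compact_space_def\<close>)
  obtain \<eta> \<gamma> where g: "0 < \<eta>" "smooth_in euclidean_mfd M {- \<eta><..<\<eta>} \<gamma>" "\<gamma> (0::real) = x"
      "\<And>t. t \<in> {- \<eta><..<\<eta>} \<Longrightarrow> f (\<gamma> t) = f x * cis t"
    using fibration_curve[OF M fib d x(1)] by metis
  have gM: "\<gamma> t \<in> mspace M" if "t \<in> {- \<eta><..<\<eta>}" for t by (rule smooth_in_image[OF g(2) that])
  have "continuous_map (top_of_set {- \<eta><..<\<eta>}) euclideanreal (h \<circ> \<gamma>)"
    using continuous_map_compose[OF smooth_in_continuous[OF g(2)] h] by simp
  then have c: "continuous_on {- \<eta><..<\<eta>} (\<lambda>t. h (\<gamma> t) - h x - t)" by (auto intro!: continuous_intros simp: o_def)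
  have "\<exists>n::int. \<forall>t\<in>{- \<eta><..<\<eta>}. h (\<gamma> t) - h x - t = 2 * pi * of_int n"
  proof (rule cis_const[OF _ c])
    fix t assume t: "t \<in> {- \<eta><..<\<eta>}"
    have "cis (h (\<gamma> t)) = cis (h x) * cis t" using g(4)[OF t] fh[OF x(1)] fh[OF gM[OF t]] by simp
    then show "cis (h (\<gamma> t) - h x - t) = 1" by (simp add: cis_divide[symmetric])
  qed simp
  then obtain n :: int where n: "\<And>t. t \<in> {- \<eta><..<\<eta>} \<Longrightarrow> h (\<gamma> t) - h x - t = 2 * pi * of_int n" by blast
  have "2 * pi * of_int n = 0" using n[of 0] g(1,3) by simp
  then have "h (\<gamma> (\<eta> / 2)) = h x + \<eta> / 2" using n[of "\<eta> / 2"] g(1) by simp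
  then show False using x(2)[OF gM[of "\<eta> / 2"]] g(1) by simp
qed

text \<open>The boundary charts are a circle chart times an adapted chart of \<open>p\<close> at a
  point of \<partial>E; the latter exists because the transverse curve from the fibration
  \<open>p\<close> stays in \<partial>E. Its normal b' is orthogonal to the direction v on which
  \<open>p\<close> depends, so \<open>p\<close>, and with it \<open>q\<close>, is constant along
  lines in direction (0, b').\<close>

lemma circle_product_extension:
  fixes E :: "('a, 'e::euclidean_space) mfd" and a b :: int
  assumes E: "smooth_manifold E" and comp: "compact_space (mtop E)" and dim: "1 \<le> mdim E"
    and p: "fibration E circle_mfd p" and c: "norm c = 1"
    and fib: "fibration (bdry (prod_mfd circle_mfd E)) circle_mfd f"
    and h: "continuous_map (mtop (bdry (prod_mfd circle_mfd E))) euclideanreal h"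
    and fh: "\<And>\<theta> x. norm \<theta> = 1 \<Longrightarrow> x \<in> mboundary E \<Longrightarrow> f (\<theta>, x) = \<theta> powi a * (p x / c) powi b * cis (h (\<theta>, x))"
  shows "\<exists>f'. fibration (prod_mfd circle_mfd E) circle_mfd f' \<and> (\<forall>x\<in>mboundary (prod_mfd circle_mfd E). f' x = f x)"
proof -
  let ?W = "prod_mfd circle_mfd E"
  note CB = disjI1[OF circle_boundary, of "mboundary E = {}"]
  have W: "smooth_manifold ?W" by (rule prod_manifold[OF circle_manifold E CB])
  have Wc: "compact_space (mtop ?W)" using comp by (simp add: compact_space_prod_topology compact_space_subtopology
      compactin_euclidean_iff)
  have Wb: "(\<theta>, x) \<in> mboundary ?W \<longleftrightarrow> norm \<theta> = 1 \<and> x \<in> mboundary E" for \<theta> x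
  proof (cases "norm \<theta> = 1 \<and> x \<in> mspace E")
    case True
    then show ?thesis using mboundary_prod[OF circle_manifold E CB, of \<theta> x] circle_boundary by simp
  next
    case False
    then have "(\<theta>, x) \<notin> mspace ?W" by auto
    then show ?thesis using mboundary_subset[OF W] mboundary_subset[OF E] False by auto
  qed
  have Wd: "2 \<le> mdim ?W" using dim by simp
  note BW = bdry_manifold[OF W]
  have mBW: "mspace (bdry ?W) = mboundary ?W" using mboundary_subset[OF W] by (auto simp: bdry_simps)
  have sp: "smooth_in E circle_mfd (mspace E) p"
    using p smooth_map_iff_smooth_in[OF E circle_manifold] by (simp add: fibration_def)
  have p1: "norm (p x) = 1" if "x \<in> mspace E" for x using smooth_in_image[OF sp that] by simp
  have p0: "p x \<noteq> 0" if "x \<in> mspace E" for x using p1[OF that] by auto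
  define q where "q z = fst z powi a * (p (snd z) / c) powi b" for z
  have c0: "c \<noteq> 0" using c by auto
  have s1: "smooth_in ?W euclidean_mfd (mspace ?W) fst"
    using smooth_in_fst[OF circle_manifold E CB] unfolding smooth_in_circle_iff[OF W] by (rule conjunct1)
  have "smooth_in ?W circle_mfd (mspace ?W) (\<lambda>z. p (snd z))"
    by (rule smooth_in_comp[OF W E circle_manifold smooth_in_snd[OF circle_manifold E CB] sp]) auto
  then have s2: "smooth_in ?W euclidean_mfd (mspace ?W) (\<lambda>z. p (snd z))" unfolding smooth_in_circle_iff[OF W]
      by (rule conjunct1)
  have s1': "smooth_in ?W euclidean_mfd (mspace ?W) (\<lambda>z. fst z powi a)"
    by (rule smooth_in_euclidean_comp[OF W s1, of "- {0}"]) (auto intro!: smooth_on_powi)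
  have s2': "smooth_in ?W euclidean_mfd (mspace ?W) (\<lambda>z. (p (snd z) / c) powi b)"
    by (rule smooth_in_euclidean_comp[OF W s2, of "- {0}"])
      (use c0 p0 in \<open>auto intro!: smooth_on_powi smooth_on_divide\<close>)
  have "smooth_in ?W euclidean_mfd (mspace ?W) q" unfolding q_def by (rule smooth_in_mult[OF W s1' s2'])
  moreover have "q ` mspace ?W \<subseteq> sphere 0 1" using p1 c by (auto simp: q_def norm_mult norm_power_int norm_divide)
  ultimately have sq: "smooth_in ?W circle_mfd (mspace ?W) q" unfolding smooth_in_circle_iff[OF W] by simp
  \<comment> \<open>If both exponents vanished, \<open>h\<close> would be a real lift of
    \<open>f\<close>.\<close>
  have ab: "a \<noteq> 0 \<or> b \<noteq> 0"
  proof (rule ccontr)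
    assume "\<not> ?thesis"
    then have "f z = cis (h z)" if "z \<in> mspace (bdry ?W)" for z using fh that Wb unfolding mBW by (cases z) simp
    moreover have "compact_space (mtop (bdry ?W))" unfolding bdry_simps
        by (rule compact_space_subtopology[OF mboundary_compact[OF W Wc]])
    ultimately show False using no_lift_of_fibration[OF BW _ _ fib h] dim by (simp add: bdry_simps)
  qed
  show ?thesis
  proof (rule fibration_extension[OF W Wc Wd sq _ _ fib h])
    show "f z = q z * cis (h z)" if "z \<in> mboundary ?W" for z using fh that Wb by (cases z) (simp add: q_def)
  next
    fix z assume z: "z \<in> mboundary ?W"
    obtain \<theta> x where zx: "z = (\<theta>, x)" "norm \<theta> = 1" "x \<in> mboundary E" using z Wb by (cases z) auto
    have xE: "x \<in> mspace E" using zx(3) mboundary_subset[OF E] by auto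
    have "\<theta> \<in> mspace circle_mfd" using zx(2) by simp
    then obtain U0 \<phi>0 where U0: "(U0, \<phi>0) \<in> full_atlas circle_mfd" "\<theta> \<in> U0" using atlas_cover[OF circle_manifold]
        by metis
    obtain V0 \<Omega>0 where d0: "chart_data (mdim circle_mfd) (mtop circle_mfd) U0 \<phi>0 V0 0 \<Omega>0"
      by (rule boundaryless_chart_data[OF circle_manifold circle_boundary U0(1)])
    obtain \<eta> \<gamma> where g: "0 < \<eta>" "smooth_in euclidean_mfd E {- \<eta><..<\<eta>} \<gamma>" "\<gamma> (0::real) = x"
       "\<gamma> ` {- \<eta><..<\<eta>} \<subseteq> mboundary E" "\<And>t. t \<in> {- \<eta><..<\<eta>} \<Longrightarrow> p (\<gamma> t) = p x * cis t"
      using fibration_curve[OF E p dim xE] zx(3) by metis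
    have "transverse_curve E p x" unfolding transverse_curve_def
      using g by (intro exI[of _ \<eta>] exI[of _ \<gamma>] exI[of _ "\<lambda>t. t"] exI[of _ 1]) simp
    then obtain U \<phi> V b' v \<Omega> where ad: "adapted_chart E p x U \<phi> V b' v \<Omega>"
      using adapted_chart_exists[OF E sp xE] by blast
    note ad' = adapted_chartD[OF ad]
    have inj: "inj_on \<phi>0 U0" "inj_on \<phi> U" using full_atlas_inj[OF U0(1)] full_atlas_inj[OF ad'(1)] by simp_all
    have "q (inv_into (U0 \<times> U) (map_prod \<phi>0 \<phi>) (map_prod \<phi>0 \<phi> y + t *\<^sub>R (0, b'))) = q y"
      if y: "y \<in> U0 \<times> U" and im: "map_prod \<phi>0 \<phi> y + t *\<^sub>R (0, b') \<in> map_prod \<phi>0 \<phi> ` (U0 \<times> U)" for y t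
    proof -
      obtain y1 y2 where y12: "y = (y1, y2)" "y1 \<in> U0" "y2 \<in> U" using y by auto
      obtain z1 z2 where z12: "z1 \<in> U0" "z2 \<in> U" "\<phi>0 y1 = \<phi>0 z1" "\<phi> y2 + t *\<^sub>R b' = \<phi> z2" using im y12(1) by auto
      have y1: "y1 = z1" using inj_onD[OF inj(1) z12(3) y12(2) z12(1)] .
      have "v \<bullet> \<phi> z2 = v \<bullet> \<phi> y2" unfolding z12(4)[symmetric] by (simp add: inner_add_right ad'(6) inner_commute[of v])
      then have "p z2 = p y2" using ad'(8)[OF z12(2)] ad'(8)[OF y12(3)] by simp
      moreover have "map_prod \<phi>0 \<phi> y + t *\<^sub>R (0, b') = (\<phi>0 z1, \<phi> z2)" using y12(1) z12(3,4) by simp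
      ultimately show ?thesis using inv_into_map_prod[OF inj z12(1,2)] y1 y12(1) by (simp add: q_def)
    qed
    then show "\<exists>U \<phi> V b \<Omega>. (U, \<phi>) \<in> full_atlas ?W \<and> z \<in> U \<and> chart_data (mdim ?W) (mtop ?W) U \<phi> V b \<Omega> \<and>
       (\<forall>y\<in>U. \<forall>t. \<phi> y + t *\<^sub>R b \<in> \<phi> ` U \<longrightarrow> q (inv_into U \<phi> (\<phi> y + t *\<^sub>R b)) = q y)"
      using full_atlas_prod[OF circle_manifold E circle_boundary U0(1) ad'(1)] zx(1) U0(2) ad'(2)
        chart_data_prod[OF d0 ad'(3) disjI1[OF refl]]
      unfolding prod_mfd_simps
      by (intro exI[of _ "U0 \<times> U"] exI[of _ "map_prod \<phi>0 \<phi>"] exI[of _ "V0 \<times> V"] exI[of _ "(0, b')"] exI[of _ "\<Omega>0 \<times>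
          \<Omega>"]) simp
  next
    fix z assume z: "z \<in> mspace ?W"
    obtain \<theta> x where zx: "z = (\<theta>, x)" "norm \<theta> = 1" "x \<in> mspace E" using z by (cases z) auto
    note em = euclidean_manifold[where 'e=real]
    show "\<exists>\<eta> \<gamma> d. 0 < \<eta> \<and> smooth_in euclidean_mfd ?W {- \<eta><..<\<eta>} \<gamma> \<and>
       \<gamma> (0::real) = z \<and> (\<forall>t\<in>{- \<eta><..<\<eta>}. q (\<gamma> t) = q z * cis (d * t)) \<and> d \<noteq> 0"
    proof (cases "a = 0")
      \<comment> \<open>Rotating the circle factor turns \<open>q\<close> with speed
        \<open>a\<close>. In the other case \<open>q\<close> turns with speed \<open>b\<close> along
        a curve in \<open>E\<close> that comes from the fibration \<open>p\<close>.\<close>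
      case False
      have "smooth_on {- 1<..<1} (\<lambda>t. \<theta> * cis t)" by (intro smooth_on_mult smooth_on_const smooth_on_cis smooth_on_id)
      then have "smooth_in euclidean_mfd euclidean_mfd {- 1<..<1} (\<lambda>t. \<theta> * cis t)" unfolding smooth_in_euclidean_iff .
      then have "smooth_in euclidean_mfd circle_mfd {- 1<..<1} (\<lambda>t. \<theta> * cis t)"
        unfolding smooth_in_circle_iff[OF em] using zx(2) by (auto simp: norm_mult)
      from smooth_in_Pair[OF em circle_manifold E CB this smooth_in_constant[OF em E _ zx(3)]]
      have "smooth_in euclidean_mfd ?W {- 1<..<1} (\<lambda>t. (\<theta> * cis t, x))" by simp
      moreover have "q (\<theta> * cis t, x) = q z * cis (of_int a * t)" for t
        by (simp add: q_def zx(1) power_int_mult_distrib cis_powi mult_ac)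
      ultimately show ?thesis using False zx(1)
        by (intro exI[of _ 1] exI[of _ "\<lambda>t. (\<theta> * cis t, x)"] exI[of _ "of_int a"]) simp
    next
      case True
      obtain \<eta> \<gamma> where g: "0 < \<eta>" "smooth_in euclidean_mfd E {- \<eta><..<\<eta>} \<gamma>" "\<gamma> (0::real) = x"
         "\<And>t. t \<in> {- \<eta><..<\<eta>} \<Longrightarrow> p (\<gamma> t) = p x * cis t"
        using fibration_curve[OF E p dim zx(3)] by metis
      have "\<theta> \<in> mspace circle_mfd" using zx(2) by simp
      from smooth_in_Pair[OF em circle_manifold E CB smooth_in_constant[OF em circle_manifold _ this] g(2)]
      have "smooth_in euclidean_mfd ?W {- \<eta><..<\<eta>} (\<lambda>t. (\<theta>, \<gamma> t))" by simp
      moreover have "q (\<theta>, \<gamma> t) = q z * cis (of_int b * t)" if "t \<in> {- \<eta><..<\<eta>}" for t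
      proof -
        have e: "p (\<gamma> t) / c = p x / c * cis t" using g(4)[OF that] by simp
        have "q (\<theta>, \<gamma> t) = \<theta> powi a * (p x / c * cis t) powi b" unfolding q_def fst_conv snd_conv e ..
        then show ?thesis by (simp only: power_int_mult_distrib cis_powi mult.assoc q_def zx(1) fst_conv snd_conv)
      qed
      ultimately show ?thesis using True ab g(1,3) zx(1)
        by (intro exI[of _ \<eta>] exI[of _ "\<lambda>t. (\<theta>, \<gamma> t)"] exI[of _ "of_int b"]) simp
    qed
  qed
qed

section \<open>The extension for a fibered knot\<close>

text \<open>What remains is to recognize \<partial>W. By the mapping torus description, \<partial>E
  is swept out by \<partial>F under \<open>\<Phi>\<close>, and \<partial>F is a circle because it is
  a longitude. This is the input of \<open>suspension_torus_map\<close>, whose condition on the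
  curve is the given inclusion of \<lambda> in a fiber.\<close>

theorem theorem2p1:
  fixes Y :: "('a, real ^ 3) mfd"
    and K N F :: "'a set"
    and T :: "(complex \<times> 'a) set"
    and A\<^sub>Y A\<^sub>F :: "('a set \<times> ('a \<Rightarrow> real ^ 3)) set"
    and p :: "'a \<Rightarrow> complex"
    and \<phi> :: "'a \<Rightarrow> 'a"
    and W :: "(complex \<times> 'a, complex \<times> (real ^ 3)) mfd"
    and \<pi> :: "complex \<times> 'a \<Rightarrow> complex"
    and s t :: complex
  assumes "closed_manifold Y" and "mdim Y = 3" and "connected_space (mtop Y)"
    and "oriented_by Y A\<^sub>Y"
    and "fibered_knot Y K N p F A\<^sub>F \<phi>"
    and "W = prod_mfd circle_mfd (exterior Y N)"
    and "fibration (bdry W) circle_mfd \<pi>"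
    and "t \<in> sphere 0 1" and "T = fiber (bdry W) \<pi> t"
    and "s \<in> sphere 0 1"
    and "{s} \<times> mboundary (submfd 2 (exterior Y N) F) \<subseteq> T"
  shows "\<exists>\<pi>'. fibration W circle_mfd \<pi>' \<and> (\<forall>x\<in>mboundary W. \<pi>' x = \<pi> x)"
proof -
  define E where "E = exterior Y N"
  define FM where "FM = submfd 2 E F"
  have tub: "tubular_nbhd Y K N" and p: "fibration E circle_mfd p" and seif: "seifert_surface Y K N F A\<^sub>F"
    using assms(5) unfolding fibered_knot_def E_def by simp_all
  obtain c where c: "norm c = 1" "F = fiber E p c" and mono: "monodromy E p c \<phi>"
    using assms(5) unfolding fibered_knot_def E_def by auto
  have E: "smooth_manifold E" and Ec: "compact_space (mtop E)"
    unfolding E_def using exterior_manifold[OF assms(1,2) tub] by simp_all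
  have dE: "mdim E = 3" by (simp add: E_def exterior_def)
  have FM: "smooth_manifold FM" and FE: "F \<subseteq> mspace E" and long: "longitude Y K N (mboundary FM)"
    using seif unfolding seifert_surface_def embedded_submanifold_def FM_def E_def by simp_all
  have FMtop: "mtop FM = subtopology (mtop E) F" by (simp add: FM_def)
  have FMsp: "mspace FM = F" using FE by (auto simp: FMtop)
  \<comment> \<open>The curve \<lambda> without its position in the circle factor. Being a
    longitude, it lies on the boundary of the exterior.\<close>
  define B where "B = mboundary FM"
  have BF: "B \<subseteq> F" unfolding B_def using mboundary_subset[OF FM] FMsp by simp
  define XF where "XF = subtopology (mtop E) B"
  define XE where "XE = subtopology (mtop E) (mboundary E)"
  have tXF: "topspace XF = B" using BF FE by (auto simp: XF_def)
  have tXE: "topspace XE = mboundary E" using mboundary_subset[OF E] by (auto simp: XE_def)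
  have BE: "B \<subseteq> mboundary E"
    using long unfolding longitude_def embedded_submanifold_def B_def E_def[symmetric] by (auto simp: bdry_simps)
  have top1: "mtop (submfd 1 (bdry E) B) = XF"
    using BE by (simp add: bdry_simps XF_def subtopology_subtopology Int_absorb1)
  obtain l0 where "diffeo circle_mfd (submfd 1 (bdry E) B) l0"
    using long unfolding longitude_def B_def E_def[symmetric] by (elim exE conjE)
  then obtain l' where "continuous_map (mtop circle_mfd) (mtop (submfd 1 (bdry E) B)) l0"
    "continuous_map (mtop (submfd 1 (bdry E) B)) (mtop circle_mfd) l'"
    "\<And>x. x \<in> mspace circle_mfd \<Longrightarrow> l' (l0 x) = x" "\<And>y. y \<in> mspace (submfd 1 (bdry E) B) \<Longrightarrow> l0 (l' y) = y"
    by (rule diffeo_continuous) (rule that)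
  then have l: "continuous_map (top_of_set (sphere 0 1)) XF l0" "continuous_map XF (top_of_set (sphere 0 1)) l'"
    "\<And>z. norm z = 1 \<Longrightarrow> l' (l0 z) = z" "\<And>y. y \<in> topspace XF \<Longrightarrow> l0 (l' y) = y"
    unfolding top1 by simp_all
  have mono': "diffeo FM FM \<phi> \<and>
      (\<exists>\<Phi>. local_diffeo (prod_mfd FM real_mfd) E \<Phi> \<and>
         \<Phi> ` (F \<times> UNIV) = mspace E \<and>
         (\<forall>x\<in>F. \<forall>y\<in>F. \<forall>s t. \<Phi> (x, s) = \<Phi> (y, t) \<longleftrightarrow>
            (\<exists>n::nat. s = t + real n \<and> y = (\<phi> ^^ n) x \<or> t = s + real n \<and> x = (\<phi> ^^ n) y)) \<and>
         (\<forall>x\<in>F. \<Phi> (x, 0) = x) \<and>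
         (\<forall>x\<in>F. \<forall>t. p (\<Phi> (x, t)) = c * cis (2 * pi * t)))"
    using mono unfolding monodromy_def Let_def c(2)[symmetric] FM_def dE by simp
  obtain \<phi>' where ph: "continuous_map (mtop FM) (mtop FM) \<phi>" "continuous_map (mtop FM) (mtop FM) \<phi>'"
    "\<And>x. x \<in> mspace FM \<Longrightarrow> \<phi>' (\<phi> x) = x" "\<And>y. y \<in> mspace FM \<Longrightarrow> \<phi> (\<phi>' y) = y"
    by (rule diffeo_continuous[OF conjunct1[OF mono']]) (rule that)
  \<comment> \<open>A homeomorphism of \<open>F\<close> preserves its boundary, so the monodromy
    restricts to the circle \<open>B\<close>.\<close>
  have phB: "\<phi> x \<in> B \<longleftrightarrow> x \<in> B" if "x \<in> F" for x
    unfolding B_def using mboundary_homeo[OF FM FM refl ph] that FMsp by simp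
  have XF': "XF = subtopology (mtop FM) B" unfolding FMtop XF_def using BF
      by (simp add: subtopology_subtopology Int_absorb1)
  have phXF: "continuous_map XF XF \<phi>"
    unfolding XF' continuous_map_in_subtopology
    using continuous_map_from_subtopology[OF ph(1)] phB BF by (auto simp: FMsp)
  have phS: "\<exists>x\<in>topspace XF. \<phi> x = y" if "y \<in> topspace XF" for y
  proof -
    have y: "y \<in> F" "y \<in> B" using that tXF BF by auto
    have "\<phi>' y \<in> F" using ph(2) y(1) FMsp by (auto simp: continuous_map_def)
    moreover have "\<phi> (\<phi>' y) = y" using ph(4) y(1) FMsp by simp
    ultimately show ?thesis using phB[of "\<phi>' y"] y(2) tXF by auto
  qed
  from conjunct2[OF mono'] obtain \<Phi> where ld: "local_diffeo (prod_mfd FM real_mfd) E \<Phi>"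
    and \<Phi>: "\<Phi> ` (F \<times> UNIV) = mspace E" "\<forall>x\<in>F. \<forall>y\<in>F. \<forall>s t. \<Phi> (x, s) = \<Phi> (y, t) \<longleftrightarrow>
            (\<exists>n::nat. s = t + real n \<and> y = (\<phi> ^^ n) x \<or> t = s + real n \<and> x = (\<phi> ^^ n) y)"
      "\<forall>x\<in>F. \<Phi> (x, 0) = x" "\<forall>x\<in>F. \<forall>t. p (\<Phi> (x, t)) = c * cis (2 * pi * t)" by (elim exE conjE)
  note PM = prod_real_manifold[OF FM]
  have dP: "mdim (prod_mfd FM real_mfd) = mdim E" using dE by (simp add: FM_def)
  note lb = local_diffeo_boundary[OF PM E dP ld]
  \<comment> \<open>The boundary of F \<times> \<real> is \<partial>F \<times> \<real>, and a local
    diffeomorphism detects boundary points. So the boundary of the exterior is the mapping torus of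
    the restricted monodromy.\<close>
  have \<Phi>B: "\<Phi> (x, t) \<in> mboundary E \<longleftrightarrow> x \<in> B" if "x \<in> F" for x t
    using lb(2)[of "(x, t)"] mboundary_prod[OF FM euclidean_manifold disjI2[OF euclidean_boundary], of x t] that
    by (simp add: FMsp B_def euclidean_boundary)
  have "prod_topology XF euclideanreal = subtopology (prod_topology (mtop FM) euclideanreal) (B \<times> UNIV)"
    unfolding XF' by (simp add: prod_topology_subtopology)
  then have \<Phi>c: "continuous_map (prod_topology XF euclideanreal) XE \<Phi>"
    unfolding XE_def continuous_map_in_subtopology
    using continuous_map_from_subtopology[OF lb(1), of "B \<times> UNIV"] \<Phi>B BF tXF by auto
  have \<Phi>S: "\<exists>y\<in>topspace XF. \<exists>t. \<Phi> (y, t) = x" if x: "x \<in> topspace XE" for x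
  proof -
    have "x \<in> \<Phi> ` (F \<times> UNIV)" using x \<Phi>(1) by (simp add: XE_def)
    then obtain y t where y: "y \<in> F" "\<Phi> (y, t) = x" by auto
    then have "y \<in> B" using \<Phi>B[OF y(1), of t] x tXE by simp
    then show ?thesis using y(2) tXF by blast
  qed
  have \<Phi>i: "\<Phi> (x, s) = \<Phi> (y, t) \<longleftrightarrow>
            (\<exists>n::nat. s = t + real n \<and> y = (\<phi> ^^ n) x \<or> t = s + real n \<and> x = (\<phi> ^^ n) y)"
    if "x \<in> topspace XF" "y \<in> topspace XF" for x y s t
    by (rule spec[OF spec[OF bspec[OF bspec[OF \<Phi>(2)]]]]) (use that tXF BF in auto)
  have \<Phi>p: "p (\<Phi> (x, t)) = c * cis (2 * pi * t)" if "x \<in> topspace XF" for x t using \<Phi>(4) that tXF BF by auto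
  have c0: "c \<noteq> 0" using c(1) by auto
  have HE: "Hausdorff_space XE" unfolding XE_def
    by (rule Hausdorff_space_subtopology) (use E in \<open>simp add: smooth_manifold_def\<close>)
  have CB: "mboundary circle_mfd = {} \<or> mboundary E = {}" by (rule disjI1[OF circle_boundary])
  have W: "W = prod_mfd circle_mfd E" unfolding E_def by (rule assms(6))
  have WM: "smooth_manifold W" unfolding W by (rule prod_manifold[OF circle_manifold E CB])
  have Wb: "mboundary W = topspace (top_of_set (sphere 0 1)) \<times> mboundary E"
  proof -
    have "z \<in> mboundary W \<longleftrightarrow> z \<in> UNIV \<times> mboundary E" if "z \<in> mspace W" for z
    proof -
      have z: "fst z \<in> mspace circle_mfd" "snd z \<in> mspace E" using that unfolding W by auto
      show ?thesis unfolding W using mboundary_prod[OF circle_manifold E CB z] circle_boundary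
          by (simp add: mem_Times_iff)
    qed
    moreover have "mspace W = topspace (top_of_set (sphere 0 1)) \<times> mspace E" by (simp add: W)
    ultimately show ?thesis using mboundary_subset[OF WM] mboundary_subset[OF E] by blast
  qed
  have WT: "mtop (bdry W) = prod_topology (top_of_set (sphere 0 1)) XE"
    unfolding bdry_simps Wb XE_def by (simp only: W prod_mfd_simps circle_simps prod_topology_subtopology(2))
  have fc: "continuous_map (prod_topology (top_of_set (sphere 0 1)) XE) (top_of_set (sphere 0 1)) \<pi>"
    using assms(7) unfolding fibration_def smooth_map_def WT by simp
  \<comment> \<open>At time 0 \<open>\<Phi>\<close> is the inclusion of \<open>F\<close>, so over
    \<open>s\<close> this is the curve \<lambda>, which lies in the fiber \<open>T\<close> over
    \<open>t\<close>.\<close>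
  have fs: "\<pi> (s, \<Phi> (x, 0)) = t" if "x \<in> topspace XF" for x
  proof -
    have x: "x \<in> B" "x \<in> F" using that tXF BF by auto
    then have "(s, x) \<in> T" using assms(11) unfolding B_def FM_def E_def by auto
    then show ?thesis using \<Phi>(3) x(2) assms(9) by (simp add: fiber_def)
  qed
  have s1: "norm s = 1" using assms(10) by simp
  obtain a b :: int and h where h: "continuous_map (prod_topology (top_of_set (sphere 0 1)) XE) euclideanreal h"
    "\<And>\<theta> x. norm \<theta> = 1 \<Longrightarrow> x \<in> topspace XE \<Longrightarrow> \<pi> (\<theta>, x) = \<theta> powi a * (p x / c) powi b * cis (h (\<theta>, x))"
    by (rule suspension_torus_map[OF l(1,2,4,3) phXF phS \<Phi>c \<Phi>S \<Phi>i \<Phi>p c0 HE fc s1 fs]) (assumption+, rule that)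
  show ?thesis unfolding W
    by (rule circle_product_extension[OF E Ec _ p c(1) assms(7)[unfolded W] h(1)[folded WT, unfolded W] h(2)])
      (simp_all add: dE tXE)
qed

end
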